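(* Let $k\in\mathbb{N}$, $r\in\mathbb{N}_0$ and $1\le p\le\infty$. There exists a constant $c$, depending only on $k$, $r$ and $p$, such that for every $f\in\mathbb{B}_p^r$, $$E_n(f)_p\le\frac{c}{n^r}\,\omega^\varphi_{k,r}(f^{(r)},1/n)_p,\qquad n\ge k+r .$$
   Context: Notation. $\mathbb{N}=\{1,2,\dots\}$, $\mathbb{N}_0=\mathbb{N}\cup\{0\}$, $\|\cdot\|_p=\|\cdot\|_{L_p[-1,1]}$, $\varphi(x)=\sqrt{1-x^2}$. Function classes: $\mathbb{B}_p^0=L_p[-1,1]$, and for $r\ge1$, $\mathbb{B}_p^r$ is the set of functions $f$ such that $f^{(r-1)}$ is locally absolutely continuous in $(-1,1)$ and $\|f^{(r)}\varphi^r\|_p<\infty$. Degree of approximation: $E_n(f)_p=\inf\|f-P\|_p$, the infimum being over all algebraic polynomials $P$ of degree $<n$. Symmetric difference: for $h\ge0$, $\Delta_h^k(g,x)=\sum_{i=0}^k\binom{k}{i}(-1)^{k-i}g(x+(i-k/2)h)$ if $x\pm kh/2\in[-1,1]$, and $\Delta_h^k(g,x)=0$ otherwise. For $\delta>0$: $\mathfrak{D}_\delta=\{x: 1-\delta\varphi(x)/2\ge|x|\}\setminus\{\pm1\}=\{x:|x|\le (4-\delta^2)/(4+\delta^2)\}$ (empty if $\delta>2$), and $\mathcal{W}_\delta(x)=\bigl((1-x-\delta\varphi(x)/2)(1+x-\delta\varphi(x)/2)\bigr)^{1/2}$ for $x\in\mathfrak{D}_\delta$. Modulus of smoothness: for $f\in\mathbb{B}_p^r$,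 $$\omega^\varphi_{k,r}(f^{(r)},t)_p=\sup_{0<h\le t}\bigl\|\mathcal{W}^r_{kh}(\cdot)\,\Delta^k_{h\varphi(\cdot)}(f^{(r)},\cdot)\bigr\|_{L_p(\mathfrak{D}_{kh})}.$$ *)

theory Defs
  imports "HOL-Probability.Essential_Supremum" "HOL-Computational_Algebra.Polynomial"
begin

text \<open>
  Norms take values in \<open>ennreal\<close>, so that a norm (or modulus) that fails to be finite is
  \<open>\<infinity>\<close>. The exponent \<open>p\<close> also has type \<open>ennreal\<close>, the value \<open>\<infinity>\<close> giving the essential supremum.
  As there is no \<open>powr\<close> on \<open>ennreal\<close>, the \<open>p\<close>-th root is taken in the reals, the infinite
  case being treated separately.
\<close>

definition Lp_norm :: "ennreal \<Rightarrow> real set \<Rightarrow> (real \<Rightarrow> real) \<Rightarrow> ennreal" where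
  "Lp_norm p A g =
     (if p = \<infinity> then esssup (lebesgue_on A) (\<lambda>x. ennreal \<bar>g x\<bar>)
      else let I = (\<integral>\<^sup>+ x. ennreal (\<bar>g x\<bar> powr enn2real p) \<partial>lebesgue_on A)
           in if I = \<infinity> then \<infinity> else ennreal (enn2real I powr (1 / enn2real p)))"

definition Lp_space :: "ennreal \<Rightarrow> real set \<Rightarrow> (real \<Rightarrow> real) set" where
  "Lp_space p A = {g \<in> borel_measurable (lebesgue_on A). Lp_norm p A g < \<infinity>}"

text \<open>
  Absolute continuity of functions. The relation \<open>D division_of \<Union>D\<close> says exactly that \<open>D\<close>
  is a finite family of nonempty compact intervals with pairwise disjoint interiors.
\<close>

definition abs_continuous_on :: "real set \<Rightarrow> (real \<Rightarrow> real) \<Rightarrow> bool" where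
  "abs_continuous_on S g \<longleftrightarrow>
     (\<forall>\<epsilon>>0. \<exists>\<delta>>0. \<forall>D. D division_of \<Union>D \<longrightarrow> \<Union>D \<subseteq> S \<longrightarrow> (\<Sum>K\<in>D. Sup K - Inf K) < \<delta>
        \<longrightarrow> (\<Sum>K\<in>D. \<bar>g (Sup K) - g (Inf K)\<bar>) < \<epsilon>)"

definition locally_abs_continuous_on :: "real set \<Rightarrow> (real \<Rightarrow> real) \<Rightarrow> bool" where
  "locally_abs_continuous_on S g \<longleftrightarrow> (\<forall>a b. {a..b} \<subseteq> S \<longrightarrow> abs_continuous_on {a..b} g)"

definition \<phi> :: "real \<Rightarrow> real" where
  "\<phi> x = sqrt (1 - x\<^sup>2)"

text \<open>
  A function on \<open>[-1,1]\<close> is an arbitrary extension to the whole line; only its values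
  on \<open>[-1,1]\<close> matter. For \<open>r \<ge> 1\<close> the derivative \<open>(deriv ^^ r) f\<close> is meaningful at almost every
  point of \<open>(-1,1)\<close>; on the remaining null set it has an irrelevant value.
\<close>

definition \<B> :: "ennreal \<Rightarrow> nat \<Rightarrow> (real \<Rightarrow> real) set" where
  "\<B> p r =
     (if r = 0 then Lp_space p {-1..1}
      else {f. (\<forall>j<r - 1. \<forall>x\<in>{-1<..<1}. (deriv ^^ j) f differentiable (at x)) \<and>
               locally_abs_continuous_on {-1<..<1} ((deriv ^^ (r - 1)) f) \<and>
               (\<lambda>x. (deriv ^^ r) f x * \<phi> x ^ r) \<in> Lp_space p {-1..1}})"

definition approx_degree :: "nat \<Rightarrow> (real \<Rightarrow> real) \<Rightarrow> ennreal \<Rightarrow> ennreal" where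
  "approx_degree n f p =
     (INF P\<in>{P :: real poly. P = 0 \<or> degree P < n}. Lp_norm p {-1..1} (\<lambda>x. f x - poly P x))"

definition symmetric_difference :: "nat \<Rightarrow> real \<Rightarrow> (real \<Rightarrow> real) \<Rightarrow> real \<Rightarrow> real" where
  "symmetric_difference k h g x =
     (if x - real k * h / 2 \<in> {-1..1} \<and> x + real k * h / 2 \<in> {-1..1}
      then \<Sum>i=0..k. real (k choose i) * (-1) ^ (k - i) * g (x + (real i - real k / 2) * h)
      else 0)"

text \<open>
  The restriction to \<open>[-1,1]\<close> is explicit because \<open>sqrt\<close>, hence \<open>\<phi>\<close>, is defined
  (and negative) also for \<open>\<bar>x\<bar> > 1\<close>.
\<close>

definition \<DD> :: "real \<Rightarrow> real set" where
  "\<DD> \<delta> = {x \<in> {-1..1}. 1 - \<delta> * \<phi> x / 2 \<ge> \<bar>x\<bar>} - {-1, 1}"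

definition \<W> :: "real \<Rightarrow> real \<Rightarrow> real" where
  "\<W> \<delta> x = sqrt ((1 - x - \<delta> * \<phi> x / 2) * (1 + x - \<delta> * \<phi> x / 2))"

text \<open>The argument \<open>g\<close> of the modulus stands for the derivative of order \<open>r\<close>.\<close>

definition modulus :: "nat \<Rightarrow> nat \<Rightarrow> (real \<Rightarrow> real) \<Rightarrow> real \<Rightarrow> ennreal \<Rightarrow> ennreal" where
  "modulus k r g t p =
     (SUP h\<in>{0<..t}. Lp_norm p (\<DD> (real k * h))
        (\<lambda>x. \<W> (real k * h) x ^ r * symmetric_difference k (h * \<phi> x) g x))"

end

theory Submission
  imports Defs
begin

text \<open>
  With \<open>n \<approx> \<nu>\<close> up to constants, \<open>[-1,1]\<close> is divided at the points \<open>cos (i \<pi> / (6 \<nu>))\<close>. On two adjacent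
  pieces, \<open>f\<close> is approximated by a polynomial of degree less than \<open>k + r\<close>: Whitney's inequality
  handles \<open>f\<^sup>(\<^sup>r\<^sup>)\<close>, and \<open>r\<close>-fold integration from the end of the interval nearer to \<open>0\<close> gains a factor
  comparable to \<open>(\<phi> / n)\<^sup>r\<close>. Up to constants, \<open>\<W>\<close> dominates \<open>\<phi>\<close> at the leftmost (or, by reflection,
  rightmost) point of the difference, so that no growth of \<open>f\<^sup>(\<^sup>r\<^sup>)\<close> at the endpoints is lost. Ordinary
  differences with step \<open>s\<close> are turned into differences with step \<open>h \<phi> x\<close> by averaging over \<open>s\<close> and changing variables.
  The local polynomials are glued by polynomial approximations of step functions, obtained from
  the Jackson kernel, whose rapid decay beats the growth of the local polynomials away from their intervals.

  All exponents are treated at once by replacing a bound \<open>\<parallel>g\<parallel> \<le> A\<close> by \<open>\<integral> \<Phi> (\<bar>g\<bar> / A) \<le> 1\<close>, where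
  \<open>\<Phi> u = u\<^sup>p\<close>, or the function that is \<open>0\<close> on \<open>[0,1]\<close> and \<open>\<infinity>\<close> elsewhere if \<open>p = \<infinity>\<close>; only
  convexity and monotonicity of \<open>\<Phi>\<close> are used.
\<close>

section \<open>Norms as integrals of a convex function\<close>

text \<open>Of the derivative of order \<open>r\<close> only a weighted norm is known, so it may
  fail to be integrable up to \<open>\<pm>1\<close>. This shapes the local work: on the left half
  every stencil extends to the right of its first point and Taylor's formula is centred at the right
  end, so that only integrals over compact subintervals of \<open>(-1,1)\<close> occur and the
  increasing weight \<open>sqrt (1 + x)\<close> can be moved from a point to points on its right.
  The right half is the left half of \<open>f (- x)\<close>.

  Integrals of \<open>young\<close> add up over intervals and obey Tonelli in position and step,
  which norms with \<open>p = \<infinity>\<close> do not; local errors can thus be summed with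
  constants independent of \<open>p\<close>.

  With \<open>d = k + r\<close>, the gluing kernel has power \<open>d + 2\<close>: its decay of
  order \<open>2 * d + 3\<close> in the distance \<open>N\<close>, counted in intervals, pays for
  the growth \<open>N^(2 * d - 2)\<close> of polynomials of degree below \<open>d\<close>, for the
  ratio \<open>N^2\<close> of interval lengths, and for summability. The degree stays below
  \<open>d + (d + 2) * (\<nu> - 1)\<close>, which is \<open>k + r\<close> for
  \<open>\<nu> = 1\<close>; this is how all \<open>n \<ge> k + r\<close> are reached.\<close>

definition young :: "ennreal \<Rightarrow> ennreal \<Rightarrow> ennreal" where
  "young p u = (if p = \<infinity> then (if u \<le> 1 then 0 else \<infinity>)
     else if u = \<infinity> then \<infinity> else ennreal (enn2real u powr enn2real p))"

lemma young_mono: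
  assumes "u \<le> v" shows "young p u \<le> young p v"
proof -
  have "enn2real u powr enn2real p \<le> enn2real v powr enn2real p" if "v \<noteq> \<infinity>"
    using that assms by (intro powr_mono2 enn2real_mono) (auto simp: less_top)
  then show ?thesis
    using assms by (auto simp: young_def top_unique intro!: ennreal_leI)
qed

lemma young_measurable [measurable]: "young p \<in> borel_measurable borel"
  unfolding young_def by measurable

lemma young_zero [simp]: "1 \<le> p \<Longrightarrow> young p 0 = 0"
  by (auto simp: young_def)

lemma young_top [simp]: "young p top = top"
  by (auto simp: young_def top_unique)

text \<open>Young's inequality for the product of \<open>u\<close> and
  \<open>a powr (p - 1)\<close>, multiplied by \<open>p\<close>. It is the tangent line of
  \<open>u powr p\<close> at \<open>u = a\<close>, arranged without subtraction so that it can be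
  transferred to \<open>ennreal\<close>.\<close>

lemma powr_tangent:
  fixes p a u :: real
  assumes "1 \<le> p" "0 \<le> a" "0 \<le> u"
  shows "p * (u * a powr (p - 1)) \<le> u powr p + (p - 1) * a powr p"
proof (cases "p = 1")
  case False
  define q where "q = p / (p - 1)"
  have p: "p > 1" using False assms by simp
  have "u * a powr (p - 1) \<le> u powr p / p + (a powr (p - 1)) powr q / q"
    using p assms by (intro Youngs_inequality) (auto simp: q_def field_simps)
  also have "(a powr (p - 1)) powr q = a powr p"
    using p by (simp add: powr_powr q_def)
  finally have "p * (u * a powr (p - 1)) \<le> p * (u powr p / p + a powr p / q)"
    using p by (intro mult_left_mono) auto
  also have "\<dots> = u powr p + (p - 1) * a powr p"
    using p by (simp add: q_def field_simps)
  finally show ?thesis .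
qed (use assms in \<open>auto simp: powr_def\<close>)

lemma enn2real_ge_1:
  assumes "1 \<le> p" "p \<noteq> (\<infinity>::ennreal)" shows "1 \<le> enn2real p"
  using assms by (metis enn2real_mono enn2real_1 infinity_ennreal_def less_top)

text \<open>Integrate the tangent inequality at the point \<open>a = \<integral> g\<close> and
  cancel the finite term. Mass at most 1 suffices because \<open>young p 0 = 0\<close>. If the
  integral of \<open>g\<close> is infinite, \<open>u \<le> 1 + young p u\<close> makes the right
  side infinite too; for \<open>p = \<infinity>\<close> the right side is infinite unless
  \<open>g \<le> 1\<close> almost everywhere.\<close>

lemma young_jensen:
  assumes p: "1 \<le> p" and M: "emeasure M (space M) \<le> 1" and g: "g \<in> borel_measurable M"
  shows "young p (\<integral>\<^sup>+x. g x \<partial>M) \<le> (\<integral>\<^sup>+x. young p (g x) \<partial>M)"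
proof (cases "p = \<infinity>")
  case True
  show ?thesis
  proof (cases "AE x in M. g x \<le> 1")
    case True
    then have "(\<integral>\<^sup>+x. g x \<partial>M) \<le> (\<integral>\<^sup>+x. 1 \<partial>M)" by (intro nn_integral_mono_AE)
    also have "\<dots> \<le> 1" using M by simp
    finally show ?thesis using \<open>p = \<infinity>\<close> by (simp add: young_def)
  next
    case False
    have "(\<integral>\<^sup>+x. young p (g x) \<partial>M) = \<infinity>"
    proof (rule ccontr)
      assume "(\<integral>\<^sup>+x. young p (g x) \<partial>M) \<noteq> \<infinity>"
      then have "AE x in M. young p (g x) \<noteq> \<infinity>"
        using g by (intro nn_integral_PInf_AE) measurable
      then have "AE x in M. g x \<le> 1"
        by eventually_elim (use \<open>p = \<infinity>\<close> in \<open>auto simp: young_def split: if_splits\<close>)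
      with False show False by simp
    qed
    then show ?thesis by simp
  qed
next
  case False
  define r where "r = enn2real p"
  have r: "1 \<le> r" using enn2real_ge_1[OF p False] by (simp add: r_def)
  have yr: "young p u = ennreal (enn2real u powr r)" if "u \<noteq> \<infinity>" for u
    using False that by (simp add: young_def r_def)
  let ?I = "\<integral>\<^sup>+x. g x \<partial>M"
  show ?thesis
  proof (cases "?I = \<infinity>")
    case True
    have le: "u \<le> 1 + young p u" for u
    proof (cases "u = \<infinity>")
      case False
      then obtain c where c: "u = ennreal c" "0 \<le> c" by (cases u) auto
      have "c \<le> 1 + c powr r"
      proof (cases "c \<le> 1")
        case False
        then have "c powr 1 \<le> c powr r" using r by (intro powr_mono) auto
        then show ?thesis using c False by simp
      qed (simp add: add_increasing2)
      then show ?thesis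
        using False c by (simp add: yr ennreal_leI flip: ennreal_plus ennreal_1)
    qed simp
    have "?I \<le> (\<integral>\<^sup>+x. 1 + young p (g x) \<partial>M)" by (intro nn_integral_mono le)
    also have "\<dots> = emeasure M (space M) + (\<integral>\<^sup>+x. young p (g x) \<partial>M)"
      using g by (subst nn_integral_add) (auto intro: measurable_compose)
    also have "\<dots> \<le> 1 + (\<integral>\<^sup>+x. young p (g x) \<partial>M)" using M by (intro add_mono) auto
    finally have "1 + (\<integral>\<^sup>+x. young p (g x) \<partial>M) = \<infinity>" using True by (simp add: top_unique)
    then show ?thesis by simp
  next
    case fin: False
    then obtain a where a: "?I = ennreal a" "0 \<le> a" by (cases ?I) auto
    have ptw: "ennreal (r * a powr (r - 1)) * u \<le> young p u + ennreal ((r - 1) * a powr r)" for u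
    proof (cases "u = \<infinity>")
      case False
      then obtain c where c: "u = ennreal c" "0 \<le> c" by (cases u) auto
      show ?thesis
        using powr_tangent[OF r a(2) c(2)] r a c False
        by (simp add: yr ac_simps ennreal_leI flip: ennreal_mult ennreal_plus)
    qed simp
    have "ennreal (r * a powr (r - 1)) * ?I = (\<integral>\<^sup>+x. ennreal (r * a powr (r - 1)) * g x \<partial>M)"
      using g by (simp add: nn_integral_cmult)
    also have "\<dots> \<le> (\<integral>\<^sup>+x. young p (g x) + ennreal ((r - 1) * a powr r) \<partial>M)"
      by (intro nn_integral_mono ptw)
    also have "\<dots> = (\<integral>\<^sup>+x. young p (g x) \<partial>M) + ennreal ((r - 1) * a powr r) * emeasure M (space M)"
      using g by (subst nn_integral_add) (auto intro: measurable_compose)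
    also have "\<dots> \<le> (\<integral>\<^sup>+x. young p (g x) \<partial>M) + ennreal ((r - 1) * a powr r) * 1"
      using M by (intro add_mono mult_left_mono) auto
    finally have *: "ennreal (r * a powr (r - 1)) * ?I
      \<le> (\<integral>\<^sup>+x. young p (g x) \<partial>M) + ennreal ((r - 1) * a powr r)" by simp
    have "ennreal (r * a powr (r - 1)) * ?I = ennreal (a powr r + (r - 1) * a powr r)"
    proof -
      have "a * a powr (r - 1) = a powr r" using a
        by (simp add: powr_mult_base)
      then have "r * a powr (r - 1) * a = a powr r + (r - 1) * a powr r"
        by (simp add: algebra_simps)
      then show ?thesis using a r by (simp flip: ennreal_mult)
    qed
    also have "\<dots> = young p ?I + ennreal ((r - 1) * a powr r)"
      using a r by (simp add: yr ennreal_plus)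
    finally show ?thesis using * by simp
  qed
qed

text \<open>Jensen's inequality for the measure with density \<open>K\<close>. The averaging
  arguments below use it in this form, with \<open>K\<close> a normalised indicator or an integral
  kernel.\<close>

lemma young_kernel:
  assumes p: "1 \<le> p" and [measurable]: "K \<in> borel_measurable M" "g \<in> borel_measurable M"
    and K: "(\<integral>\<^sup>+x. K x \<partial>M) \<le> 1"
  shows "young p (\<integral>\<^sup>+x. K x * g x \<partial>M) \<le> (\<integral>\<^sup>+x. K x * young p (g x) \<partial>M)"
proof -
  have "young p (\<integral>\<^sup>+x. g x \<partial>density M K) \<le> (\<integral>\<^sup>+x. young p (g x) \<partial>density M K)"
  proof (rule young_jensen[OF p])
    show "emeasure (density M K) (space (density M K)) \<le> 1"
      using K by (simp add: emeasure_density cong: nn_integral_cong)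
  qed simp
  then show ?thesis by (simp add: nn_integral_density)
qed

lemma young_sum:
  assumes p: "1 \<le> p" and S: "finite S" and K: "(\<Sum>x\<in>S. K x) \<le> 1"
  shows "young p (\<Sum>x\<in>S. K x * g x) \<le> (\<Sum>x\<in>S. K x * young p (g x))"
proof -
  have "young p (\<integral>\<^sup>+x. K x * g x \<partial>count_space S) \<le> (\<integral>\<^sup>+x. K x * young p (g x) \<partial>count_space S)"
    using K S by (intro young_kernel[OF p]) (auto simp: nn_integral_count_space_finite)
  then show ?thesis using S by (simp add: nn_integral_count_space_finite)
qed

text \<open>Schur's test: Jensen in \<open>y\<close> for fixed \<open>x\<close> uses the row masses,
  and Tonelli then turns the column masses into the factor \<open>B\<close>. The rows must have mass
  at most 1, as \<open>young\<close> does not commute with scaling when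
  \<open>p = \<infinity>\<close>.\<close>

lemma young_schur:
  assumes p: "1 \<le> p" and "sigma_finite_measure M" "sigma_finite_measure N"
    and [measurable]: "case_prod K \<in> borel_measurable (N \<Otimes>\<^sub>M M)" "g \<in> borel_measurable M"
    and K1: "\<And>x. x \<in> space N \<Longrightarrow> (\<integral>\<^sup>+y. K x y \<partial>M) \<le> 1"
    and K2: "\<And>y. y \<in> space M \<Longrightarrow> (\<integral>\<^sup>+x. K x y \<partial>N) \<le> B"
    and f: "\<And>x. x \<in> space N \<Longrightarrow> f x \<le> (\<integral>\<^sup>+y. K x y * g y \<partial>M)"
  shows "(\<integral>\<^sup>+x. young p (f x) \<partial>N) \<le> B * (\<integral>\<^sup>+y. young p (g y) \<partial>M)"
proof -
  interpret M: sigma_finite_measure M by fact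
  interpret N: sigma_finite_measure N by fact
  interpret pair_sigma_finite N M ..
  have "(\<integral>\<^sup>+x. young p (f x) \<partial>N) \<le> (\<integral>\<^sup>+x. (\<integral>\<^sup>+y. K x y * young p (g y) \<partial>M) \<partial>N)"
    by (intro nn_integral_mono order.trans[OF young_mono[OF f] young_kernel[OF p]] K1) auto
  also have "\<dots> = (\<integral>\<^sup>+y. (\<integral>\<^sup>+x. K x y * young p (g y) \<partial>N) \<partial>M)"
    by (intro Fubini'[symmetric]) auto
  also have "\<dots> = (\<integral>\<^sup>+y. (\<integral>\<^sup>+x. K x y \<partial>N) * young p (g y) \<partial>M)"
    by (intro nn_integral_cong nn_integral_multc) auto
  also have "\<dots> \<le> (\<integral>\<^sup>+y. B * young p (g y) \<partial>M)"
    by (intro nn_integral_mono mult_right_mono K2) auto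
  also have "\<dots> = B * (\<integral>\<^sup>+y. young p (g y) \<partial>M)"
    by (intro nn_integral_cmult) auto
  finally show ?thesis .
qed

text \<open>The point is that \<open>g\<close> is arbitrary: the integral is a supremum over simple
  functions below the integrand, and division by \<open>c\<close> maps such functions to each other.
  The differences in the modulus are not known to be measurable when their norm is first
  estimated.\<close>

lemma nn_integral_cmult_le:
  assumes "0 < c"
  shows "(\<integral>\<^sup>+x. ennreal c * g x \<partial>M) \<le> ennreal c * (\<integral>\<^sup>+x. g x \<partial>M)"
proof -
  have "(\<integral>\<^sup>+x. ennreal c * g x \<partial>M) = (SUP s\<in>{s. simple_function M s \<and> s \<le> (\<lambda>x. ennreal c * g x)}. integral\<^sup>S M s)"
    by (simp add: nn_integral_def)
  also have "\<dots> \<le> ennreal c * (\<integral>\<^sup>+x. g x \<partial>M)"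
  proof (intro SUP_least, safe)
    fix s assume s: "simple_function M s" and le: "s \<le> (\<lambda>x. ennreal c * g x)"
    have inv: "ennreal c * (ennreal (1 / c) * u) = u" for u
      using assms by (simp flip: ennreal_mult' mult.assoc)
    have inv': "ennreal (1 / c) * (ennreal c * u) = u" for u
      using assms by (simp flip: ennreal_mult' mult.assoc)
    have "integral\<^sup>S M s = integral\<^sup>N M (\<lambda>x. ennreal c * (ennreal (1 / c) * s x))"
      using s by (simp add: inv nn_integral_eq_simple_integral)
    also have "\<dots> = ennreal c * integral\<^sup>N M (\<lambda>x. ennreal (1 / c) * s x)"
      using s by (intro nn_integral_cmult) (auto intro: borel_measurable_simple_function)
    also have "\<dots> \<le> ennreal c * (\<integral>\<^sup>+x. g x \<partial>M)"
      using le by (intro mult_left_mono nn_integral_mono)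
        (auto simp: le_fun_def inv' intro: order.trans[OF mult_left_mono[of _ _ "ennreal (1 / c)"]])
    finally show "integral\<^sup>S M s \<le> ennreal c * (\<integral>\<^sup>+x. g x \<partial>M)" .
  qed
  finally show ?thesis .
qed

lemma young_Lp_norm_le:
  assumes p: "1 \<le> p" and A: "0 < A" and le: "Lp_norm p S g \<le> ennreal A"
  shows "(\<integral>\<^sup>+x. young p (ennreal (\<bar>g x\<bar> / A)) \<partial>lebesgue_on S) \<le> 1"
proof (cases "p = \<infinity>")
  case True
  have "AE x in lebesgue_on S. ennreal \<bar>g x\<bar> \<le> esssup (lebesgue_on S) (\<lambda>x. ennreal \<bar>g x\<bar>)"
    by (rule esssup_AE)
  then have "AE x in lebesgue_on S. young p (ennreal (\<bar>g x\<bar> / A)) = 0"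
  proof eventually_elim
    case (elim x)
    then have "ennreal \<bar>g x\<bar> \<le> ennreal A"
      using le True by (auto simp: Lp_norm_def intro: order_trans)
    then have "\<bar>g x\<bar> \<le> A" using A by simp
    then show ?case using A True by (simp add: young_def flip: ennreal_1)
  qed
  then have "(\<integral>\<^sup>+x. young p (ennreal (\<bar>g x\<bar> / A)) \<partial>lebesgue_on S) = (\<integral>\<^sup>+x. 0 \<partial>lebesgue_on S)"
    by (intro nn_integral_cong_AE) auto
  then show ?thesis by simp
next
  case False
  define r where "r = enn2real p"
  have r: "1 \<le> r" using enn2real_ge_1[OF p False] by (simp add: r_def)
  define I where "I = (\<integral>\<^sup>+ x. ennreal (\<bar>g x\<bar> powr r) \<partial>lebesgue_on S)"
  have fin: "I \<noteq> \<infinity>" and le': "enn2real I powr (1 / r) \<le> A"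
    using le False A unfolding Lp_norm_def r_def[symmetric] I_def[symmetric]
    by (auto simp: Let_def top_unique split: if_splits)
  have "enn2real I = (enn2real I powr (1 / r)) powr r" using r by (simp add: powr_powr)
  also have "\<dots> \<le> A powr r" using le' r by (intro powr_mono2) auto
  finally have I: "I \<le> ennreal (A powr r)" using fin
    by (metis ennreal_enn2real ennreal_leI infinity_ennreal_def less_top)
  have "(\<integral>\<^sup>+x. young p (ennreal (\<bar>g x\<bar> / A)) \<partial>lebesgue_on S)
     = (\<integral>\<^sup>+x. ennreal ((1 / A) powr r) * ennreal (\<bar>g x\<bar> powr r) \<partial>lebesgue_on S)"
    using A False r by (intro nn_integral_cong)
      (simp add: young_def powr_divide flip: r_def ennreal_mult)
  also have "\<dots> \<le> ennreal ((1 / A) powr r) * I"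
    unfolding I_def using A by (intro nn_integral_cmult_le) simp
  also have "\<dots> \<le> ennreal ((1 / A) powr r) * ennreal (A powr r)"
    using I by (intro mult_left_mono) auto
  also have "\<dots> = 1" using A by (simp add: powr_divide flip: ennreal_mult)
  finally show ?thesis .
qed

text \<open>The constant does not depend on \<open>p\<close>: for finite \<open>p\<close> the root
  of \<open>B\<close> is at most \<open>B\<close> because \<open>1 \<le> B\<close>, and for
  \<open>p = \<infinity>\<close> a finite integral of \<open>young\<close> means that the integrand
  is at most 1 almost everywhere.\<close>

lemma Lp_norm_le_young:
  assumes p: "1 \<le> p" and A: "0 < A" and B: "1 \<le> B" and [measurable]: "g \<in> borel_measurable (lebesgue_on S)"
    and le: "(\<integral>\<^sup>+x. young p (ennreal (\<bar>g x\<bar> / A)) \<partial>lebesgue_on S) \<le> ennreal B"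
  shows "Lp_norm p S g \<le> ennreal (B * A)"
proof (cases "p = \<infinity>")
  case True
  have "(\<integral>\<^sup>+x. young p (ennreal (\<bar>g x\<bar> / A)) \<partial>lebesgue_on S) \<noteq> \<infinity>"
    using le by (auto simp: top_unique)
  then have "AE x in lebesgue_on S. young p (ennreal (\<bar>g x\<bar> / A)) \<noteq> \<infinity>"
    by (intro nn_integral_PInf_AE) measurable
  then have "AE x in lebesgue_on S. ennreal \<bar>g x\<bar> \<le> ennreal A"
  proof eventually_elim
    case (elim x)
    then have "ennreal (\<bar>g x\<bar> / A) \<le> 1" using True by (auto simp: young_def split: if_splits)
    then show ?case using A by (auto intro!: ennreal_leI simp flip: ennreal_1)
  qed
  then have "esssup (lebesgue_on S) (\<lambda>x. ennreal \<bar>g x\<bar>) \<le> ennreal A"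
    by (intro esssup_I) measurable
  also have "\<dots> \<le> ennreal (B * A)" using A B by (intro ennreal_leI) simp
  finally show ?thesis using True by (simp add: Lp_norm_def)
next
  case False
  define r where "r = enn2real p"
  have r: "1 \<le> r" using enn2real_ge_1[OF p False] by (simp add: r_def)
  define I where "I = (\<integral>\<^sup>+ x. ennreal (\<bar>g x\<bar> powr r) \<partial>lebesgue_on S)"
  have "I = (\<integral>\<^sup>+x. ennreal (A powr r) * young p (ennreal (\<bar>g x\<bar> / A)) \<partial>lebesgue_on S)"
    unfolding I_def
    using A False r by (intro nn_integral_cong)
      (simp add: young_def powr_divide flip: r_def ennreal_mult)
  also have "\<dots> = ennreal (A powr r) * (\<integral>\<^sup>+x. young p (ennreal (\<bar>g x\<bar> / A)) \<partial>lebesgue_on S)"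
    by (intro nn_integral_cmult) measurable
  also have "\<dots> \<le> ennreal (A powr r) * ennreal B" using le by (intro mult_left_mono) auto
  finally have I: "I \<le> ennreal (A powr r * B)" using B by (simp add: ennreal_mult)
  then have fin: "I \<noteq> \<infinity>" by (auto simp: top_unique)
  have "enn2real I \<le> A powr r * B" using I B by (metis enn2real_leI mult_nonneg_nonneg order.trans zero_le_one powr_ge_zero)
  also have "\<dots> \<le> A powr r * B powr r"
    using B r by (intro mult_left_mono) (metis powr_mono powr_one order.trans zero_le_one, simp)
  also have "\<dots> = (A * B) powr r" using A B by (simp add: powr_mult)
  finally have "enn2real I powr (1 / r) \<le> ((A * B) powr r) powr (1 / r)" using r by (intro powr_mono2) auto
  also have "\<dots> = B * A" using r A B by (simp add: powr_powr)
  finally show ?thesis using False fin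
    unfolding Lp_norm_def r_def[symmetric] I_def[symmetric] by (simp add: Let_def ennreal_leI)
qed

section \<open>Differentiation of absolutely continuous functions\<close>

text \<open>Essentially: a lower derivate at \<open>x\<close> at most \<open>p\<close>, and in the
  next definition an upper derivate at least \<open>q\<close>, for difference quotients over short
  intervals that merely contain \<open>x\<close>. In this form the intervals are a Vitali cover of
  the set of such points.\<close>

definition small_slope :: "(real \<Rightarrow> real) \<Rightarrow> real \<Rightarrow> real \<Rightarrow> bool" where
  "small_slope U p x \<longleftrightarrow> (\<forall>d>0. \<exists>z y. z \<le> x \<and> x \<le> y \<and> z < y \<and> y - z < d \<and> U y - U z < p * (y - z))"

definition large_slope :: "(real \<Rightarrow> real) \<Rightarrow> real \<Rightarrow> real \<Rightarrow> bool" where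
  "large_slope U q x \<longleftrightarrow> (\<forall>d>0. \<exists>z y. z \<le> x \<and> x \<le> y \<and> z < y \<and> y - z < d \<and> q * (y - z) < U y - U z)"

text \<open>The derivative is \<open>Sup A\<close>, where \<open>A\<close> is the down-closed set of
  levels exceeded on arbitrarily short intervals around \<open>x\<close>; monotonicity puts
  \<open>-1\<close> into it and \<open>bdd\<close> bounds it. Above the supremum slopes are bounded
  by definition of \<open>A\<close>; below it two rational levels are inserted, and
  \<open>nE\<close> excludes slopes smaller than the lower one. Rational levels keep the exceptional
  set a countable union.\<close>

lemma real_differentiable_if_slopes:
  fixes U :: "real \<Rightarrow> real"
  assumes "mono U"
    and nE: "\<And>p q. p \<in> \<rat> \<Longrightarrow> q \<in> \<rat> \<Longrightarrow> p < q \<Longrightarrow> \<not> (small_slope U p x \<and> large_slope U q x)"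
    and bdd: "\<not> large_slope U Q x"
  shows "U differentiable (at x)"
proof -
  define A where "A = {q. large_slope U q x}"
  have down: "q' \<in> A" if "q \<in> A" "q' \<le> q" for q q'
    unfolding A_def large_slope_def
  proof (intro CollectI allI impI)
    fix d :: real assume "d > 0"
    moreover have "large_slope U q x" using that(1) by (simp add: A_def)
    ultimately obtain z y where *: "z \<le> x" "x \<le> y" "z < y" "y - z < d" "q * (y - z) < U y - U z"
      unfolding large_slope_def by blast
    moreover have "q' * (y - z) \<le> q * (y - z)" using * that(2) by (intro mult_right_mono) auto
    ultimately show "\<exists>z y. z \<le> x \<and> x \<le> y \<and> z < y \<and> y - z < d \<and> q' * (y - z) < U y - U z"
      by (meson order.strict_trans1)
  qed
  have "-1 \<in> A"
    unfolding A_def large_slope_def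
  proof (intro CollectI allI impI)
    fix d :: real assume "d > 0"
    moreover have "U x \<le> U (x + d/2)" using \<open>d > 0\<close> by (intro monoD[OF \<open>mono U\<close>]) auto
    ultimately show "\<exists>z y. z \<le> x \<and> x \<le> y \<and> z < y \<and> y - z < d \<and> -1 * (y - z) < U y - U z"
      by (intro exI[of _ x] exI[of _ "x + d/2"]) auto
  qed
  have ub: "q \<le> Q" if "q \<in> A" for q
    using down[OF that, of Q] bdd by (force simp: A_def)
  then have bA: "bdd_above A" by (auto simp: bdd_above_def)
  define D where "D = Sup A"
  have upper: "\<exists>d>0. \<forall>z y. z \<le> x \<and> x \<le> y \<and> z < y \<and> y - z < d \<longrightarrow> U y - U z \<le> (D + e) * (y - z)"
    if "e > 0" for e
  proof -
    have "D + e \<notin> A" using cSup_upper[OF _ bA, of "D + e"] that by (auto simp: D_def)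
    then show ?thesis unfolding A_def large_slope_def by (force simp: not_less)
  qed
  have lower: "\<exists>d>0. \<forall>z y. z \<le> x \<and> x \<le> y \<and> z < y \<and> y - z < d \<longrightarrow> (D - e) * (y - z) \<le> U y - U z"
    if "e > 0" for e
  proof -
    have "\<exists>q\<in>A. D - e < q"
      using \<open>-1 \<in> A\<close> that unfolding D_def by (intro less_cSupD) auto
    then obtain q where q: "q \<in> A" "D - e < q" by blast
    obtain p1 where p1: "p1 \<in> \<rat>" "D - e < p1" "p1 < q" using Rats_dense_in_real q(2) by blast
    obtain q1 where q1: "q1 \<in> \<rat>" "p1 < q1" "q1 < q" using Rats_dense_in_real p1(3) by blast
    have "large_slope U q1 x" using down[OF q(1), of q1] q1 by (auto simp: A_def)
    then have "\<not> small_slope U p1 x" using nE p1 q1 by blast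
    then obtain d where d: "d > 0" and
      *: "\<And>z y. z \<le> x \<Longrightarrow> x \<le> y \<Longrightarrow> z < y \<Longrightarrow> y - z < d \<Longrightarrow> p1 * (y - z) \<le> U y - U z"
      unfolding small_slope_def by (force simp: not_less)
    show ?thesis
    proof (intro exI[of _ d] conjI allI impI d)
      fix z y assume H: "z \<le> x \<and> x \<le> y \<and> z < y \<and> y - z < d"
      then have "(D - e) * (y - z) \<le> p1 * (y - z)" using p1 by (intro mult_right_mono) auto
      also have "\<dots> \<le> U y - U z" using * H by blast
      finally show "(D - e) * (y - z) \<le> U y - U z" .
    qed
  qed
  have "(U has_field_derivative D) (at x)"
    unfolding has_field_derivative_def has_derivative_at_alt
  proof (intro conjI allI impI)
    show "bounded_linear ((*) D)" by (rule bounded_linear_mult_right)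
    fix e :: real assume e: "e > 0"
    obtain d1 where d1: "d1 > 0" "\<And>z y. z \<le> x \<Longrightarrow> x \<le> y \<Longrightarrow> z < y \<Longrightarrow> y - z < d1 \<Longrightarrow> U y - U z \<le> (D + e) * (y - z)"
      using upper[OF e] by blast
    obtain d2 where d2: "d2 > 0" "\<And>z y. z \<le> x \<Longrightarrow> x \<le> y \<Longrightarrow> z < y \<Longrightarrow> y - z < d2 \<Longrightarrow> (D - e) * (y - z) \<le> U y - U z"
      using lower[OF e] by blast
    show "\<exists>d>0. \<forall>y. norm (y - x) < d \<longrightarrow> norm (U y - U x - D * (y - x)) \<le> e * norm (y - x)"
    proof (intro exI[of _ "min d1 d2"] conjI allI impI)
      fix y assume y: "norm (y - x) < min d1 d2"
      consider "y = x" | "x < y" | "y < x" by linarith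
      then show "norm (U y - U x - D * (y - x)) \<le> e * norm (y - x)"
      proof cases
        case 2 then show ?thesis using d1(2)[of x y] d2(2)[of x y] y
          by (simp add: abs_le_iff algebra_simps)
      next
        case 3 then show ?thesis using d1(2)[of y x] d2(2)[of y x] y
          by (simp add: abs_le_iff algebra_simps)
      qed auto
    qed (use d1 d2 in auto)
  qed
  then show ?thesis using real_differentiable_def by blast
qed

lemma cball_midpoint:
  fixes z y :: real
  shows "cball ((z + y) / 2) ((y - z) / 2) = {z..y}"
  unfolding cball_eq_atLeastAtMost by (auto simp: field_simps)

text \<open>Vitali's theorem for closed balls, an interval being the ball around its midpoint.
  Further demands on the intervals, such as lying in a given open set, go into
  \<open>P\<close>.\<close>

lemma Vitali_covering_intervals:
  fixes S :: "real set"
  assumes fine: "\<And>x d. x \<in> S \<Longrightarrow> 0 < d \<Longrightarrow> \<exists>z y. z \<le> x \<and> x \<le> y \<and> z < y \<and> y - z < d \<and> P z y"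
  obtains C where "countable C" "\<And>i. i \<in> C \<Longrightarrow> fst i < snd i \<and> P (fst i) (snd i)"
    "disjoint_family_on (\<lambda>i. {fst i..snd i}) C" "negligible (S - (\<Union>i\<in>C. {fst i..snd i}))"
proof -
  define K where "K = {i. fst i < snd i \<and> P (fst i) (snd i)}"
  obtain C where C: "countable C" "C \<subseteq> K"
     "pairwise (\<lambda>i j. disjnt (cball ((fst i + snd i) / 2) ((snd i - fst i) / 2)) (cball ((fst j + snd j) / 2) ((snd j - fst j) / 2))) C"
     "negligible(S - (\<Union>i \<in> C. cball ((fst i + snd i) / 2) ((snd i - fst i) / 2)))"
  proof (rule Vitali_covering_theorem_cballs[of K "\<lambda>i. (snd i - fst i) / 2" S "\<lambda>i. (fst i + snd i) / 2"])
    fix x d :: real assume "x \<in> S" "0 < d"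
    with fine[of x d] obtain z y where "z \<le> x \<and> x \<le> y \<and> z < y \<and> y - z < d \<and> P z y" by blast
    then show "\<exists>i. i \<in> K \<and> x \<in> cball ((fst i + snd i) / 2) ((snd i - fst i) / 2) \<and> (snd i - fst i) / 2 < d"
      unfolding cball_midpoint by (intro exI[of _ "(z, y)"]) (auto simp: K_def)
  qed (auto simp: K_def)
  show thesis
  proof (rule that[OF C(1)])
    show "disjoint_family_on (\<lambda>i. {fst i..snd i}) C"
      using C(3) unfolding cball_midpoint disjoint_family_on_def pairwise_def disjnt_def by blast
  qed (use C in \<open>auto simp: cball_midpoint K_def\<close>)
qed

text \<open>The open intervals between the values of a monotone function at the ends of disjoint
  intervals are disjoint, which bounds the total increment.\<close>

lemma sum_increments_le:
  fixes U :: "real \<Rightarrow> real"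
  assumes "mono U" "countable C" "disjoint_family_on (\<lambda>i. {fst i..snd i}) C"
    and C: "\<And>i. i \<in> C \<Longrightarrow> a \<le> fst i \<and> fst i < snd i \<and> snd i \<le> b"
  shows "(\<integral>\<^sup>+i. ennreal (U (snd i) - U (fst i)) \<partial>count_space C) \<le> ennreal (U b - U a)"
proof (cases "C = {}")
  case False
  have dj: "disjoint_family_on (\<lambda>i. {U (fst i)<..<U (snd i)}) C"
    unfolding disjoint_family_on_def
  proof (intro ballI impI)
    fix i j assume ij: "i \<in> C" "j \<in> C" "i \<noteq> j"
    then have "{fst i..snd i} \<inter> {fst j..snd j} = {}"
      using assms(3) by (auto simp: disjoint_family_on_def)
    then have "snd i < fst j \<or> snd j < fst i"
      using C[OF ij(1)] C[OF ij(2)] by (smt (verit) IntI atLeastAtMost_iff empty_iff)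
    then show "{U (fst i)<..<U (snd i)} \<inter> {U (fst j)<..<U (snd j)} = {}"
      using monoD[OF \<open>mono U\<close>, of "snd i" "fst j"] monoD[OF \<open>mono U\<close>, of "snd j" "fst i"] by auto
  qed
  have le: "U (fst i) \<le> U (snd i)" if "i \<in> C" for i using C[OF that] by (intro monoD[OF \<open>mono U\<close>]) auto
  have "(\<integral>\<^sup>+i. ennreal (U (snd i) - U (fst i)) \<partial>count_space C)
     = (\<integral>\<^sup>+i. emeasure lborel {U (fst i)<..<U (snd i)} \<partial>count_space C)"
    using le by (intro nn_integral_cong) auto
  also have "\<dots> = emeasure lborel (\<Union>i\<in>C. {U (fst i)<..<U (snd i)})"
    using dj \<open>countable C\<close> by (intro emeasure_UN_countable[symmetric]) auto
  also have "\<dots> \<le> emeasure lborel {U a..U b}"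
  proof (intro emeasure_mono UN_least)
    fix i assume "i \<in> C"
    then have "U a \<le> U (fst i)" "U (snd i) \<le> U b" using C[of i] by (auto intro!: monoD[OF \<open>mono U\<close>])
    then show "{U (fst i)<..<U (snd i)} \<subseteq> {U a..U b}" by auto
  qed auto
  also have "\<dots> = ennreal (U b - U a)"
  proof -
    obtain i where "i \<in> C" using False by blast
    then have "a \<le> b" using C[of i] by auto
    then show ?thesis using monoD[OF \<open>mono U\<close>] by simp
  qed
  finally show ?thesis .
qed (simp add: nn_integral_empty)

lemma emeasure_UN_countable_le:
  assumes [measurable]: "\<And>i. i \<in> I \<Longrightarrow> X i \<in> sets M" and "countable I"
  shows "emeasure M (\<Union>i\<in>I. X i) \<le> (\<integral>\<^sup>+i. emeasure M (X i) \<partial>count_space I)"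
proof -
  have "emeasure M (\<Union>i\<in>I. X i) = (\<integral>\<^sup>+x. indicator (\<Union>i\<in>I. X i) x \<partial>M)"
    using assms by (intro nn_integral_indicator[symmetric] sets.countable_UN') auto
  also have "\<dots> \<le> (\<integral>\<^sup>+x. (\<integral>\<^sup>+i. indicator (X i) x \<partial>count_space I) \<partial>M)"
  proof (intro nn_integral_mono)
    fix x
    show "indicator (\<Union>i\<in>I. X i) x \<le> (\<integral>\<^sup>+i. (indicator (X i) x :: ennreal) \<partial>count_space I)"
    proof (cases "x \<in> (\<Union>i\<in>I. X i)")
      case True
      then obtain i where i: "i \<in> I" "x \<in> X i" by blast
      then have "1 = (\<integral>\<^sup>+j. indicator (X i) x * indicator {i} j \<partial>count_space I)"
        by (simp add: nn_integral_count_space_indicator one_ennreal_def[symmetric])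
      also have "\<dots> \<le> (\<integral>\<^sup>+j. indicator (X j) x \<partial>count_space I)"
        by (intro nn_integral_mono) (auto simp: indicator_def)
      finally show ?thesis using True by simp
    qed simp
  qed
  also have "\<dots> = (\<integral>\<^sup>+i. (\<integral>\<^sup>+x. indicator (X i) x \<partial>M) \<partial>count_space I)"
    using assms(2) by (intro nn_integral_count_space_nn_integral) auto
  also have "\<dots> = (\<integral>\<^sup>+i. emeasure M (X i) \<partial>count_space I)"
    by (intro nn_integral_cong) auto
  finally show ?thesis .
qed

text \<open>Disjoint Vitali intervals of slope at least \<open>q\<close> have total length at most
  \<open>1 / q\<close> times the total increment of \<open>U\<close>, and they miss only a null set
  of \<open>S\<close>. As \<open>S\<close> need not be measurable, the bound is for a measurable set
  around it.\<close>

lemma large_slope_cover: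
  fixes U :: "real \<Rightarrow> real"
  assumes "mono U" "a < b" "S \<subseteq> {a<..<b}" "0 < q" and S: "\<And>x. x \<in> S \<Longrightarrow> large_slope U q x"
  obtains T where "S \<subseteq> T" "T \<in> sets lebesgue" "emeasure lebesgue T \<le> ennreal ((U b - U a) / q)"
proof -
  obtain C where C: "countable C"
     "\<And>i. i \<in> C \<Longrightarrow> fst i < snd i \<and> (a \<le> fst i \<and> snd i \<le> b \<and> q * (snd i - fst i) \<le> U (snd i) - U (fst i))"
     and dj: "disjoint_family_on (\<lambda>i. {fst i..snd i}) C" and neg: "negligible (S - (\<Union>i\<in>C. {fst i..snd i}))"
  proof (rule Vitali_covering_intervals[of S "\<lambda>z y. a \<le> z \<and> y \<le> b \<and> q * (y - z) \<le> U y - U z"])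
    fix x d :: real assume x: "x \<in> S" and d: "0 < d"
    then have ab: "a < x" "x < b" using assms by auto
    then obtain z y where *: "z \<le> x" "x \<le> y" "z < y" "y - z < min d (min (x - a) (b - x))" "q * (y - z) < U y - U z"
      using S[OF x] d unfolding large_slope_def by (metis diff_gt_0_iff_gt min_less_iff_conj)
    then show "\<exists>z y. z \<le> x \<and> x \<le> y \<and> z < y \<and> y - z < d \<and> a \<le> z \<and> y \<le> b \<and> q * (y - z) \<le> U y - U z"
      by (intro exI[of _ z] exI[of _ y]) auto
  qed blast
  let ?J = "\<Union>i\<in>C. {fst i..snd i}"
  let ?N = "S - ?J"
  have J: "?J \<in> sets lebesgue" using C(1) by (intro sets.countable_UN') auto
  have N: "?N \<in> null_sets lebesgue" using neg by (simp add: negligible_iff_null_sets)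
  have "emeasure lebesgue (?J \<union> ?N) = emeasure lebesgue ?J"
    using J N by (intro emeasure_Un_null_set)
  also have "\<dots> = (\<integral>\<^sup>+i. emeasure lebesgue {fst i..snd i} \<partial>count_space C)"
    using C(1) dj by (intro emeasure_UN_countable) auto
  also have "\<dots> \<le> (\<integral>\<^sup>+i. ennreal (1 / q) * ennreal (U (snd i) - U (fst i)) \<partial>count_space C)"
  proof (intro nn_integral_mono)
    fix i assume "i \<in> space (count_space C)"
    then have "i \<in> C" by simp
    then have "snd i - fst i \<le> 1 / q * (U (snd i) - U (fst i))" using C(2)[of i] \<open>0 < q\<close>
      by (simp add: field_simps)
    then show "emeasure lebesgue {fst i..snd i} \<le> ennreal (1 / q) * ennreal (U (snd i) - U (fst i))"
      using C(2)[OF \<open>i \<in> C\<close>] \<open>0 < q\<close> by (simp add: ennreal_leI flip: ennreal_mult')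
  qed
  also have "\<dots> = ennreal (1 / q) * (\<integral>\<^sup>+i. ennreal (U (snd i) - U (fst i)) \<partial>count_space C)"
    by (intro nn_integral_cmult) auto
  also have "\<dots> \<le> ennreal (1 / q) * ennreal (U b - U a)"
    using C by (intro mult_left_mono sum_increments_le[OF \<open>mono U\<close> C(1) dj]) auto
  also have "\<dots> = ennreal ((U b - U a) / q)"
    using \<open>0 < q\<close> by (simp flip: ennreal_mult')
  finally have "emeasure lebesgue (?J \<union> ?N) \<le> ennreal ((U b - U a) / q)" .
  moreover have "?J \<union> ?N \<in> sets lebesgue" using J null_setsD2[OF N] by (rule sets.Un)
  ultimately show thesis by (intro that[of "?J \<union> ?N"]) auto
qed

text \<open>Let \<open>m\<close> be the outer measure of \<open>S\<close>. Intervals of slope at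
  most \<open>p\<close> inside an open set of measure at most \<open>m + e\<close> have total
  increment at most \<open>p * (m + e)\<close>; covering \<open>S\<close> inside each of them by
  \<open>large_slope_cover\<close> costs at most the increment over \<open>q\<close>. Hence
  \<open>m \<le> p / q * (m + e)\<close>, which forces \<open>m = 0\<close>. For
  \<open>p \<le> 0\<close> monotonicity leaves no such points.\<close>

lemma negligible_small_large_slope:
  fixes U :: "real \<Rightarrow> real"
  assumes "mono U" "p < q" and S: "bounded S" "\<And>x. x \<in> S \<Longrightarrow> small_slope U p x \<and> large_slope U q x"
  shows "negligible S"
proof (cases "p \<le> 0")
  case True
  have "S = {}"
  proof (rule ccontr)
    assume "S \<noteq> {}"
    then obtain x where "small_slope U p x" using S(2) by blast
    then obtain z y where "z < y" "U y - U z < p * (y - z)" unfolding small_slope_def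
      by (meson zero_less_one)
    moreover have "U z \<le> U y" using \<open>z < y\<close> by (intro monoD[OF \<open>mono U\<close>]) auto
    moreover have "p * (y - z) \<le> 0" using True \<open>z < y\<close> by (simp add: mult_nonpos_nonneg)
    ultimately show False by linarith
  qed
  then show ?thesis by simp
next
  case False
  then have p: "0 < p" and q: "0 < q" using assms by auto
  \<comment> \<open>The infimum of this set is the outer measure of \<open>S\<close>, whose
    measurability is unknown.\<close>
  define \<M> where "\<M> = {measure lebesgue T | T. S \<subseteq> T \<and> T \<in> lmeasurable}"
  obtain c where c: "S \<subseteq> cbox (-c) c" using S(1) bounded_subset_cbox_symmetric by blast
  then have ne: "\<M> \<noteq> {}" unfolding \<M>_def by (auto intro!: exI[of _ "cbox (-c) c"])
  have bdd: "bdd_below \<M>" unfolding \<M>_def by (intro bdd_belowI[of _ 0]) auto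
  define m where "m = Inf \<M>"
  have m0: "0 \<le> m" unfolding m_def using ne by (intro cInf_greatest) (auto simp: \<M>_def)
  have step: "m \<le> p / q * (m + e)" if e: "e > 0" for e
  proof -
    obtain T where T: "S \<subseteq> T" "T \<in> lmeasurable" "measure lebesgue T < m + e/2"
      using cInf_lessD[OF ne, of "m + e/2"] e by (auto simp: m_def \<M>_def)
    obtain W where W: "open W" "T \<subseteq> W" "(W - T) \<in> lmeasurable" "emeasure lebesgue (W - T) < ennreal (e/2)"
      using sets_lebesgue_outer_open[of T "e/2"] T e by auto
    have Wm: "emeasure lebesgue W \<le> ennreal (m + e)"
    proof -
      have "emeasure lebesgue W = emeasure lebesgue (T \<union> (W - T))" using W by (simp add: Un_absorb1)
      also have "\<dots> \<le> emeasure lebesgue T + emeasure lebesgue (W - T)"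
        using T W by (intro emeasure_subadditive) (auto simp: fmeasurableD)
      also have "\<dots> \<le> ennreal (m + e/2) + ennreal (e/2)"
        using T W by (intro add_mono) (auto simp: emeasure_eq_measure2 intro!: ennreal_leI)
      also have "\<dots> = ennreal (m + e)" using e m0 by (simp flip: ennreal_plus)
      finally show ?thesis .
    qed
    obtain C where C: "countable C"
       "\<And>i. i \<in> C \<Longrightarrow> fst i < snd i \<and> ({fst i..snd i} \<subseteq> W \<and> U (snd i) - U (fst i) \<le> p * (snd i - fst i))"
       and dj: "disjoint_family_on (\<lambda>i. {fst i..snd i}) C" and neg: "negligible (S - (\<Union>i\<in>C. {fst i..snd i}))"
    proof (rule Vitali_covering_intervals[of S "\<lambda>z y. {z..y} \<subseteq> W \<and> U y - U z \<le> p * (y - z)"])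
      fix x d :: real assume x: "x \<in> S" and d: "0 < d"
      then obtain d' where d': "d' > 0" "ball x d' \<subseteq> W" using W T by (meson openE subsetD)
      then obtain z y where *: "z \<le> x" "x \<le> y" "z < y" "y - z < min d d'" "U y - U z < p * (y - z)"
        using S(2)[OF x] d unfolding small_slope_def by (metis min_less_iff_conj)
      moreover have "{z..y} \<subseteq> ball x d'" using * by (auto simp: dist_real_def)
      ultimately show "\<exists>z y. z \<le> x \<and> x \<le> y \<and> z < y \<and> y - z < d \<and> {z..y} \<subseteq> W \<and> U y - U z \<le> p * (y - z)"
        using d' by (intro exI[of _ z] exI[of _ y]) auto
    qed blast
    have "\<exists>T. S \<inter> {fst i<..<snd i} \<subseteq> T \<and> T \<in> sets lebesgue \<and> emeasure lebesgue T \<le> ennreal ((U (snd i) - U (fst i)) / q)"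
      if "i \<in> C" for i
      using large_slope_cover[OF \<open>mono U\<close>, of "fst i" "snd i" "S \<inter> {fst i<..<snd i}" q] C(2)[OF that] q S(2)
      by (metis IntD1 inf_le2)
    then obtain T' where T': "\<And>i. i \<in> C \<Longrightarrow> S \<inter> {fst i<..<snd i} \<subseteq> T' i \<and> T' i \<in> sets lebesgue \<and>
        emeasure lebesgue (T' i) \<le> ennreal ((U (snd i) - U (fst i)) / q)"
      by metis
    \<comment> \<open>Besides the part missed by the Vitali intervals, \<open>N\<close> collects
      their countably many endpoints, because \<open>large_slope_cover\<close> is applied in the
      open intervals.\<close>
    define N where "N = (S - (\<Union>i\<in>C. {fst i..snd i})) \<union> (fst ` C \<union> snd ` C)"
    have "negligible (fst ` C \<union> snd ` C)"
      using C(1) by (simp add: negligible_iff_null_sets null_sets_completionI countable_imp_null_set_lborel)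
    then have N: "N \<in> null_sets lebesgue" using neg by (simp add: N_def negligible_iff_null_sets[symmetric])
    let ?X = "(\<Union>i\<in>C. T' i)"
    have X: "?X \<in> sets lebesgue" using C(1) T' by (intro sets.countable_UN') auto
    have sub: "S \<subseteq> ?X \<union> N"
    proof
      fix x assume x: "x \<in> S"
      show "x \<in> ?X \<union> N"
      proof (cases "x \<in> N")
        case False
        then obtain i where i: "i \<in> C" "x \<in> {fst i..snd i}" using x by (auto simp: N_def)
        then have "x \<noteq> fst i" "x \<noteq> snd i" using False by (auto simp: N_def)
        then have "x \<in> S \<inter> {fst i<..<snd i}" using i x by auto
        then show ?thesis using T'[OF i(1)] i(1) by blast
      qed auto
    qed
    have "emeasure lebesgue (?X \<union> N) = emeasure lebesgue ?X" using X N by (intro emeasure_Un_null_set)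
    also have "\<dots> \<le> (\<integral>\<^sup>+i. emeasure lebesgue (T' i) \<partial>count_space C)"
      using C(1) T' by (intro emeasure_UN_countable_le) auto
    also have "\<dots> \<le> (\<integral>\<^sup>+i. ennreal (p / q) * emeasure lebesgue {fst i..snd i} \<partial>count_space C)"
    proof (intro nn_integral_mono)
      fix i assume "i \<in> space (count_space C)"
      then have i: "i \<in> C" by simp
      have "emeasure lebesgue (T' i) \<le> ennreal ((U (snd i) - U (fst i)) / q)" using T'[OF i] by blast
      also have "\<dots> \<le> ennreal (p / q * (snd i - fst i))"
        using C(2)[OF i] q by (intro ennreal_leI) (auto simp: divide_right_mono)
      also have "\<dots> = ennreal (p / q) * emeasure lebesgue {fst i..snd i}"
        using C(2)[OF i] p q by (simp flip: ennreal_mult')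
      finally show "emeasure lebesgue (T' i) \<le> ennreal (p / q) * emeasure lebesgue {fst i..snd i}" .
    qed
    also have "\<dots> = ennreal (p / q) * (\<integral>\<^sup>+i. emeasure lebesgue {fst i..snd i} \<partial>count_space C)"
      by (intro nn_integral_cmult) auto
    also have "(\<integral>\<^sup>+i. emeasure lebesgue {fst i..snd i} \<partial>count_space C) = emeasure lebesgue (\<Union>i\<in>C. {fst i..snd i})"
      using C(1) dj by (intro emeasure_UN_countable[symmetric]) auto
    also have "ennreal (p / q) * emeasure lebesgue (\<Union>i\<in>C. {fst i..snd i}) \<le> ennreal (p / q) * emeasure lebesgue W"
      using C(2) W(1) by (intro mult_left_mono emeasure_mono) auto
    also have "ennreal (p / q) * emeasure lebesgue W \<le> ennreal (p / q) * ennreal (m + e)"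
      using Wm by (intro mult_left_mono) auto
    also have "\<dots> = ennreal (p / q * (m + e))" using p q e m0 by (intro ennreal_mult[symmetric]) auto
    finally have E: "emeasure lebesgue (?X \<union> N) \<le> ennreal (p / q * (m + e))" .
    then have lm: "?X \<union> N \<in> lmeasurable" using X N
      by (intro fmeasurableI) (auto simp: less_top[symmetric] top_unique)
    then have "measure lebesgue (?X \<union> N) \<in> \<M>" using sub by (auto simp: \<M>_def)
    then have "m \<le> measure lebesgue (?X \<union> N)" unfolding m_def by (intro cInf_lower bdd)
    also have "\<dots> \<le> p / q * (m + e)"
      using E lm p q e m0 by (simp add: emeasure_eq_measure2)
    finally show ?thesis .
  qed
  have "m = 0"
  proof (rule ccontr)
    assume "m \<noteq> 0"
    then have "m > 0" using m0 by simp
    \<comment> \<open>With this \<open>e\<close> the bound \<open>p / q * (m + e)\<close> becomes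
      \<open>m * (p + q) / (2 * q)\<close>, which is below \<open>m\<close>.\<close>
    define e where "e = m * (q - p) / (2 * p)"
    have "e > 0" using \<open>m > 0\<close> p assms by (simp add: e_def)
    then have "m \<le> p / q * (m + e)" by (rule step)
    also have "\<dots> = m * (p + q) / (2 * q)" using p q by (simp add: e_def field_simps)
    also have "\<dots> < m" using \<open>m > 0\<close> p q assms by (simp add: field_simps)
    finally show False by simp
  qed
  show ?thesis unfolding negligible_outer_le
  proof (intro allI impI)
    fix e :: real assume "e > 0"
    then obtain T where "S \<subseteq> T" "T \<in> lmeasurable" "measure lebesgue T < e"
      using cInf_lessD[OF ne, of e] \<open>m = 0\<close> by (auto simp: m_def \<M>_def)
    then show "\<exists>T. S \<subseteq> T \<and> T \<in> lmeasurable \<and> measure lebesgue T \<le> e" by (intro exI[of _ T]) auto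
  qed
qed

lemma negligible_infinite_slope:
  fixes U :: "real \<Rightarrow> real"
  assumes "mono U" and S: "bounded S" "\<And>x q. x \<in> S \<Longrightarrow> large_slope U q x"
  shows "negligible S"
  unfolding negligible_outer_le
proof (intro allI impI)
  fix e :: real assume e: "e > 0"
  obtain c where c: "S \<subseteq> box (-c) c" using S(1) bounded_subset_box_symmetric by blast
  show "\<exists>T. S \<subseteq> T \<and> T \<in> lmeasurable \<and> measure lebesgue T \<le> e"
  proof (cases "c > 0")
    case True
    \<comment> \<open>The summand 1 keeps \<open>q\<close> positive when \<open>U\<close> has no
      increment on \<open>[-c,c]\<close>.\<close>
    define q where "q = (U c - U (-c) + 1) / e"
    have UU: "U (-c) \<le> U c" using True by (intro monoD[OF \<open>mono U\<close>]) auto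
    then have q: "q > 0" using e by (simp add: q_def)
    obtain T where T: "S \<subseteq> T" "T \<in> sets lebesgue" "emeasure lebesgue T \<le> ennreal ((U c - U (-c)) / q)"
      using large_slope_cover[OF \<open>mono U\<close>, of "-c" c S q] c True q S(2) by auto
    then have lm: "T \<in> lmeasurable" by (intro fmeasurableI) (auto simp: less_top[symmetric] top_unique)
    then have "measure lebesgue T \<le> (U c - U (-c)) / q"
      using T UU q by (simp add: emeasure_eq_measure2)
    also have "\<dots> \<le> e" using UU e by (simp add: q_def field_simps)
    finally show ?thesis using T lm by blast
  next
    case False
    then have "S = {}" using c by auto
    then show ?thesis using e by (intro exI[of _ "{}"]) auto
  qed
qed

text \<open>Lebesgue's theorem. The exceptional set is a countable union over pairs of rational
  levels and over balls, which only serve to make the pieces bounded.\<close>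

theorem mono_differentiable_ae:
  fixes U :: "real \<Rightarrow> real"
  assumes "mono U"
  shows "negligible {x. \<not> U differentiable (at x)}"
proof -
  define E where "E p q n = {x\<in>cball 0 (real n). small_slope U p x \<and> large_slope U q x}" for p q n
  define I where "I n = {x\<in>cball 0 (real n). \<forall>q. large_slope U q x}" for n
  have b: "bounded {x\<in>cball 0 c. Q x}" for Q and c :: real
    by (rule bounded_subset[OF bounded_cball, of _ 0 c]) auto
  have "negligible (I n)" for n unfolding I_def by (rule negligible_infinite_slope[OF assms b]) auto
  moreover have "negligible (E p q n)" if "p < q" for p q n
    unfolding E_def by (rule negligible_small_large_slope[OF assms that b]) auto
  moreover have "countable {(p::real,q::real,n::nat). p\<in>\<rat> \<and> q\<in>\<rat> \<and> p<q}"
  proof (rule countable_subset)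
    show "countable ((\<rat> :: real set) \<times> (\<rat> :: real set) \<times> (UNIV :: nat set))"
      by (intro countable_SIGMA countable_rat) auto
  qed auto
  ultimately have "negligible ((\<Union>n. I n) \<union> (\<Union>(p,q,n)\<in>{(p,q,n). p\<in>\<rat> \<and> q\<in>\<rat> \<and> p<q}. E p q n))"
    by (intro negligible_Un negligible_countable_Union countable_image) auto
  then show ?thesis
  proof (rule negligible_subset, safe)
    fix x assume nd: "\<not> U differentiable (at x)"
      and nE: "x \<notin> (\<Union>(p,q,n)\<in>{(p,q,n). p\<in>\<rat> \<and> q\<in>\<rat> \<and> p<q}. E p q n)"
    obtain n where n: "x \<in> cball 0 (real n)" using real_arch_simple[of "\<bar>x\<bar>"] by auto
    have "\<forall>q. large_slope U q x"
    proof (rule ccontr)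
      assume "\<not> (\<forall>q. large_slope U q x)"
      then obtain Q where "\<not> large_slope U Q x" by blast
      with nE n have "U differentiable (at x)"
        by (intro real_differentiable_if_slopes[OF assms]) (auto simp: E_def)
      with nd show False ..
    qed
    then show "x \<in> (\<Union>n. I n)" using n by (auto simp: I_def)
  qed
qed

section \<open>Absolutely continuous functions: differentiability almost everywhere and the
  fundamental theorem\<close>

lemma real_division_mem:
  fixes K :: "real set"
  assumes "D division_of T" "K \<in> D"
  obtains u v where "u \<le> v" "K = {u..v}"
proof -
  obtain u v where uv: "K = cbox u v" using division_ofD(4)[OF assms] by blast
  moreover have "K \<noteq> {}" using division_ofD(3)[OF assms] .
  ultimately show thesis by (intro that[of u v]) auto
qed

lemma abs_continuous_onE:
  assumes "abs_continuous_on S g" "0 < e"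
  obtains \<delta> where "\<delta> > 0" "\<And>D. D division_of \<Union>D \<Longrightarrow> \<Union>D \<subseteq> S \<Longrightarrow> (\<Sum>K\<in>D. Sup K - Inf K) < \<delta> \<Longrightarrow>
       (\<Sum>K\<in>D. \<bar>g (Sup K) - g (Inf K)\<bar>) < e"
proof -
  have "\<exists>\<delta>>0. \<forall>D. D division_of \<Union>D \<longrightarrow> \<Union>D \<subseteq> S \<longrightarrow> (\<Sum>K\<in>D. Sup K - Inf K) < \<delta>
        \<longrightarrow> (\<Sum>K\<in>D. \<bar>g (Sup K) - g (Inf K)\<bar>) < e"
    using assms unfolding abs_continuous_on_def by simp
  then show thesis using that by (elim exE conjE) simp
qed

lemma measure_division:
  fixes T :: "real set"
  assumes D: "D division_of T"
  shows "(\<Sum>K\<in>D. Sup K - Inf K) = measure lebesgue T"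
proof -
  have "measure lebesgue (\<Union>D) = (\<Sum>K\<in>D. measure lebesgue K)"
  proof (rule measure_negligible_finite_Union)
    show "finite D" using D by auto
    show "K \<in> lmeasurable" if "K \<in> D" for K
      using real_division_mem[OF D that] by (metis lmeasurable_cbox box_real(2))
    show "pairwise (\<lambda>S T. negligible (S \<inter> T)) D"
      unfolding pairwise_def
    proof (intro ballI impI)
      fix K L assume KL: "K \<in> D" "L \<in> D" "K \<noteq> L"
      obtain u v u' v' where "K = cbox u v" "L = cbox u' v'"
        using division_ofD(4)[OF D KL(1)] division_ofD(4)[OF D KL(2)] by blast
      then have "convex (K \<inter> L)" by (simp add: convex_Int)
      moreover have "interior (K \<inter> L) = {}" using division_ofD(5)[OF D KL] by simp
      ultimately show "negligible (K \<inter> L)" by (simp add: negligible_convex_interior)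
    qed
  qed
  moreover have "measure lebesgue K = Sup K - Inf K" if "K \<in> D" for K
  proof -
    obtain u v where "u \<le> v" "K = {u..v}" using real_division_mem[OF D \<open>K \<in> D\<close>] .
    then show ?thesis by simp
  qed
  moreover have "\<Union>D = T" using D by auto
  ultimately show ?thesis by simp
qed

lemma division_insert_right:
  fixes x y c :: real
  assumes D: "D division_of \<Union>D" "\<Union>D \<subseteq> {c..x}" and xy: "x < y"
  shows "insert {x..y} D division_of \<Union>(insert {x..y} D)" "{x..y} \<notin> D"
proof -
  show nm: "{x..y} \<notin> D"
  proof
    assume "{x..y} \<in> D"
    then have "y \<in> {c..x}" using D(2) xy by (meson UnionI atLeastAtMost_iff less_imp_le order_refl subsetD)
    then show False using xy by simp
  qed
  have disj: "interior K \<inter> interior {x..y} = {}" if "K \<in> D" for K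
  proof -
    have "K \<subseteq> {c..x}" using D that by blast
    then have "interior K \<subseteq> interior {c..x}" by (rule interior_mono)
    then show ?thesis by auto
  qed
  show "insert {x..y} D division_of \<Union>(insert {x..y} D)"
  proof (rule division_ofI)
    show "finite (insert {x..y} D)" using D by auto
    fix K assume K: "K \<in> insert {x..y} D"
    show "K \<subseteq> \<Union>(insert {x..y} D)" using K by blast
    show "K \<noteq> {}" using K D xy by auto
    show "\<exists>a b. K = cbox a b" using K division_ofD(4)[OF D(1)] by (metis box_real(2) insert_iff)
    fix L assume "L \<in> insert {x..y} D" "K \<noteq> L"
    then show "interior K \<inter> interior L = {}"
      using K disj[of K] disj[of L] division_ofD(5)[OF D(1), of K L] by (metis Int_commute insertE)
  qed simp
qed

text \<open>On an interval shorter than the \<open>\<delta>\<close> belonging to \<open>\<epsilon> = 1\<close>, the variation of an absolutely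
  continuous function is at most 1, so that no subdivision argument is needed.\<close>

lemma abs_continuous_differentiable_short:
  fixes G :: "real \<Rightarrow> real"
  assumes cd: "c < d"
    and short: "\<And>D. D division_of \<Union>D \<Longrightarrow> \<Union>D \<subseteq> {c..d} \<Longrightarrow> (\<Sum>K\<in>D. \<bar>G (Sup K) - G (Inf K)\<bar>) \<le> 1"
  shows "negligible {x\<in>{c<..<d}. \<not> G differentiable (at x)}"
proof -
  \<comment> \<open>\<open>V\<close> is the variation of \<open>G\<close> on \<open>[c,x]\<close>,
    taken over divisions of subsets.\<close>
  define \<V> where "\<V> x = {(\<Sum>K\<in>D. \<bar>G (Sup K) - G (Inf K)\<bar>) | D. D division_of \<Union>D \<and> \<Union>D \<subseteq> {c..x}}" for x
  define V where "V x = Sup (\<V> x)" for x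
  have bdd: "bdd_above (\<V> x)" if "x \<le> d" for x
  proof (rule bdd_aboveI[of _ 1])
    fix s assume "s \<in> \<V> x"
    then have "\<exists>D. s = (\<Sum>K\<in>D. \<bar>G (Sup K) - G (Inf K)\<bar>) \<and> D division_of \<Union>D \<and> \<Union>D \<subseteq> {c..x}"
      unfolding \<V>_def by (rule CollectD)
    then obtain D where D: "D division_of \<Union>D" "\<Union>D \<subseteq> {c..x}" "s = (\<Sum>K\<in>D. \<bar>G (Sup K) - G (Inf K)\<bar>)"
      by blast
    have "\<Union>D \<subseteq> {c..d}" using D(2) that by (meson atLeastatMost_subset_iff order.refl subset_trans)
    then show "s \<le> 1" using short[OF D(1)] D(3) by simp
  qed
  have ne: "0 \<in> \<V> x" for x unfolding \<V>_def by (auto intro!: exI[of _ "{}"])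
  have incr: "V x + \<bar>G y - G x\<bar> \<le> V y" if "c \<le> x" "x < y" "y \<le> d" for x y
  proof -
    have "s \<le> V y - \<bar>G y - G x\<bar>" if "s \<in> \<V> x" for s
    proof -
      have "\<exists>D. s = (\<Sum>K\<in>D. \<bar>G (Sup K) - G (Inf K)\<bar>) \<and> D division_of \<Union>D \<and> \<Union>D \<subseteq> {c..x}"
        using that unfolding \<V>_def by (rule CollectD)
      then obtain D where D: "D division_of \<Union>D" "\<Union>D \<subseteq> {c..x}" "s = (\<Sum>K\<in>D. \<bar>G (Sup K) - G (Inf K)\<bar>)"
        by blast
      have "finite D" using D(1) by auto
      then have "(\<Sum>K\<in>insert {x..y} D. \<bar>G (Sup K) - G (Inf K)\<bar>) = \<bar>G y - G x\<bar> + s"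
        using division_insert_right(2)[OF D(1,2) \<open>x < y\<close>] D(3) \<open>x < y\<close> by simp
      moreover have "\<Union>(insert {x..y} D) \<subseteq> {c..y}" using D(2) \<open>c \<le> x\<close> \<open>x < y\<close> by force
      ultimately have "\<bar>G y - G x\<bar> + s \<in> \<V> y"
        using division_insert_right(1)[OF D(1,2) \<open>x < y\<close>] unfolding \<V>_def by (metis (mono_tags, lifting) mem_Collect_eq)
      then have "\<bar>G y - G x\<bar> + s \<le> V y" unfolding V_def by (intro cSup_upper bdd that) (use \<open>y \<le> d\<close> in auto)
      then show ?thesis by simp
    qed
    then have "V x \<le> V y - \<bar>G y - G x\<bar>" unfolding V_def using ne by (intro cSup_least) auto
    then show ?thesis by simp
  qed
  \<comment> \<open>Clamping makes the functions monotone on the whole line without changing them on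
    \<open>{c<..<d}\<close>.\<close>
  define cl where "cl x = max c (min d x)" for x :: real
  have cl: "c \<le> cl x" "cl x \<le> d" "x \<le> y \<Longrightarrow> cl x \<le> cl y" for x y
    using cd by (auto simp: cl_def)
  have VG: "V (cl x) + \<bar>G (cl y) - G (cl x)\<bar> \<le> V (cl y)" if "x \<le> y" for x y
    using incr[of "cl x" "cl y"] cl[of x] cl[of y] cl(3)[OF that] by (cases "cl x = cl y") auto
  \<comment> \<open>Jordan decomposition: \<open>G\<close> is the difference of \<open>V + G\<close>
    and \<open>V\<close>, both monotone because the variation dominates every increment of
    \<open>G\<close>.\<close>
  have m: "mono (\<lambda>x. V (cl x))" "mono (\<lambda>x. V (cl x) + G (cl x))"
  proof -
    have "V (cl x) \<le> V (cl y)" "V (cl x) + G (cl x) \<le> V (cl y) + G (cl y)" if "x \<le> y" for x y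
      using VG[OF that] by linarith+
    then show "mono (\<lambda>x. V (cl x))" "mono (\<lambda>x. V (cl x) + G (cl x))" by (auto intro!: monoI)
  qed
  have "negligible ({x. \<not> (\<lambda>x. V (cl x)) differentiable (at x)} \<union> {x. \<not> (\<lambda>x. V (cl x) + G (cl x)) differentiable (at x)})"
    using m by (intro negligible_Un mono_differentiable_ae)
  then show ?thesis
  proof (rule negligible_subset)
    have "G differentiable (at x)" if x: "x \<in> {c<..<d}"
      and d2: "(\<lambda>x. V (cl x) + G (cl x)) differentiable (at x)"
      and d1: "(\<lambda>x. V (cl x)) differentiable (at x)" for x
    proof -
      have "(\<lambda>x. (V (cl x) + G (cl x)) - V (cl x)) differentiable (at x)"
        using d1 d2 by (rule differentiable_diff[rotated])
      then have "(\<lambda>x. G (cl x)) differentiable (at x)" by simp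
      then obtain D where "((\<lambda>x. G (cl x)) has_derivative D) (at x)" by (auto simp: differentiable_def)
      then have "(G has_derivative D) (at x)"
        by (rule has_derivative_transform_within_open[of _ _ _ _ "{c<..<d}"]) (use x in \<open>auto simp: cl_def\<close>)
      then show ?thesis by (auto simp: differentiable_def)
    qed
    then show "{x\<in>{c<..<d}. \<not> G differentiable (at x)} \<subseteq> {x. \<not> (\<lambda>x. V (cl x)) differentiable (at x)} \<union> {x. \<not> (\<lambda>x. V (cl x) + G (cl x)) differentiable (at x)}"
      by blast
  qed
qed

text \<open>Every interior point lies in an interval with rational ends and length below
  \<open>\<delta>\<close>. Divisions inside such an interval have total length below
  \<open>\<delta>\<close>, so the short version applies, and there are countably many of these
  intervals.\<close>

lemma abs_continuous_differentiable_ae: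
  assumes G: "abs_continuous_on {a..b} G"
  shows "negligible {x\<in>{a<..<b}. \<not> G differentiable (at x)}"
proof -
  obtain \<delta> where \<delta>: "\<delta> > 0" "\<And>D. D division_of \<Union>D \<Longrightarrow> \<Union>D \<subseteq> {a..b} \<Longrightarrow> (\<Sum>K\<in>D. Sup K - Inf K) < \<delta> \<Longrightarrow>
       (\<Sum>K\<in>D. \<bar>G (Sup K) - G (Inf K)\<bar>) < 1"
    using abs_continuous_onE[OF G zero_less_one] by blast
  define I where "I = {(c,d). c \<in> \<rat> \<and> d \<in> \<rat> \<and> a \<le> c \<and> c < d \<and> d \<le> b \<and> d - c < \<delta>}"
  have "countable I"
    by (rule countable_subset[of _ "(\<rat> :: real set) \<times> (\<rat> :: real set)"]) (auto simp: I_def intro: countable_SIGMA countable_rat)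
  have "negligible (case i of (c,d) \<Rightarrow> {x\<in>{c<..<d}. \<not> G differentiable (at x)})" if i: "i \<in> I" for i
  proof -
    obtain c d where cd: "i = (c,d)" "a \<le> c" "c < d" "d \<le> b" "d - c < \<delta>" using i by (auto simp: I_def)
    have "negligible {x\<in>{c<..<d}. \<not> G differentiable (at x)}"
    proof (rule abs_continuous_differentiable_short[OF \<open>c < d\<close>])
      fix D assume D: "D division_of \<Union>D" "\<Union>D \<subseteq> {c..d}"
      have "(\<Sum>K\<in>D. Sup K - Inf K) = measure lebesgue (\<Union>D)" by (rule measure_division[OF D(1)])
      also have "\<dots> \<le> measure lebesgue {c..d}"
        using D by (intro measure_mono_fmeasurable) (auto intro!: sets.finite_Union lmeasurable_division)
      also have "\<dots> < \<delta>" using cd by simp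
      finally have "(\<Sum>K\<in>D. \<bar>G (Sup K) - G (Inf K)\<bar>) < 1" using D cd by (intro \<delta>(2)) auto
      then show "(\<Sum>K\<in>D. \<bar>G (Sup K) - G (Inf K)\<bar>) \<le> 1" by simp
    qed
    then show ?thesis using cd by simp
  qed
  then have "negligible (\<Union>i\<in>I. case i of (c,d) \<Rightarrow> {x\<in>{c<..<d}. \<not> G differentiable (at x)})"
    using \<open>countable I\<close> by (intro negligible_countable_Union) auto
  then show ?thesis
  proof (rule negligible_subset, safe)
    fix x assume x: "x \<in> {a<..<b}" and nd: "\<not> G differentiable (at x)"
    obtain c where c: "c \<in> \<rat>" "max a (x - \<delta>/2) < c" "c < x"
      using Rats_dense_in_real[of "max a (x - \<delta>/2)" x] x \<delta>(1) by auto
    obtain d where d: "d \<in> \<rat>" "x < d" "d < min b (x + \<delta>/2)"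
      using Rats_dense_in_real[of x "min b (x + \<delta>/2)"] x \<delta>(1) by auto
    have "(c, d) \<in> I" using c d by (auto simp: I_def)
    then show "x \<in> (\<Union>i\<in>I. case i of (c,d) \<Rightarrow> {x\<in>{c<..<d}. \<not> G differentiable (at x)})"
      using nd c d by (intro UN_I[of "(c,d)"]) auto
  qed
qed

text \<open>The gauge integral is verified directly, so that integrability of the derivative is a
  conclusion. At tags of differentiability the gauge makes each increment nearly linear; the tags in
  the null set \<open>N\<close> are confined to an open set \<open>W\<close> of measure below
  \<open>\<eta>\<close>, where absolute continuity bounds the sum of the increments and the modified
  integrand \<open>f\<close> vanishes.\<close>

theorem abs_continuous_FTC:
  assumes G: "abs_continuous_on {a..b} G" and ab: "a \<le> b"
  shows "(deriv G has_integral G b - G a) {a..b}"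
proof -
  define N where "N = {x\<in>{a..b}. \<not> (a < x \<and> x < b \<and> G differentiable (at x))}"
  have neg: "negligible N"
  proof (rule negligible_subset)
    show "negligible ({x\<in>{a<..<b}. \<not> G differentiable (at x)} \<union> {a, b})"
      using G by (intro negligible_Un abs_continuous_differentiable_ae) auto
  qed (auto simp: N_def)
  define f where "f x = (if x \<in> N then 0 else deriv G x)" for x
  have "(f has_integral G b - G a) {a..b}"
    unfolding has_integral_real
  proof (intro allI impI)
    fix e :: real assume e: "e > 0"
    define e1 where "e1 = e / (2 * (b - a + 1))"
    have e1: "e1 > 0" "e1 * (b - a) < e / 2" using e ab by (auto simp: e1_def field_simps)
    obtain \<eta> where \<eta>: "\<eta> > 0" "\<And>D. D division_of \<Union>D \<Longrightarrow> \<Union>D \<subseteq> {a..b} \<Longrightarrow> (\<Sum>K\<in>D. Sup K - Inf K) < \<eta> \<Longrightarrow>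
       (\<Sum>K\<in>D. \<bar>G (Sup K) - G (Inf K)\<bar>) < e/2"
      using abs_continuous_onE[OF G half_gt_zero[OF e]] by blast
    obtain W where W: "open W" "N \<subseteq> W" "W \<in> lmeasurable" "measure lebesgue W < \<eta>"
    proof -
      have "N \<in> sets lebesgue" "emeasure lebesgue N = 0"
        using neg by (auto simp: negligible_iff_null_sets)
      then obtain W where W: "open W" "N \<subseteq> W" "(W - N) \<in> lmeasurable" "emeasure lebesgue (W - N) < ennreal \<eta>"
        using sets_lebesgue_outer_open[of N \<eta>] \<eta>(1) by auto
      have "W = (W - N) \<union> N" using W by auto
      then have "W \<in> lmeasurable" "measure lebesgue W = measure lebesgue (W - N)"
        using W(3) neg by (metis fmeasurable.Un negligible_imp_measurable, metis W(3) measure_Un_null_set neg negligible_iff_null_sets fmeasurableD)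
      then show ?thesis using W \<eta>(1) by (intro that[of W]) (auto simp: emeasure_eq_measure2 ennreal_less_iff)
    qed
    \<comment> \<open>The straddle lemma: for \<open>z \<le> x \<le> y\<close> the errors on the two
      sides of \<open>x\<close> add up to a multiple of \<open>y - z\<close>.\<close>
    have "\<exists>\<delta>>0. \<forall>y z. z \<le> x \<longrightarrow> x \<le> y \<longrightarrow> z \<in> ball x \<delta> \<longrightarrow> y \<in> ball x \<delta> \<longrightarrow> \<bar>G y - G z - deriv G x * (y - z)\<bar> \<le> e1 * (y - z)"
      if x: "x \<in> {a..b} - N" for x
    proof -
      have "(G has_field_derivative deriv G x) (at x)"
        using x by (intro DERIV_deriv_iff_real_differentiable[THEN iffD2]) (auto simp: N_def)
      then obtain d where d: "d > 0" "\<And>y. norm (y - x) < d \<Longrightarrow> norm (G y - G x - deriv G x * (y - x)) \<le> e1 * norm (y - x)"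
        using e1(1) unfolding has_field_derivative_def has_derivative_at_alt by blast
      show ?thesis
      proof (intro exI[of _ d] conjI allI impI d(1))
        fix y z assume *: "z \<le> x" "x \<le> y" "z \<in> ball x d" "y \<in> ball x d"
        then have "\<bar>G y - G x - deriv G x * (y - x)\<bar> \<le> e1 * (y - x)" "\<bar>G z - G x - deriv G x * (z - x)\<bar> \<le> e1 * (x - z)"
          using d(2)[of y] d(2)[of z] by (auto simp: dist_real_def)
        then show "\<bar>G y - G z - deriv G x * (y - z)\<bar> \<le> e1 * (y - z)"
          by (simp add: abs_le_iff algebra_simps)
      qed
    qed
    then obtain \<delta> where \<delta>: "\<And>x. x \<in> {a..b} - N \<Longrightarrow> \<delta> x > 0"
      "\<And>x y z. x \<in> {a..b} - N \<Longrightarrow> z \<le> x \<Longrightarrow> x \<le> y \<Longrightarrow> z \<in> ball x (\<delta> x) \<Longrightarrow> y \<in> ball x (\<delta> x) \<Longrightarrow> \<bar>G y - G z - deriv G x * (y - z)\<bar> \<le> e1 * (y - z)"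
      by metis
    define \<gamma> where "\<gamma> x = (if x \<in> N then W else if x \<in> {a..b} then ball x (\<delta> x) else ball x 1)" for x
    show "\<exists>\<gamma>. gauge \<gamma> \<and> (\<forall>D. D tagged_division_of {a..b} \<and> \<gamma> fine D \<longrightarrow>
         norm ((\<Sum>(x,k)\<in>D. measure lborel k *\<^sub>R f x) - (G b - G a)) < e)"
    proof (intro exI[of _ \<gamma>] conjI allI impI)
      show "gauge \<gamma>" using W \<delta>(1) by (auto simp: gauge_def \<gamma>_def)
      fix D assume D: "D tagged_division_of {a..b} \<and> \<gamma> fine D"
      then have td: "D tagged_division_of {a..b}" by blast
      have fin: "finite D" using td by auto
      have K: "\<exists>u v. k = {u..v} \<and> u \<le> x \<and> x \<le> v \<and> x \<in> {a..b} \<and> {u..v} \<subseteq> \<gamma> x \<and> {u..v} \<subseteq> {a..b}" if xk: "(x, k) \<in> D" for x k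
      proof -
        obtain u v where uv: "k = cbox u v" using tagged_division_ofD(4)[OF td xk] by blast
        moreover have "x \<in> k" "k \<subseteq> {a..b}" using tagged_division_ofD(2,3)[OF td xk] by auto
        moreover have "k \<subseteq> \<gamma> x" using D xk by (auto simp: fine_def)
        ultimately show ?thesis by (intro exI[of _ u] exI[of _ v]) auto
      qed
      define g where "g = (\<lambda>k. G (Sup k) - G (Inf k))"
      have "(\<Sum>(x,k)\<in>D. measure lborel k *\<^sub>R f x) - (G b - G a) = (\<Sum>(x,k)\<in>D. measure lborel k *\<^sub>R f x) - (\<Sum>(x,k)\<in>D. g k)"
        using additive_tagged_division_1[OF ab td, of G] by (simp add: g_def)
      also have "\<dots> = (\<Sum>(x,k)\<in>D. measure lborel k * f x - g k)" by (simp add: sum_subtractf[symmetric] case_prod_unfold)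
      also have "norm \<dots> \<le> (\<Sum>(x,k)\<in>D. \<bar>measure lborel k * f x - g k\<bar>)"
        by (simp add: case_prod_unfold)
      also have "\<dots> \<le> (\<Sum>(x,k)\<in>D. e1 * measure lborel k + (if x \<in> N then \<bar>g k\<bar> else 0))"
      proof (intro sum_mono, clarsimp, intro conjI impI)
        fix x k assume xk: "(x, k) \<in> D"
        obtain u v where uv: "k = {u..v}" "u \<le> x" "x \<le> v" "x \<in> {a..b}" "{u..v} \<subseteq> \<gamma> x" using K[OF xk] by blast
        show "\<bar>measure lborel k * f x - g k\<bar> \<le> e1 * measure lborel k + \<bar>g k\<bar>" if "x \<in> N"
          using that e1 by (simp add: f_def)
        show "\<bar>measure lborel k * f x - g k\<bar> \<le> e1 * measure lborel k" if "x \<notin> N"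
        proof -
          have "u \<in> {u..v}" "v \<in> {u..v}" using uv by auto
          moreover have "{u..v} \<subseteq> ball x (\<delta> x)" using uv that by (simp add: \<gamma>_def)
          ultimately have "u \<in> ball x (\<delta> x)" "v \<in> ball x (\<delta> x)" by blast+
          then have "\<bar>G v - G u - deriv G x * (v - u)\<bar> \<le> e1 * (v - u)" using uv that by (intro \<delta>(2)) auto
          then show ?thesis using uv that by (simp add: g_def f_def abs_le_iff algebra_simps)
        qed
      qed
      also have "\<dots> = e1 * (\<Sum>(x,k)\<in>D. measure lborel k) + (\<Sum>(x,k)\<in>D. if x \<in> N then \<bar>g k\<bar> else 0)"
        by (simp add: sum.distrib sum_distrib_left case_prod_unfold)
      also have "(\<Sum>(x,k)\<in>D. measure lborel k) = b - a"
        using additive_content_tagged_division[of D a b] td ab by simp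
      also have "(\<Sum>(x,k)\<in>D. if x \<in> N then \<bar>g k\<bar> else 0) < e / 2"
      proof -
        define D' where "D' = {(x,k)\<in>D. x \<in> N}"
        have D': "D' tagged_division_of \<Union>(snd ` D')"
        proof (rule tagged_partial_division_of_Union_self, rule tagged_partial_division_subset)
          show "D tagged_partial_division_of {a..b}" using td by (simp add: tagged_division_of_def)
        qed (auto simp: D'_def)
        have dv: "(snd ` D') division_of \<Union>(snd ` D')" by (rule division_of_tagged_division[OF D'])
        have sub: "\<Union>(snd ` D') \<subseteq> W" "\<Union>(snd ` D') \<subseteq> {a..b}"
          using K by (force simp: D'_def \<gamma>_def)+
        have "(\<Sum>K\<in>snd ` D'. Sup K - Inf K) = measure lebesgue (\<Union>(snd ` D'))" by (rule measure_division[OF dv])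
        also have "\<dots> \<le> measure lebesgue W" using dv W sub
          by (intro measure_mono_fmeasurable) (auto intro!: fmeasurableD lmeasurable_division)
        also have "\<dots> < \<eta>" by fact
        finally have lt: "(\<Sum>K\<in>snd ` D'. \<bar>G (Sup K) - G (Inf K)\<bar>) < e / 2"
          using dv sub by (intro \<eta>(2)) auto
        \<comment> \<open>The lemma on tagged divisions used below wants the value 0 on every box
          with empty interior, and among these is \<open>{}\<close>, on which \<open>Sup\<close> and
          \<open>Inf\<close> tell nothing.\<close>
        define h where "h k = (if k = {} then 0 else \<bar>g k\<bar>)" for k
        have "(\<Sum>(x,k)\<in>D. if x \<in> N then \<bar>g k\<bar> else 0) = (\<Sum>(x,k)\<in>D'. \<bar>g k\<bar>)"
          using fin by (intro sum.mono_neutral_cong_right) (auto simp: D'_def split: if_splits)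
        also have "\<dots> = (\<Sum>(x,k)\<in>D'. h k)"
          using K by (intro sum.cong) (fastforce simp: D'_def h_def)+
        also have "\<dots> = (\<Sum>K\<in>snd ` D'. h K)"
        proof (rule sum.over_tagged_division_lemma[OF D'])
          fix u v :: real assume "box u v = {}"
          then show "h (cbox u v) = 0" by (cases "u = v") (auto simp: h_def g_def)
        qed
        also have "\<dots> \<le> (\<Sum>K\<in>snd ` D'. \<bar>g K\<bar>)" by (intro sum_mono) (auto simp: h_def)
        finally show ?thesis using lt by (simp add: g_def)
      qed
      finally show "norm ((\<Sum>(x,k)\<in>D. measure lborel k *\<^sub>R f x) - (G b - G a)) < e" using e1(2) by simp
    qed
  qed
  then show ?thesis
    by (rule has_integral_spike[OF neg, rotated]) (simp add: f_def)
qed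

section \<open>Polynomial approximation of step functions\<close>

text \<open>Cosines only: these are the trigonometric polynomials in \<open>t\<close> that are
  algebraic polynomials of the same degree in \<open>cos t\<close>.\<close>

definition trigpoly :: "nat \<Rightarrow> (real \<Rightarrow> real) \<Rightarrow> bool" where
  "trigpoly d f \<longleftrightarrow> (\<exists>a. \<forall>t. f t = (\<Sum>l\<le>d. a l * cos (real l * t)))"

lemma trigpoly_cos:
  assumes "l \<le> d" shows "trigpoly d (\<lambda>t. cos (real l * t))"
proof -
  have "cos (real l * t) = (\<Sum>i\<le>d. (if i = l then 1 else 0) * cos (real i * t))" for t
  proof -
    have "(\<Sum>i\<le>d. (if i = l then 1 else 0) * cos (real i * t)) = (\<Sum>i\<le>d. if i = l then cos (real i * t) else 0)"
      by (intro sum.cong) auto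
    then show ?thesis using assms by simp
  qed
  then show ?thesis unfolding trigpoly_def by (intro exI[of _ "\<lambda>i. if i = l then 1 else 0"] allI)
qed

lemma trigpoly_add:
  assumes "trigpoly d f" "trigpoly d g" shows "trigpoly d (\<lambda>t. f t + g t)"
proof -
  obtain a b where "\<And>t. f t = (\<Sum>l\<le>d. a l * cos (real l * t))" "\<And>t. g t = (\<Sum>l\<le>d. b l * cos (real l * t))"
    using assms by (auto simp: trigpoly_def)
  then show ?thesis unfolding trigpoly_def
    by (intro exI[of _ "\<lambda>l. a l + b l"]) (simp add: sum.distrib[symmetric] distrib_right)
qed

lemma trigpoly_cmult:
  assumes "trigpoly d f" shows "trigpoly d (\<lambda>t. c * f t)"
proof -
  obtain a where "\<And>t. f t = (\<Sum>l\<le>d. a l * cos (real l * t))"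
    using assms by (auto simp: trigpoly_def)
  then show ?thesis unfolding trigpoly_def
    by (intro exI[of _ "\<lambda>l. c * a l"]) (simp add: sum_distrib_left mult.assoc)
qed

lemma trigpoly_const: "trigpoly d (\<lambda>t. c)"
  using trigpoly_cmult[OF trigpoly_cos[of 0 d], of c] by simp

lemma trigpoly_sum:
  assumes "\<And>i. i \<in> I \<Longrightarrow> trigpoly d (f i)" shows "trigpoly d (\<lambda>t. \<Sum>i\<in>I. f i t)"
  using assms by (induction I rule: infinite_finite_induct) (auto intro: trigpoly_const trigpoly_add)

lemma trigpoly_cos_mult_cos:
  assumes "a \<le> d" "b \<le> e"
  shows "trigpoly (d + e) (\<lambda>t. cos (real a * t) * cos (real b * t))"
proof -
  define c where "c = (if a \<le> b then b - a else a - b)"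
  have "cos (real a * t) * cos (real b * t) = 1/2 * cos (real c * t) + 1/2 * cos (real (a + b) * t)" for t
  proof -
    have "cos (real a * t - real b * t) = cos (real c * t)"
    proof (cases "a \<le> b")
      case True
      then have "real a * t - real b * t = - (real c * t)" by (simp add: c_def of_nat_diff algebra_simps)
      then show ?thesis by simp
    qed (simp add: c_def of_nat_diff algebra_simps)
    then show ?thesis using cos_times_cos[of "real a * t" "real b * t"] by (simp add: distrib_right)
  qed
  then show ?thesis
    using assms by (simp only:) (intro trigpoly_add trigpoly_cmult trigpoly_cos, auto simp: c_def)
qed

lemma trigpoly_mult:
  assumes "trigpoly d f" "trigpoly e g" shows "trigpoly (d + e) (\<lambda>t. f t * g t)"
proof -
  obtain a b where ab: "\<And>t. f t = (\<Sum>l\<le>d. a l * cos (real l * t))" "\<And>t. g t = (\<Sum>l\<le>e. b l * cos (real l * t))"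
    using assms by (auto simp: trigpoly_def)
  have "f t * g t = (\<Sum>i\<le>d. \<Sum>j\<le>e. a i * (b j * (cos (real i * t) * cos (real j * t))))" for t
    unfolding ab by (simp add: sum_product ac_simps)
  then show ?thesis by (simp only:) (intro trigpoly_sum trigpoly_cmult trigpoly_cos_mult_cos, auto)
qed

lemma trigpoly_power:
  assumes "trigpoly d f" shows "trigpoly (m * d) (\<lambda>t. f t ^ m)"
  using trigpoly_mult[OF assms] assms by (induction m) (auto intro: trigpoly_const)

lemma trigpoly_continuous:
  assumes "trigpoly d f" shows "continuous_on A f"
proof -
  obtain a where a: "f = (\<lambda>t. \<Sum>l\<le>d. a l * cos (real l * t))"
    using assms by (auto simp: trigpoly_def fun_eq_iff)
  show ?thesis unfolding a by (intro continuous_intros)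
qed

text \<open>The Chebyshev polynomials, from the three-term recurrence given by the product formula
  for cosines.\<close>

lemma cos_nat_mult_poly: "\<exists>P::real poly. degree P \<le> n \<and> (\<forall>t. cos (real n * t) = poly P (cos t))"
proof (induction n rule: less_induct)
  case (less n)
  consider "n = 0" | "n = 1" | m where "n = Suc (Suc m)" by (metis One_nat_def not0_implies_Suc)
  then show ?case
  proof cases
    case 1 then show ?thesis by (intro exI[of _ 1]) auto
  next
    case 2 then show ?thesis by (intro exI[of _ "[:0, 1:]"]) auto
  next
    case (3 m)
    obtain P Q :: "real poly" where P: "degree P \<le> m" "\<And>t. cos (real m * t) = poly P (cos t)"
       and Q: "degree Q \<le> Suc m" "\<And>t. cos (real (Suc m) * t) = poly Q (cos t)"
      using less.IH[of m] less.IH[of "Suc m"] 3 by auto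
    have "cos (real n * t) = 2 * cos t * cos (real (Suc m) * t) - cos (real m * t)" for t
      using cos_times_cos[of "real (Suc m) * t" t] by (simp add: 3 algebra_simps)
    then have "cos (real n * t) = poly ([:0, 2:] * Q - P) (cos t)" for t
      unfolding P(2) Q(2) by simp
    moreover have "degree ([:0, 2:] * Q - P) \<le> n"
    proof (rule degree_diff_le)
      have "degree ([:0, 2:] * Q) \<le> degree [:0, 2::real:] + degree Q" by (rule degree_mult_le)
      then show "degree ([:0, 2:] * Q) \<le> n" using Q(1) 3 by simp
    qed (use P 3 in auto)
    ultimately show ?thesis by blast
  qed
qed

text \<open>Integrating over a window centred at \<open>\<theta>\<close> is convolution with an even
  function, so it only multiplies the coefficient of each cosine, by \<open>s l\<close>. For
  negative \<open>\<tau>\<close> the window is empty and the zero polynomial serves.\<close>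

lemma trigpoly_window_integral:
  assumes "trigpoly d f"
  shows "\<exists>P::real poly. degree P \<le> d \<and> (\<forall>\<theta>. integral {\<theta> - \<tau>..\<theta> + \<tau>} f = poly P (cos \<theta>))"
proof (cases "0 \<le> \<tau>")
  case True
  obtain a where a: "f = (\<lambda>t. \<Sum>l\<le>d. a l * cos (real l * t))"
    using assms by (auto simp: trigpoly_def fun_eq_iff)
  define s where "s l = (if l = 0 then 2 * \<tau> else 2 * sin (real l * \<tau>) / real l)" for l :: nat
  have hi: "((\<lambda>t. cos (real l * t)) has_integral (s l * cos (real l * \<theta>))) {\<theta> - \<tau>..\<theta> + \<tau>}" for l \<theta>
  proof (cases "l = 0")
    case True then show ?thesis using \<open>0 \<le> \<tau>\<close> has_integral_const_real[of "1::real" "\<theta> - \<tau>" "\<theta> + \<tau>"] by (simp add: s_def)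
  next
    case False
    have "((\<lambda>t. cos (real l * t)) has_integral (sin (real l * (\<theta> + \<tau>)) / real l - sin (real l * (\<theta> - \<tau>)) / real l)) {\<theta> - \<tau>..\<theta> + \<tau>}"
      using False \<open>0 \<le> \<tau>\<close>
      by (intro fundamental_theorem_of_calculus)
        (auto simp flip: has_real_derivative_iff_has_vector_derivative intro!: derivative_eq_intros)
    moreover have "sin (real l * (\<theta> + \<tau>)) / real l - sin (real l * (\<theta> - \<tau>)) / real l = s l * cos (real l * \<theta>)"
      using False by (simp add: s_def distrib_left right_diff_distrib sin_add sin_diff field_simps)
    ultimately show ?thesis by simp
  qed
  obtain P :: "nat \<Rightarrow> real poly" where P: "\<And>n. degree (P n) \<le> n" "\<And>n t. cos (real n * t) = poly (P n) (cos t)"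
    using cos_nat_mult_poly by metis
  have "(f has_integral (\<Sum>l\<le>d. a l * (s l * cos (real l * \<theta>)))) {\<theta> - \<tau>..\<theta> + \<tau>}" for \<theta>
    unfolding a by (intro has_integral_sum has_integral_mult_right hi) auto
  then have "integral {\<theta> - \<tau>..\<theta> + \<tau>} f = poly (\<Sum>l\<le>d. smult (a l * s l) (P l)) (cos \<theta>)" for \<theta>
    by (simp add: integral_unique poly_sum P(2) mult.assoc)
  moreover have "degree (\<Sum>l\<le>d. smult (a l * s l) (P l)) \<le> d"
    using P(1) by (intro degree_sum_le) (auto intro: order.trans[OF degree_smult_le] order.trans)
  ultimately show ?thesis by blast
next
  case False
  then show ?thesis by (intro exI[of _ 0]) auto
qed

text \<open>The Fejer kernel times \<open>\<nu>\<close>. As a squared modulus it is visibly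
  nonnegative and needs no division by \<open>sin (t / 2)\<close>; the quotient of sines is
  recovered in \<open>fejer_sin\<close>.\<close>

definition fejer :: "nat \<Rightarrow> real \<Rightarrow> real" where
  "fejer \<nu> t = (cmod (\<Sum>l<\<nu>. cis t ^ l))\<^sup>2"

lemma fejer_nonneg [simp]: "0 \<le> fejer \<nu> t"
  by (simp add: fejer_def)

lemma fejer_eq: "fejer \<nu> t = (\<Sum>l<\<nu>. \<Sum>l'<\<nu>. cos (real l * t - real l' * t))"
proof -
  have "fejer \<nu> t = (\<Sum>l<\<nu>. cos (real l * t))\<^sup>2 + (\<Sum>l<\<nu>. sin (real l * t))\<^sup>2"
    unfolding fejer_def cmod_power2 by (simp add: Complex.DeMoivre)
  then show ?thesis
    by (simp add: power2_eq_square sum_product sum.distrib[symmetric] cos_diff)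
qed

lemma fejer_trigpoly:
  assumes "\<nu> \<ge> 1" shows "trigpoly (\<nu> - 1) (fejer \<nu>)"
proof -
  have "trigpoly (\<nu> - 1) (\<lambda>t. cos (real l * t - real l' * t))" if "l < \<nu>" "l' < \<nu>" for l l'
  proof -
    define c where "c = (if l \<le> l' then l' - l else l - l')"
    have "cos (real l * t - real l' * t) = cos (real c * t)" for t
    proof (cases "l \<le> l'")
      case True
      then have "real l * t - real l' * t = - (real c * t)" by (simp add: c_def of_nat_diff algebra_simps)
      then show ?thesis by simp
    qed (simp add: c_def of_nat_diff algebra_simps)
    then show ?thesis using that by (simp only:) (intro trigpoly_cos, auto simp: c_def)
  qed
  then have "trigpoly (\<nu> - 1) (\<lambda>t. \<Sum>l<\<nu>. \<Sum>l'<\<nu>. cos (real l * t - real l' * t))"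
    by (intro trigpoly_sum) auto
  then show ?thesis by (simp add: fejer_eq[abs_def])
qed

lemma fejer_periodic: "fejer \<nu> (t + 2 * pi) = fejer \<nu> t"
proof -
  have "cis (t + 2 * pi) = cis t" by (simp add: complex_eq_iff)
  then show ?thesis by (simp add: fejer_def)
qed

lemma fejer_even: "fejer \<nu> (- t) = fejer \<nu> t"
  unfolding fejer_eq by (intro sum.cong refl) (metis cos_minus minus_diff_eq mult_minus_right minus_diff_minus)

lemma fejer_sin: "fejer \<nu> t * (sin (t / 2))\<^sup>2 = (sin (real \<nu> * t / 2))\<^sup>2"
proof -
  have *: "(cmod (1 - cis a))\<^sup>2 = 4 * (sin (a / 2))\<^sup>2" for a
  proof -
    have "(cmod (1 - cis a))\<^sup>2 = (1 - cos a)\<^sup>2 + (sin a)\<^sup>2" by (simp add: cmod_power2)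
    also have "\<dots> = 2 - 2 * cos a" using sin_cos_squared_add[of a] by (simp add: power2_eq_square algebra_simps)
    also have "cos a = 1 - 2 * (sin (a / 2))\<^sup>2" using cos_double_sin[of "a / 2"] by simp
    finally show ?thesis by simp
  qed
  have "(1 - cis t) * (\<Sum>l<\<nu>. cis t ^ l) = 1 - cis t ^ \<nu>" by (rule sum_gp_basic[of "cis t" "\<nu> - 1"] | (cases \<nu>; simp add: lessThan_Suc_atMost sum_gp_basic))
  then have "(cmod (1 - cis t))\<^sup>2 * fejer \<nu> t = (cmod (1 - cis (real \<nu> * t)))\<^sup>2"
    unfolding fejer_def by (metis Complex.DeMoivre norm_mult power_mult_distrib)
  then show ?thesis unfolding * by (simp add: mult.commute)
qed

text \<open>For \<open>l < \<nu>\<close> the angle \<open>l * t\<close> is at most 1, hence at most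
  \<open>pi / 3\<close>, so every summand has real part at least \<open>1 / 2\<close>.\<close>

lemma fejer_lower:
  assumes "0 \<le> t" "t \<le> 1 / real \<nu>"
  shows "(real \<nu> / 2)\<^sup>2 \<le> fejer \<nu> t"
proof -
  have "real \<nu> / 2 = (\<Sum>l<\<nu>. 1/2)" by simp
  also have "\<dots> \<le> (\<Sum>l<\<nu>. cos (real l * t))"
  proof (intro sum_mono)
    fix l assume "l \<in> {..<\<nu>}"
    then have "real l * t \<le> real \<nu> * (1 / real \<nu>)" using assms by (intro mult_mono) auto
    also have "\<dots> \<le> 1" by simp
    finally have "real l * t \<le> pi / 3" using pi_gt3 by simp
    then have "cos (pi / 3) \<le> cos (real l * t)" using assms by (intro cos_monotone_0_pi_le) auto
    then show "1/2 \<le> cos (real l * t)" by (simp add: cos_60)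
  qed
  also have "\<dots> = Re (\<Sum>l<\<nu>. cis t ^ l)" by (simp add: Complex.DeMoivre)
  also have "\<dots> \<le> cmod (\<Sum>l<\<nu>. cis t ^ l)" by (rule complex_Re_le_cmod)
  finally show ?thesis unfolding fejer_def by (intro power_mono) auto
qed

text \<open>Jordan's inequality, from the concavity of the sine on
  \<open>[0, pi / 2]\<close>.\<close>

lemma sin_ge_chord:
  assumes "0 \<le> x" "x \<le> pi / 2" shows "2 * x / pi \<le> sin x"
proof -
  have "convex_on {0..pi/2} (\<lambda>x. - sin x)"
    by (rule f''_ge0_imp_convex[of _ _ "\<lambda>x. - cos x" sin])
      (auto intro!: derivative_eq_intros sin_ge_zero)
  from convex_onD[OF this, of "2 * x / pi" 0 "pi / 2"] assms show ?thesis
    by (simp add: field_simps)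
qed

lemma fejer_upper:
  assumes "0 < t" "t \<le> pi" shows "fejer \<nu> t \<le> (pi / t)\<^sup>2"
proof -
  have "t / pi \<le> sin (t / 2)" using sin_ge_chord[of "t / 2"] assms by simp
  then have "(t / pi)\<^sup>2 \<le> (sin (t / 2))\<^sup>2" using assms by (intro power_mono) auto
  then have "fejer \<nu> t * (t / pi)\<^sup>2 \<le> fejer \<nu> t * (sin (t / 2))\<^sup>2" by (intro mult_left_mono) auto
  also have "\<dots> \<le> 1" unfolding fejer_sin using abs_sin_le_one by (simp add: abs_square_le_1)
  finally show ?thesis using assms by (simp add: field_simps)
qed

lemma power_tail_integral:
  fixes \<delta> b :: real
  assumes "0 < \<delta>" "\<delta> \<le> b" "1 \<le> m"
  shows "integral {\<delta>..b} (\<lambda>t. 1 / t ^ (2 * m)) \<le> 1 / \<delta> ^ (2 * m - 1)"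
    and "(\<lambda>t. 1 / t ^ (2 * m)) integrable_on {\<delta>..b}"
proof -
  obtain n where n: "2 * m = Suc (Suc n)" using assms by (metis Suc_1 mult_2 Suc_le_D add_Suc_right add_Suc One_nat_def)
  define G where "G t = - (1 / real (Suc n)) * inverse t ^ Suc n" for t :: real
  have "((\<lambda>t. 1 / t ^ (2 * m)) has_integral (G b - G \<delta>)) {\<delta>..b}"
  proof (rule fundamental_theorem_of_calculus[OF assms(2)])
    fix t assume "t \<in> {\<delta>..b}"
    then have "t > 0" using assms by auto
    then have "(G has_real_derivative - (1 / real (Suc n)) * (real (Suc n) * (- (inverse t ^ Suc (Suc 0)) * inverse t ^ (Suc n - Suc 0)))) (at t within {\<delta>..b})"
      unfolding G_def using assms by (intro DERIV_cmult DERIV_power DERIV_inverse) auto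
    also have "- (1 / real (Suc n)) * (real (Suc n) * (- (inverse t ^ Suc (Suc 0)) * inverse t ^ (Suc n - Suc 0))) = 1 / t ^ (2 * m)"
      unfolding n by (simp add: power_inverse divide_inverse del: of_nat_Suc)
    finally have "(G has_real_derivative 1 / t ^ (2 * m)) (at t within {\<delta>..b})" .
    then show "(G has_vector_derivative 1 / t ^ (2 * m)) (at t within {\<delta>..b})"
      by (simp add: has_real_derivative_iff_has_vector_derivative)
  qed
  note hi = this
  show "(\<lambda>t. 1 / t ^ (2 * m)) integrable_on {\<delta>..b}" using hi by blast
  have "integral {\<delta>..b} (\<lambda>t. 1 / t ^ (2 * m)) = G b - G \<delta>" using hi by (rule integral_unique)
  also have "\<dots> \<le> - G \<delta>" using assms by (simp add: G_def)
  also have "\<dots> = 1 / real (Suc n) * (1 / \<delta> ^ Suc n)" by (simp add: G_def power_inverse divide_inverse del: of_nat_Suc power_Suc)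
  also have "\<dots> \<le> 1 * (1 / \<delta> ^ Suc n)" using assms by (intro mult_right_mono) auto
  also have "Suc n = 2 * m - 1" using n by simp
  finally show "integral {\<delta>..b} (\<lambda>t. 1 / t ^ (2 * m)) \<le> 1 / \<delta> ^ (2 * m - 1)" by simp
qed

text \<open>The step function is convolved with the normalised Jackson kernel \<open>fejer \<nu> t ^ m\<close>; the error at
  distance \<open>\<delta>\<close> from the jump is the mass of the kernel on \<open>[\<delta>, 2\<pi> - \<delta>]\<close>.\<close>

theorem step_function_approx:
  fixes m :: nat
  assumes m: "1 \<le> m"
  obtains C :: real where "C > 0"
    "\<And>\<nu> \<tau>. 1 \<le> \<nu> \<Longrightarrow> 0 \<le> \<tau> \<Longrightarrow> \<tau> \<le> pi \<Longrightarrow> \<exists>P::real poly. degree P \<le> m * (\<nu> - 1) \<and>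
       (\<forall>\<theta>\<in>{0..pi}. \<bar>(if \<tau> \<le> \<theta> then 1 else 0) - poly P (cos \<theta>)\<bar> \<le> C / (1 + real \<nu> * \<bar>\<theta> - \<tau>\<bar>) ^ (2 * m - 1))"
proof
  \<comment> \<open>The power of 2 compares \<open>1 + \<nu> * \<delta>\<close> with 2 or with
    \<open>2 * \<nu> * \<delta>\<close>; \<open>4 ^ m\<close> comes from the lower bound for the
    total mass \<open>c\<close>, the power of \<open>pi\<close> from \<open>fejer_upper\<close>, and
    the factor 2 from the two sides of the kernel.\<close>
  define C :: real where "C = 2 ^ (2 * m - 1) * (1 + 4 ^ m * 2 * pi ^ (2 * m))"
  show "C > 0" by (simp add: C_def add_pos_nonneg)
  fix \<nu> :: nat and \<tau> :: real assume \<nu>: "1 \<le> \<nu>" and \<tau>: "0 \<le> \<tau>" "\<tau> \<le> pi"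
  define J where "J t = fejer \<nu> t ^ m" for t
  have J: "trigpoly (m * (\<nu> - 1)) J" unfolding J_def[abs_def] by (intro trigpoly_power fejer_trigpoly \<nu>)
  have cont: "continuous_on A J" for A by (rule trigpoly_continuous[OF J])
  have int: "J integrable_on {a..b}" for a b by (intro integrable_continuous_real cont)
  have J0: "0 \<le> J t" for t by (simp add: J_def)
  have per: "J (t + 2 * pi) = J t" and even: "J (- t) = J t" for t by (simp_all add: J_def fejer_periodic fejer_even)
  have sub: "integral {a..b} J \<le> integral {c..d} J" if "c \<le> a" "b \<le> d" for a b c d
    using that by (intro integral_subset_le int) (auto simp: J0)
  have comb: "integral {a..c} J + integral {c..b} J = integral {a..b} J" if "a \<le> c" "c \<le> b" for a b c
    using that by (intro Henstock_Kurzweil_Integration.integral_combine int)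
  define c where "c = integral {-pi..pi} J"
  have shift: "integral {a + 2 * pi..b + 2 * pi} J = integral {a..b} J" for a b
    using integral_shift[OF cont, of a b "2 * pi"] by (simp add: o_def per)
  have period: "integral {a..a + 2 * pi} J = c" if "- pi \<le> a" "a \<le> pi" for a
    using comb[of a pi "a + 2 * pi"] comb[of "-pi" a pi] shift[of "-pi" a] that by (simp add: c_def)
  \<comment> \<open>Already the mass on \<open>[0, 1 / \<nu>]\<close> is this large, by
    \<open>fejer_lower\<close>.\<close>
  have c_low: "real \<nu> ^ (2 * m - 1) / 4 ^ m \<le> c"
  proof -
    have "real \<nu> ^ (2 * m - 1) / 4 ^ m = integral {0..1 / real \<nu>} (\<lambda>t. ((real \<nu> / 2)\<^sup>2) ^ m)"
    proof -
      have "real \<nu> ^ (2 * m) = real \<nu> * real \<nu> ^ (2 * m - 1)" using m by (subst power_Suc[symmetric]) simp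
      moreover have "((real \<nu> / 2)\<^sup>2) ^ m = real \<nu> ^ (2 * m) / 4 ^ m"
        by (simp add: power_divide power_mult)
      ultimately show ?thesis using \<nu> by simp
    qed
    also have "\<dots> \<le> integral {0..1 / real \<nu>} J"
      by (intro integral_le int) (auto simp: J_def intro!: power_mono fejer_lower)
    also have "\<dots> \<le> c" unfolding c_def
    proof (intro sub)
      have "1 / real \<nu> \<le> 1" using \<nu> by simp
      also have "1 \<le> pi" using pi_gt3 by simp
      finally show "1 / real \<nu> \<le> pi" .
    qed simp
    finally show ?thesis .
  qed
  then have c0: "c > 0" using \<nu> by (intro less_le_trans[OF _ c_low]) auto
  \<comment> \<open>If \<open>\<nu> * \<delta> \<le> 1\<close>, the total mass \<open>c\<close> is a
    sufficient bound. Otherwise periodicity and evenness reduce the set to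
    \<open>[\<delta>, pi]\<close>, where \<open>fejer_upper\<close> gives decay like
    \<open>t ^ (- 2 m)\<close>.\<close>
  have tail: "integral {\<delta>..2 * pi - \<delta>} J \<le> c * (C / (1 + real \<nu> * \<delta>) ^ (2 * m - 1))" if \<delta>: "0 \<le> \<delta>" "\<delta> \<le> pi" for \<delta>
  proof (cases "real \<nu> * \<delta> \<le> 1")
    case True
    have "integral {\<delta>..2 * pi - \<delta>} J \<le> integral {0..0 + 2 * pi} J" using \<delta> by (intro sub) auto
    also have "\<dots> = c * 1" using period[of 0] by simp
    also have "\<dots> \<le> c * (C / (1 + real \<nu> * \<delta>) ^ (2 * m - 1))"
    proof (intro mult_left_mono)
      have "(1 + real \<nu> * \<delta>) ^ (2 * m - 1) \<le> 2 ^ (2 * m - 1)" using True \<delta> by (intro power_mono) auto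
      also have "\<dots> \<le> C" unfolding C_def by (simp add: mult_le_cancel_left1)
      finally show "1 \<le> C / (1 + real \<nu> * \<delta>) ^ (2 * m - 1)" using \<delta> by (simp add: le_divide_eq add_pos_nonneg)
    qed (use c0 in auto)
    finally show ?thesis .
  next
    case False
    then have d0: "\<delta> > 0" using \<delta> by (cases "\<delta> = 0") auto
    have "integral {pi..2 * pi - \<delta>} J = integral {- pi..- \<delta>} J" using shift[of "-pi" "-\<delta>"] by (simp add: algebra_simps)
    also have "\<dots> = integral {\<delta>..pi} J"
      using Henstock_Kurzweil_Integration.integral_reflect_real[of pi \<delta> J] by (simp add: even)
    finally have "integral {\<delta>..2 * pi - \<delta>} J = 2 * integral {\<delta>..pi} J" using comb[of \<delta> pi "2 * pi - \<delta>"] \<delta> by simp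
    also have "integral {\<delta>..pi} J \<le> integral {\<delta>..pi} (\<lambda>t. pi ^ (2 * m) * (1 / t ^ (2 * m)))"
    proof (intro integral_le int integrable_on_mult_right power_tail_integral d0 \<delta> m)
      fix t assume "t \<in> {\<delta>..pi}"
      then have "J t \<le> ((pi / t)\<^sup>2) ^ m" unfolding J_def using d0 by (intro power_mono fejer_upper) auto
      then show "J t \<le> pi ^ (2 * m) * (1 / t ^ (2 * m))" by (simp add: power_mult[symmetric] power_divide)
    qed
    also have "\<dots> = pi ^ (2 * m) * integral {\<delta>..pi} (\<lambda>t. 1 / t ^ (2 * m))" by (rule Henstock_Kurzweil_Integration.integral_mult_right)
    also have "\<dots> \<le> pi ^ (2 * m) * (1 / \<delta> ^ (2 * m - 1))"
      using power_tail_integral(1)[OF d0 \<delta>(2) m] by (intro mult_left_mono) auto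
    finally have "integral {\<delta>..2 * pi - \<delta>} J \<le> 2 * pi ^ (2 * m) * (1 / \<delta> ^ (2 * m - 1))" by simp
    also have "1 / \<delta> ^ (2 * m - 1) \<le> 2 ^ (2 * m - 1) * real \<nu> ^ (2 * m - 1) / (1 + real \<nu> * \<delta>) ^ (2 * m - 1)"
    proof -
      have "(1 + real \<nu> * \<delta>) ^ (2 * m - 1) \<le> (2 * real \<nu> * \<delta>) ^ (2 * m - 1)"
      proof (intro power_mono)
        show "1 + real \<nu> * \<delta> \<le> 2 * real \<nu> * \<delta>" using False by linarith
      qed (use \<delta> in auto)
      then show ?thesis using d0 by (simp add: field_simps power_mult_distrib add_pos_nonneg)
    qed
    also have "2 * pi ^ (2 * m) * (2 ^ (2 * m - 1) * real \<nu> ^ (2 * m - 1) / (1 + real \<nu> * \<delta>) ^ (2 * m - 1))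
       = (real \<nu> ^ (2 * m - 1) / 4 ^ m) * (2 ^ (2 * m - 1) * (4 ^ m * 2 * pi ^ (2 * m))) / (1 + real \<nu> * \<delta>) ^ (2 * m - 1)"
      by simp
    also have "\<dots> \<le> c * C / (1 + real \<nu> * \<delta>) ^ (2 * m - 1)"
      using c_low c0 \<delta> by (intro divide_right_mono mult_mono) (auto simp: C_def)
    finally show ?thesis by simp
  qed
  obtain P :: "real poly" where P: "degree P \<le> m * (\<nu> - 1)" "\<And>\<theta>. integral {\<theta> - \<tau>..\<theta> + \<tau>} J = poly P (cos \<theta>)"
    using trigpoly_window_integral[OF J] by blast
  \<comment> \<open>Put \<open>\<delta> = \<bar>\<theta> - \<tau>\<bar>\<close>. For
    \<open>\<tau> \<le> \<theta>\<close> the window around \<open>\<theta>\<close> lies in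
    \<open>[\<delta>, 2 pi - \<delta>]\<close>; for \<open>\<theta> < \<tau>\<close> the rest of a
    period does. So in either case the error is at most the mass of the tail divided by
    \<open>c\<close>.\<close>
  have "\<bar>(if \<tau> \<le> \<theta> then 1 else 0) - poly (1 - smult (1 / c) P) (cos \<theta>)\<bar> \<le> C / (1 + real \<nu> * \<bar>\<theta> - \<tau>\<bar>) ^ (2 * m - 1)"
    if \<theta>: "\<theta> \<in> {0..pi}" for \<theta>
  proof -
    have eq: "poly (1 - smult (1 / c) P) (cos \<theta>) = 1 - integral {\<theta> - \<tau>..\<theta> + \<tau>} J / c" by (simp add: P(2))
    have pos: "0 \<le> integral {a..b} J" for a b by (intro integral_nonneg int) (auto simp: J0)
    show ?thesis
    proof (cases "\<tau> \<le> \<theta>")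
      case True
      have "integral {\<theta> - \<tau>..\<theta> + \<tau>} J \<le> integral {\<theta> - \<tau>..2 * pi - (\<theta> - \<tau>)} J" using \<theta> by (intro sub) auto
      also have "\<dots> \<le> c * (C / (1 + real \<nu> * (\<theta> - \<tau>)) ^ (2 * m - 1))" using \<theta> \<tau> True by (intro tail) auto
      finally show ?thesis unfolding eq using True c0 pos by (simp add: divide_le_eq mult.commute)
    next
      case False
      have "c - integral {\<theta> - \<tau>..\<theta> + \<tau>} J = integral {\<theta> + \<tau>..\<theta> - \<tau> + 2 * pi} J"
        using comb[of "\<theta> - \<tau>" "\<theta> + \<tau>" "\<theta> - \<tau> + 2 * pi"] period[of "\<theta> - \<tau>"] \<theta> \<tau> by simp
      also have "\<dots> \<le> integral {\<tau> - \<theta>..2 * pi - (\<tau> - \<theta>)} J" using \<theta> by (intro sub) auto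
      also have "\<dots> \<le> c * (C / (1 + real \<nu> * (\<tau> - \<theta>)) ^ (2 * m - 1))" using \<theta> \<tau> False by (intro tail) auto
      finally have *: "c - integral {\<theta> - \<tau>..\<theta> + \<tau>} J \<le> c * (C / (1 + real \<nu> * (\<tau> - \<theta>)) ^ (2 * m - 1))" .
      have "integral {\<theta> - \<tau>..\<theta> + \<tau>} J \<le> integral {\<theta> - \<tau>..\<theta> - \<tau> + 2 * pi} J" using \<tau> \<theta> by (intro sub) auto
      also have "\<dots> = c" using \<theta> \<tau> by (intro period) auto
      finally have "integral {\<theta> - \<tau>..\<theta> + \<tau>} J \<le> c" .
      then have "\<bar>(if \<tau> \<le> \<theta> then 1 else 0) - poly (1 - smult (1 / c) P) (cos \<theta>)\<bar> = (c - integral {\<theta> - \<tau>..\<theta> + \<tau>} J) / c"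
        unfolding eq using False c0 by (simp add: field_simps)
      also have "\<dots> \<le> C / (1 + real \<nu> * \<bar>\<theta> - \<tau>\<bar>) ^ (2 * m - 1)"
        using * False c0 by (simp add: divide_le_eq mult.commute)
      finally show ?thesis .
    qed
  qed
  moreover have "degree (1 - smult (1 / c) P) \<le> m * (\<nu> - 1)"
    using P(1) by (intro degree_diff_le) (auto intro: order.trans[OF degree_smult_le])
  ultimately show "\<exists>P::real poly. degree P \<le> m * (\<nu> - 1) \<and>
       (\<forall>\<theta>\<in>{0..pi}. \<bar>(if \<tau> \<le> \<theta> then 1 else 0) - poly P (cos \<theta>)\<bar> \<le> C / (1 + real \<nu> * \<bar>\<theta> - \<tau>\<bar>) ^ (2 * m - 1))"
    by (intro exI[of _ "1 - smult (1 / c) P"] conjI ballI)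
qed

section \<open>Gluing local polynomials\<close>

lemma borel_measurable_poly [measurable (raw)]:
  fixes P :: "real poly"
  assumes "f \<in> borel_measurable M"
  shows "(\<lambda>x. poly P (f x)) \<in> borel_measurable M"
  by (rule measurable_compose[OF assms borel_measurable_continuous_onI]) (intro continuous_intros)

text \<open>Lagrange interpolation at the \<open>\<xi> i\<close>: each of the \<open>d - 1\<close>
  factors of a basis polynomial has numerator at most \<open>\<rho> * h\<close> and denominator at
  least \<open>h\<close>.\<close>

lemma lagrange_bound:
  fixes R :: "real poly" and \<xi> :: "nat \<Rightarrow> real"
  assumes d: "degree R < d" and h: "0 < h" and sep: "\<And>i j. i < j \<Longrightarrow> j < d \<Longrightarrow> h \<le> \<xi> j - \<xi> i"
    and dist: "\<And>i. i < d \<Longrightarrow> \<bar>x - \<xi> i\<bar> \<le> \<rho> * h" and V: "\<And>i. i < d \<Longrightarrow> \<bar>poly R (\<xi> i)\<bar> \<le> V"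
  shows "\<bar>poly R x\<bar> \<le> real d * V * \<rho> ^ (d - 1)"
proof -
  have sep': "h \<le> \<bar>\<xi> i - \<xi> j\<bar>" if "i \<noteq> j" "i < d" "j < d" for i j
    using sep[of i j] sep[of j i] that h by (cases "i < j") auto
  define lag where "lag i = (\<Prod>l\<in>{..<d} - {i}. smult (1 / (\<xi> i - \<xi> l)) [:- \<xi> l, 1:])" for i
  define L where "L = (\<Sum>i<d. smult (poly R (\<xi> i)) (lag i))"
  have inj: "inj_on \<xi> {..<d}" using sep' h by (force simp: inj_on_def)
  have lag: "poly (lag i) y = (\<Prod>l\<in>{..<d} - {i}. (y - \<xi> l) / (\<xi> i - \<xi> l))" for i y
    by (simp add: lag_def poly_prod) (intro prod.cong, auto simp: field_simps diff_divide_distrib)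
  have delta: "poly (lag i) (\<xi> j) = (if i = j then 1 else 0)" if "i < d" "j < d" for i j
  proof (cases "i = j")
    case True
    have "(\<xi> i - \<xi> l) / (\<xi> i - \<xi> l) = 1" if "l \<in> {..<d} - {i}" for l
      using sep'[of i l] that \<open>i < d\<close> h by auto
    then show ?thesis using True by (simp add: lag)
  next
    case False
    then show ?thesis using that by (auto simp: lag intro!: prod_zero bexI[of _ j])
  qed
  have "R = L"
  proof (rule poly_eqI_degree[of "\<xi> ` {..<d}"])
    fix y assume "y \<in> \<xi> ` {..<d}"
    then obtain j where j: "j < d" "y = \<xi> j" by auto
    have "poly L y = (\<Sum>i<d. poly R (\<xi> i) * (if i = j then 1 else 0))"
      unfolding L_def poly_sum using j by (intro sum.cong) (auto simp: delta)
    then show "poly R y = poly L y" using j by (simp add: if_distrib cong: if_cong)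
  next
    show "degree R < card (\<xi> ` {..<d})" using d inj by (simp add: card_image)
    have "degree (lag i) \<le> d - 1" if "i < d" for i
    proof -
      have "degree (lag i) \<le> (\<Sum>l\<in>{..<d} - {i}. degree (smult (1 / (\<xi> i - \<xi> l)) [:- \<xi> l, 1:]))"
        unfolding lag_def using degree_prod_sum_le[of "{..<d} - {i}" "\<lambda>l. smult (1 / (\<xi> i - \<xi> l)) [:- \<xi> l, 1:]"]
        by (simp only: o_def finite_Diff finite_lessThan)
      also have "\<dots> \<le> (\<Sum>l\<in>{..<d} - {i}. 1)" by (intro sum_mono order.trans[OF degree_smult_le]) auto
      finally show ?thesis using that by simp
    qed
    then have "degree L \<le> d - 1" unfolding L_def
      by (intro degree_sum_le) (auto intro: order.trans[OF degree_smult_le])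
    then show "degree L < card (\<xi> ` {..<d})" using d inj by (simp add: card_image)
  qed
  have "\<bar>poly (lag i) x\<bar> \<le> \<rho> ^ (d - 1)" if i: "i < d" for i
  proof -
    have "\<bar>poly (lag i) x\<bar> = (\<Prod>l\<in>{..<d} - {i}. \<bar>x - \<xi> l\<bar> / \<bar>\<xi> i - \<xi> l\<bar>)"
      by (simp add: lag abs_prod)
    also have "\<dots> \<le> (\<Prod>l\<in>{..<d} - {i}. \<rho>)"
    proof (intro prod_mono conjI)
      fix l assume l: "l \<in> {..<d} - {i}"
      then have *: "h \<le> \<bar>\<xi> i - \<xi> l\<bar>" using i by (intro sep') auto
      have "0 \<le> \<rho> * h" using dist[OF i] abs_ge_zero order_trans by blast
      then have "0 \<le> \<rho>" using h by (simp add: zero_le_mult_iff)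
      then have "\<bar>x - \<xi> l\<bar> \<le> \<rho> * \<bar>\<xi> i - \<xi> l\<bar>" using dist[of l] l * by (meson DiffD1 lessThan_iff mult_left_mono order_trans)
      then show "\<bar>x - \<xi> l\<bar> / \<bar>\<xi> i - \<xi> l\<bar> \<le> \<rho>" using * h by (simp add: divide_le_eq)
    qed auto
    also have "\<dots> = \<rho> ^ (d - 1)" using i by simp
    finally show ?thesis .
  qed note lb = this
  have "\<bar>poly R x\<bar> \<le> (\<Sum>i<d. \<bar>poly R (\<xi> i)\<bar> * \<bar>poly (lag i) x\<bar>)"
    by (subst \<open>R = L\<close>) (simp add: L_def poly_sum order.trans[OF sum_abs] abs_mult)
  also have "\<dots> \<le> (\<Sum>i<d. V * \<rho> ^ (d - 1))"
  proof (intro sum_mono mult_mono V lb)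
    fix i assume "i \<in> {..<d}"
    then show "0 \<le> V" using V[of i] by force
  qed auto
  finally show ?thesis by simp
qed

lemma exists_le_average:
  fixes g :: "real \<Rightarrow> real"
  assumes "a < b" "continuous_on {a..b} g" "\<And>x. 0 \<le> g x"
  shows "\<exists>\<xi>\<in>{a..b}. ennreal (g \<xi> * (b - a)) \<le> (\<integral>\<^sup>+x\<in>{a..b}. ennreal (g x) \<partial>lborel)"
proof -
  obtain \<xi> where \<xi>: "\<xi> \<in> {a..b}" "\<And>x. x \<in> {a..b} \<Longrightarrow> g \<xi> \<le> g x"
    using continuous_attains_inf[of "{a..b}" g] assms by force
  have "ennreal (g \<xi> * (b - a)) = (\<integral>\<^sup>+x\<in>{a..b}. ennreal (g \<xi>) \<partial>lborel)"
    using assms by (simp add: nn_integral_cmult_indicator ennreal_mult)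
  also have "\<dots> \<le> (\<integral>\<^sup>+x\<in>{a..b}. ennreal (g x) \<partial>lborel)"
    using \<xi>(2) by (intro nn_integral_mono) (auto simp: indicator_def intro: ennreal_leI)
  finally show ?thesis using \<xi>(1) by blast
qed

text \<open>Cut \<open>[a,b]\<close> into \<open>d\<close> cells of length \<open>2 * h\<close> and
  choose in the left half of each a point where \<open>\<bar>R\<bar>\<close> is at most its average
  there. These points are at least \<open>h\<close> apart, and Lagrange interpolation at them bounds
  \<open>R\<close> everywhere by its integral norm, with growth of order
  \<open>d - 1\<close>.\<close>

lemma poly_growth_bound:
  fixes R :: "real poly"
  assumes d: "degree R < d" and ab: "a < b"
  shows "ennreal \<bar>poly R x\<bar> \<le> ennreal (real d * (2 * real d) ^ d * (1 + \<bar>x - a\<bar> / (b - a)) ^ (d - 1) / (b - a))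
           * (\<integral>\<^sup>+y\<in>{a..b}. ennreal \<bar>poly R y\<bar> \<partial>lborel)"
proof -
  define h where "h = (b - a) / (2 * real d)"
  have d0: "d > 0" using d by auto
  have h: "h > 0" using ab d0 by (simp add: h_def)
  have hb: "2 * real d * h = b - a" using d0 by (simp add: h_def)
  let ?I = "\<integral>\<^sup>+y\<in>{a..b}. ennreal \<bar>poly R y\<bar> \<partial>lborel"
  have "\<exists>\<xi>\<in>{a + 2 * real i * h..a + 2 * real i * h + h}. ennreal (\<bar>poly R \<xi>\<bar> * h) \<le> ?I" if "i < d" for i
  proof -
    have "\<exists>\<xi>\<in>{a + 2 * real i * h..a + 2 * real i * h + h}. ennreal (\<bar>poly R \<xi>\<bar> * ((a + 2 * real i * h + h) - (a + 2 * real i * h)))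
       \<le> (\<integral>\<^sup>+x\<in>{a + 2 * real i * h..a + 2 * real i * h + h}. ennreal \<bar>poly R x\<bar> \<partial>lborel)"
      using h by (intro exists_le_average) (auto intro!: continuous_intros)
    then obtain \<xi> where \<xi>: "\<xi> \<in> {a + 2 * real i * h..a + 2 * real i * h + h}"
      "ennreal (\<bar>poly R \<xi>\<bar> * h) \<le> (\<integral>\<^sup>+x\<in>{a + 2 * real i * h..a + 2 * real i * h + h}. ennreal \<bar>poly R x\<bar> \<partial>lborel)"
      unfolding add_diff_cancel_left' by blast
    note \<xi>(2)
    also have "(\<integral>\<^sup>+x\<in>{a + 2 * real i * h..a + 2 * real i * h + h}. ennreal \<bar>poly R x\<bar> \<partial>lborel) \<le> ?I"
    proof (intro nn_integral_mono mult_left_mono indicator_leI)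
      have le: "2 * real i * h + h \<le> 2 * real d * h"
      proof -
        have "(2 * real i + 1) * h \<le> (2 * real d) * h" using that h by (intro mult_right_mono) auto
        then show ?thesis by (simp add: algebra_simps)
      qed
      define c where "c = 2 * real i * h"
      have "0 \<le> c" using h by (simp add: c_def)
      moreover have "c + h \<le> b - a" using le unfolding hb c_def .
      ultimately show "x \<in> {a + 2 * real i * h..a + 2 * real i * h + h} \<Longrightarrow> x \<in> {a..b}" for x
        unfolding c_def[symmetric] by auto
    qed auto
    finally show ?thesis using \<xi>(1) by blast
  qed
  then have "\<exists>\<xi>. \<forall>i. i < d \<longrightarrow> \<xi> i \<in> {a + 2 * real i * h..a + 2 * real i * h + h} \<and> ennreal (\<bar>poly R (\<xi> i)\<bar> * h) \<le> ?I"
    by (intro choice) blast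
  then obtain \<xi> where "\<forall>i. i < d \<longrightarrow> \<xi> i \<in> {a + 2 * real i * h..a + 2 * real i * h + h} \<and> ennreal (\<bar>poly R (\<xi> i)\<bar> * h) \<le> ?I" ..
  then have \<xi>: "\<And>i. i < d \<Longrightarrow> a + 2 * real i * h \<le> \<xi> i" "\<And>i. i < d \<Longrightarrow> \<xi> i \<le> a + 2 * real i * h + h"
     "\<And>i. i < d \<Longrightarrow> ennreal (\<bar>poly R (\<xi> i)\<bar> * h) \<le> ?I"
    by simp_all
  show ?thesis
  proof (cases "?I = \<infinity>")
    case True
    define q where "q = real d * (2 * real d) ^ d * (1 + \<bar>x - a\<bar> / (b - a)) ^ (d - 1) / (b - a)"
    have "0 < q" unfolding q_def
      using ab d0 by (intro divide_pos_pos mult_pos_pos zero_less_power add_pos_nonneg) auto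
    then show ?thesis using True unfolding q_def[symmetric] by (simp add: ennreal_mult_top)
  next
    case False
    then obtain I where I: "?I = ennreal I" "0 \<le> I" by (cases ?I) auto
    define \<rho> where "\<rho> = 2 * real d * (1 + \<bar>x - a\<bar> / (b - a))"
    have rh: "\<rho> * h = (b - a) + \<bar>x - a\<bar>" using ab d0 by (simp add: \<rho>_def h_def field_simps)
    have "\<bar>poly R x\<bar> \<le> real d * (I / h) * \<rho> ^ (d - 1)"
    proof (rule lagrange_bound[OF d h])
      fix i assume i: "i < d"
      show "\<bar>poly R (\<xi> i)\<bar> \<le> I / h" using \<xi>(3)[OF i] I h by (simp add: field_simps)
      have "2 * real i * h + h \<le> 2 * real d * h"
      proof -
        have "(2 * real i + 1) * h \<le> (2 * real d) * h" using i h by (intro mult_right_mono) auto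
        then show ?thesis by (simp add: algebra_simps)
      qed
      moreover define c where "c = 2 * real i * h"
      moreover have "0 \<le> c" using h by (simp add: c_def)
      ultimately have "a \<le> \<xi> i" "\<xi> i \<le> b" using \<xi>(1,2)[OF i] unfolding hb c_def[symmetric] by auto
      then show "\<bar>x - \<xi> i\<bar> \<le> \<rho> * h" unfolding rh by linarith
    next
      fix i j assume ij: "i < j" "j < d"
      have "(2 * real i + 2) * h \<le> (2 * real j) * h" using ij h by (intro mult_right_mono) auto
      then have "2 * real i * h + 2 * h \<le> 2 * real j * h" by (simp add: algebra_simps)
      then show "h \<le> \<xi> j - \<xi> i" using \<xi>(2)[of i] \<xi>(1)[of j] ij by simp
    qed
    also have "\<dots> = real d * (2 * real d) ^ d * (1 + \<bar>x - a\<bar> / (b - a)) ^ (d - 1) / (b - a) * I"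
    proof -
      have "(2 * real d) ^ d = 2 * real d * (2 * real d) ^ (d - 1)" using d0 by (metis power_minus_mult mult.commute)
      then show ?thesis unfolding \<rho>_def h_def power_mult_distrib using d0 ab by (simp add: field_simps)
    qed
    finally show ?thesis using I ab by (simp add: ennreal_leI flip: ennreal_mult)
  qed
qed

lemma sum_inverse_squares_le:
  fixes i :: nat
  assumes "finite S"
  shows "(\<Sum>j\<in>S. 1 / (1 + \<bar>real i - real j\<bar>)\<^sup>2) \<le> 4"
proof -
  have base: "(\<Sum>n<N. 1 / (1 + real n)\<^sup>2) \<le> 2 - 1 / real N" if "N \<ge> 1" for N
    using that
  proof (induction N rule: nat_induct_at_least)
    case (Suc N)
    have "1 / (1 + real N)\<^sup>2 \<le> 1 / (real N * (1 + real N))" using Suc by (intro divide_left_mono) (auto simp: power2_eq_square)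
    also have "\<dots> = 1 / real N - 1 / (1 + real N)" using Suc by (simp add: field_simps)
    finally show ?case using Suc by simp
  qed simp
  have base': "(\<Sum>n\<in>T. 1 / (1 + real n)\<^sup>2) \<le> 2" if "finite T" for T
  proof -
    define N where "N = Suc (Max (insert 0 T))"
    have "T \<subseteq> {..<N}" using that unfolding N_def by (auto simp: less_Suc_eq_le)
    then have "(\<Sum>n\<in>T. 1 / (1 + real n)\<^sup>2) \<le> (\<Sum>n<N. 1 / (1 + real n)\<^sup>2)" by (intro sum_mono2) auto
    also have "\<dots> \<le> 2 - 1 / real N" by (rule base) (simp add: N_def)
    also have "\<dots> \<le> 2" by simp
    finally show ?thesis .
  qed
  have "(\<Sum>j\<in>S. 1 / (1 + \<bar>real i - real j\<bar>)\<^sup>2)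
      = (\<Sum>j\<in>{j\<in>S. j \<le> i}. 1 / (1 + \<bar>real i - real j\<bar>)\<^sup>2) + (\<Sum>j\<in>{j\<in>S. i < j}. 1 / (1 + \<bar>real i - real j\<bar>)\<^sup>2)"
    using assms by (subst sum.union_disjoint[symmetric]) (auto intro!: sum.cong)
  also have "(\<Sum>j\<in>{j\<in>S. j \<le> i}. 1 / (1 + \<bar>real i - real j\<bar>)\<^sup>2) = (\<Sum>n\<in>(\<lambda>j. i - j) ` {j\<in>S. j \<le> i}. 1 / (1 + real n)\<^sup>2)"
    by (subst sum.reindex) (auto intro!: inj_onI sum.cong)
  also have "(\<Sum>j\<in>{j\<in>S. i < j}. 1 / (1 + \<bar>real i - real j\<bar>)\<^sup>2) = (\<Sum>n\<in>(\<lambda>j. j - i) ` {j\<in>S. i < j}. 1 / (1 + real n)\<^sup>2)"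
    by (subst sum.reindex) (auto intro!: inj_onI sum.cong)
  finally show ?thesis
    using base'[of "(\<lambda>j. i - j) ` {j\<in>S. j \<le> i}"] base'[of "(\<lambda>j. j - i) ` {j\<in>S. i < j}"] assms by simp
qed

section \<open>Geometry of the Chebyshev nodes\<close>

lemma sin_ge_endpoint:
  fixes a t :: real
  assumes "0 \<le> a" "a \<le> t" "t \<le> pi - a"
  shows "sin a \<le> sin t"
proof (cases "t \<le> pi / 2")
  case True
  then show ?thesis using assms by (intro sin_monotone_2pi_le) auto
next
  case False
  have "sin a \<le> sin (pi - t)" using assms False by (intro sin_monotone_2pi_le) auto
  then show ?thesis by simp
qed

text \<open>Differences of cosines factor into two sines. For the interval ending at node
  \<open>j\<close> these are \<open>S\<close> and \<open>s\<close>. For \<open>\<theta>\<close> the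
  first sine exceeds \<open>S\<close> by at most \<open>\<beta> * (1 + n)\<close> and the second is
  at most \<open>\<beta> * (1 + n) / 2\<close>; both are controlled because
  \<open>\<beta> \<le> pi * s \<le> pi * S\<close>. The inequality \<open>s \<le> S\<close> covers
  the shortest intervals, at the ends of \<open>[-1,1]\<close>. Distances measured in interval
  lengths thus grow only quadratically in the number of intervals.\<close>

lemma cos_nodes_distance:
  fixes \<beta> \<theta> :: real and i j :: nat
  assumes \<beta>: "0 < \<beta>" "\<beta> \<le> pi" and j: "1 \<le> j" "real j * \<beta> \<le> pi"
    and \<theta>: "real i * \<beta> \<le> \<theta>" "\<theta> \<le> (real i + 1) * \<beta>"
  defines "n \<equiv> \<bar>real i - real j\<bar>"
  shows "\<bar>cos \<theta> - cos (real j * \<beta>)\<bar> \<le> 8 * (1 + n)\<^sup>2 * (cos ((real j - 1) * \<beta>) - cos (real j * \<beta>))"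
proof -
  define S where "S = sin ((real j - 1 / 2) * \<beta>)"
  define s where "s = sin (\<beta> / 2)"
  have s: "\<beta> / pi \<le> s" using sin_ge_chord[of "\<beta> / 2"] \<beta> by (simp add: s_def)
  then have s0: "s > 0" using \<beta> by (meson divide_pos_pos less_le_trans pi_gt_zero)
  have j2: "\<beta> / 2 \<le> (real j - 1 / 2) * \<beta>"
  proof -
    have "(1/2) * \<beta> \<le> (real j - 1 / 2) * \<beta>" using j \<beta> by (intro mult_right_mono) auto
    then show ?thesis by simp
  qed
  moreover have "(real j - 1 / 2) * \<beta> \<le> pi - \<beta> / 2" using j by (simp add: algebra_simps)
  ultimately have sS: "s \<le> S" unfolding s_def S_def using \<beta> by (intro sin_ge_endpoint) auto
  have L: "cos ((real j - 1) * \<beta>) - cos (real j * \<beta>) = 2 * S * s"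
    unfolding cos_diff_cos S_def s_def by (simp add: algebra_simps) (simp add: field_simps)
  define \<delta> where "\<delta> = (\<theta> - real j * \<beta>) / 2"
  have n0: "n \<ge> 0" by (simp add: n_def)
  have d: "\<bar>\<delta>\<bar> \<le> \<beta> * (1 + n) / 2"
  proof -
    have "\<bar>\<theta> - real j * \<beta>\<bar> \<le> \<bar>\<theta> - real i * \<beta>\<bar> + \<bar>real i * \<beta> - real j * \<beta>\<bar>" by simp
    also have "\<bar>\<theta> - real i * \<beta>\<bar> \<le> \<beta>" using \<theta> by (simp add: algebra_simps)
    also have "\<bar>real i * \<beta> - real j * \<beta>\<bar> = n * \<beta>" using \<beta> by (simp add: n_def abs_mult left_diff_distrib[symmetric])
    finally show ?thesis by (simp add: \<delta>_def algebra_simps)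
  qed
  have "\<bar>sin ((\<theta> + real j * \<beta>) / 2)\<bar> \<le> S + \<beta> * (1 + n)"
  proof -
    define b where "b = \<delta> + \<beta> / 2"
    have S0: "0 \<le> S" using s0 sS by simp
    have "\<bar>sin ((real j - 1 / 2) * \<beta> + b)\<bar> \<le> \<bar>S\<bar> * \<bar>cos b\<bar> + \<bar>cos ((real j - 1 / 2) * \<beta>)\<bar> * \<bar>sin b\<bar>"
      unfolding sin_add S_def by (metis abs_mult abs_triangle_ineq)
    also have "\<dots> \<le> S * 1 + 1 * \<bar>b\<bar>" using S0
      by (intro add_mono mult_mono abs_sin_x_le_abs_x) auto
    also have "\<bar>b\<bar> \<le> \<beta> * (1 + n)"
    proof -
      have "\<bar>b\<bar> \<le> \<beta> * (1 + n) / 2 + \<beta> / 2" using d \<beta> by (auto simp: b_def)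
      also have "\<dots> \<le> \<beta> * (1 + n)" using \<beta> mult_nonneg_nonneg[of \<beta> n] n0 by (simp add: field_simps)
      finally show ?thesis .
    qed
    also have "(real j - 1 / 2) * \<beta> + b = (\<theta> + real j * \<beta>) / 2" by (simp add: b_def \<delta>_def field_simps)
    finally show ?thesis by simp
  qed
  also have "\<dots> \<le> S * (1 + pi * (1 + n))"
  proof -
    have "\<beta> \<le> S * pi" using s sS by (simp add: divide_le_eq order.trans mult_right_mono)
    then have "\<beta> * (1 + n) \<le> (S * pi) * (1 + n)" using n0 by (intro mult_right_mono) auto
    then show ?thesis by (simp add: algebra_simps)
  qed
  finally have A: "\<bar>sin ((\<theta> + real j * \<beta>) / 2)\<bar> \<le> S * (1 + pi * (1 + n))" .
  have B: "\<bar>sin ((real j * \<beta> - \<theta>) / 2)\<bar> \<le> s * (pi * (1 + n) / 2)"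
  proof -
    have "\<bar>sin ((real j * \<beta> - \<theta>) / 2)\<bar> \<le> \<bar>\<delta>\<bar>"
      using abs_sin_x_le_abs_x[of "(real j * \<beta> - \<theta>) / 2"] by (simp add: \<delta>_def abs_minus_commute)
    also have "\<dots> \<le> (s * pi) * ((1 + n) / 2)"
    proof -
      have "\<beta> \<le> s * pi" using s by (simp add: divide_le_eq)
      then have "\<beta> * ((1 + n) / 2) \<le> (s * pi) * ((1 + n) / 2)" using n0 by (intro mult_right_mono) auto
      then show ?thesis using d by simp
    qed
    finally show ?thesis by (simp add: ac_simps)
  qed
  have "\<bar>cos \<theta> - cos (real j * \<beta>)\<bar> = 2 * (\<bar>sin ((\<theta> + real j * \<beta>) / 2)\<bar> * \<bar>sin ((real j * \<beta> - \<theta>) / 2)\<bar>)"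
    unfolding cos_diff_cos by (simp add: abs_mult)
  also have "\<dots> \<le> 2 * ((S * (1 + pi * (1 + n))) * (s * (pi * (1 + n) / 2)))"
    using A B by (intro mult_left_mono mult_mono) (auto intro: order.trans[OF abs_ge_zero A])
  also have "\<dots> = (2 * S * s) * ((1 + pi * (1 + n)) * (pi * (1 + n) / 2))" by simp
  also have "\<dots> \<le> (2 * S * s) * (8 * (1 + n)\<^sup>2)"
  proof (intro mult_left_mono)
    have pi: "pi \<le> 3.2" using pi_approx by simp
    have "(1 + pi * (1 + n)) * (pi * (1 + n) / 2) \<le> ((1 + n) + 3.2 * (1 + n)) * (3.2 * (1 + n) / 2)"
      using n0 pi by (intro mult_mono add_mono divide_right_mono mult_right_mono) auto
    also have "\<dots> = 6.72 * (1 + n)\<^sup>2" by (simp add: power2_eq_square field_simps)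
    also have "\<dots> \<le> 8 * (1 + n)\<^sup>2" by (intro mult_right_mono) auto
    finally show "(1 + pi * (1 + n)) * (pi * (1 + n) / 2) \<le> 8 * (1 + n)\<^sup>2" .
    show "0 \<le> 2 * S * s" using s0 sS by auto
  qed
  finally show ?thesis unfolding L by (simp add: ac_simps)
qed

lemma half_le_1: "ennreal (1 / 2) \<le> 1"
  using ennreal_leI[of "1 / 2" 1] by (simp only: ennreal_1)

text \<open>The piecewise polynomial \<open>P i\<close> on the \<open>i\<close>-th Chebyshev interval is
  \<open>P 0 + (\<Sum>j. (P j - P (j - 1)) \<chi>\<^sub>j)\<close> with step functions \<open>\<chi>\<^sub>j\<close>, which are replaced by their
  polynomial approximations. Both \<open>P (j - 1)\<close> and \<open>P j\<close> are close to \<open>f\<close> on the interval number \<open>j - 1\<close>.\<close>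

theorem glue_local_polynomials:
  fixes d :: nat
  assumes d: "1 \<le> d"
  obtains C :: real where "1 \<le> C"
    "\<And>p \<nu> f P A. 1 \<le> p \<Longrightarrow> 1 \<le> \<nu> \<Longrightarrow> f \<in> borel_measurable borel \<Longrightarrow> (\<And>i. degree (P i) < d) \<Longrightarrow> 0 < A \<Longrightarrow>
      \<exists>Q::real poly. degree Q < d + (d + 2) * (\<nu> - 1) \<and>
        (\<integral>\<^sup>+x\<in>{-1<..1}. young p (ennreal (\<bar>f x - poly Q x\<bar> / (C * A))) \<partial>lborel)
        \<le> ennreal C * (\<Sum>i<6 * \<nu>. \<integral>\<^sup>+x\<in>{cos ((real i + 1) * (pi / (6 * real \<nu>)))..cos (real i * (pi / (6 * real \<nu>)))}.
              (young p (ennreal (\<bar>f x - poly (P i) x\<bar> / A)) + young p (ennreal (\<bar>f x - poly (P (Suc i)) x\<bar> / A))) \<partial>lborel)"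
proof -
  \<comment> \<open>The error of a step function then decays like
    \<open>N ^ (2 * (d - 1) + 5)\<close> in \<open>N = 1 + n i j\<close>. The jump of the local
    polynomials costs \<open>N ^ (2 * (d - 1))\<close>; of the rest at least \<open>N ^ 4\<close>
    remains, one square for the ratio of interval lengths and one for summation.\<close>
  define m where "m = d + 2"
  obtain C0 :: real where C0: "C0 > 0" and
    step: "\<And>\<nu> \<tau>. 1 \<le> \<nu> \<Longrightarrow> 0 \<le> \<tau> \<Longrightarrow> \<tau> \<le> pi \<Longrightarrow> \<exists>P::real poly. degree P \<le> m * (\<nu> - 1) \<and>
       (\<forall>\<theta>\<in>{0..pi}. \<bar>(if \<tau> \<le> \<theta> then 1 else 0) - poly P (cos \<theta>)\<bar> \<le> C0 / (1 + real \<nu> * \<bar>\<theta> - \<tau>\<bar>) ^ (2 * m - 1))"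
    using step_function_approx[of m] by (auto simp: m_def)
  define D where "D = real d * (2 * real d) ^ d"
  have D1: "D > 0" using d by (simp add: D_def)
  define C1 where "C1 = C0 * 2 ^ (2 * m - 1) * D * 9 ^ d"
  have C1: "C1 > 0" using C0 D1 by (simp add: C1_def)
  \<comment> \<open>\<open>16 * C1\<close> brings the weights of the jumps down to
    \<open>1 / 8\<close> in front of \<open>N ^ (- 4)\<close>. The 9 is \<open>1 + 2 * 4\<close>
    from the last summation: each \<open>E i\<close> once as own error and at most 8 times through
    the jumps.\<close>
  define C where "C = max 9 (16 * C1)"
  have C: "9 \<le> C" "16 * C1 \<le> C" by (auto simp: C_def)
  show thesis
  proof (rule that[of C])
    show "1 \<le> C" using C by simp
    fix p :: ennreal and \<nu> :: nat and f :: "real \<Rightarrow> real" and P :: "nat \<Rightarrow> real poly" and A :: real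
    assume p: "1 \<le> p" and \<nu>: "1 \<le> \<nu>" and f[measurable]: "f \<in> borel_measurable borel" and P: "\<And>i. degree (P i) < d" and A: "0 < A"
    define \<beta> where "\<beta> = pi / (6 * real \<nu>)"
    define M where "M = 6 * \<nu>"
    have \<beta>: "0 < \<beta>" "\<beta> \<le> pi" "real M * \<beta> = pi" "1/2 \<le> real \<nu> * \<beta>"
    proof -
      show "0 < \<beta>" using \<nu> by (simp add: \<beta>_def)
      have "pi * 1 \<le> pi * (6 * real \<nu>)" using \<nu> by (intro mult_left_mono) auto
      then show "\<beta> \<le> pi" using \<nu> by (simp add: \<beta>_def divide_le_eq)
      show "real M * \<beta> = pi" using \<nu> by (simp add: \<beta>_def M_def)
      have "real \<nu> * \<beta> = pi / 6" using \<nu> by (simp add: \<beta>_def)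
      then show "1/2 \<le> real \<nu> * \<beta>" using pi_gt3 by simp
    qed
    have jpi: "real j * \<beta> \<le> pi" if "j \<le> M" for j
      using mult_right_mono[of "real j" "real M" \<beta>] that \<beta> by simp
    define X where "X i = cos (real i * \<beta>)" for i :: nat
    have Xlt: "X j < X i" if "i < j" "j \<le> M" for i j
      unfolding X_def using that \<beta> jpi[of j] by (intro cos_monotone_0_pi) auto
    have Xle: "X j \<le> X i" if "i \<le> j" "j \<le> M" for i j
      using Xlt[of i j] that by (cases "i = j") auto
    define I where "I i = {X (Suc i)..X i}" for i
    define L where "L j = X (j - 1) - X j" for j
    have L: "L j > 0" if "1 \<le> j" "j \<le> M" for j using Xlt[of "j - 1" j] that by (simp add: L_def)
    define n where "n i j = \<bar>real i - real j\<bar>" for i j :: nat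
    have n0: "0 \<le> n i j" for i j by (simp add: n_def)
    have dist: "\<bar>x - X j\<bar> \<le> 8 * (1 + n i j)\<^sup>2 * L j" if "x \<in> I i" "i < M" "1 \<le> j" "j \<le> M" for x i j
    proof -
      have range: "X (Suc i) \<le> x" "x \<le> X i" "-1 \<le> x" "x \<le> 1"
        using that by (auto simp: I_def X_def intro: order.trans[OF cos_ge_minus_one] order.trans[OF _ cos_le_one])
      have ar: "real i * \<beta> \<le> arccos x" "arccos x \<le> (real i + 1) * \<beta>"
      proof -
        have "arccos (X i) \<le> arccos x" using range by (intro arccos_le_mono[THEN iffD2]) (auto simp: X_def)
        moreover have "arccos (X i) = real i * \<beta>" unfolding X_def using that \<beta> jpi[of i] by (intro arccos_cos) auto
        ultimately show "real i * \<beta> \<le> arccos x" by simp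
        have "arccos x \<le> arccos (X (Suc i))" using range by (intro arccos_le_mono[THEN iffD2]) (auto simp: X_def)
        moreover have "arccos (X (Suc i)) = real (Suc i) * \<beta>" unfolding X_def using that \<beta> jpi[of "Suc i"] by (intro arccos_cos) auto
        ultimately show "arccos x \<le> (real i + 1) * \<beta>" by (simp add: add.commute)
      qed
      have "\<bar>cos (arccos x) - cos (real j * \<beta>)\<bar> \<le> 8 * (1 + n i j)\<^sup>2 * (cos ((real j - 1) * \<beta>) - cos (real j * \<beta>))"
        unfolding n_def using that \<beta> jpi ar by (intro cos_nodes_distance) auto
      then show ?thesis using range that by (simp add: L_def X_def of_nat_diff)
    qed
    have len: "X i - X (Suc i) \<le> 16 * (1 + n i j)\<^sup>2 * L j" if "i < M" "1 \<le> j" "j \<le> M" for i j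
    proof -
      have "X i \<in> I i" "X (Suc i) \<in> I i" using Xle[of i "Suc i"] that by (auto simp: I_def)
      from dist[OF this(1) that] dist[OF this(2) that] show ?thesis by linarith
    qed
    have "\<exists>T. \<forall>j. j \<le> M \<longrightarrow> degree (T j :: real poly) \<le> m * (\<nu> - 1) \<and>
       (\<forall>\<theta>\<in>{0..pi}. \<bar>(if real j * \<beta> \<le> \<theta> then 1 else 0) - poly (T j) (cos \<theta>)\<bar> \<le> C0 / (1 + real \<nu> * \<bar>\<theta> - real j * \<beta>\<bar>) ^ (2 * m - 1))"
      using step[OF \<nu>, of "real _ * \<beta>"] jpi \<beta> by (intro choice allI) (auto simp: choice_iff')
    then obtain T :: "nat \<Rightarrow> real poly" where T: "\<And>j. j \<le> M \<Longrightarrow> degree (T j) \<le> m * (\<nu> - 1)"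
      "\<And>j \<theta>. j \<le> M \<Longrightarrow> \<theta> \<in> {0..pi} \<Longrightarrow> \<bar>(if real j * \<beta> \<le> \<theta> then 1 else 0) - poly (T j) (cos \<theta>)\<bar> \<le> C0 / (1 + real \<nu> * \<bar>\<theta> - real j * \<beta>\<bar>) ^ (2 * m - 1)"
      by blast
    have Terr: "\<bar>(if j \<le> i then 1 else 0) - poly (T j) x\<bar> \<le> C0 * 2 ^ (2 * m - 1) / (1 + n i j) ^ (2 * m - 1)"
      if x: "X (Suc i) < x" "x \<le> X i" and ij: "i < M" "j \<le> M" for i j x
    proof -
      define \<theta> where "\<theta> = arccos x"
      have range: "-1 < x" "x \<le> 1"
        using x by (auto simp: X_def intro: order.strict_trans1[OF cos_ge_minus_one] order.trans[OF _ cos_le_one])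
      have cosx: "cos \<theta> = x" and th: "\<theta> \<in> {0..pi}" using range by (auto simp: \<theta>_def arccos_lbound arccos_ubound)
      have t1: "real i * \<beta> \<le> \<theta>"
      proof -
        have "arccos (X i) \<le> arccos x" using range x by (intro arccos_le_mono[THEN iffD2]) (auto simp: X_def)
        moreover have "arccos (X i) = real i * \<beta>" unfolding X_def using ij \<beta> jpi[of i] by (intro arccos_cos) auto
        ultimately show ?thesis by (simp add: \<theta>_def)
      qed
      have t2: "\<theta> < (real i + 1) * \<beta>"
      proof (rule ccontr)
        assume "\<not> ?thesis"
        then have "cos \<theta> \<le> cos (real (Suc i) * \<beta>)" using th \<beta> by (intro cos_monotone_0_pi_le) (auto simp: add.commute)
        then show False using x cosx by (simp add: X_def)
      qed
      have iff: "real j * \<beta> \<le> \<theta> \<longleftrightarrow> j \<le> i"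
      proof
        assume "real j * \<beta> \<le> \<theta>"
        then have "real j * \<beta> < (real i + 1) * \<beta>" using t2 by linarith
        then show "j \<le> i" using \<beta> by simp
      next
        assume "j \<le> i"
        then have "real j * \<beta> \<le> real i * \<beta>" using \<beta> by (intro mult_right_mono) auto
        then show "real j * \<beta> \<le> \<theta>" using t1 by linarith
      qed
      \<comment> \<open>Since \<open>\<nu> * \<beta> = pi / 6\<close> exceeds \<open>1 / 2\<close>,
        a distance of at least \<open>(n i j - 1) * \<beta>\<close> in angle is worth
        \<open>(n i j - 1) / 2\<close>.\<close>
      have sep: "(1 + n i j) / 2 \<le> 1 + real \<nu> * \<bar>\<theta> - real j * \<beta>\<bar>"
      proof -
        have "n i j * \<beta> - \<beta> \<le> \<bar>\<theta> - real j * \<beta>\<bar>"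
        proof -
          have "n i j * \<beta> = \<bar>real i * \<beta> - real j * \<beta>\<bar>" using \<beta> by (simp add: n_def abs_mult left_diff_distrib[symmetric])
          also have "\<dots> \<le> \<bar>\<theta> - real j * \<beta>\<bar> + \<bar>\<theta> - real i * \<beta>\<bar>" by linarith
          also have "\<bar>\<theta> - real i * \<beta>\<bar> \<le> \<beta>" using t1 t2 by (simp add: algebra_simps)
          finally show ?thesis by simp
        qed
        then have "real \<nu> * (n i j * \<beta> - \<beta>) \<le> real \<nu> * \<bar>\<theta> - real j * \<beta>\<bar>" by (intro mult_left_mono) auto
        moreover have "(n i j - 1) * (1/2) \<le> (n i j - 1) * (real \<nu> * \<beta>)" if "n i j \<ge> 1"
          using that \<beta> by (intro mult_left_mono) auto
        moreover have "0 \<le> real \<nu> * \<bar>\<theta> - real j * \<beta>\<bar>" by simp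
        ultimately show ?thesis
        proof (cases "n i j \<ge> 1")
          case True
          have "(n i j - 1) * (real \<nu> * \<beta>) = real \<nu> * (n i j * \<beta> - \<beta>)" by (simp add: algebra_simps)
          then have "(n i j - 1) * (1/2) \<le> real \<nu> * \<bar>\<theta> - real j * \<beta>\<bar>"
            using \<open>real \<nu> * (n i j * \<beta> - \<beta>) \<le> _\<close> \<open>n i j \<ge> 1 \<Longrightarrow> _\<close> True by linarith
          then show ?thesis by (simp add: field_simps)
        next
          case False
          then have "(1 + n i j) / 2 \<le> 1" by simp
          also have "1 \<le> 1 + real \<nu> * \<bar>\<theta> - real j * \<beta>\<bar>" by simp
          finally show ?thesis .
        qed
      qed
      have "\<bar>(if j \<le> i then 1 else 0) - poly (T j) x\<bar> \<le> C0 / (1 + real \<nu> * \<bar>\<theta> - real j * \<beta>\<bar>) ^ (2 * m - 1)"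
        using T(2)[OF ij(2) th] by (simp add: iff cosx)
      also have "\<dots> \<le> C0 / ((1 + n i j) / 2) ^ (2 * m - 1)"
        using sep C0 n0[of i j] by (intro divide_left_mono power_mono mult_pos_pos zero_less_power) (auto simp: add_pos_nonneg)
      finally show ?thesis by (simp add: power_divide)
    qed
    define Q where "Q = P 0 + (\<Sum>j\<in>{1..<M}. (P j - P (j - 1)) * T j)"
    have degQ: "degree Q < d + m * (\<nu> - 1)"
    proof -
      have "degree ((P j - P (j - 1)) * T j) \<le> d - 1 + m * (\<nu> - 1)" if "j \<in> {1..<M}" for j
      proof -
        have "degree (P j - P (j - 1)) \<le> d - 1" using P[of j] P[of "j - 1"] by (intro degree_diff_le) auto
        moreover have "degree (T j) \<le> m * (\<nu> - 1)" using T(1) that by auto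
        ultimately show ?thesis by (intro order.trans[OF degree_mult_le] add_mono)
      qed
      moreover have "degree (P 0) \<le> d - 1 + m * (\<nu> - 1)" using P[of 0] by simp
      ultimately have "degree Q \<le> d - 1 + m * (\<nu> - 1)" unfolding Q_def by (intro degree_add_le degree_sum_le) auto
      then show ?thesis using d by simp
    qed
    \<comment> \<open>The average over interval \<open>j - 1\<close> of the mean of the two errors
      made there by \<open>P j\<close> and \<open>P (j - 1)\<close>. By the triangle inequality
      through \<open>f\<close> it dominates the average of the jump divided by \<open>2 * A\<close>,
      from which \<open>poly_growth_bound\<close> controls the jump everywhere.\<close>
    define b where "b j = ennreal (1 / L j) * (\<integral>\<^sup>+x\<in>I (j - 1). ennreal (\<bar>f x - poly (P j) x\<bar> / (2 * A) + \<bar>f x - poly (P (j - 1)) x\<bar> / (2 * A)) \<partial>lborel)" for j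
    have jump: "ennreal \<bar>poly (P j - P (j - 1)) x\<bar> \<le> ennreal (D * 9 ^ d * (1 + n i j) ^ (2 * (d - 1)) * (2 * A)) * b j"
      if x: "x \<in> I i" and ij: "i < M" "1 \<le> j" "j < M" for i j x
    proof -
      have Lj: "L j > 0" using L ij by simp
      have "Suc (j - 1) = j" using ij by simp
      then have Ij: "I (j - 1) = {X j..X (j - 1)}" by (simp add: I_def)
      have "degree (P j - P (j - 1)) < d" using P[of j] P[of "j - 1"] by (intro le_less_trans[OF degree_diff_le_max]) auto
      from poly_growth_bound[OF this, of "X j" "X (j - 1)" x] Lj
      have "ennreal \<bar>poly (P j - P (j - 1)) x\<bar> \<le> ennreal (D * (1 + \<bar>x - X j\<bar> / L j) ^ (d - 1) / L j)
           * (\<integral>\<^sup>+y\<in>I (j - 1). ennreal \<bar>poly (P j - P (j - 1)) y\<bar> \<partial>lborel)"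
        unfolding Ij by (simp add: L_def D_def)
      also have "\<dots> \<le> ennreal (D * (9 * (1 + n i j)\<^sup>2) ^ (d - 1) / L j) * (\<integral>\<^sup>+y\<in>I (j - 1). ennreal (2 * A) * ennreal (\<bar>f y - poly (P j) y\<bar> / (2 * A) + \<bar>f y - poly (P (j - 1)) y\<bar> / (2 * A)) \<partial>lborel)"
      proof (intro mult_mono ennreal_leI divide_right_mono mult_left_mono power_mono nn_integral_mono mult_right_mono)
        have "\<bar>x - X j\<bar> / L j \<le> 8 * (1 + n i j)\<^sup>2" using dist[OF x ij(1,2)] ij Lj by (simp add: divide_le_eq)
        moreover have "1 \<le> (1 + n i j)\<^sup>2" using n0[of i j] by (simp add: one_le_power)
        ultimately show "1 + \<bar>x - X j\<bar> / L j \<le> 9 * (1 + n i j)\<^sup>2" by linarith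
        fix y
        have "\<bar>poly (P j - P (j - 1)) y\<bar> \<le> 2 * A * (\<bar>f y - poly (P j) y\<bar> / (2 * A) + \<bar>f y - poly (P (j - 1)) y\<bar> / (2 * A))"
        proof -
          have "2 * A * (\<bar>f y - poly (P j) y\<bar> / (2 * A) + \<bar>f y - poly (P (j - 1)) y\<bar> / (2 * A)) = \<bar>f y - poly (P j) y\<bar> + \<bar>f y - poly (P (j - 1)) y\<bar>"
            using A by (simp add: distrib_left)
          then show ?thesis unfolding poly_diff by linarith
        qed
        then show "ennreal \<bar>poly (P j - P (j - 1)) y\<bar> \<le> ennreal (2 * A) * ennreal (\<bar>f y - poly (P j) y\<bar> / (2 * A) + \<bar>f y - poly (P (j - 1)) y\<bar> / (2 * A))"
          using A by (subst ennreal_mult[symmetric]) (auto intro: ennreal_leI)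
      qed (use D1 Lj in auto)
      also have "\<dots> = ennreal (D * (9 * (1 + n i j)\<^sup>2) ^ (d - 1) / L j) * (ennreal (2 * A) * (\<integral>\<^sup>+y\<in>I (j - 1). ennreal (\<bar>f y - poly (P j) y\<bar> / (2 * A) + \<bar>f y - poly (P (j - 1)) y\<bar> / (2 * A)) \<partial>lborel))"
        by (simp only: mult.assoc, subst nn_integral_cmult) (auto simp: I_def)
      also have "\<dots> = ennreal (D * (9 * (1 + n i j)\<^sup>2) ^ (d - 1) * (2 * A)) * b j"
      proof -
        have "ennreal (D * (9 * (1 + n i j)\<^sup>2) ^ (d - 1) / L j) * ennreal (2 * A) = ennreal (D * (9 * (1 + n i j)\<^sup>2) ^ (d - 1) * (2 * A)) * ennreal (1 / L j)"
          using D1 Lj A by (simp flip: ennreal_mult')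
        then show ?thesis unfolding b_def by (simp add: mult.assoc[symmetric])
      qed
      also have "\<dots> \<le> ennreal (D * 9 ^ d * (1 + n i j) ^ (2 * (d - 1)) * (2 * A)) * b j"
      proof (intro mult_right_mono ennreal_leI)
        have "D * (9 * (1 + n i j)\<^sup>2) ^ (d - 1) = D * 9 ^ (d - 1) * (1 + n i j) ^ (2 * (d - 1))"
          by (simp add: power_mult_distrib power_mult)
        also have "\<dots> \<le> D * 9 ^ d * (1 + n i j) ^ (2 * (d - 1))"
          using D1 n0[of i j] by (intro mult_right_mono mult_left_mono power_increasing) auto
        finally show "D * (9 * (1 + n i j)\<^sup>2) ^ (d - 1) \<le> D * 9 ^ d * (1 + n i j) ^ (2 * (d - 1))" .
      qed (use A in auto)
      finally show ?thesis .
    qed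
    \<comment> \<open>The weights sum to at most \<open>1 / 2\<close> over \<open>j\<close>;
      together with \<open>1 / 2\<close> for the own error on interval \<open>i\<close> they form
      coefficients admissible in \<open>young_sum\<close>.\<close>
    define \<kappa> where "\<kappa> i j = 1 / (8 * (1 + n i j) ^ 4)" for i j
    have \<kappa>0: "0 < \<kappa> i j" for i j using n0[of i j] by (auto simp: \<kappa>_def)
    have ptw: "ennreal (\<bar>f x - poly Q x\<bar> / (C * A)) \<le> ennreal (1/2) * ennreal (\<bar>f x - poly (P i) x\<bar> / A) + (\<Sum>j\<in>{1..<M}. ennreal (\<kappa> i j) * b j)"
      if x: "X (Suc i) < x" "x \<le> X i" and i: "i < M" for i x
    proof -
      have xI: "x \<in> I i" using x by (simp add: I_def)
      have tel: "poly (P i) x = poly (P 0) x + (\<Sum>j\<in>{1..<M}. poly (P j - P (j - 1)) x * (if j \<le> i then 1 else 0))"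
      proof -
        have "(\<Sum>j\<in>{1..<M}. poly (P j - P (j - 1)) x * (if j \<le> i then 1 else 0)) = (\<Sum>j\<in>{1..i}. poly (P j) x - poly (P (j - 1)) x)"
          using i by (intro sum.mono_neutral_cong_right) auto
        also have "\<dots> = (\<Sum>j<i. poly (P (Suc j)) x - poly (P j) x)"
          by (rule sum.reindex_bij_witness[of _ Suc "\<lambda>j. j - 1"]) auto
        also have "\<dots> = poly (P i) x - poly (P 0) x" by (rule sum_lessThan_telescope)
        finally show ?thesis by simp
      qed
      have "f x - poly Q x = (f x - poly (P i) x) + (\<Sum>j\<in>{1..<M}. poly (P j - P (j - 1)) x * ((if j \<le> i then 1 else 0) - poly (T j) x))"
        unfolding tel Q_def by (simp add: poly_sum sum_subtractf right_diff_distrib)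
      then have "\<bar>f x - poly Q x\<bar> \<le> \<bar>f x - poly (P i) x\<bar> + (\<Sum>j\<in>{1..<M}. \<bar>poly (P j - P (j - 1)) x\<bar> * \<bar>(if j \<le> i then 1 else 0) - poly (T j) x\<bar>)"
        using sum_abs[of "\<lambda>j. poly (P j - P (j - 1)) x * ((if j \<le> i then 1 else 0) - poly (T j) x)" "{1..<M}"] by (simp add: abs_mult)
      then have "\<bar>f x - poly Q x\<bar> / (C * A) \<le> (\<bar>f x - poly (P i) x\<bar> + (\<Sum>j\<in>{1..<M}. \<bar>poly (P j - P (j - 1)) x\<bar> * \<bar>(if j \<le> i then 1 else 0) - poly (T j) x\<bar>)) / (C * A)"
        using C A by (intro divide_right_mono) auto
      also have "\<dots> = 1 / C * (\<bar>f x - poly (P i) x\<bar> / A) + (\<Sum>j\<in>{1..<M}. \<bar>poly (P j - P (j - 1)) x\<bar> * (\<bar>(if j \<le> i then 1 else 0) - poly (T j) x\<bar> / (C * A)))"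
        by (simp add: add_divide_distrib sum_divide_distrib)
      finally have "ennreal (\<bar>f x - poly Q x\<bar> / (C * A)) \<le> ennreal (1 / C * (\<bar>f x - poly (P i) x\<bar> / A) + (\<Sum>j\<in>{1..<M}. \<bar>poly (P j - P (j - 1)) x\<bar> * (\<bar>(if j \<le> i then 1 else 0) - poly (T j) x\<bar> / (C * A))))"
        by (rule ennreal_leI)
      also have "\<dots> = ennreal (1 / C) * ennreal (\<bar>f x - poly (P i) x\<bar> / A) + (\<Sum>j\<in>{1..<M}. ennreal (\<bar>(if j \<le> i then 1 else 0) - poly (T j) x\<bar> / (C * A)) * ennreal \<bar>poly (P j - P (j - 1)) x\<bar>)"
      proof -
        define w where "w j = \<bar>(if j \<le> i then 1 else 0) - poly (T j) x\<bar> / (C * A)" for j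
        define v where "v j = \<bar>poly (P j - P (j - 1)) x\<bar>" for j
        have w: "0 \<le> w j" "0 \<le> v j" for j using C A by (auto simp: w_def v_def)
        have "ennreal (1 / C * (\<bar>f x - poly (P i) x\<bar> / A) + (\<Sum>j\<in>{1..<M}. v j * w j))
           = ennreal (1 / C * (\<bar>f x - poly (P i) x\<bar> / A)) + ennreal (\<Sum>j\<in>{1..<M}. v j * w j)"
          using C A w by (intro ennreal_plus sum_nonneg mult_nonneg_nonneg) auto
        also have "ennreal (1 / C * (\<bar>f x - poly (P i) x\<bar> / A)) = ennreal (1 / C) * ennreal (\<bar>f x - poly (P i) x\<bar> / A)"
          using C A by (intro ennreal_mult) auto
        also have "ennreal (\<Sum>j\<in>{1..<M}. v j * w j) = (\<Sum>j\<in>{1..<M}. ennreal (v j * w j))"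
          using w by (intro sum_ennreal[symmetric]) auto
        also have "\<dots> = (\<Sum>j\<in>{1..<M}. ennreal (w j) * ennreal (v j))"
          using w by (intro sum.cong) (auto simp: ennreal_mult mult.commute)
        finally show ?thesis unfolding w_def v_def .
      qed
      also have "\<dots> \<le> ennreal (1/2) * ennreal (\<bar>f x - poly (P i) x\<bar> / A) + (\<Sum>j\<in>{1..<M}. ennreal (\<kappa> i j) * b j)"
      proof (intro add_mono sum_mono mult_right_mono ennreal_leI)
        show "1 / C \<le> 1 / 2" using C by (simp add: field_simps)
        fix j assume "j \<in> {1..<M}"
        then have j: "1 \<le> j" "j < M" by auto
        have "ennreal (\<bar>(if j \<le> i then 1 else 0) - poly (T j) x\<bar> / (C * A)) * ennreal \<bar>poly (P j - P (j - 1)) x\<bar>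
          \<le> ennreal (C0 * 2 ^ (2 * m - 1) / (1 + n i j) ^ (2 * m - 1) / (C * A)) * (ennreal (D * 9 ^ d * (1 + n i j) ^ (2 * (d - 1)) * (2 * A)) * b j)"
          using C A Terr[OF x i] j by (intro mult_mono jump[OF xI i j] ennreal_leI divide_right_mono) auto
        also have "\<dots> = ennreal (C0 * 2 ^ (2 * m - 1) / (1 + n i j) ^ (2 * m - 1) / (C * A) * (D * 9 ^ d * (1 + n i j) ^ (2 * (d - 1)) * (2 * A))) * b j"
          using C0 C A n0[of i j] D1 by (subst ennreal_mult) (auto simp: mult.assoc)
        also have "\<dots> \<le> ennreal (\<kappa> i j) * b j"
        proof (intro mult_right_mono ennreal_leI)
          define N where "N = 1 + n i j"
          have N: "N \<ge> 1" using n0[of i j] by (simp add: N_def)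
          have e: "2 * m - 1 = 2 * (d - 1) + 5" using d by (simp add: m_def)
          have "C0 * 2 ^ (2 * m - 1) / N ^ (2 * m - 1) / (C * A) * (D * 9 ^ d * N ^ (2 * (d - 1)) * (2 * A)) = 2 * C1 / C * (N ^ (2 * (d - 1)) / N ^ (2 * m - 1))"
            using A C by (simp add: C1_def ac_simps)
          also have "N ^ (2 * (d - 1)) / N ^ (2 * m - 1) = 1 / N ^ 5" unfolding e power_add using N by simp
          also have "2 * C1 / C * (1 / N ^ 5) \<le> 1 / 8 * (1 / N ^ 4)"
            using C C1 N by (intro mult_mono divide_left_mono power_increasing) (auto simp: field_simps)
          finally show "C0 * 2 ^ (2 * m - 1) / (1 + n i j) ^ (2 * m - 1) / (C * A) * (D * 9 ^ d * (1 + n i j) ^ (2 * (d - 1)) * (2 * A)) \<le> \<kappa> i j"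
            by (simp add: \<kappa>_def N_def)
        qed auto
        finally show "ennreal (\<bar>(if j \<le> i then 1 else 0) - poly (T j) x\<bar> / (C * A)) * ennreal \<bar>poly (P j - P (j - 1)) x\<bar> \<le> ennreal (\<kappa> i j) * b j" .
      qed auto
      finally show ?thesis .
    qed
    define e where "e i x = young p (ennreal (\<bar>f x - poly (P i) x\<bar> / A))" for i x
    have [measurable]: "e i \<in> borel_measurable borel" for i unfolding e_def by measurable
    have [measurable]: "I i \<in> sets borel" for i by (simp add: I_def)
    define E where "E i = (\<integral>\<^sup>+x\<in>I i. (e i x + e (Suc i) x) \<partial>lborel)" for i
    have \<kappa>4: "\<kappa> i j \<le> 1 / 8 * (1 / (1 + n i j)\<^sup>2)" for i j
    proof -
      have "1 * (1 + n i j)\<^sup>2 \<le> (1 + n i j)\<^sup>2 * (1 + n i j)\<^sup>2" using n0[of i j] by (intro mult_right_mono one_le_power) auto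
      then have "(1 + n i j)\<^sup>2 \<le> (1 + n i j) ^ 4" by (simp flip: power_add)
      then show ?thesis using n0[of i j] unfolding \<kappa>_def by (auto simp: divide_simps add_nonneg_eq_0_iff)
    qed
    \<comment> \<open>Jensen twice: over the interval with normalised length, and for the mean of
      the two errors.\<close>
    have young_b: "young p (b j) \<le> ennreal (1 / L j) * E (j - 1)" if j: "1 \<le> j" "j < M" for j
    proof -
      have Lj: "L j > 0" using L j by simp
      have Sj: "Suc (j - 1) = j" using j by simp
      have mass: "(\<integral>\<^sup>+x. ennreal (1 / L j) * indicator (I (j - 1)) x \<partial>lborel) \<le> 1"
      proof -
        have "(\<integral>\<^sup>+x. ennreal (1 / L j) * indicator (I (j - 1)) x \<partial>lborel) = ennreal (1 / L j) * ennreal (L j)"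
          using Xle[of "j - 1" j] j Sj by (subst nn_integral_cmult_indicator) (auto simp: I_def L_def)
        also have "\<dots> = 1" using Lj by (simp flip: ennreal_mult')
        finally show ?thesis by simp
      qed
      have "b j = (\<integral>\<^sup>+x. (ennreal (1 / L j) * indicator (I (j - 1)) x) * ennreal (\<bar>f x - poly (P j) x\<bar> / (2 * A) + \<bar>f x - poly (P (j - 1)) x\<bar> / (2 * A)) \<partial>lborel)"
        unfolding b_def by (subst nn_integral_cmult[symmetric]) (auto simp: ac_simps)
      then have "young p (b j) \<le> (\<integral>\<^sup>+x. (ennreal (1 / L j) * indicator (I (j - 1)) x) * young p (ennreal (\<bar>f x - poly (P j) x\<bar> / (2 * A) + \<bar>f x - poly (P (j - 1)) x\<bar> / (2 * A))) \<partial>lborel)"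
        using mass by (simp only:) (intro young_kernel[OF p], auto)
      also have "\<dots> \<le> (\<integral>\<^sup>+x. (ennreal (1 / L j) * indicator (I (j - 1)) x) * (e (j - 1) x + e j x) \<partial>lborel)"
      proof (intro nn_integral_mono mult_left_mono)
        fix x
        have half: "ennreal (\<bar>u\<bar> / (2 * A)) = ennreal (1/2) * ennreal (\<bar>u\<bar> / A)" for u
          using A by (subst ennreal_mult[symmetric]) auto
        have ne: "j - 1 \<noteq> j" using Sj by simp
        have "ennreal (\<bar>f x - poly (P j) x\<bar> / (2 * A) + \<bar>f x - poly (P (j - 1)) x\<bar> / (2 * A))
           = ennreal (\<bar>f x - poly (P j) x\<bar> / (2 * A)) + ennreal (\<bar>f x - poly (P (j - 1)) x\<bar> / (2 * A))"
          using A by (intro ennreal_plus) auto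
        also have "\<dots> = (\<Sum>l\<in>{j - 1, j}. ennreal (1/2) * ennreal (\<bar>f x - poly (P l) x\<bar> / A))"
          unfolding half using ne by (simp add: add.commute)
        also have "young p \<dots> \<le> (\<Sum>l\<in>{j - 1, j}. ennreal (1/2) * e l x)"
          unfolding e_def
        proof (intro young_sum[OF p])
          have "(\<Sum>l\<in>{j - 1, j}. ennreal (1/2)) = ennreal (\<Sum>l\<in>{j - 1, j}. 1/2)" by (intro sum_ennreal) auto
          then show "(\<Sum>l\<in>{j - 1, j}. ennreal (1/2)) \<le> 1" using ne by simp
        qed auto
        also have "\<dots> \<le> (\<Sum>l\<in>{j - 1, j}. 1 * e l x)" by (intro sum_mono mult_right_mono half_le_1) auto
        also have "\<dots> = e (j - 1) x + e j x" using Sj by simp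
        finally show "young p (ennreal (\<bar>f x - poly (P j) x\<bar> / (2 * A) + \<bar>f x - poly (P (j - 1)) x\<bar> / (2 * A))) \<le> e (j - 1) x + e j x" .
      qed auto
      also have "\<dots> = ennreal (1 / L j) * E (j - 1)" unfolding E_def Sj
        by (subst nn_integral_cmult[symmetric]) (auto simp: ac_simps)
      finally show ?thesis .
    qed
    have youngQ: "young p (ennreal (\<bar>f x - poly Q x\<bar> / (C * A))) \<le> e i x + (\<Sum>j\<in>{1..<M}. ennreal (\<kappa> i j / L j) * E (j - 1))"
      if x: "X (Suc i) < x" "x \<le> X i" and i: "i < M" for i x
    proof -
      define K where "K j = (if j = 0 then ennreal (1/2) else ennreal (\<kappa> i j))" for j
      define v where "v j = (if j = 0 then ennreal (\<bar>f x - poly (P i) x\<bar> / A) else b j)" for j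
      have split: "(\<Sum>j\<in>{..<M}. K j * w j) = ennreal (1/2) * w 0 + (\<Sum>j\<in>{1..<M}. ennreal (\<kappa> i j) * w j)" for w
      proof -
        have "{..<M} = insert 0 {1..<M}" using i by auto
        then show ?thesis by (simp add: K_def)
      qed
      have "(\<Sum>j\<in>{..<M}. K j) \<le> 1"
      proof -
        have "(\<Sum>j\<in>{1..<M}. \<kappa> i j) \<le> (\<Sum>j\<in>{1..<M}. 1 / 8 * (1 / (1 + n i j)\<^sup>2))" by (intro sum_mono \<kappa>4)
        also have "\<dots> \<le> 1 / 8 * 4" unfolding sum_distrib_left[symmetric] n_def
          by (intro mult_left_mono sum_inverse_squares_le) auto
        finally have *: "(\<Sum>j\<in>{1..<M}. \<kappa> i j) \<le> 1 / 2" by simp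
        have "(\<Sum>j\<in>{..<M}. K j) = ennreal (1/2) + ennreal (\<Sum>j\<in>{1..<M}. \<kappa> i j)"
          using split[of "\<lambda>_. 1"] less_imp_le[OF \<kappa>0] by (simp add: sum_ennreal)
        also have "\<dots> \<le> ennreal (1/2) + ennreal (1/2)" using * by (intro add_mono ennreal_leI) auto
        also have "\<dots> = 1" by (subst ennreal_plus[symmetric]) auto
        finally show ?thesis .
      qed
      have "young p (ennreal (\<bar>f x - poly Q x\<bar> / (C * A))) \<le> young p (\<Sum>j\<in>{..<M}. K j * v j)"
        using ptw[OF x i] unfolding split by (intro young_mono) (auto simp: v_def intro!: order.trans[OF _ add_mono] sum_mono)
      also have "\<dots> \<le> (\<Sum>j\<in>{..<M}. K j * young p (v j))"
        by (rule young_sum[OF p finite_lessThan]) fact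
      also have "\<dots> = ennreal (1/2) * e i x + (\<Sum>j\<in>{1..<M}. ennreal (\<kappa> i j) * young p (b j))"
        unfolding split by (simp add: v_def e_def)
      also have "\<dots> \<le> 1 * e i x + (\<Sum>j\<in>{1..<M}. ennreal (\<kappa> i j) * (ennreal (1 / L j) * E (j - 1)))"
        using young_b by (intro add_mono mult_right_mono[OF half_le_1] sum_mono mult_left_mono) auto
      also have "\<dots> = e i x + (\<Sum>j\<in>{1..<M}. ennreal (\<kappa> i j / L j) * E (j - 1))"
      proof -
        have "ennreal (\<kappa> i j) * (ennreal (1 / L j) * E (j - 1)) = ennreal (\<kappa> i j / L j) * E (j - 1)" if "j \<in> {1..<M}" for j
          using \<kappa>0[of i j] L[of j] that by (simp add: mult.assoc[symmetric] flip: ennreal_mult)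
        then show ?thesis by simp
      qed
      finally show ?thesis .
    qed
    \<comment> \<open>Half-open pieces are disjoint and cover \<open>{-1<..1}\<close>; the error
      estimate for step functions was proved for \<open>X (Suc i) < x\<close>, which places
      \<open>\<theta>\<close> on the correct side of each jump.\<close>
    define H where "H i = {X (Suc i)<..X i}" for i
    have [measurable]: "H i \<in> sets borel" for i by (simp add: H_def)
    have cover: "{-1<..1} \<subseteq> (\<Union>i<M. H i)"
    proof
      fix x :: real assume x: "x \<in> {-1<..1}"
      define i where "i = (LEAST i. X (Suc i) < x)"
      have XM: "X M = -1" using \<beta> by (simp add: X_def)
      have M1: "Suc (M - 1) = M" using \<nu> by (simp add: M_def)
      have ex: "X (Suc (M - 1)) < x" using x XM M1 by simp
      then have 1: "X (Suc i) < x" unfolding i_def by (rule LeastI)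
      have "i \<le> M - 1" unfolding i_def using ex by (rule Least_le)
      then have 2: "i < M" using M1 by simp
      have 3: "x \<le> X i"
      proof (cases i)
        case 0 then show ?thesis using x by (simp add: X_def)
      next
        case (Suc i')
        then have "i' < (LEAST i. X (Suc i) < x)" unfolding i_def by simp
        then have "\<not> X (Suc i') < x" by (rule not_less_Least)
        then show ?thesis using Suc by simp
      qed
      show "x \<in> (\<Union>i<M. H i)" using 1 2 3 by (auto simp: H_def)
    qed
    have "(\<integral>\<^sup>+x\<in>{-1<..1}. young p (ennreal (\<bar>f x - poly Q x\<bar> / (C * A))) \<partial>lborel)
       \<le> (\<integral>\<^sup>+x. (\<Sum>i<M. (e i x + (\<Sum>j\<in>{1..<M}. ennreal (\<kappa> i j / L j) * E (j - 1))) * indicator (H i) x) \<partial>lborel)"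
    proof (intro nn_integral_mono)
      fix x :: real
      show "young p (ennreal (\<bar>f x - poly Q x\<bar> / (C * A))) * indicator {-1<..1} x
         \<le> (\<Sum>i<M. (e i x + (\<Sum>j\<in>{1..<M}. ennreal (\<kappa> i j / L j) * E (j - 1))) * indicator (H i) x)"
      proof (cases "x \<in> {-1<..1}")
        case True
        then obtain i where i: "i < M" "x \<in> H i" using cover by blast
        then have "young p (ennreal (\<bar>f x - poly Q x\<bar> / (C * A))) \<le> (e i x + (\<Sum>j\<in>{1..<M}. ennreal (\<kappa> i j / L j) * E (j - 1))) * indicator (H i) x"
          using youngQ[of i x] by (simp add: H_def)
        also have "\<dots> \<le> (\<Sum>i<M. (e i x + (\<Sum>j\<in>{1..<M}. ennreal (\<kappa> i j / L j) * E (j - 1))) * indicator (H i) x)"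
          using i by (intro member_le_sum) auto
        finally show ?thesis using True by simp
      qed auto
    qed
    also have "\<dots> = (\<Sum>i<M. (\<integral>\<^sup>+x\<in>H i. e i x \<partial>lborel) + (\<Sum>j\<in>{1..<M}. ennreal (\<kappa> i j / L j) * E (j - 1)) * emeasure lborel (H i))"
      by (subst nn_integral_sum) (auto simp: distrib_right nn_integral_add nn_integral_cmult_indicator intro!: sum.cong)
    also have "\<dots> \<le> (\<Sum>i<M. E i + (\<Sum>j\<in>{1..<M}. ennreal (2 * (1 / (1 + n i j)\<^sup>2)) * E (j - 1)))"
    proof (intro sum_mono add_mono)
      fix i assume i: "i \<in> {..<M}"
      show "(\<integral>\<^sup>+x\<in>H i. e i x \<partial>lborel) \<le> E i" unfolding E_def
        by (intro nn_integral_mono mult_mono indicator_leI) (auto simp: H_def I_def)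
      have "(\<Sum>j\<in>{1..<M}. ennreal (\<kappa> i j / L j) * E (j - 1)) * emeasure lborel (H i)
         = (\<Sum>j\<in>{1..<M}. ennreal (\<kappa> i j / L j * (X i - X (Suc i))) * E (j - 1))"
        unfolding sum_distrib_right
      proof (intro sum.cong refl)
        fix j assume j: "j \<in> {1..<M}"
        have "emeasure lborel (H i) = ennreal (X i - X (Suc i))" unfolding H_def using i Xle[of i "Suc i"] by simp
        then show "ennreal (\<kappa> i j / L j) * E (j - 1) * emeasure lborel (H i) = ennreal (\<kappa> i j / L j * (X i - X (Suc i))) * E (j - 1)"
          using i Xle[of i "Suc i"] \<kappa>0[of i j] L[of j] j by (subst ennreal_mult) (auto simp: ac_simps)
      qed
      also have "\<dots> \<le> (\<Sum>j\<in>{1..<M}. ennreal (2 * (1 / (1 + n i j)\<^sup>2)) * E (j - 1))"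
      proof (intro sum_mono mult_right_mono ennreal_leI)
        fix j assume j: "j \<in> {1..<M}"
        have Lj: "L j > 0" using L j by simp
        \<comment> \<open>The length of interval \<open>i\<close> is at most
          \<open>16 * (1 + n i j)^2\<close> times that of interval \<open>j - 1\<close>, so two of
          the four powers in \<open>\<kappa>\<close> are spent and two remain for the sum over
          \<open>i\<close>.\<close>
        have "\<kappa> i j / L j * (X i - X (Suc i)) \<le> \<kappa> i j / L j * (16 * (1 + n i j)\<^sup>2 * L j)"
          using i j \<kappa>0[of i j] Lj by (intro mult_left_mono len) (auto intro: divide_nonneg_nonneg less_imp_le)
        also have "\<dots> = 2 * ((1 + n i j)\<^sup>2 / (1 + n i j) ^ 4)" using Lj by (simp add: \<kappa>_def)
        also have "(1 + n i j)\<^sup>2 / (1 + n i j) ^ 4 = 1 / (1 + n i j)\<^sup>2"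
        proof -
          have sq: "(1 + n i j) ^ 4 = (1 + n i j)\<^sup>2 * (1 + n i j)\<^sup>2" by (simp flip: power_add)
          have "(1 + n i j)\<^sup>2 \<noteq> 0" using n0[of i j] by auto
          then show ?thesis unfolding sq by (rule nonzero_divide_mult_cancel_left)
        qed
        finally show "\<kappa> i j / L j * (X i - X (Suc i)) \<le> 2 * (1 / (1 + n i j)\<^sup>2)" .
      qed auto
      finally show "(\<Sum>j\<in>{1..<M}. ennreal (\<kappa> i j / L j) * E (j - 1)) * emeasure lborel (H i)
        \<le> (\<Sum>j\<in>{1..<M}. ennreal (2 * (1 / (1 + n i j)\<^sup>2)) * E (j - 1))" .
    qed
    also have "\<dots> = (\<Sum>i<M. E i) + (\<Sum>j\<in>{1..<M}. (\<Sum>i<M. ennreal (2 * (1 / (1 + n i j)\<^sup>2))) * E (j - 1))"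
      unfolding sum.distrib sum_distrib_right by (subst sum.swap) (rule refl)
    also have "\<dots> \<le> (\<Sum>i<M. E i) + (\<Sum>j\<in>{1..<M}. ennreal 8 * E (j - 1))"
    proof (intro add_mono order.refl sum_mono mult_right_mono)
      fix j
      have "(\<Sum>i<M. ennreal (2 * (1 / (1 + n i j)\<^sup>2))) = ennreal (2 * (\<Sum>i<M. 1 / (1 + \<bar>real j - real i\<bar>)\<^sup>2))"
        by (simp add: sum_ennreal sum_distrib_left n_def abs_minus_commute)
      also have "\<dots> \<le> ennreal (2 * 4)" by (intro ennreal_leI mult_left_mono sum_inverse_squares_le) auto
      finally show "(\<Sum>i<M. ennreal (2 * (1 / (1 + n i j)\<^sup>2))) \<le> ennreal 8" by simp
    qed auto
    also have "(\<Sum>j\<in>{1..<M}. ennreal 8 * E (j - 1)) \<le> ennreal 8 * (\<Sum>i<M. E i)"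
    proof -
      have "(\<Sum>j\<in>{1..<M}. E (j - 1)) = (\<Sum>i\<in>(\<lambda>j. j - 1) ` {1..<M}. E i)"
        by (subst sum.reindex) (auto intro!: inj_onI)
      also have "\<dots> \<le> (\<Sum>i<M. E i)" by (intro sum_mono2) auto
      finally show ?thesis unfolding sum_distrib_left[symmetric] by (intro mult_left_mono) auto
    qed
    also have "(\<Sum>i<M. E i) + ennreal 8 * (\<Sum>i<M. E i) = ennreal 9 * (\<Sum>i<M. E i)"
    proof -
      have "ennreal 9 = 1 + ennreal 8" by simp
      then show ?thesis by (simp only: distrib_right mult_1_left)
    qed
    also have "\<dots> \<le> ennreal C * (\<Sum>i<M. E i)" using C by (intro mult_right_mono ennreal_leI) auto
    finally have "(\<integral>\<^sup>+x\<in>{-1<..1}. young p (ennreal (\<bar>f x - poly Q x\<bar> / (C * A))) \<partial>lborel) \<le> ennreal C * (\<Sum>i<M. E i)"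
      by (simp add: add_left_mono)
    then show "\<exists>Q::real poly. degree Q < d + (d + 2) * (\<nu> - 1) \<and>
        (\<integral>\<^sup>+x\<in>{-1<..1}. young p (ennreal (\<bar>f x - poly Q x\<bar> / (C * A))) \<partial>lborel)
        \<le> ennreal C * (\<Sum>i<6 * \<nu>. \<integral>\<^sup>+x\<in>{cos ((real i + 1) * (pi / (6 * real \<nu>)))..cos (real i * (pi / (6 * real \<nu>)))}.
              (young p (ennreal (\<bar>f x - poly (P i) x\<bar> / A)) + young p (ennreal (\<bar>f x - poly (P (Suc i)) x\<bar> / A))) \<partial>lborel)"
      using degQ unfolding E_def e_def I_def X_def M_def m_def \<beta>_def
      by (intro exI[of _ Q]) (simp add: add.commute[of 1])
  qed
qed

section \<open>Finite differences and Taylor's formula\<close>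

text \<open>The forward difference, whose stencil starts at \<open>y\<close>. The symmetric
  difference at \<open>Y\<close> with step \<open>s\<close> is the forward difference at
  \<open>Y - k * s / 2\<close>.\<close>

definition fdiff :: "nat \<Rightarrow> real \<Rightarrow> (real \<Rightarrow> real) \<Rightarrow> real \<Rightarrow> real" where
  "fdiff k s F y = (\<Sum>i\<le>k. (-1) ^ (k - i) * real (k choose i) * F (y + real i * s))"

lemma fdiff_0 [simp]: "fdiff 0 s F y = F y"
  by (simp add: fdiff_def)

lemma fdiff_Suc: "fdiff (Suc k) s F y = fdiff k s F (y + s) - fdiff k s F y"
proof -
  let ?a = "\<lambda>i. F (y + real i * s)"
  have 1: "fdiff k s F (y + s) = (\<Sum>i\<le>k. (-1) ^ (k - i) * real (k choose i) * ?a (Suc i))"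
    unfolding fdiff_def by (intro sum.cong) (auto simp: algebra_simps)
  have 2: "fdiff k s F y = (-1) ^ k * ?a 0 + (\<Sum>i<k. (-1) ^ (k - Suc i) * real (k choose Suc i) * ?a (Suc i))"
    unfolding fdiff_def by (subst sum.atMost_shift) simp
  have 3: "fdiff (Suc k) s F y = - ((-1) ^ k * ?a 0) + (\<Sum>i<Suc k. (-1) ^ (k - i) * real (Suc k choose Suc i) * ?a (Suc i))"
    unfolding fdiff_def lessThan_Suc_atMost[symmetric] by (subst sum.lessThan_Suc_shift) simp
  have "(\<Sum>i<Suc k. (-1) ^ (k - i) * real (Suc k choose Suc i) * ?a (Suc i))
     = (\<Sum>i<Suc k. (-1) ^ (k - i) * real (k choose i) * ?a (Suc i)) + (\<Sum>i<Suc k. (-1) ^ (k - i) * real (k choose Suc i) * ?a (Suc i))"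
    unfolding sum.distrib[symmetric] by (intro sum.cong) (auto simp: algebra_simps)
  also have "(\<Sum>i<Suc k. (-1) ^ (k - i) * real (k choose Suc i) * ?a (Suc i)) = - (\<Sum>i<k. (-1) ^ (k - Suc i) * real (k choose Suc i) * ?a (Suc i))"
  proof -
    have "(-1) ^ (k - i) = - ((-1) ^ (k - Suc i) :: real)" if "i < k" for i
      using that by (metis Suc_diff_Suc mult_minus1 power_Suc)
    then show ?thesis by (simp add: sum_negf[symmetric])
  qed
  finally show ?thesis unfolding 1 2 3 by (simp add: lessThan_Suc_atMost)
qed

lemma fdiff_sum: "fdiff k s (\<lambda>x. \<Sum>l\<in>I. c l * g l x) y = (\<Sum>l\<in>I. c l * fdiff k s (g l) y)"
  unfolding fdiff_def sum_distrib_left by (subst sum.swap) (simp add: ac_simps)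

lemma fdiff_diff: "fdiff k s (\<lambda>x. f x - g x) y = fdiff k s f y - fdiff k s g y"
  unfolding fdiff_def by (simp add: algebra_simps sum_subtractf)

lemma fdiff_shift: "fdiff k s (\<lambda>x. f (x + a)) y = fdiff k s f (y + a)"
  unfolding fdiff_def by (simp add: algebra_simps)

text \<open>Induction on \<open>k\<close>: one difference turns \<open>x ^ m\<close> into a
  combination of powers below \<open>m\<close>, of which only the power \<open>k\<close> can survive
  the remaining \<open>k\<close> differences.\<close>

lemma fdiff_power:
  "m \<le> k \<Longrightarrow> fdiff k s (\<lambda>x. x ^ m) y = (if m = k then fact k * s ^ k else 0)"
proof (induction k arbitrary: m y)
  case (Suc k)
  have pw: "(x + s) ^ m - x ^ m = (\<Sum>l<m. (real (m choose l) * s ^ (m - l)) * x ^ l)" for x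
  proof -
    have "(x + s) ^ m = (\<Sum>l\<le>m. real (m choose l) * x ^ l * s ^ (m - l))" by (rule binomial_ring)
    also have "\<dots> = x ^ m + (\<Sum>l<m. real (m choose l) * x ^ l * s ^ (m - l))"
      by (simp add: lessThan_Suc_atMost[symmetric])
    finally show ?thesis by (simp add: ac_simps)
  qed
  have "fdiff (Suc k) s (\<lambda>x. x ^ m) y = fdiff k s (\<lambda>x. (x + s) ^ m - x ^ m) y"
    unfolding fdiff_Suc fdiff_diff using fdiff_shift[of k s "\<lambda>x. x ^ m" s y] by simp
  also have "\<dots> = (\<Sum>l<m. (real (m choose l) * s ^ (m - l)) * fdiff k s (\<lambda>x. x ^ l) y)"
    unfolding pw fdiff_sum ..
  also have "\<dots> = (\<Sum>l<m. (real (m choose l) * s ^ (m - l)) * (if l = k then fact k * s ^ k else 0))"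
    using Suc.prems by (intro sum.cong refl arg_cong2[of _ _ _ _ "(*)"] Suc.IH) auto
  also have "\<dots> = (if m = Suc k then fact (Suc k) * s ^ Suc k else 0)"
  proof (cases "m = Suc k")
    case True
    then show ?thesis by (simp add: if_distrib[of "\<lambda>x. _ * x"] sum.delta cong: if_cong)
  next
    case False
    then show ?thesis using Suc.prems by (simp add: if_distrib[of "\<lambda>x. _ * x"] sum.delta cong: if_cong)
  qed
  finally show ?case .
qed simp

lemma fdiff_measurable [measurable]:
  assumes [measurable]: "F \<in> borel_measurable borel" "s \<in> borel_measurable M" "y \<in> borel_measurable M"
  shows "(\<lambda>x. fdiff k (s x) F (y x)) \<in> borel_measurable M"
  unfolding fdiff_def by measurable

text \<open>Integrability only over intervals whose closure lies in \<open>(-1,1)\<close>, since the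
  weight permits singularities at the ends. Half-open intervals make adjacent pieces add up
  exactly.\<close>

definition locint :: "(real \<Rightarrow> real) \<Rightarrow> bool" where
  "locint F \<longleftrightarrow> F \<in> borel_measurable borel \<and>
     (\<forall>c d. -1 < c \<longrightarrow> d < 1 \<longrightarrow> integrable lborel (\<lambda>t. indicator {c<..d} t * F t))"

lemma locint_mult:
  assumes F: "locint F" and cd: "-1 < c" "d < 1" and w: "continuous_on UNIV w"
  shows "integrable lborel (\<lambda>t. indicator {c<..d} t * (F t * (w t :: real)))"
proof -
  have [measurable]: "F \<in> borel_measurable borel" "w \<in> borel_measurable borel"
    using F w by (auto simp: locint_def intro: borel_measurable_continuous_onI)
  have "compact (w ` {c..d})" using w by (intro compact_continuous_image) (auto intro: continuous_on_subset)
  then obtain B where B: "\<And>t. t \<in> {c..d} \<Longrightarrow> \<bar>w t\<bar> \<le> B"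
    using compact_imp_bounded bounded_iff by (metis image_eqI real_norm_def)
  have int: "integrable lborel (\<lambda>t. B * (indicator {c<..d} t * F t))"
    using F cd by (intro integrable_mult_right) (auto simp: locint_def)
  show ?thesis
  proof (rule Bochner_Integration.integrable_bound[OF int], measurable, rule AE_I2)
    fix t
    show "norm (indicator {c<..d} t * (F t * w t)) \<le> norm (B * (indicator {c<..d} t * F t))"
    proof (cases "t \<in> {c<..d}")
      case True
      then have "\<bar>w t\<bar> \<le> B" by (intro B) auto
      then have "\<bar>F t\<bar> * \<bar>w t\<bar> \<le> \<bar>F t\<bar> * \<bar>B\<bar>" by (intro mult_left_mono) auto
      then show ?thesis using True by (simp add: abs_mult mult.commute)
    qed simp
  qed
qed

lemma integral_power_interval:
  fixes x b :: real
  assumes "x \<le> b"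
  shows "integrable lborel (\<lambda>t. indicator {x<..b} t * t ^ n)"
    and "(\<integral>t. indicator {x<..b} t * t ^ n \<partial>lborel) = (b ^ Suc n - x ^ Suc n) / real (Suc n)"
proof -
  have hb: "has_bochner_integral lborel (\<lambda>t. t ^ n * indicator {x..b} t) (b ^ Suc n / real (Suc n) - x ^ Suc n / real (Suc n))"
    using assms
    by (intro has_bochner_integral_FTC_Icc_real) (auto intro!: derivative_eq_intros continuous_intros simp del: power_Suc of_nat_Suc)
  have ae: "AE t in lborel. t ^ n * indicator {x..b} t = indicator {x<..b} t * t ^ n"
    using AE_lborel_singleton[of x] by eventually_elim (auto simp: indicator_def)
  have "has_bochner_integral lborel (\<lambda>t. indicator {x<..b} t * t ^ n) (b ^ Suc n / real (Suc n) - x ^ Suc n / real (Suc n))"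
    using hb ae by (subst has_bochner_integral_cong_AE[symmetric]) auto
  then show "integrable lborel (\<lambda>t. indicator {x<..b} t * t ^ n)"
    "(\<integral>t. indicator {x<..b} t * t ^ n \<partial>lborel) = (b ^ Suc n - x ^ Suc n) / real (Suc n)"
    by (auto simp: has_bochner_integral_iff diff_divide_distrib)
qed

text \<open>Binomial expansion of \<open>(t - x) ^ r\<close> and termwise integration. The lemma
  turns a polynomial close to the derivative of \<open>f\<close> into a polynomial close to
  \<open>f\<close>, with degree raised by the number of integrations.\<close>

lemma poly_moment:
  fixes q :: "real poly"
  assumes "degree q < k"
  shows "\<exists>p. degree p < k + Suc r \<and> (\<forall>x\<le>b. (\<integral>t. indicator {x<..b} t * (poly q t * (t - x) ^ r) \<partial>lborel) = poly p x)"
proof -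
  define R where "R m l = smult (coeff q m * real (r choose l) / real (Suc (m + l)))
     ([:0, -1:] ^ (r - l) * ([:b ^ Suc (m + l):] - [:0, 1:] ^ Suc (m + l)))" for m l
  define p where "p = (\<Sum>m<k. \<Sum>l\<le>r. R m l)"
  have "degree (R m l) \<le> k + r" if "m < k" "l \<le> r" for m l
  proof -
    have "degree ([:0, -1::real:] ^ (r - l)) \<le> (r - l) * 1" by (rule order.trans[OF degree_power_le]) simp
    moreover have "degree ([:b ^ Suc (m + l):] - [:0, 1::real:] ^ Suc (m + l)) \<le> Suc (m + l)"
      by (intro degree_diff_le order.trans[OF degree_power_le]) auto
    ultimately have "degree ([:0, -1:] ^ (r - l) * ([:b ^ Suc (m + l):] - [:0, 1:] ^ Suc (m + l))) \<le> (r - l) * 1 + Suc (m + l)"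
      by (intro order.trans[OF degree_mult_le] add_mono)
    also have "\<dots> \<le> k + r" using that by simp
    finally show ?thesis unfolding R_def by (intro order.trans[OF degree_smult_le])
  qed
  then have "degree p \<le> k + r" unfolding p_def by (intro degree_sum_le) auto
  moreover have "(\<integral>t. indicator {x<..b} t * (poly q t * (t - x) ^ r) \<partial>lborel) = poly p x" if x: "x \<le> b" for x
  proof -
    define c where "c m l = coeff q m * (real (r choose l) * (- x) ^ (r - l))" for m l
    have "poly q t = (\<Sum>m<k. coeff q m * t ^ m)" for t
      unfolding poly_altdef using assms by (intro sum.mono_neutral_left) (auto simp: coeff_eq_0)
    moreover have "(t - x) ^ r = (\<Sum>l\<le>r. real (r choose l) * t ^ l * (- x) ^ (r - l))" for t
      using binomial_ring[of t "- x" r] by simp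
    ultimately have prod: "poly q t * (t - x) ^ r = (\<Sum>m<k. \<Sum>l\<le>r. (coeff q m * t ^ m) * (real (r choose l) * t ^ l * (- x) ^ (r - l)))" for t
      by (simp only: sum_product)
    have "indicator {x<..b} t * (poly q t * (t - x) ^ r) = (\<Sum>m<k. \<Sum>l\<le>r. c m l * (indicator {x<..b} t * t ^ (m + l)))" for t
      unfolding prod sum_distrib_left by (intro sum.cong refl) (simp add: c_def power_add ac_simps)
    then have "(\<integral>t. indicator {x<..b} t * (poly q t * (t - x) ^ r) \<partial>lborel) = (\<Sum>m<k. \<Sum>l\<le>r. c m l * ((b ^ Suc (m + l) - x ^ Suc (m + l)) / real (Suc (m + l))))"
      using integral_power_interval[OF x] by (simp add: Bochner_Integration.integral_sum del: power_Suc of_nat_Suc)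
    also have "\<dots> = poly p x"
      unfolding p_def R_def poly_sum by (intro sum.cong refl) (simp add: c_def field_simps del: power_Suc of_nat_Suc)
    finally show ?thesis .
  qed
  ultimately show ?thesis by (intro exI[of _ p]) auto
qed

text \<open>One step of Cauchy's formula for repeated integration: Fubini on the triangle
  \<open>x < v < t \<le> b\<close>. As \<open>-1 < x\<close>, the triangle stays where
  \<open>F\<close> is integrable, and \<open>(b - x) ^ n\<close> dominates the polynomial
  factor.\<close>

lemma iterated_moment_integral:
  assumes F: "locint F" and xb: "-1 < x" "x \<le> b" "b < 1"
  shows "integrable lborel (\<lambda>v. indicator {x<..b} v * (\<integral>t. indicator {v<..b} t * (F t * (t - v) ^ n) \<partial>lborel))"
    and "(\<integral>v. indicator {x<..b} v * (\<integral>t. indicator {v<..b} t * (F t * (t - v) ^ n) \<partial>lborel) \<partial>lborel)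
      = (\<integral>t. indicator {x<..b} t * (F t * (t - x) ^ Suc n) \<partial>lborel) / real (Suc n)"
proof -
  have [measurable]: "F \<in> borel_measurable borel" using F by (simp add: locint_def)
  define H where "H = (\<lambda>(v, t). indicator {x<..b} v * (indicator {v<..b} t * (F t * (t - v) ^ n)) :: real)"
  have ind: "indicator {v<..b} t = (if v < t \<and> t \<le> b then 1 else (0::real))" for v t by (simp add: indicator_def)
  have [measurable]: "H \<in> borel_measurable (lborel \<Otimes>\<^sub>M lborel)" unfolding H_def ind by measurable
  define K where "K = (\<integral>\<^sup>+t. ennreal \<bar>indicator {x<..b} t * F t\<bar> \<partial>lborel)"
  have K: "K < \<infinity>"
    using F xb unfolding K_def locint_def by (auto simp: integrable_iff_bounded)
  have int: "integrable (lborel \<Otimes>\<^sub>M lborel) H"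
  proof (rule integrableI_bounded)
    have "(\<integral>\<^sup>+z. ennreal (norm (H z)) \<partial>(lborel \<Otimes>\<^sub>M lborel)) = (\<integral>\<^sup>+v. \<integral>\<^sup>+t. ennreal (norm (H (v, t))) \<partial>lborel \<partial>lborel)"
      by (intro lborel.nn_integral_fst[symmetric]) measurable
    also have "\<dots> \<le> (\<integral>\<^sup>+v. \<integral>\<^sup>+t. ennreal ((b - x) ^ n * indicator {x<..b} v) * ennreal \<bar>indicator {x<..b} t * F t\<bar> \<partial>lborel \<partial>lborel)"
    proof (intro nn_integral_mono)
      fix v t
      show "ennreal (norm (H (v, t))) \<le> ennreal ((b - x) ^ n * indicator {x<..b} v) * ennreal \<bar>indicator {x<..b} t * F t\<bar>"
      proof (cases "x < v \<and> v < t \<and> t \<le> b")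
        case True
        then have "(t - v) ^ n \<le> (b - x) ^ n" by (intro power_mono) auto
        then have "\<bar>F t\<bar> * (t - v) ^ n \<le> \<bar>F t\<bar> * (b - x) ^ n" by (intro mult_left_mono) auto
        then show ?thesis using True xb by (simp add: H_def abs_mult mult.commute ennreal_leI flip: ennreal_mult)
      next
        case False
        then have "H (v, t) = 0" by (auto simp: H_def indicator_def)
        then show ?thesis by simp
      qed
    qed
    also have "\<dots> = (\<integral>\<^sup>+v. ennreal ((b - x) ^ n * indicator {x<..b} v) * K \<partial>lborel)"
      unfolding K_def by (intro nn_integral_cong nn_integral_cmult) measurable
    also have "\<dots> = (\<integral>\<^sup>+v. ennreal ((b - x) ^ n) * K * indicator {x<..b} v \<partial>lborel)"
      by (intro nn_integral_cong) (auto simp: indicator_def)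
    also have "\<dots> = ennreal ((b - x) ^ n) * K * ennreal (b - x)"
      using xb by (subst nn_integral_cmult_indicator) auto
    also have "\<dots> < \<infinity>" using K by (simp add: ennreal_mult_less_top)
    finally show "(\<integral>\<^sup>+z. ennreal (norm (H z)) \<partial>(lborel \<Otimes>\<^sub>M lborel)) < \<infinity>" .
  qed measurable
  have 1: "(\<integral>t. H (v, t) \<partial>lborel) = indicator {x<..b} v * (\<integral>t. indicator {v<..b} t * (F t * (t - v) ^ n) \<partial>lborel)" for v
    unfolding H_def by simp
  have "integrable lborel (\<lambda>v. \<integral>t. H (v, t) \<partial>lborel)" by (rule lborel_pair.integrable_fst'[OF int])
  then show "integrable lborel (\<lambda>v. indicator {x<..b} v * (\<integral>t. indicator {v<..b} t * (F t * (t - v) ^ n) \<partial>lborel))"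
    unfolding 1 .
  have 2: "(\<integral>v. H (v, t) \<partial>lborel) = indicator {x<..b} t * (F t * (t - x) ^ Suc n) / real (Suc n)" for t
  proof (cases "t \<in> {x<..b}")
    case True
    have hb: "has_bochner_integral lborel (\<lambda>v. (t - v) ^ n * indicator {x..t} v) (- ((t - t) ^ Suc n / real (Suc n)) - (- ((t - x) ^ Suc n / real (Suc n))))"
      using True
      by (intro has_bochner_integral_FTC_Icc_real)
         (auto intro!: derivative_eq_intros continuous_intros simp del: power_Suc of_nat_Suc)
    have "AE v in lborel. H (v, t) = F t * ((t - v) ^ n * indicator {x..t} v)"
      using AE_lborel_singleton[of x] AE_lborel_singleton[of t] by eventually_elim (use True in \<open>auto simp: H_def indicator_def\<close>)
    then have "(\<integral>v. H (v, t) \<partial>lborel) = (\<integral>v. F t * ((t - v) ^ n * indicator {x..t} v) \<partial>lborel)"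
      by (intro integral_cong_AE) measurable
    also have "\<dots> = F t * (- ((t - t) ^ Suc n / real (Suc n)) - (- ((t - x) ^ Suc n / real (Suc n))))"
      using has_bochner_integral_integral_eq[OF hb] by (simp del: power_Suc of_nat_Suc)
    finally show ?thesis using True by simp
  next
    case False
    then have "H (v, t) = 0" for v by (auto simp: H_def indicator_def)
    then show ?thesis using False by simp
  qed
  have "(\<integral>v. indicator {x<..b} v * (\<integral>t. indicator {v<..b} t * (F t * (t - v) ^ n) \<partial>lborel) \<partial>lborel) = (\<integral>v. \<integral>t. H (v, t) \<partial>lborel \<partial>lborel)"
    unfolding 1 ..
  also have "\<dots> = (\<integral>t. \<integral>v. H (v, t) \<partial>lborel \<partial>lborel)"
    using lborel_pair.Fubini_integral[of "\<lambda>v t. H (v, t)"] int by (simp add: case_prod_beta')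
  also have "\<dots> = (\<integral>t. indicator {x<..b} t * (F t * (t - x) ^ Suc n) \<partial>lborel) / real (Suc n)"
    unfolding 2 by simp
  finally show "(\<integral>v. indicator {x<..b} v * (\<integral>t. indicator {v<..b} t * (F t * (t - v) ^ n) \<partial>lborel) \<partial>lborel)
      = (\<integral>t. indicator {x<..b} t * (F t * (t - x) ^ Suc n) \<partial>lborel) / real (Suc n)" .
qed

text \<open>Taylor's formula at \<open>b\<close> with integral remainder; the sign
  \<open>(-1) ^ Suc n\<close> arises because \<open>x\<close> lies to the left of \<open>b\<close>.
  The formula for \<open>deriv f\<close> is integrated from \<open>x\<close> to \<open>b\<close>.
  The hypothesis \<open>top\<close> enters only at the bottom of the induction, where the highest
  derivative need not be differentiable everywhere.\<close>

lemma taylor_locint: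
  assumes F: "locint F" and b: "-1 < b" "b < 1"
    and diff: "\<And>j x. j < n \<Longrightarrow> x \<in> {-1<..<1} \<Longrightarrow> (deriv ^^ j) f differentiable (at x)"
    and top: "\<And>x. -1 < x \<Longrightarrow> x \<le> b \<Longrightarrow> (deriv ^^ n) f b - (deriv ^^ n) f x = (\<integral>t. indicator {x<..b} t * F t \<partial>lborel)"
  shows "\<exists>T::real poly. degree T \<le> n \<and> (\<forall>x. -1 < x \<longrightarrow> x \<le> b \<longrightarrow>
           f x = poly T x + (-1) ^ Suc n / fact n * (\<integral>t. indicator {x<..b} t * (F t * (t - x) ^ n) \<partial>lborel))"
  using diff top
proof (induction n arbitrary: f)
  case 0
  show ?case using 0(2) by (intro exI[of _ "[:f b:]"]) (auto simp: algebra_simps)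
next
  case (Suc n)
  have "\<exists>T::real poly. degree T \<le> n \<and> (\<forall>x. -1 < x \<longrightarrow> x \<le> b \<longrightarrow>
           deriv f x = poly T x + (-1) ^ Suc n / fact n * (\<integral>t. indicator {x<..b} t * (F t * (t - x) ^ n) \<partial>lborel))"
  proof (rule Suc.IH)
    fix j and x :: real assume "j < n" "x \<in> {-1<..<1}"
    then show "(deriv ^^ j) (deriv f) differentiable (at x)"
      using Suc.prems(1)[of "Suc j" x] by (simp add: funpow_Suc_right del: funpow.simps)
  next
    fix x assume "-1 < x" "x \<le> b"
    then show "(deriv ^^ n) (deriv f) b - (deriv ^^ n) (deriv f) x = (\<integral>t. indicator {x<..b} t * F t \<partial>lborel)"
      using Suc.prems(2)[of x] by (simp add: funpow_Suc_right del: funpow.simps)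
  qed
  then obtain T :: "real poly" where T: "degree T \<le> n" "\<And>x. -1 < x \<Longrightarrow> x \<le> b \<Longrightarrow>
           deriv f x = poly T x + (-1) ^ Suc n / fact n * (\<integral>t. indicator {x<..b} t * (F t * (t - x) ^ n) \<partial>lborel)"
    by blast
  obtain p where p: "degree p < Suc n + Suc 0" "\<And>x. x \<le> b \<Longrightarrow> (\<integral>t. indicator {x<..b} t * (poly T t * (t - x) ^ 0) \<partial>lborel) = poly p x"
    using poly_moment[of T "Suc n" 0 b] T(1) by auto
  have "f x = poly ([:f b:] - p) x + (-1) ^ Suc (Suc n) / fact (Suc n) * (\<integral>t. indicator {x<..b} t * (F t * (t - x) ^ Suc n) \<partial>lborel)"
    if x: "-1 < x" "x \<le> b" for x
  proof -
    define G where "G v = indicator {x<..b} v * (\<integral>t. indicator {v<..b} t * (F t * (t - v) ^ n) \<partial>lborel)" for v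
    note G = iterated_moment_integral[OF F x(1,2) b(2), of n, folded G_def]
    have iT: "integrable lborel (\<lambda>v. indicator {x<..b} v * poly T v)"
      unfolding poly_altdef sum_distrib_left
      using integral_power_interval(1)[OF x(2)] by (intro Bochner_Integration.integrable_sum) (simp add: mult.left_commute)
    define D where "D v = indicator {x<..b} v * poly T v + (-1) ^ Suc n / fact n * G v" for v
    have iD: "integrable lborel D" unfolding D_def using iT G(1)
      by (intro Bochner_Integration.integrable_add integrable_mult_right)
    have "(deriv f has_integral (f b - f x)) {x..b}"
    proof (rule fundamental_theorem_of_calculus[OF x(2)])
      fix v assume v: "v \<in> {x..b}"
      then have "f differentiable (at v)" using Suc.prems(1)[of 0 v] x b by simp
      then have "(f has_real_derivative deriv f v) (at v)" by (simp add: DERIV_deriv_iff_real_differentiable)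
      then show "(f has_vector_derivative deriv f v) (at v within {x..b})"
        by (simp add: has_real_derivative_iff_has_vector_derivative has_vector_derivative_at_within)
    qed
    moreover have "(deriv f has_integral (\<integral>v. D v \<partial>lborel)) {x..b}"
    proof -
    have "(D has_integral (\<integral>v. D v \<partial>lborel)) {x..b}"
    proof -
      have "(D has_integral (\<integral>v. D v \<partial>lborel)) UNIV" using has_integral_integral_lborel[OF iD] .
      moreover have "(\<lambda>v. if v \<in> {x..b} then D v else 0) = D" by (auto simp: D_def G_def indicator_def fun_eq_iff)
      ultimately show ?thesis by (metis (no_types) has_integral_restrict_UNIV)
    qed
    then show ?thesis
    proof (rule has_integral_spike[OF negligible_sing[of x], rotated])
      fix v assume "v \<in> {x..b} - {x}"
      then show "deriv f v = D v" using T(2)[of v] x by (simp add: D_def G_def)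
    qed
    qed
    ultimately have "f b - f x = (\<integral>v. D v \<partial>lborel)" by (rule has_integral_unique)
    also have "\<dots> = (\<integral>v. indicator {x<..b} v * poly T v \<partial>lborel) + (-1) ^ Suc n / fact n * (\<integral>v. G v \<partial>lborel)"
      unfolding D_def using iT G(1) by simp
    also have "(\<integral>v. indicator {x<..b} v * poly T v \<partial>lborel) = poly p x" using p(2)[OF x(2)] by simp
    finally show ?thesis unfolding G(2) by (simp add: field_simps)
  qed
  moreover have "degree ([:f b:] - p) \<le> Suc n" using p(1) by (intro degree_diff_le) auto
  ultimately show ?case by blast
qed

section \<open>Whitney's inequality\<close>

lemma integral_interval_shift:
  fixes g :: "real \<Rightarrow> real"
  shows "(\<integral>t. indicator {x + a<..b + a} t * g t \<partial>lborel) = (\<integral>t. indicator {x<..b} t * g (t + a) \<partial>lborel)"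
  by (subst lborel_integral_real_affine[of 1 _ a]) (auto intro!: Bochner_Integration.integral_cong simp: indicator_def add.commute)

lemma abs_integral_le_nn_integral:
  fixes g :: "real \<Rightarrow> real"
  shows "ennreal \<bar>\<integral>t. g t \<partial>M\<bar> \<le> (\<integral>\<^sup>+t. ennreal \<bar>g t\<bar> \<partial>M)"
proof (cases "integrable M g")
  case True
  then show ?thesis using integral_norm_bound_ennreal[OF True] by simp
qed (simp add: not_integrable_integral_eq)

text \<open>The difference of order \<open>k\<close> of the truncated powers
  \<open>(j - v) ^ (k - 1)\<close>. The cut at 0 changes nothing essential: for \<open>v < 0\<close>
  the full powers would cancel, being of degree below \<open>k\<close> in \<open>j\<close>.\<close>

definition whitney_kernel :: "nat \<Rightarrow> real \<Rightarrow> real" where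
  "whitney_kernel k v = (\<Sum>j\<le>k. ((-1) ^ (k - j) * real (k choose j)) * (indicator {0<..real j} v * (real j - v) ^ (k - 1)))"

lemma whitney_kernel_bound: "\<bar>whitney_kernel k v\<bar> \<le> 2 ^ k * real k ^ (k - 1) * indicator {0<..real k} v"
proof -
  have "\<bar>whitney_kernel k v\<bar> \<le> (\<Sum>j\<le>k. real (k choose j) * \<bar>indicator {0<..real j} v * (real j - v) ^ (k - 1)\<bar>)"
    unfolding whitney_kernel_def by (rule order.trans[OF sum_abs]) (simp add: abs_mult)
  also have "\<dots> \<le> (\<Sum>j\<le>k. real (k choose j) * (real k ^ (k - 1) * indicator {0<..real k} v))"
    by (intro sum_mono mult_left_mono) (auto simp: indicator_def intro!: power_mono)
  also have "\<dots> = 2 ^ k * real k ^ (k - 1) * indicator {0<..real k} v"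
  proof -
    have "(\<Sum>j\<le>k. real (k choose j)) = real (2 ^ k)" unfolding choose_row_sum[symmetric] by simp
    then show ?thesis by (simp add: sum_distrib_right[symmetric] mult.assoc)
  qed
  finally show ?thesis .
qed

text \<open>With \<open>N\<close> the Whitney kernel (a B-spline up to scaling), the averages
  \<open>A i = \<integral> F (x + i s v) N v dv\<close> combine to the average of \<open>fdiff k (s v) F x\<close>, while for \<open>i \<ge> 1\<close> each
  of them is a \<open>k\<close>-th difference of a \<open>k\<close>-fold antiderivative of \<open>F\<close>, hence by Taylor's formula at \<open>b\<close>
  a polynomial plus an integral of \<open>fdiff k (i s) F\<close>.\<close>

lemma whitney_local:
  fixes k :: nat and \<Lambda> :: real
  assumes k: "1 \<le> k" and \<Lambda>: "1 \<le> \<Lambda>"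
    and F: "locint F" and ab: "-1 \<le> a" "a < b" and s: "0 < s" "b + (real k)\<^sup>2 * s < 1" "b - a \<le> \<Lambda> * s"
  shows "\<exists>q::real poly. degree q < k \<and> (\<forall>x\<in>{a<..b}.
     ennreal \<bar>F x - poly q x\<bar> \<le> ennreal (2 ^ k * real k ^ k) * (\<integral>\<^sup>+v\<in>{0<..real k}. ennreal \<bar>fdiff k (s * v) F x\<bar> \<partial>lborel)
        + ennreal (2 ^ k * \<Lambda> ^ k / s) * (\<integral>\<^sup>+t\<in>{x<..b}. (\<Sum>i\<in>{1..k}. ennreal \<bar>fdiff k (real i * s) F t\<bar>) \<partial>lborel))"
proof -
  note One_nat_def [simp del]
  have [measurable]: "F \<in> borel_measurable borel" using F by (simp add: locint_def)
  define c :: "nat \<Rightarrow> real" where "c j = (-1) ^ (k - j) * real (k choose j)" for j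
  \<comment> \<open>Up to the factor \<open>(k - 1)!\<close>, \<open>B w x\<close> is the difference
    at \<open>x\<close> with step \<open>w\<close> of the \<open>k\<close>-fold antiderivative of
    \<open>F\<close> that starts at \<open>x\<close>.\<close>
  define B where "B w x = (\<Sum>j\<le>k. c j * (\<integral>t. indicator {x<..x + real j * w} t * (F t * (x + real j * w - t) ^ (k - 1)) \<partial>lborel))" for w x
  define A where "A w x = (\<integral>v. F (x + w * v) * whitney_kernel k v \<partial>lborel)" for w x
  define R where "R w x = (\<integral>t. indicator {x<..b} t * (fdiff k w F t * (x - t) ^ (k - 1)) \<partial>lborel)" for w x
  have int: "integrable lborel (\<lambda>t. indicator {x<..d} t * (F t * (y - t) ^ (k - 1)))" if "-1 < x" "d < 1" for x d y
    using that by (intro locint_mult[OF F] continuous_intros) auto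
  have "\<exists>\<pi>::real poly. degree \<pi> < k \<and> (\<forall>x\<in>{a<..b}. B w x = poly \<pi> x - R w x)" if w: "0 < w" "b + real k * w < 1" for w
  proof -
    define \<pi>j where "\<pi>j j = (\<Sum>l\<le>k - 1. smult (\<integral>t. indicator {b<..b + real j * w} t * (F t * (real (k - 1 choose l) * (real j * w - t) ^ (k - 1 - l))) \<partial>lborel) ([:0, 1:] ^ l))" for j
    define \<pi> where "\<pi> = (\<Sum>j\<le>k. smult (c j) (\<pi>j j))"
    have jw: "b + real j * w < 1" "0 \<le> real j * w" if "j \<le> k" for j
    proof -
      have "real j * w \<le> real k * w" using that w by (intro mult_right_mono) auto
      then show "b + real j * w < 1" using w(2) by linarith
      show "0 \<le> real j * w" using w(1) by simp
    qed
    have poly_\<pi>j: "(\<integral>t. indicator {b<..b + real j * w} t * (F t * (x + real j * w - t) ^ (k - 1)) \<partial>lborel) = poly (\<pi>j j) x" if "j \<le> k" for j x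
    proof -
      have bin: "(x + real j * w - t) ^ (k - 1) = (\<Sum>l\<le>k - 1. real (k - 1 choose l) * x ^ l * (real j * w - t) ^ (k - 1 - l))" for t
        using binomial_ring[of x "real j * w - t" "k - 1"] by (simp add: algebra_simps)
      have "(\<integral>t. indicator {b<..b + real j * w} t * (F t * (x + real j * w - t) ^ (k - 1)) \<partial>lborel)
         = (\<integral>t. (\<Sum>l\<le>k - 1. x ^ l * (indicator {b<..b + real j * w} t * (F t * (real (k - 1 choose l) * (real j * w - t) ^ (k - 1 - l))))) \<partial>lborel)"
        unfolding bin by (intro Bochner_Integration.integral_cong refl) (simp add: sum_distrib_left ac_simps)
      also have "\<dots> = (\<Sum>l\<le>k - 1. x ^ l * (\<integral>t. indicator {b<..b + real j * w} t * (F t * (real (k - 1 choose l) * (real j * w - t) ^ (k - 1 - l))) \<partial>lborel))"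
        using ab jw[OF that]
        by (subst Bochner_Integration.integral_sum) (auto intro!: integrable_mult_right locint_mult[OF F] continuous_intros)
      also have "\<dots> = poly (\<pi>j j) x" by (simp add: \<pi>j_def poly_sum mult.commute)
      finally show ?thesis .
    qed
    have "B w x = poly \<pi> x - R w x" if x: "x \<in> {a<..b}" for x
    proof -
      have x1: "-1 < x" "x \<le> b" using x ab by auto
      define g where "g j t = F t * (x + real j * w - t) ^ (k - 1)" for j t
      have i: "integrable lborel (\<lambda>t. indicator {y<..d} t * g j t)" if "-1 < y" "d < 1" for y d j
        unfolding g_def by (rule int[OF that])
      \<comment> \<open>The integral from \<open>x\<close> to \<open>x + j * w\<close> is rerouted
        through \<open>b\<close>. Summed with the coefficients \<open>c j\<close>, the part up to
        \<open>b\<close> vanishes, as it contains the difference of order \<open>k\<close> of a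
        power \<open>k - 1\<close>; the part beyond \<open>b\<close> is a polynomial in
        \<open>x\<close>; and the last part, shifted by \<open>j * w\<close>, becomes the integral
        \<open>R\<close> of differences of \<open>F\<close>.\<close>
      have split: "(\<integral>t. indicator {x<..x + real j * w} t * g j t \<partial>lborel)
         = (\<integral>t. indicator {x<..b} t * g j t \<partial>lborel) + (\<integral>t. indicator {b<..b + real j * w} t * g j t \<partial>lborel)
           - (\<integral>t. indicator {x + real j * w<..b + real j * w} t * g j t \<partial>lborel)" if j: "j \<le> k" for j
      proof -
        have "(\<integral>t. indicator {x<..x + real j * w} t * g j t \<partial>lborel) + (\<integral>t. indicator {x + real j * w<..b + real j * w} t * g j t \<partial>lborel)
            = (\<integral>t. indicator {x<..x + real j * w} t * g j t + indicator {x + real j * w<..b + real j * w} t * g j t \<partial>lborel)"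
          using x1 jw[OF j] by (intro Bochner_Integration.integral_add[symmetric] i) auto
        also have "\<dots> = (\<integral>t. indicator {x<..b} t * g j t + indicator {b<..b + real j * w} t * g j t \<partial>lborel)"
          using x1 jw[OF j] by (intro Bochner_Integration.integral_cong refl) (auto simp: indicator_def)
        also have "\<dots> = (\<integral>t. indicator {x<..b} t * g j t \<partial>lborel) + (\<integral>t. indicator {b<..b + real j * w} t * g j t \<partial>lborel)"
          using x1 jw[OF j] ab by (intro Bochner_Integration.integral_add i) auto
        finally show ?thesis by simp
      qed
      have zero: "(\<Sum>j\<le>k. c j * (\<integral>t. indicator {x<..b} t * g j t \<partial>lborel)) = 0"
      proof -
        have "(\<Sum>j\<le>k. c j * (\<integral>t. indicator {x<..b} t * g j t \<partial>lborel)) = (\<integral>t. (\<Sum>j\<le>k. c j * (indicator {x<..b} t * g j t)) \<partial>lborel)"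
          using x1 ab jw[of 0] by (subst Bochner_Integration.integral_sum) (auto intro!: integrable_mult_right i)
        also have "(\<lambda>t. \<Sum>j\<le>k. c j * (indicator {x<..b} t * g j t)) = (\<lambda>t. indicator {x<..b} t * F t * fdiff k w (\<lambda>z. z ^ (k - 1)) (x - t))"
          by (simp add: fdiff_def c_def g_def sum_distrib_left fun_eq_iff algebra_simps)
        also have "\<dots> = (\<lambda>t. 0)" using k by (subst fdiff_power) auto
        finally show ?thesis by simp
      qed
      have third: "(\<Sum>j\<le>k. c j * (\<integral>t. indicator {x + real j * w<..b + real j * w} t * g j t \<partial>lborel)) = R w x"
      proof -
        have sh: "integrable lborel (\<lambda>t. indicator {x<..b} t * g j (t + real j * w))" if j: "j \<le> k" for j
        proof -
          have "integrable lborel (\<lambda>t. indicator {x + real j * w<..b + real j * w} t * g j t)" using x1 jw[OF j] by (intro i) auto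
          from lborel_integrable_real_affine[OF this, of 1 "real j * w"]
          have "integrable lborel (\<lambda>t. indicator {x + real j * w<..b + real j * w} (real j * w + 1 * t) * g j (real j * w + 1 * t))" by simp
          also have "(\<lambda>t. indicator {x + real j * w<..b + real j * w} (real j * w + 1 * t) * g j (real j * w + 1 * t)) = (\<lambda>t. indicator {x<..b} t * g j (t + real j * w))"
            by (auto simp: indicator_def fun_eq_iff add.commute)
          finally show ?thesis .
        qed
        have "(\<Sum>j\<le>k. c j * (\<integral>t. indicator {x + real j * w<..b + real j * w} t * g j t \<partial>lborel)) = (\<integral>t. (\<Sum>j\<le>k. c j * (indicator {x<..b} t * g j (t + real j * w))) \<partial>lborel)"
          unfolding integral_interval_shift
          by (subst Bochner_Integration.integral_sum) (auto intro!: integrable_mult_right sh)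
        also have "\<dots> = R w x" unfolding R_def
          by (intro Bochner_Integration.integral_cong refl) (simp add: fdiff_def c_def g_def sum_distrib_left sum_distrib_right ac_simps)
        finally show ?thesis .
      qed
      have "B w x = (\<Sum>j\<le>k. c j * (\<integral>t. indicator {x<..b} t * g j t \<partial>lborel)) + (\<Sum>j\<le>k. c j * (\<integral>t. indicator {b<..b + real j * w} t * g j t \<partial>lborel))
           - (\<Sum>j\<le>k. c j * (\<integral>t. indicator {x + real j * w<..b + real j * w} t * g j t \<partial>lborel))"
        unfolding B_def g_def[symmetric] sum.distrib[symmetric] sum_subtractf[symmetric]
        by (intro sum.cong refl) (simp only: split distrib_left right_diff_distrib atMost_iff)
      also have "(\<Sum>j\<le>k. c j * (\<integral>t. indicator {b<..b + real j * w} t * g j t \<partial>lborel)) = poly \<pi> x"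
        unfolding g_def \<pi>_def poly_sum poly_smult by (intro sum.cong refl) (simp only: poly_\<pi>j atMost_iff)
      finally show ?thesis unfolding zero third by simp
    qed
    moreover have "degree \<pi> < k"
    proof -
      have "degree (\<pi>j j) \<le> k - 1" for j unfolding \<pi>j_def
      proof (intro degree_sum_le)
        fix l assume "l \<in> {..k - 1}"
        have "degree ([:0, 1::real:] ^ l) \<le> degree [:0, 1::real:] * l" by (rule degree_power_le)
        then have "degree ([:0, 1::real:] ^ l) \<le> k - 1" using \<open>l \<in> {..k - 1}\<close> by simp
        then show "degree (smult (\<integral>t. indicator {b<..b + real j * w} t * (F t * (real (k - 1 choose l) * (real j * w - t) ^ (k - 1 - l))) \<partial>lborel) ([:0, 1:] ^ l)) \<le> k - 1"
          by (rule order.trans[OF degree_smult_le])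
      qed auto
      then have "degree \<pi> \<le> k - 1" unfolding \<pi>_def by (intro degree_sum_le) (auto intro: order.trans[OF degree_smult_le])
      then show ?thesis using k by simp
    qed
    ultimately show ?thesis by blast
  qed
  note Bpoly = this
  have "\<exists>\<pi>. \<forall>i. i \<in> {1..k} \<longrightarrow> degree (\<pi> i :: real poly) < k \<and> (\<forall>x\<in>{a<..b}. B (real i * s) x = poly (\<pi> i) x - R (real i * s) x)"
  proof (intro choice allI)
    fix i
    show "\<exists>\<pi>::real poly. i \<in> {1..k} \<longrightarrow> degree \<pi> < k \<and> (\<forall>x\<in>{a<..b}. B (real i * s) x = poly \<pi> x - R (real i * s) x)"
    proof (cases "i \<in> {1..k}")
      case True
      \<comment> \<open>The largest step is \<open>k * s\<close>, and its stencil has length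
        \<open>k * (k * s)\<close>; this is the origin of the hypothesis on
        \<open>b + (real k)\<^sup>2 * s\<close>.\<close>
      have "real k * (real i * s) \<le> real k * (real k * s)" using True s by (intro mult_left_mono mult_right_mono) auto
      then have "b + real k * (real i * s) < 1" using s(2) unfolding power2_eq_square mult.assoc by linarith
      then show ?thesis using Bpoly[of "real i * s"] True s(1) by auto
    qed auto
  qed
  then obtain \<pi> :: "nat \<Rightarrow> real poly" where \<pi>: "\<And>i. i \<in> {1..k} \<Longrightarrow> degree (\<pi> i) < k"
    "\<And>i x. i \<in> {1..k} \<Longrightarrow> x \<in> {a<..b} \<Longrightarrow> B (real i * s) x = poly (\<pi> i) x - R (real i * s) x" by blast
  have iN: "integrable lborel (\<lambda>v. indicator {0<..real j} v * (real j - v) ^ (k - 1))"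
    and IN: "(\<integral>v. indicator {0<..real j} v * (real j - v) ^ (k - 1) \<partial>lborel) = real j ^ k / real k" for j
  proof -
    have hb: "has_bochner_integral lborel (\<lambda>v. (real j - v) ^ (k - 1) * indicator {0..real j} v) (- ((real j - real j) ^ k / real k) - (- ((real j - 0) ^ k / real k)))"
      using k
      by (intro has_bochner_integral_FTC_Icc_real) (auto intro!: derivative_eq_intros continuous_intros simp: One_nat_def)
    have ae: "AE v in lborel. (real j - v) ^ (k - 1) * indicator {0..real j} v = indicator {0<..real j} v * (real j - v) ^ (k - 1)"
      using AE_lborel_singleton[of 0] by eventually_elim (auto simp: indicator_def)
    have "has_bochner_integral lborel (\<lambda>v. indicator {0<..real j} v * (real j - v) ^ (k - 1)) (- ((real j - real j) ^ k / real k) - (- ((real j - 0) ^ k / real k)))"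
      using hb ae by (subst has_bochner_integral_cong_AE[symmetric]) auto
    then show "integrable lborel (\<lambda>v. indicator {0<..real j} v * (real j - v) ^ (k - 1))"
      "(\<integral>v. indicator {0<..real j} v * (real j - v) ^ (k - 1) \<partial>lborel) = real j ^ k / real k"
      using k by (auto simp: has_bochner_integral_iff)
  qed
  \<comment> \<open>The total mass is a difference of order \<open>k\<close> of the power
    \<open>k\<close>, hence a factorial; it normalises the average.\<close>
  have mass: "(\<integral>v. whitney_kernel k v \<partial>lborel) = fact (k - 1)"
  proof -
    have "(\<integral>v. whitney_kernel k v \<partial>lborel) = (\<Sum>j\<le>k. c j * (real j ^ k / real k))"
      unfolding whitney_kernel_def c_def[symmetric]
      by (subst Bochner_Integration.integral_sum) (auto intro!: integrable_mult_right iN simp: IN)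
    also have "\<dots> = fdiff k 1 (\<lambda>x. x ^ k) 0 / real k" by (simp add: fdiff_def c_def sum_divide_distrib)
    also have "\<dots> = fact k / real k" by (subst fdiff_power) auto
    also have "\<dots> = fact (k - 1)" using k by (simp add: fact_reduce)
    finally show ?thesis .
  qed
  have iK: "integrable lborel (whitney_kernel k)"
    unfolding whitney_kernel_def by (intro Bochner_Integration.integrable_sum integrable_mult_right iN)
  \<comment> \<open>Substitution \<open>t = x + w * v\<close>.\<close>
  have scale: "integrable lborel (\<lambda>v. F (x + w * v) * whitney_kernel k v)" "B w x = w ^ k * A w x"
    if w: "0 < w" "x + real k * w < 1" and x: "-1 < x" for w x
  proof -
    have jw: "x + real j * w < 1" if "j \<le> k" for j
    proof -
      have "real j * w \<le> real k * w" using that w by (intro mult_right_mono) auto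
      then show ?thesis using w(2) by linarith
    qed
    have eq: "indicator {x<..x + real j * w} (x + w * v) * (F (x + w * v) * (x + real j * w - (x + w * v)) ^ (k - 1))
        = w ^ (k - 1) * (indicator {0<..real j} v * (F (x + w * v) * (real j - v) ^ (k - 1)))" for j v
    proof -
      have "indicator {x<..x + real j * w} (x + w * v) = (indicator {0<..real j} v :: real)"
        using w by (auto simp: indicator_def zero_less_mult_iff mult.commute[of w])
      moreover have "x + real j * w - (x + w * v) = w * (real j - v)" by (simp add: algebra_simps)
      ultimately show ?thesis by (simp add: power_mult_distrib ac_simps)
    qed
    have ij: "integrable lborel (\<lambda>v. indicator {0<..real j} v * (F (x + w * v) * (real j - v) ^ (k - 1)))" if j: "j \<le> k" for j
    proof -
      have "integrable lborel (\<lambda>v. w ^ (k - 1) * (indicator {0<..real j} v * (F (x + w * v) * (real j - v) ^ (k - 1))))"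
        using lborel_integrable_real_affine[OF int[OF x jw[OF j]], of w x "x + real j * w"] w unfolding eq by simp
      then have "w ^ (k - 1) = 0 \<or> integrable lborel (\<lambda>v. indicator {0<..real j} v * (F (x + w * v) * (real j - v) ^ (k - 1)))"
        by (rule integrable_mult_left_iff[THEN iffD1])
      then show ?thesis using w by simp
    qed
    have sum: "F (x + w * v) * whitney_kernel k v = (\<Sum>j\<le>k. c j * (indicator {0<..real j} v * (F (x + w * v) * (real j - v) ^ (k - 1))))" for v
      unfolding whitney_kernel_def by (simp add: c_def sum_distrib_left ac_simps)
    show "integrable lborel (\<lambda>v. F (x + w * v) * whitney_kernel k v)"
      unfolding sum by (intro Bochner_Integration.integrable_sum integrable_mult_right ij) auto
    have "B w x = (\<Sum>j\<le>k. c j * (w * (\<integral>v. w ^ (k - 1) * (indicator {0<..real j} v * (F (x + w * v) * (real j - v) ^ (k - 1))) \<partial>lborel)))"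
      unfolding B_def
    proof (intro sum.cong refl arg_cong2[of _ _ _ _ "(*)"])
      fix j
      show "(\<integral>t. indicator {x<..x + real j * w} t * (F t * (x + real j * w - t) ^ (k - 1)) \<partial>lborel)
         = w * (\<integral>v. w ^ (k - 1) * (indicator {0<..real j} v * (F (x + w * v) * (real j - v) ^ (k - 1))) \<partial>lborel)"
        using lborel_integral_real_affine[of w "\<lambda>t. indicator {x<..x + real j * w} t * (F t * (x + real j * w - t) ^ (k - 1))" x] w(1)
        unfolding eq by (simp only: real_scaleR_def abs_of_pos less_imp_neq[symmetric] simp_thms)
    qed
    also have "\<dots> = w ^ k * (\<Sum>j\<le>k. c j * (\<integral>v. indicator {0<..real j} v * (F (x + w * v) * (real j - v) ^ (k - 1)) \<partial>lborel))"
    proof -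
      have "w ^ k = w * w ^ (k - 1)" using k by (simp add: power_eq_if)
      then show ?thesis by (simp add: sum_distrib_left ac_simps)
    qed
    also have "(\<Sum>j\<le>k. c j * (\<integral>v. indicator {0<..real j} v * (F (x + w * v) * (real j - v) ^ (k - 1)) \<partial>lborel)) = A w x"
      unfolding A_def sum by (subst Bochner_Integration.integral_sum) (auto intro!: integrable_mult_right ij)
    finally show "B w x = w ^ k * A w x" .
  qed
  \<comment> \<open>Found by solving the identity for \<open>I\<close> below for \<open>F x\<close>:
    its term \<open>i = 0\<close> is \<open>(-1) ^ k * (k - 1)! * F x\<close>, since
    \<open>A 0 x\<close> integrates the kernel alone, and the polynomial parts of the other terms go
    into \<open>q\<close>.\<close>
  define q where "q = (\<Sum>i\<in>{1..k}. smult (- ((-1) ^ k) * c i / (fact (k - 1) * (real i * s) ^ k)) (\<pi> i))"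
  have "degree q < k"
  proof -
    have "degree q \<le> k - 1" unfolding q_def using \<pi>(1)
      by (intro degree_sum_le) (force intro: order.trans[OF degree_smult_le])+
    then show ?thesis using k by simp
  qed
  moreover have "ennreal \<bar>F x - poly q x\<bar> \<le> ennreal (2 ^ k * real k ^ k) * (\<integral>\<^sup>+v\<in>{0<..real k}. ennreal \<bar>fdiff k (s * v) F x\<bar> \<partial>lborel)
        + ennreal (2 ^ k * \<Lambda> ^ k / s) * (\<integral>\<^sup>+t\<in>{x<..b}. (\<Sum>i\<in>{1..k}. ennreal \<bar>fdiff k (real i * s) F t\<bar>) \<partial>lborel)"
    if x: "x \<in> {a<..b}" for x
  proof -
    have x1: "-1 < x" "x \<le> b" using x ab by auto
    have step_is: "0 < real i * s" "x + real k * (real i * s) < 1" if "i \<in> {1..k}" for i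
    proof -
      have "real k * (real i * s) \<le> real k * (real k * s)" using that s by (intro mult_left_mono mult_right_mono) auto
      then show "x + real k * (real i * s) < 1" using s(2) x1(2) unfolding power2_eq_square mult.assoc by linarith
      show "0 < real i * s" using that s by auto
    qed
    define I where "I = (\<integral>v. whitney_kernel k v * fdiff k (s * v) F x \<partial>lborel)"
    have ii: "integrable lborel (\<lambda>v. F (x + (real i * s) * v) * whitney_kernel k v)" if "i \<le> k" for i
    proof (cases "i = 0")
      case True
      then show ?thesis using iK by simp
    next
      case False
      then show ?thesis using step_is[of i] that x1 by (intro scale) auto
    qed
    have "I = (\<integral>v. (\<Sum>i\<le>k. c i * (F (x + (real i * s) * v) * whitney_kernel k v)) \<partial>lborel)"
      unfolding I_def by (intro Bochner_Integration.integral_cong refl) (simp add: fdiff_def c_def sum_distrib_left ac_simps)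
    also have "\<dots> = (\<Sum>i\<le>k. c i * A (real i * s) x)"
      unfolding A_def by (subst Bochner_Integration.integral_sum) (auto intro!: integrable_mult_right ii)
    also have "\<dots> = c 0 * A 0 x + (\<Sum>i\<in>{1..k}. c i * A (real i * s) x)"
    proof -
      have "{..k} = insert 0 {1..k}" by auto
      then show ?thesis by simp
    qed
    also have "A 0 x = F x * fact (k - 1)" unfolding A_def by (simp add: mass)
    also have "(\<Sum>i\<in>{1..k}. c i * A (real i * s) x) = (\<Sum>i\<in>{1..k}. c i / (real i * s) ^ k * (poly (\<pi> i) x - R (real i * s) x))"
    proof (intro sum.cong refl)
      fix i assume i: "i \<in> {1..k}"
      show "c i * A (real i * s) x = c i / (real i * s) ^ k * (poly (\<pi> i) x - R (real i * s) x)"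
      proof -
        have eq: "poly (\<pi> i) x - R (real i * s) x = (real i * s) ^ k * A (real i * s) x"
          using scale(2)[OF step_is[OF i] x1(1)] \<pi>(2)[OF i x] by (simp only:)
        have "(real i * s) ^ k \<noteq> 0" using step_is(1)[OF i] by (intro power_not_zero) linarith
        moreover have "e / d * (d * a) = e * a" if "d \<noteq> 0" for a d e :: real using that by simp
        ultimately show ?thesis unfolding eq by metis
      qed
    qed
    finally have I: "I = c 0 * (F x * fact (k - 1)) + (\<Sum>i\<in>{1..k}. c i / (real i * s) ^ k * (poly (\<pi> i) x - R (real i * s) x))" .
    have c0: "c 0 = (-1) ^ k" "c 0 * c 0 = 1" by (simp_all add: c_def flip: power_mult_distrib)
    have pq: "poly q x = - (c 0 / fact (k - 1)) * (\<Sum>i\<in>{1..k}. c i / (real i * s) ^ k * poly (\<pi> i) x)"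
      unfolding q_def poly_sum sum_distrib_left c0(1) by (intro sum.cong refl) simp
    have "F x - poly q x = c 0 / fact (k - 1) * (I + (\<Sum>i\<in>{1..k}. c i / (real i * s) ^ k * R (real i * s) x))"
    proof -
      have "c 0 / fact (k - 1) * (I + (\<Sum>i\<in>{1..k}. c i / (real i * s) ^ k * R (real i * s) x))
          = c 0 / fact (k - 1) * (c 0 * (F x * fact (k - 1))) + c 0 / fact (k - 1) * (\<Sum>i\<in>{1..k}. c i / (real i * s) ^ k * poly (\<pi> i) x)"
        unfolding I by (simp add: right_diff_distrib sum_subtractf distrib_left)
      also have "c 0 / fact (k - 1) * (c 0 * (F x * fact (k - 1))) = (c 0 * c 0) * F x" by simp
      finally show ?thesis unfolding c0(2) pq by simp
    qed
    then have "\<bar>F x - poly q x\<bar> = \<bar>I + (\<Sum>i\<in>{1..k}. c i / (real i * s) ^ k * R (real i * s) x)\<bar> / fact (k - 1)"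
      by (simp add: abs_mult c0(1))
    also have "\<dots> \<le> \<bar>I + (\<Sum>i\<in>{1..k}. c i / (real i * s) ^ k * R (real i * s) x)\<bar> / 1"
      by (intro divide_left_mono) auto
    also have "\<dots> \<le> \<bar>I\<bar> + (\<Sum>i\<in>{1..k}. \<bar>c i / (real i * s) ^ k * R (real i * s) x\<bar>)"
      using sum_abs[of "\<lambda>i. c i / (real i * s) ^ k * R (real i * s) x" "{1..k}"] by simp
    also have "\<dots> \<le> \<bar>I\<bar> + (\<Sum>i\<in>{1..k}. 2 ^ k / s ^ k * \<bar>R (real i * s) x\<bar>)"
    proof (intro add_left_mono sum_mono)
      fix i assume i: "i \<in> {1..k}"
      have "(k choose i) \<le> (\<Sum>j\<le>k. k choose j)" using i by (intro member_le_sum) auto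
      then have ci: "\<bar>c i\<bar> \<le> 2 ^ k" unfolding choose_row_sum c_def by (simp add: abs_mult)
      have "s ^ k \<le> (real i * s) ^ k" using i s by (intro power_mono) auto
      then have "\<bar>c i\<bar> / (real i * s) ^ k \<le> 2 ^ k / s ^ k" using ci s i by (intro frac_le) auto
      moreover have "0 \<le> real i * s" using i s by simp
      ultimately show "\<bar>c i / (real i * s) ^ k * R (real i * s) x\<bar> \<le> 2 ^ k / s ^ k * \<bar>R (real i * s) x\<bar>"
        by (simp only: abs_mult abs_divide power_abs[symmetric] abs_of_nonneg) (intro mult_right_mono, auto)
    qed
    finally have "ennreal \<bar>F x - poly q x\<bar> \<le> ennreal (\<bar>I\<bar> + (\<Sum>i\<in>{1..k}. 2 ^ k / s ^ k * \<bar>R (real i * s) x\<bar>))" by (rule ennreal_leI)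
    also have "\<dots> = ennreal \<bar>I\<bar> + (\<Sum>i\<in>{1..k}. ennreal (2 ^ k / s ^ k) * ennreal \<bar>R (real i * s) x\<bar>)"
    proof -
      have nn: "0 \<le> 2 ^ k / s ^ k * \<bar>R (real i * s) x\<bar>" for i using s by simp
      then have "(\<Sum>i\<in>{1..k}. ennreal (2 ^ k / s ^ k * \<bar>R (real i * s) x\<bar>)) = ennreal (\<Sum>i\<in>{1..k}. 2 ^ k / s ^ k * \<bar>R (real i * s) x\<bar>)"
        by (intro sum_ennreal)
      moreover have "ennreal (2 ^ k / s ^ k * \<bar>R (real i * s) x\<bar>) = ennreal (2 ^ k / s ^ k) * ennreal \<bar>R (real i * s) x\<bar>" for i
        using s by (intro ennreal_mult) auto
      ultimately show ?thesis using nn by (subst ennreal_plus) (auto intro!: sum_nonneg)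
    qed
    also have "\<dots> \<le> ennreal (2 ^ k * real k ^ k) * (\<integral>\<^sup>+v\<in>{0<..real k}. ennreal \<bar>fdiff k (s * v) F x\<bar> \<partial>lborel)
       + (\<Sum>i\<in>{1..k}. ennreal (2 ^ k / s ^ k) * (ennreal ((\<Lambda> * s) ^ (k - 1)) * (\<integral>\<^sup>+t\<in>{x<..b}. ennreal \<bar>fdiff k (real i * s) F t\<bar> \<partial>lborel)))"
    proof (intro add_mono sum_mono mult_left_mono)
      have "ennreal \<bar>I\<bar> \<le> (\<integral>\<^sup>+v. ennreal \<bar>whitney_kernel k v * fdiff k (s * v) F x\<bar> \<partial>lborel)"
        unfolding I_def by (rule abs_integral_le_nn_integral)
      also have "\<dots> \<le> (\<integral>\<^sup>+v. ennreal (2 ^ k * real k ^ k) * (ennreal \<bar>fdiff k (s * v) F x\<bar> * indicator {0<..real k} v) \<partial>lborel)"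
      proof (intro nn_integral_mono)
        fix v
        have "\<bar>whitney_kernel k v * fdiff k (s * v) F x\<bar> \<le> 2 ^ k * real k ^ (k - 1) * indicator {0<..real k} v * \<bar>fdiff k (s * v) F x\<bar>"
          unfolding abs_mult by (intro mult_right_mono whitney_kernel_bound) auto
        also have "\<dots> \<le> 2 ^ k * real k ^ k * indicator {0<..real k} v * \<bar>fdiff k (s * v) F x\<bar>"
          using k by (intro mult_right_mono mult_left_mono power_increasing) auto
        finally have "ennreal \<bar>whitney_kernel k v * fdiff k (s * v) F x\<bar> \<le> ennreal (2 ^ k * real k ^ k * indicator {0<..real k} v * \<bar>fdiff k (s * v) F x\<bar>)"
          by (rule ennreal_leI)
        also have "\<dots> = ennreal (2 ^ k * real k ^ k) * (ennreal \<bar>fdiff k (s * v) F x\<bar> * indicator {0<..real k} v)"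
          by (cases "v \<in> {0<..real k}") (auto simp: ennreal_mult)
        finally show "ennreal \<bar>whitney_kernel k v * fdiff k (s * v) F x\<bar> \<le> ennreal (2 ^ k * real k ^ k) * (ennreal \<bar>fdiff k (s * v) F x\<bar> * indicator {0<..real k} v)" .
      qed
      also have "\<dots> = ennreal (2 ^ k * real k ^ k) * (\<integral>\<^sup>+v\<in>{0<..real k}. ennreal \<bar>fdiff k (s * v) F x\<bar> \<partial>lborel)"
        by (intro nn_integral_cmult) measurable
      finally show "ennreal \<bar>I\<bar> \<le> ennreal (2 ^ k * real k ^ k) * (\<integral>\<^sup>+v\<in>{0<..real k}. ennreal \<bar>fdiff k (s * v) F x\<bar> \<partial>lborel)" .
    next
      fix i
      have "ennreal \<bar>R (real i * s) x\<bar> \<le> (\<integral>\<^sup>+t. ennreal \<bar>indicator {x<..b} t * (fdiff k (real i * s) F t * (x - t) ^ (k - 1))\<bar> \<partial>lborel)"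
        unfolding R_def by (rule abs_integral_le_nn_integral)
      also have "\<dots> \<le> (\<integral>\<^sup>+t. ennreal ((\<Lambda> * s) ^ (k - 1)) * (ennreal \<bar>fdiff k (real i * s) F t\<bar> * indicator {x<..b} t) \<partial>lborel)"
      proof (intro nn_integral_mono)
        fix t
        show "ennreal \<bar>indicator {x<..b} t * (fdiff k (real i * s) F t * (x - t) ^ (k - 1))\<bar> \<le> ennreal ((\<Lambda> * s) ^ (k - 1)) * (ennreal \<bar>fdiff k (real i * s) F t\<bar> * indicator {x<..b} t)"
        proof (cases "t \<in> {x<..b}")
          case True
          then have "\<bar>x - t\<bar> \<le> \<Lambda> * s" using x s(3) by auto
          then have "\<bar>x - t\<bar> ^ (k - 1) \<le> (\<Lambda> * s) ^ (k - 1)" by (intro power_mono) auto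
          then have "\<bar>fdiff k (real i * s) F t\<bar> * \<bar>x - t\<bar> ^ (k - 1) \<le> \<bar>fdiff k (real i * s) F t\<bar> * (\<Lambda> * s) ^ (k - 1)"
            by (intro mult_left_mono) auto
          then show ?thesis using True s \<Lambda> by (simp add: abs_mult power_abs mult.commute ennreal_leI flip: ennreal_mult)
        qed simp
      qed
      also have "\<dots> = ennreal ((\<Lambda> * s) ^ (k - 1)) * (\<integral>\<^sup>+t\<in>{x<..b}. ennreal \<bar>fdiff k (real i * s) F t\<bar> \<partial>lborel)"
        by (intro nn_integral_cmult) measurable
      finally show "ennreal \<bar>R (real i * s) x\<bar> \<le> ennreal ((\<Lambda> * s) ^ (k - 1)) * (\<integral>\<^sup>+t\<in>{x<..b}. ennreal \<bar>fdiff k (real i * s) F t\<bar> \<partial>lborel)" .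
    qed auto
    also have "(\<Sum>i\<in>{1..k}. ennreal (2 ^ k / s ^ k) * (ennreal ((\<Lambda> * s) ^ (k - 1)) * (\<integral>\<^sup>+t\<in>{x<..b}. ennreal \<bar>fdiff k (real i * s) F t\<bar> \<partial>lborel)))
       = ennreal (2 ^ k / s ^ k) * ennreal ((\<Lambda> * s) ^ (k - 1)) * (\<integral>\<^sup>+t\<in>{x<..b}. (\<Sum>i\<in>{1..k}. ennreal \<bar>fdiff k (real i * s) F t\<bar>) \<partial>lborel)"
      unfolding sum_distrib_right by (subst nn_integral_sum) (auto simp: sum_distrib_left mult.assoc)
    also have "ennreal (2 ^ k / s ^ k) * ennreal ((\<Lambda> * s) ^ (k - 1)) \<le> ennreal (2 ^ k * \<Lambda> ^ k / s)"
    proof -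
      have "s ^ k = s * s ^ (k - 1)" using k by (simp add: power_eq_if)
      then have "2 ^ k / s ^ k * (\<Lambda> * s) ^ (k - 1) = 2 ^ k * \<Lambda> ^ (k - 1) / s" using s by (simp add: power_mult_distrib)
      also have "\<dots> \<le> 2 ^ k * \<Lambda> ^ k / s" using s \<Lambda> by (intro divide_right_mono mult_left_mono power_increasing) auto
      finally show ?thesis using s \<Lambda> by (subst ennreal_mult[symmetric]) (auto intro: ennreal_leI)
    qed
    finally show ?thesis by (simp add: add_left_mono mult_right_mono)
  qed
  ultimately show ?thesis by blast
qed

section \<open>Weighted local approximation\<close>

text \<open>Difference of squares. In the variable \<open>sqrt (1 + x)\<close> the Chebyshev
  intervals of the left half have increments bounded by a multiple of the angular mesh.\<close>

lemma sqrt_increment: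
  fixes t x :: real
  assumes "-1 \<le> x" "x \<le> t" "sqrt (1 + t) - sqrt (1 + x) \<le> \<delta>" "0 \<le> \<delta>"
  shows "t - x \<le> 2 * \<delta> * sqrt (1 + t)"
proof -
  have "t - x = (sqrt (1 + t) - sqrt (1 + x)) * (sqrt (1 + t) + sqrt (1 + x))"
  proof -
    have "(sqrt (1 + t) - sqrt (1 + x)) * (sqrt (1 + t) + sqrt (1 + x)) = (sqrt (1 + t))\<^sup>2 - (sqrt (1 + x))\<^sup>2"
      by (simp add: power2_eq_square algebra_simps)
    then show ?thesis using assms by simp
  qed
  also have "\<dots> \<le> \<delta> * (2 * sqrt (1 + t))" using assms by (intro mult_mono) auto
  finally show ?thesis by simp
qed

lemma young_half_sum:
  assumes p: "1 \<le> p" and w: "w \<le> ennreal (1/2) * a + ennreal (1/2) * b"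
  shows "young p w \<le> young p a + young p b"
proof -
  have "young p w \<le> young p (\<Sum>i\<in>{True, False}. ennreal (1/2) * (if i then a else b))"
    by (rule young_mono) (use w in simp)
  also have "\<dots> \<le> (\<Sum>i\<in>{True, False}. ennreal (1/2) * young p (if i then a else b))"
  proof (rule young_sum[OF p])
    have "(\<Sum>i\<in>{True, False}. ennreal (1/2)) = ennreal (\<Sum>i\<in>{True, False}. 1/2)" by (intro sum_ennreal) auto
    then show "(\<Sum>i\<in>{True, False}. ennreal (1/2)) \<le> 1" by simp
  qed auto
  also have "\<dots> \<le> (\<Sum>i\<in>{True, False}. 1 * young p (if i then a else b))" by (intro sum_mono mult_right_mono half_le_1) auto
  finally show ?thesis by simp
qed

text \<open>Whitney's bound at \<open>x\<close> involves differences at \<open>x\<close> and at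
  points \<open>t > x\<close>; since \<open>sqrt (1 + x)\<close> increases, the weight may be
  carried along to \<open>t\<close>. For \<open>r = Suc n\<close> the polynomial is integrated with
  Taylor's formula: \<open>(t - x) ^ n\<close> is at most
  \<open>(2 * \<delta> * sqrt (1 + t)) ^ n\<close>, and a kernel supplies one more such factor, so
  that all \<open>r\<close> weights are used and \<open>(2 * \<delta>) ^ r\<close> is
  gained.\<close>

lemma local_approx:
  fixes k r :: nat and \<Lambda> \<delta> s A l u :: real and F f :: "real \<Rightarrow> real" and p :: ennreal
  assumes k: "1 \<le> k" and \<Lambda>: "1 \<le> \<Lambda>" and F: "locint F" and f[measurable]: "f \<in> borel_measurable borel"
    and lu: "-1 \<le> l" "l < u" and s: "0 < s" "u + (real k)\<^sup>2 * s < 1" "u - l \<le> \<Lambda> * s"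
    and \<delta>: "0 < \<delta>" "sqrt (1 + u) - sqrt (1 + l) \<le> \<delta>" and p: "1 \<le> p" and A: "0 < A"
    and f0: "r = 0 \<Longrightarrow> f = F"
    and fr: "\<And>n. r = Suc n \<Longrightarrow> \<exists>T::real poly. degree T \<le> n \<and> (\<forall>x. -1 < x \<longrightarrow> x \<le> u \<longrightarrow>
           f x = poly T x + (-1) ^ Suc n / fact n * (\<integral>t. indicator {x<..u} t * (F t * (t - x) ^ n) \<partial>lborel))"
  defines "Y \<equiv> \<lambda>x s'. young p (ennreal (sqrt (1 + x) ^ r * \<bar>fdiff k s' F x\<bar> / A))"
  shows "\<exists>P::real poly. degree P < k + r \<and>
    (\<integral>\<^sup>+x\<in>{l<..u}. young p (ennreal (\<bar>f x - poly P x\<bar> / ((2 * \<delta>) ^ r * (2 ^ (k + 1) * (real k * \<Lambda>) ^ (k + 1)) * A))) \<partial>lborel)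
    \<le> (\<integral>\<^sup>+x\<in>{l<..u}. (\<integral>\<^sup>+v\<in>{0<..real k}. Y x (s * v) \<partial>lborel) \<partial>lborel) + (\<Sum>i\<in>{1..k}. \<integral>\<^sup>+x\<in>{l<..u}. Y x (real i * s) \<partial>lborel)"
proof -
  have [measurable]: "F \<in> borel_measurable borel" using F by (simp add: locint_def)
  \<comment> \<open>Large enough for both constants of \<open>whitney_local\<close> after they are
    multiplied by \<open>2 * k\<close> and \<open>2 * k * \<Lambda>\<close>, which turns sums and
    integrals into averages and leaves the factor \<open>1 / 2\<close> in front of \<open>a\<close>
    and \<open>b\<close>.\<close>
  define C where "C = 2 ^ (k + 1) * (real k * \<Lambda>) ^ (k + 1)"
  have k\<Lambda>: "1 * 1 \<le> real k * \<Lambda>" using k \<Lambda> by (intro mult_mono) auto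
  have "1 * 1 \<le> C" unfolding C_def using k\<Lambda> by (intro mult_mono one_le_power) auto
  then have C: "0 < C" by simp
  define X where "X x s' = ennreal (sqrt (1 + x) ^ r * \<bar>fdiff k s' F x\<bar> / A)" for x s'
  have YX: "Y x s' = young p (X x s')" for x s' by (simp add: Y_def X_def)
  obtain q :: "real poly" where q: "degree q < k" "\<And>x. x \<in> {l<..u} \<Longrightarrow>
     ennreal \<bar>F x - poly q x\<bar> \<le> ennreal (2 ^ k * real k ^ k) * (\<integral>\<^sup>+v\<in>{0<..real k}. ennreal \<bar>fdiff k (s * v) F x\<bar> \<partial>lborel)
        + ennreal (2 ^ k * \<Lambda> ^ k / s) * (\<integral>\<^sup>+t\<in>{x<..u}. (\<Sum>i\<in>{1..k}. ennreal \<bar>fdiff k (real i * s) F t\<bar>) \<partial>lborel)"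
    using whitney_local[OF k \<Lambda> F lu s] by blast
  define g where "g x = ennreal (sqrt (1 + x) ^ r * \<bar>F x - poly q x\<bar> / (C * A))" for x
  have [measurable]: "g \<in> borel_measurable borel" unfolding g_def by measurable
  \<comment> \<open>\<open>a\<close> averages over the steps \<open>s * v\<close> at the point
    \<open>x\<close>. \<open>b\<close> averages over the fixed steps \<open>i * s\<close> and over
    \<open>t\<close> in \<open>{x<..u}\<close>, normalised by \<open>\<Lambda> * s\<close>, which is
    at least the length of the interval.\<close>
  define a where "a x = ennreal (1 / real k) * (\<integral>\<^sup>+v\<in>{0<..real k}. X x (s * v) \<partial>lborel)" for x
  define b where "b x = (\<Sum>i\<in>{1..k}. ennreal (1 / real k) * (\<integral>\<^sup>+t. (ennreal (1 / (\<Lambda> * s)) * indicator {x<..u} t) * X t (real i * s) \<partial>lborel))" for x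
  have [measurable]: "(\<lambda>z. X (fst z) (h z)) \<in> borel_measurable (borel \<Otimes>\<^sub>M borel)" if [measurable]: "h \<in> borel_measurable (borel \<Otimes>\<^sub>M borel)" for h
    unfolding X_def by measurable
  have mX[measurable]: "(\<lambda>v. X (e v) (h v)) \<in> borel_measurable M" if [measurable]: "e \<in> borel_measurable M" "h \<in> borel_measurable M" for e h and M :: "'b measure"
    unfolding X_def by measurable
  have gle: "g x \<le> ennreal (1/2) * a x + ennreal (1/2) * b x" if x: "x \<in> {l<..u}" for x
  proof -
    define w where "w = sqrt (1 + x) ^ r / (C * A)"
    have w: "0 \<le> w" using x lu C A by (simp add: w_def)
    have "g x = ennreal w * ennreal \<bar>F x - poly q x\<bar>" unfolding g_def w_def
      using x lu C A by (subst ennreal_mult[symmetric]) auto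
    also have "\<dots> \<le> ennreal w * (ennreal (2 ^ k * real k ^ k) * (\<integral>\<^sup>+v\<in>{0<..real k}. ennreal \<bar>fdiff k (s * v) F x\<bar> \<partial>lborel)
        + ennreal (2 ^ k * \<Lambda> ^ k / s) * (\<integral>\<^sup>+t\<in>{x<..u}. (\<Sum>i\<in>{1..k}. ennreal \<bar>fdiff k (real i * s) F t\<bar>) \<partial>lborel))"
      by (intro mult_left_mono q(2)[OF x]) simp
    also have "\<dots> = ennreal w * ennreal (2 ^ k * real k ^ k) * (\<integral>\<^sup>+v\<in>{0<..real k}. ennreal \<bar>fdiff k (s * v) F x\<bar> \<partial>lborel)
        + ennreal w * ennreal (2 ^ k * \<Lambda> ^ k / s) * (\<Sum>i\<in>{1..k}. \<integral>\<^sup>+t\<in>{x<..u}. ennreal \<bar>fdiff k (real i * s) F t\<bar> \<partial>lborel)"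
    proof -
      have "(\<integral>\<^sup>+t\<in>{x<..u}. (\<Sum>i\<in>{1..k}. ennreal \<bar>fdiff k (real i * s) F t\<bar>) \<partial>lborel) = (\<Sum>i\<in>{1..k}. \<integral>\<^sup>+t\<in>{x<..u}. ennreal \<bar>fdiff k (real i * s) F t\<bar> \<partial>lborel)"
        unfolding sum_distrib_right by (intro nn_integral_sum) measurable
      then show ?thesis by (simp only: distrib_left mult.assoc)
    qed
    also have "\<dots> \<le> ennreal (1/2) * a x + ennreal (1/2) * b x"
    proof (intro add_mono)
      have "ennreal w * ennreal (2 ^ k * real k ^ k) * (\<integral>\<^sup>+v\<in>{0<..real k}. ennreal \<bar>fdiff k (s * v) F x\<bar> \<partial>lborel)
         = (\<integral>\<^sup>+v. ennreal (w * (2 ^ k * real k ^ k)) * (ennreal \<bar>fdiff k (s * v) F x\<bar> * indicator {0<..real k} v) \<partial>lborel)"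
        using w by (subst nn_integral_cmult) (auto simp: ennreal_mult)
      also have "\<dots> \<le> (\<integral>\<^sup>+v. ennreal (1 / (2 * real k)) * (X x (s * v) * indicator {0<..real k} v) \<partial>lborel)"
      proof (intro nn_integral_mono)
        fix v
        have "w * (2 ^ k * real k ^ k) * \<bar>fdiff k (s * v) F x\<bar> \<le> 1 / (2 * real k) * (sqrt (1 + x) ^ r * \<bar>fdiff k (s * v) F x\<bar> / A)"
        proof -
          have "2 ^ k * real k ^ k * (2 * real k) \<le> C"
          proof -
            have "real k ^ (k + 1) \<le> (real k * \<Lambda>) ^ (k + 1)" using k \<Lambda> by (intro power_mono) (auto simp: mult_le_cancel_left1)
            then have "2 ^ (k + 1) * real k ^ (k + 1) \<le> C" unfolding C_def by (intro mult_left_mono) auto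
            then show ?thesis by (simp add: ac_simps)
          qed
          then have "2 ^ k * real k ^ k / C \<le> 1 / (2 * real k)" using C k by (simp add: field_simps)
          then have "(2 ^ k * real k ^ k / C) * (sqrt (1 + x) ^ r * \<bar>fdiff k (s * v) F x\<bar> / A) \<le> 1 / (2 * real k) * (sqrt (1 + x) ^ r * \<bar>fdiff k (s * v) F x\<bar> / A)"
            using A x lu by (intro mult_right_mono) auto
          then show ?thesis by (simp add: w_def ac_simps)
        qed
        then show "ennreal (w * (2 ^ k * real k ^ k)) * (ennreal \<bar>fdiff k (s * v) F x\<bar> * indicator {0<..real k} v) \<le> ennreal (1 / (2 * real k)) * (X x (s * v) * indicator {0<..real k} v)"
          unfolding X_def using w A x lu k
          by (cases "v \<in> {0<..real k}") (auto simp: ennreal_mult[symmetric] intro!: ennreal_leI)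
      qed
      also have "\<dots> = ennreal (1 / (2 * real k)) * (\<integral>\<^sup>+v\<in>{0<..real k}. X x (s * v) \<partial>lborel)"
        by (intro nn_integral_cmult) measurable
      also have "\<dots> = ennreal (1/2) * a x"
      proof -
        have "ennreal (1 / (2 * real k)) = ennreal (1/2) * ennreal (1 / real k)" by (subst ennreal_mult[symmetric]) auto
        then show ?thesis unfolding a_def by (simp only: mult.assoc)
      qed
      finally show "ennreal w * ennreal (2 ^ k * real k ^ k) * (\<integral>\<^sup>+v\<in>{0<..real k}. ennreal \<bar>fdiff k (s * v) F x\<bar> \<partial>lborel) \<le> ennreal (1/2) * a x" .
      have "ennreal w * ennreal (2 ^ k * \<Lambda> ^ k / s) * (\<integral>\<^sup>+t\<in>{x<..u}. ennreal \<bar>fdiff k (real i * s) F t\<bar> \<partial>lborel)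
         \<le> ennreal (1/2) * (ennreal (1 / real k) * (\<integral>\<^sup>+t. (ennreal (1 / (\<Lambda> * s)) * indicator {x<..u} t) * X t (real i * s) \<partial>lborel))" for i
      proof -
        have "ennreal w * ennreal (2 ^ k * \<Lambda> ^ k / s) * (\<integral>\<^sup>+t\<in>{x<..u}. ennreal \<bar>fdiff k (real i * s) F t\<bar> \<partial>lborel)
          = (\<integral>\<^sup>+t. ennreal (w * (2 ^ k * \<Lambda> ^ k / s)) * (ennreal \<bar>fdiff k (real i * s) F t\<bar> * indicator {x<..u} t) \<partial>lborel)"
        proof -
          have "ennreal (w * (2 ^ k * \<Lambda> ^ k / s)) = ennreal w * ennreal (2 ^ k * \<Lambda> ^ k / s)" using w s \<Lambda> by (intro ennreal_mult) auto
          moreover have m: "(\<lambda>t. ennreal \<bar>fdiff k (real i * s) F t\<bar> * indicator {x<..u} t) \<in> borel_measurable lborel" by measurable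
          ultimately show ?thesis unfolding nn_integral_cmult[OF m] by (simp only:)
        qed
        also have "\<dots> \<le> (\<integral>\<^sup>+t. ennreal (1 / (2 * real k)) * ((ennreal (1 / (\<Lambda> * s)) * indicator {x<..u} t) * X t (real i * s)) \<partial>lborel)"
        proof (intro nn_integral_mono)
          fix t
          show "ennreal (w * (2 ^ k * \<Lambda> ^ k / s)) * (ennreal \<bar>fdiff k (real i * s) F t\<bar> * indicator {x<..u} t) \<le> ennreal (1 / (2 * real k)) * ((ennreal (1 / (\<Lambda> * s)) * indicator {x<..u} t) * X t (real i * s))"
          proof (cases "t \<in> {x<..u}")
            case True
            define d where "d = \<bar>fdiff k (real i * s) F t\<bar>"
            have d0: "0 \<le> d" by (simp add: d_def)
            have "2 ^ k * \<Lambda> ^ k * (2 * real k * \<Lambda>) \<le> C"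
            proof -
              have "\<Lambda> ^ k \<le> (real k * \<Lambda>) ^ k" using k \<Lambda> by (intro power_mono) (auto simp: mult_le_cancel_right1)
              then have "(2 ^ k * (2 * real k * \<Lambda>)) * \<Lambda> ^ k \<le> (2 ^ k * (2 * real k * \<Lambda>)) * (real k * \<Lambda>) ^ k"
                using \<Lambda> by (intro mult_left_mono) auto
              then show ?thesis unfolding C_def by (simp add: ac_simps)
            qed
            then have c: "2 ^ k * \<Lambda> ^ k / C \<le> 1 / (2 * real k) * (1 / \<Lambda>)" using C k \<Lambda> by (simp add: field_simps)
            have "w * (2 ^ k * \<Lambda> ^ k / s) * d = (2 ^ k * \<Lambda> ^ k / C) * (sqrt (1 + x) ^ r * d / A / s)"
              by (simp add: w_def ac_simps)
            also have "\<dots> \<le> (1 / (2 * real k) * (1 / \<Lambda>)) * (sqrt (1 + t) ^ r * d / A / s)"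
              using c A s True x lu d0 C \<Lambda> by (intro mult_mono divide_right_mono mult_right_mono power_mono) auto
            also have "\<dots> = 1 / (2 * real k) * (1 / (\<Lambda> * s) * (sqrt (1 + t) ^ r * d / A))" by simp
            finally have "ennreal (w * (2 ^ k * \<Lambda> ^ k / s) * d) \<le> ennreal (1 / (2 * real k) * (1 / (\<Lambda> * s) * (sqrt (1 + t) ^ r * d / A)))"
              by (rule ennreal_leI)
            moreover have "ennreal (w * (2 ^ k * \<Lambda> ^ k / s) * d) = ennreal (w * (2 ^ k * \<Lambda> ^ k / s)) * ennreal d"
              using w s \<Lambda> d0 by (intro ennreal_mult) auto
            moreover have "ennreal (1 / (2 * real k) * (1 / (\<Lambda> * s) * (sqrt (1 + t) ^ r * d / A))) = ennreal (1 / (2 * real k)) * (ennreal (1 / (\<Lambda> * s)) * ennreal (sqrt (1 + t) ^ r * d / A))"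
              using s \<Lambda> d0 A True x lu by (subst ennreal_mult, simp, simp, subst ennreal_mult) auto
            ultimately show ?thesis using True by (simp add: X_def d_def)
          qed simp
        qed
        also have "\<dots> = ennreal (1 / (2 * real k)) * (\<integral>\<^sup>+t. (ennreal (1 / (\<Lambda> * s)) * indicator {x<..u} t) * X t (real i * s) \<partial>lborel)"
          by (intro nn_integral_cmult) measurable
        also have "ennreal (1 / (2 * real k)) = ennreal (1/2) * ennreal (1 / real k)" by (subst ennreal_mult[symmetric]) auto
        finally show ?thesis by (simp only: mult.assoc)
      qed
      then show "ennreal w * ennreal (2 ^ k * \<Lambda> ^ k / s) * (\<Sum>i\<in>{1..k}. \<integral>\<^sup>+t\<in>{x<..u}. ennreal \<bar>fdiff k (real i * s) F t\<bar> \<partial>lborel) \<le> ennreal (1/2) * b x"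
        unfolding b_def sum_distrib_left by (intro sum_mono)
    qed
    finally show ?thesis .
  qed
  have ya: "young p (a x) \<le> (\<integral>\<^sup>+v\<in>{0<..real k}. Y x (s * v) \<partial>lborel)" for x
  proof -
    have "a x = (\<integral>\<^sup>+v. (ennreal (1 / real k) * indicator {0<..real k} v) * X x (s * v) \<partial>lborel)"
      unfolding a_def by (subst nn_integral_cmult[symmetric]) (auto simp: ac_simps)
    also have "young p \<dots> \<le> (\<integral>\<^sup>+v. (ennreal (1 / real k) * indicator {0<..real k} v) * young p (X x (s * v)) \<partial>lborel)"
    proof (rule young_kernel[OF p])
      have "(\<integral>\<^sup>+v. ennreal (1 / real k) * indicator {0<..real k} v \<partial>lborel) = ennreal (1 / real k) * ennreal (real k)"
        by (subst nn_integral_cmult_indicator) auto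
      also have "\<dots> = 1" using k by (subst ennreal_mult[symmetric]) auto
      finally show "(\<integral>\<^sup>+v. ennreal (1 / real k) * indicator {0<..real k} v \<partial>lborel) \<le> 1" by simp
    qed measurable
    also have "\<dots> \<le> (\<integral>\<^sup>+v. (1 * indicator {0<..real k} v) * young p (X x (s * v)) \<partial>lborel)"
    proof (intro nn_integral_mono mult_right_mono)
      have "ennreal (1 / real k) \<le> ennreal 1" using k by (intro ennreal_leI) auto
      then show "ennreal (1 / real k) \<le> 1" by simp
    qed auto
    finally show ?thesis unfolding YX by (simp add: mult.commute)
  qed
  have yb: "young p (b x) \<le> ennreal (1 / (\<Lambda> * s)) * (\<Sum>i\<in>{1..k}. \<integral>\<^sup>+t\<in>{l<..u}. Y t (real i * s) \<partial>lborel)" if x: "x \<in> {l<..u}" for x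
  proof -
    have "young p (b x) \<le> (\<Sum>i\<in>{1..k}. ennreal (1 / real k) * young p (\<integral>\<^sup>+t. (ennreal (1 / (\<Lambda> * s)) * indicator {x<..u} t) * X t (real i * s) \<partial>lborel))"
      unfolding b_def
    proof (rule young_sum[OF p])
      have "(\<Sum>i\<in>{1..k}. ennreal (1 / real k)) = ennreal (\<Sum>i\<in>{1..k}. 1 / real k)" by (intro sum_ennreal) auto
      then show "(\<Sum>i\<in>{1..k}. ennreal (1 / real k)) \<le> 1" using k by simp
    qed auto
    also have "\<dots> \<le> (\<Sum>i\<in>{1..k}. 1 * (\<integral>\<^sup>+t. (ennreal (1 / (\<Lambda> * s)) * indicator {l<..u} t) * Y t (real i * s) \<partial>lborel))"
    proof (intro sum_mono mult_mono)
      have "ennreal (1 / real k) \<le> ennreal 1" using k by (intro ennreal_leI) auto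
      then show "ennreal (1 / real k) \<le> 1" by simp
      fix i
      have "young p (\<integral>\<^sup>+t. (ennreal (1 / (\<Lambda> * s)) * indicator {x<..u} t) * X t (real i * s) \<partial>lborel)
         \<le> (\<integral>\<^sup>+t. (ennreal (1 / (\<Lambda> * s)) * indicator {x<..u} t) * young p (X t (real i * s)) \<partial>lborel)"
      proof (rule young_kernel[OF p])
        have "(\<integral>\<^sup>+t. ennreal (1 / (\<Lambda> * s)) * indicator {x<..u} t \<partial>lborel) = ennreal (1 / (\<Lambda> * s)) * ennreal (u - x)"
          using x by (subst nn_integral_cmult_indicator) auto
        also have "\<dots> = ennreal (1 / (\<Lambda> * s) * (u - x))" using x s \<Lambda> by (intro ennreal_mult[symmetric]) auto
        also have "\<dots> \<le> ennreal 1" using x s \<Lambda> by (intro ennreal_leI) (auto simp: divide_le_eq)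
        finally show "(\<integral>\<^sup>+t. ennreal (1 / (\<Lambda> * s)) * indicator {x<..u} t \<partial>lborel) \<le> 1" by simp
      qed measurable
      also have "\<dots> \<le> (\<integral>\<^sup>+t. (ennreal (1 / (\<Lambda> * s)) * indicator {l<..u} t) * Y t (real i * s) \<partial>lborel)"
        unfolding YX using x by (intro nn_integral_mono mult_right_mono mult_left_mono indicator_leI) auto
      finally show "young p (\<integral>\<^sup>+t. (ennreal (1 / (\<Lambda> * s)) * indicator {x<..u} t) * X t (real i * s) \<partial>lborel)
         \<le> (\<integral>\<^sup>+t. (ennreal (1 / (\<Lambda> * s)) * indicator {l<..u} t) * Y t (real i * s) \<partial>lborel)" .
    qed auto
    also have "\<dots> = ennreal (1 / (\<Lambda> * s)) * (\<Sum>i\<in>{1..k}. \<integral>\<^sup>+t\<in>{l<..u}. Y t (real i * s) \<partial>lborel)"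
      unfolding sum_distrib_left mult_1_left
    proof (intro sum.cong refl)
      fix i
      have "(\<integral>\<^sup>+t. (ennreal (1 / (\<Lambda> * s)) * indicator {l<..u} t) * Y t (real i * s) \<partial>lborel) = (\<integral>\<^sup>+t. ennreal (1 / (\<Lambda> * s)) * (Y t (real i * s) * indicator {l<..u} t) \<partial>lborel)"
        by (simp add: ac_simps)
      also have "\<dots> = ennreal (1 / (\<Lambda> * s)) * (\<integral>\<^sup>+t\<in>{l<..u}. Y t (real i * s) \<partial>lborel)"
        unfolding YX by (intro nn_integral_cmult) measurable
      finally show "(\<integral>\<^sup>+t. (ennreal (1 / (\<Lambda> * s)) * indicator {l<..u} t) * Y t (real i * s) \<partial>lborel) = ennreal (1 / (\<Lambda> * s)) * (\<integral>\<^sup>+t\<in>{l<..u}. Y t (real i * s) \<partial>lborel)" .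
    qed
    finally show ?thesis .
  qed
  define RHS where "RHS = (\<integral>\<^sup>+x\<in>{l<..u}. (\<integral>\<^sup>+v\<in>{0<..real k}. Y x (s * v) \<partial>lborel) \<partial>lborel) + (\<Sum>i\<in>{1..k}. \<integral>\<^sup>+x\<in>{l<..u}. Y x (real i * s) \<partial>lborel)"
  have gbound: "(\<integral>\<^sup>+x\<in>{l<..u}. young p (g x) \<partial>lborel) \<le> RHS"
  proof -
    let ?S = "\<Sum>i\<in>{1..k}. \<integral>\<^sup>+t\<in>{l<..u}. Y t (real i * s) \<partial>lborel"
    have "(\<integral>\<^sup>+x\<in>{l<..u}. young p (g x) \<partial>lborel) \<le> (\<integral>\<^sup>+x. (\<integral>\<^sup>+v\<in>{0<..real k}. Y x (s * v) \<partial>lborel) * indicator {l<..u} x + (ennreal (1 / (\<Lambda> * s)) * ?S) * indicator {l<..u} x \<partial>lborel)"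
    proof (intro nn_integral_mono)
      fix x
      show "young p (g x) * indicator {l<..u} x \<le> (\<integral>\<^sup>+v\<in>{0<..real k}. Y x (s * v) \<partial>lborel) * indicator {l<..u} x + (ennreal (1 / (\<Lambda> * s)) * ?S) * indicator {l<..u} x"
      proof (cases "x \<in> {l<..u}")
        case True
        have "young p (g x) \<le> young p (a x) + young p (b x)" using gle[OF True] by (rule young_half_sum[OF p])
        also have "\<dots> \<le> (\<integral>\<^sup>+v\<in>{0<..real k}. Y x (s * v) \<partial>lborel) + ennreal (1 / (\<Lambda> * s)) * ?S"
          by (intro add_mono ya yb True)
        finally show ?thesis using True by simp
      qed simp
    qed
    also have "\<dots> = (\<integral>\<^sup>+x\<in>{l<..u}. (\<integral>\<^sup>+v\<in>{0<..real k}. Y x (s * v) \<partial>lborel) \<partial>lborel) + (ennreal (1 / (\<Lambda> * s)) * ?S) * ennreal (u - l)"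
      unfolding YX using lu by (subst nn_integral_add) (auto simp: nn_integral_cmult_indicator)
    \<comment> \<open>Integrating over \<open>x\<close> contributes the length \<open>u - l\<close>,
      which the normalisation \<open>1 / (\<Lambda> * s)\<close> absorbs.\<close>
    also have "(ennreal (1 / (\<Lambda> * s)) * ?S) * ennreal (u - l) = ennreal ((u - l) / (\<Lambda> * s)) * ?S"
    proof -
      have "ennreal ((u - l) / (\<Lambda> * s)) = ennreal (u - l) * ennreal (1 / (\<Lambda> * s))"
        using lu s \<Lambda> by (subst ennreal_mult[symmetric]) auto
      then show ?thesis by (simp only: ac_simps)
    qed
    also have "\<dots> \<le> 1 * ?S"
    proof (intro mult_right_mono)
      have "ennreal ((u - l) / (\<Lambda> * s)) \<le> ennreal 1" using s \<Lambda> by (intro ennreal_leI) (auto simp: divide_le_eq)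
      then show "ennreal ((u - l) / (\<Lambda> * s)) \<le> 1" by simp
    qed auto
    finally show ?thesis by (simp add: RHS_def add_left_mono)
  qed
  show ?thesis
  proof (cases r)
    case 0
    then have "f = F" by (rule f0)
    then have "(\<integral>\<^sup>+x\<in>{l<..u}. young p (ennreal (\<bar>f x - poly q x\<bar> / ((2 * \<delta>) ^ r * C * A))) \<partial>lborel) \<le> RHS"
      using gbound 0 by (simp add: g_def)
    then show ?thesis using q(1) 0 unfolding C_def RHS_def by (intro exI[of _ q]) simp
  next
    case (Suc n)
    obtain T :: "real poly" where T: "degree T \<le> n" "\<And>x. -1 < x \<Longrightarrow> x \<le> u \<Longrightarrow>
           f x = poly T x + (-1) ^ Suc n / fact n * (\<integral>t. indicator {x<..u} t * (F t * (t - x) ^ n) \<partial>lborel)"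
      using fr[OF Suc] by blast
    obtain Q :: "real poly" where Q: "degree Q < k + Suc n" "\<And>x. x \<le> u \<Longrightarrow> (\<integral>t. indicator {x<..u} t * (poly q t * (t - x) ^ n) \<partial>lborel) = poly Q x"
      using poly_moment[OF q(1), of n u] by blast
    \<comment> \<open>The Taylor polynomial of \<open>f\<close> plus the remainder term with
      \<open>F\<close> replaced by \<open>q\<close>; hence \<open>f - P\<close> is the remainder
      term of \<open>F - q\<close>.\<close>
    define P where "P = T + smult ((-1) ^ Suc n / fact n) Q"
    have "degree P < k + r"
    proof -
      have "degree P \<le> k + n" unfolding P_def using T(1) Q(1) by (intro degree_add_le order.trans[OF degree_smult_le]) auto
      then show ?thesis using Suc by simp
    qed
    moreover have "(\<integral>\<^sup>+x\<in>{l<..u}. young p (ennreal (\<bar>f x - poly P x\<bar> / ((2 * \<delta>) ^ r * C * A))) \<partial>lborel) \<le> RHS"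
    proof -
      \<comment> \<open>Both masses are at most 1: in \<open>t\<close> because
        \<open>sqrt (1 + t) / \<delta>\<close> is an antiderivative, in \<open>x\<close> by
        \<open>sqrt_increment\<close>. So Schur's test loses no constant.\<close>
      define K where "K x t = ennreal (indicator {l<..u} x * indicator {x<..u} t / (2 * \<delta> * sqrt (1 + t)))" for x t :: real
      have ind: "indicator {x<..u} t = (if x < t \<and> t \<le> u then 1 else (0::real))" for x t by (simp add: indicator_def)
      have sq: "sqrt (1 + t) - sqrt (1 + x) \<le> \<delta>" if "l \<le> x" "t \<le> u" for x t
      proof -
        have "sqrt (1 + t) \<le> sqrt (1 + u)" "sqrt (1 + l) \<le> sqrt (1 + x)" using that by auto
        then show ?thesis using \<delta>(2) by linarith
      qed
      have "(\<integral>\<^sup>+x. young p (ennreal (\<bar>f x - poly P x\<bar> / ((2 * \<delta>) ^ r * C * A)) * indicator {l<..u} x) \<partial>lborel)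
         \<le> 1 * (\<integral>\<^sup>+t. young p (g t * indicator {l<..u} t) \<partial>lborel)"
      proof (rule young_schur[OF p, where K = K])
        show "sigma_finite_measure (lborel :: real measure)" by (rule lborel.sigma_finite_measure_axioms)
        then show "sigma_finite_measure (lborel :: real measure)" .
        show "case_prod K \<in> borel_measurable (lborel \<Otimes>\<^sub>M lborel)" unfolding K_def ind by measurable
        show "(\<lambda>t. g t * indicator {l<..u} t) \<in> borel_measurable lborel" by measurable
      next
        fix x :: real
        show "(\<integral>\<^sup>+t. K x t \<partial>lborel) \<le> 1"
        proof (cases "x \<in> {l<..u}")
          case True
          have "(\<integral>\<^sup>+t. K x t \<partial>lborel) \<le> (\<integral>\<^sup>+t. ennreal (1 / (2 * \<delta> * sqrt (1 + t))) * indicator {x..u} t \<partial>lborel)"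
            using True \<delta> lu by (intro nn_integral_mono) (auto simp: K_def indicator_def)
          also have "\<dots> = ennreal (sqrt (1 + u) / \<delta> - sqrt (1 + x) / \<delta>)"
            using True lu \<delta>
            by (intro nn_integral_FTC_Icc) (auto intro!: derivative_eq_intros simp: field_simps)
          also have "\<dots> \<le> ennreal 1" using sq[of x u] True \<delta> by (intro ennreal_leI) (simp add: diff_divide_distrib[symmetric])
          finally show ?thesis by simp
        qed (simp add: K_def)
      next
        fix t :: real
        show "(\<integral>\<^sup>+x. K x t \<partial>lborel) \<le> 1"
        proof (cases "t \<in> {l<..u}")
          case True
          have "(\<integral>\<^sup>+x. K x t \<partial>lborel) \<le> (\<integral>\<^sup>+x. ennreal (1 / (2 * \<delta> * sqrt (1 + t))) * indicator {l<..t} x \<partial>lborel)"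
            using True \<delta> lu by (intro nn_integral_mono) (auto simp: K_def indicator_def)
          also have "\<dots> = ennreal (1 / (2 * \<delta> * sqrt (1 + t))) * ennreal (t - l)"
            using True by (subst nn_integral_cmult_indicator) auto
          also have "\<dots> = ennreal ((t - l) / (2 * \<delta> * sqrt (1 + t)))" using True lu \<delta> by (subst ennreal_mult[symmetric]) auto
          also have "\<dots> \<le> ennreal 1"
          proof (intro ennreal_leI)
            have "t - l \<le> 2 * \<delta> * sqrt (1 + t)" using True lu \<delta> by (intro sqrt_increment sq) auto
            then show "(t - l) / (2 * \<delta> * sqrt (1 + t)) \<le> 1" using True lu \<delta> by (simp add: divide_le_eq)
          qed
          finally show ?thesis by simp
        next
          case False
          have "K x t = 0" for x using False by (auto simp: K_def indicator_def)
          then show ?thesis by simp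
        qed
      next
        fix x :: real
        show "ennreal (\<bar>f x - poly P x\<bar> / ((2 * \<delta>) ^ r * C * A)) * indicator {l<..u} x \<le> (\<integral>\<^sup>+t. K x t * (g t * indicator {l<..u} t) \<partial>lborel)"
        proof (cases "x \<in> {l<..u}")
          case True
          then have x1: "-1 < x" "x \<le> u" "l < x" using lu by auto
          have u1: "u < 1"
          proof -
            have "0 \<le> (real k)\<^sup>2 * s" using s by simp
            then show ?thesis using s(2) by linarith
          qed
          have iF: "integrable lborel (\<lambda>t. indicator {x<..u} t * (F t * (t - x) ^ n))"
            by (intro locint_mult[OF F x1(1) u1] continuous_intros)
          have iq: "integrable lborel (\<lambda>t. indicator {x<..u} t * (poly q t * (t - x) ^ n))"
          proof -
            have "locint (poly q)" unfolding locint_def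
            proof (intro conjI allI impI)
              fix c d :: real
              have "integrable lborel (\<lambda>t. poly q t * indicator {c..d} t)"
                by (intro borel_integrable_atLeastAtMost) (auto intro!: continuous_intros)
              moreover have "integrable lborel (\<lambda>t. indicator {c<..d} t * (poly q t * indicator {c..d} t))"
                using calculation by (intro integrable_real_mult_indicator[where f = "\<lambda>t. poly q t * indicator {c..d} t", simplified mult.commute]) auto
              then show "integrable lborel (\<lambda>t. indicator {c<..d} t * poly q t)"
                by (rule back_subst[of "integrable lborel"]) (auto simp: indicator_def fun_eq_iff)
            qed measurable
            then show ?thesis by (intro locint_mult[OF _ x1(1) u1] continuous_intros)
          qed
          have "f x - poly P x = (-1) ^ Suc n / fact n * (\<integral>t. indicator {x<..u} t * ((F t - poly q t) * (t - x) ^ n) \<partial>lborel)"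
          proof -
            have "(\<integral>t. indicator {x<..u} t * ((F t - poly q t) * (t - x) ^ n) \<partial>lborel)
               = (\<integral>t. indicator {x<..u} t * (F t * (t - x) ^ n) - indicator {x<..u} t * (poly q t * (t - x) ^ n) \<partial>lborel)"
              by (intro Bochner_Integration.integral_cong refl) (simp add: algebra_simps)
            also have "\<dots> = (\<integral>t. indicator {x<..u} t * (F t * (t - x) ^ n) \<partial>lborel) - poly Q x"
              using iF iq Q(2)[OF x1(2)] by (simp add: Bochner_Integration.integral_diff)
            finally have I: "(\<integral>t. indicator {x<..u} t * ((F t - poly q t) * (t - x) ^ n) \<partial>lborel)
               = (\<integral>t. indicator {x<..u} t * (F t * (t - x) ^ n) \<partial>lborel) - poly Q x" .
            show ?thesis unfolding I T(2)[OF x1(1,2)] P_def by (simp add: right_diff_distrib)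
          qed
          then have "\<bar>f x - poly P x\<bar> = \<bar>\<integral>t. indicator {x<..u} t * ((F t - poly q t) * (t - x) ^ n) \<partial>lborel\<bar> / fact n"
            by (simp add: abs_mult)
          also have "\<dots> \<le> \<bar>\<integral>t. indicator {x<..u} t * ((F t - poly q t) * (t - x) ^ n) \<partial>lborel\<bar> / 1"
            by (intro divide_left_mono) auto
          finally have "\<bar>f x - poly P x\<bar> / ((2 * \<delta>) ^ r * C * A) \<le> \<bar>\<integral>t. indicator {x<..u} t * ((F t - poly q t) * (t - x) ^ n) \<partial>lborel\<bar> / ((2 * \<delta>) ^ r * C * A)"
            using \<delta> C A by (intro divide_right_mono) auto
          then have "ennreal (\<bar>f x - poly P x\<bar> / ((2 * \<delta>) ^ r * C * A)) \<le> ennreal (1 / ((2 * \<delta>) ^ r * C * A)) * ennreal \<bar>\<integral>t. indicator {x<..u} t * ((F t - poly q t) * (t - x) ^ n) \<partial>lborel\<bar>"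
            using \<delta> C A by (subst ennreal_mult[symmetric]) (auto intro!: ennreal_leI)
          also have "\<dots> \<le> ennreal (1 / ((2 * \<delta>) ^ r * C * A)) * (\<integral>\<^sup>+t. ennreal \<bar>indicator {x<..u} t * ((F t - poly q t) * (t - x) ^ n)\<bar> \<partial>lborel)"
            by (intro mult_left_mono abs_integral_le_nn_integral) auto
          also have "\<dots> = (\<integral>\<^sup>+t. ennreal (1 / ((2 * \<delta>) ^ r * C * A)) * ennreal \<bar>indicator {x<..u} t * ((F t - poly q t) * (t - x) ^ n)\<bar> \<partial>lborel)"
            by (intro nn_integral_cmult[symmetric]) measurable
          also have "\<dots> \<le> (\<integral>\<^sup>+t. K x t * (g t * indicator {l<..u} t) \<partial>lborel)"
          proof (intro nn_integral_mono)
            fix t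
            show "ennreal (1 / ((2 * \<delta>) ^ r * C * A)) * ennreal \<bar>indicator {x<..u} t * ((F t - poly q t) * (t - x) ^ n)\<bar> \<le> K x t * (g t * indicator {l<..u} t)"
            proof (cases "t \<in> {x<..u}")
              case t: True
              define z where "z = sqrt (1 + t)"
              have z: "z > 0" using t x1 by (simp add: z_def)
              define e where "e = \<bar>F t - poly q t\<bar> / (C * A)"
              have e: "0 \<le> e" using C A by (simp add: e_def)
              have "t - x \<le> 2 * \<delta> * z" unfolding z_def using t x1 lu \<delta> by (intro sqrt_increment sq) auto
              then have "(t - x) ^ n \<le> (2 * \<delta> * z) ^ n" using t by (intro power_mono) auto
              then have "e * (t - x) ^ n / (2 * \<delta>) ^ r \<le> e * (2 * \<delta> * z) ^ n / (2 * \<delta>) ^ r"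
                using \<delta> e by (intro divide_right_mono mult_left_mono) auto
              also have "\<dots> = 1 / (2 * \<delta> * z) * (z ^ r * e)"
                using z \<delta> by (simp add: Suc power_mult_distrib field_simps)
              finally have "ennreal (e * (t - x) ^ n / (2 * \<delta>) ^ r) \<le> ennreal (1 / (2 * \<delta> * z) * (z ^ r * e))" by (rule ennreal_leI)
              moreover have "ennreal (1 / ((2 * \<delta>) ^ r * C * A)) * ennreal \<bar>indicator {x<..u} t * ((F t - poly q t) * (t - x) ^ n)\<bar> = ennreal (e * (t - x) ^ n / (2 * \<delta>) ^ r)"
                using t \<delta> C A by (subst ennreal_mult[symmetric]) (auto simp: e_def abs_mult power_abs[symmetric] ac_simps)
              moreover have "K x t * (g t * indicator {l<..u} t) = ennreal (1 / (2 * \<delta> * z) * (z ^ r * e))"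
              proof -
                have "g t = ennreal (z ^ r * e)" by (simp add: g_def z_def e_def)
                moreover have "K x t = ennreal (1 / (2 * \<delta> * z))" using t True by (simp add: K_def z_def)
                moreover have "t \<in> {l<..u}" using t x1 by auto
                moreover have "ennreal (1 / (2 * \<delta> * z) * (z ^ r * e)) = ennreal (1 / (2 * \<delta> * z)) * ennreal (z ^ r * e)"
                  using z \<delta> e by (intro ennreal_mult) auto
                ultimately show ?thesis by simp
              qed
              ultimately show ?thesis by simp
            qed simp
          qed
          finally show ?thesis using True by simp
        qed simp
      qed
      also have "(\<integral>\<^sup>+x. young p (ennreal (\<bar>f x - poly P x\<bar> / ((2 * \<delta>) ^ r * C * A)) * indicator {l<..u} x) \<partial>lborel) = (\<integral>\<^sup>+x\<in>{l<..u}. young p (ennreal (\<bar>f x - poly P x\<bar> / ((2 * \<delta>) ^ r * C * A))) \<partial>lborel)"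
        using p by (intro nn_integral_cong) (auto simp: indicator_def)
      also have "(\<integral>\<^sup>+t. young p (g t * indicator {l<..u} t) \<partial>lborel) = (\<integral>\<^sup>+x\<in>{l<..u}. young p (g x) \<partial>lborel)"
        using p by (intro nn_integral_cong) (auto simp: indicator_def)
      finally show ?thesis using gbound by simp
    qed
    ultimately show ?thesis unfolding C_def RHS_def by blast
  qed
qed

section \<open>Approximation on half of the interval\<close>

lemma phi_nonneg: "\<bar>Y\<bar> \<le> 1 \<Longrightarrow> 0 \<le> \<phi> Y"
  by (simp add: \<phi>_def abs_square_le_1)

lemma phi_pos: "\<bar>Y\<bar> < 1 \<Longrightarrow> 0 < \<phi> Y"
  by (simp add: \<phi>_def abs_square_less_1)

lemma phi_measurable [measurable]: "\<phi> \<in> borel_measurable borel"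
  unfolding \<phi>_def[abs_def] by measurable

lemma sum_indicator_consecutive:
  fixes x :: "nat \<Rightarrow> real"
  assumes "\<And>i j. i \<le> j \<Longrightarrow> j \<le> N \<Longrightarrow> x i \<le> x j"
  shows "(\<Sum>j<N. indicator {x j<..x (Suc j)} y) = (indicator {x 0<..x N} y :: ennreal)"
  using assms
proof (induction N)
  case 0
  show ?case by simp
next
  case (Suc N)
  have "x 0 \<le> x N" "x N \<le> x (Suc N)" using Suc.prems by auto
  moreover have "(\<Sum>j<N. indicator {x j<..x (Suc j)} y) = (indicator {x 0<..x N} y :: ennreal)"
    using Suc.prems by (intro Suc.IH) auto
  ultimately show ?case by (auto simp: indicator_def)
qed

text \<open>Guarantees that an ordinary step \<open>s'\<close> at the first point \<open>y\<close>
  is one of the steps of the modulus at the centre \<open>Y\<close>, namely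
  \<open>h * \<phi> Y\<close> with \<open>h \<le> 1 / n\<close>, and that the stencil stays away
  from \<open>1\<close>. Here \<open>w\<close> is the size of \<open>sqrt (1 + x)\<close> at the
  right end of the interval and \<open>\<beta>\<close> the angular mesh.\<close>

lemma step_geometry:
  fixes k K :: nat and \<epsilon> \<beta> y u l w s' n Y :: real
  assumes k: "1 \<le> k" and K: "1 \<le> K" and \<epsilon>: "\<epsilon> = 1 / (64 * (real k)\<^sup>2 * (real K)\<^sup>2)"
    and \<beta>: "0 < \<beta>" "\<beta> \<le> 0.54" and w: "w = sqrt (1 + u)" "\<beta> \<le> 3 * w" and u: "u \<le> 1 / 2"
    and lu: "sqrt (1 + u) - sqrt (1 + l) \<le> 2 * \<beta>" "-1 \<le> l" "l < y" "y \<le> u"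
    and n: "0 < n" "n * \<beta> \<le> real K" and s': "0 < s'" "s' \<le> 2 * real k * (\<epsilon> * \<beta> * w)"
    and Y: "Y = y + real k * s' / 2"
  shows "-1 < Y" "Y + real k * s' / 2 \<le> 3 / 4" "n * s' \<le> \<phi> Y" "\<phi> Y \<le> 2 * w"
proof -
  have w0: "0 < w" using w(2) \<beta>(1) by simp
  have w2: "w\<^sup>2 = 1 + u" using w(1) lu by simp
  have w54: "w \<le> 5 / 4"
  proof (rule power2_le_imp_le)
    show "w\<^sup>2 \<le> (5 / 4)\<^sup>2" unfolding w2 using u by (simp add: power2_eq_square)
  qed simp
  have e1: "\<epsilon> * (real k)\<^sup>2 \<le> 1 / 64"
  proof -
    have "1 \<le> (real K)\<^sup>2" using K by simp
    then show ?thesis unfolding \<epsilon> using k by (simp add: divide_simps)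
  qed
  have e0: "0 < \<epsilon>" using k K by (simp add: \<epsilon>)
  have ks: "real k * s' \<le> 1 / 32 * (\<beta> * w)"
  proof -
    have "real k * s' \<le> real k * (2 * real k * (\<epsilon> * \<beta> * w))" using s' by (intro mult_left_mono) auto
    also have "\<dots> = 2 * (\<epsilon> * (real k)\<^sup>2) * (\<beta> * w)" by (simp add: power2_eq_square)
    also have "\<dots> \<le> 2 * (1 / 64) * (\<beta> * w)" using e1 \<beta> w0 by (intro mult_right_mono mult_left_mono) auto
    finally show ?thesis by simp
  qed
  have bw: "\<beta> * w \<le> 1"
  proof -
    have "\<beta> * w \<le> 0.54 * (5 / 4)" using \<beta> w54 w0 by (intro mult_mono) auto
    then show ?thesis by simp
  qed
  have ks0: "0 < real k * s'" using k s' by simp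
  show "-1 < Y" using lu ks0 by (simp add: Y)
  show Y34: "Y + real k * s' / 2 \<le> 3 / 4" unfolding Y using ks bw u lu(4) by linarith
  have Y1: "Y \<le> 3 / 4" using Y34 ks0 by linarith
  have Ym: "1 + Y = 1 + y + real k * s' / 2" by (simp add: Y)
  have y1: "0 < 1 + y" using lu by simp
  have phi2: "(\<phi> Y)\<^sup>2 = (1 - Y) * (1 + Y)"
  proof -
    have "0 \<le> (1 - Y) * (1 + Y)" using Y1 \<open>-1 < Y\<close> by (intro mult_nonneg_nonneg) auto
    then show ?thesis unfolding \<phi>_def by (simp add: power2_eq_square algebra_simps)
  qed
  have phi0: "0 \<le> \<phi> Y" using Y1 \<open>-1 < Y\<close> by (intro phi_nonneg) auto
  show "\<phi> Y \<le> 2 * w"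
  proof (rule power2_le_imp_le)
    have "(\<phi> Y)\<^sup>2 \<le> 2 * (1 + Y)" unfolding phi2 using \<open>-1 < Y\<close> by (intro mult_right_mono) auto
    also have "\<dots> \<le> 2 * w\<^sup>2 + 1 / 32 * (\<beta> * w)" using ks lu w2 by (simp add: Ym)
    also have "\<beta> * w \<le> 3 * w * w" using w(2) w0 by (intro mult_right_mono) auto
    finally show "(\<phi> Y)\<^sup>2 \<le> (2 * w)\<^sup>2" using mult_pos_pos[OF w0 w0] by (simp add: power2_eq_square)
  qed (use w0 in simp)
  have ns: "n * s' \<le> 2 * real k * \<epsilon> * real K * w"
  proof -
    have "n * s' \<le> n * (2 * real k * (\<epsilon> * \<beta> * w))" using s' n by (intro mult_left_mono) auto
    also have "\<dots> = (n * \<beta>) * (2 * real k * \<epsilon> * w)" by simp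
    also have "\<dots> \<le> real K * (2 * real k * \<epsilon> * w)" using n e0 w0 k by (intro mult_right_mono) auto
    finally show ?thesis by (simp add: ac_simps)
  qed
  show "n * s' \<le> \<phi> Y"
  proof (rule power2_le_imp_le[OF _ phi0])
    have "(n * s')\<^sup>2 \<le> (1 + Y) / 4"
    \<comment> \<open>If \<open>4 * \<beta> \<le> w\<close>, the interval is away from
      \<open>-1\<close> and \<open>sqrt (1 + y)\<close> is at least \<open>w / 2\<close>. Otherwise
      \<open>y\<close> may be arbitrarily near \<open>-1\<close>, but the centre is at distance at
      least \<open>k * s' / 2\<close> from it, and \<open>w < 4 * \<beta>\<close> makes
      \<open>(n * s')^2\<close> small against \<open>s'\<close>.\<close>
    proof (cases "4 * \<beta> \<le> w")
      case True
      have "w / 2 \<le> sqrt (1 + y)"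
      proof -
        have "sqrt (1 + l) \<le> sqrt (1 + y)" using lu by simp
        then show ?thesis using lu(1) True w(1) by linarith
      qed
      then have "(w / 2)\<^sup>2 \<le> (sqrt (1 + y))\<^sup>2" using w0 by (intro power_mono) auto
      then have wy: "w\<^sup>2 / 4 \<le> 1 + y" using y1 by (simp add: power_divide)
      have "2 * real k * \<epsilon> * real K \<le> 1 / 32"
      proof -
        have "1 * 1 \<le> real k * real K" using k K by (intro mult_mono) auto
        moreover have "2 * real k * \<epsilon> * real K = 1 / (32 * (real k * real K))"
          unfolding \<epsilon> using k K by (simp add: power2_eq_square)
        moreover have "1 / (32 * (real k * real K)) \<le> 1 / 32" using \<open>1 * 1 \<le> real k * real K\<close> by (intro divide_left_mono) auto
        ultimately show ?thesis by simp
      qed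
      then have "2 * real k * \<epsilon> * real K * w \<le> 1 / 32 * w" using w0 by (intro mult_right_mono) auto
      then have "n * s' \<le> w / 32" using ns by simp
      then have "(n * s')\<^sup>2 \<le> (w / 32)\<^sup>2" using n s' by (intro power_mono) auto
      then have "(n * s')\<^sup>2 \<le> w\<^sup>2 / 1024" by (simp only: power_divide) simp
      also have "w\<^sup>2 / 1024 \<le> w\<^sup>2 / 4 / 4" by simp
      also have "\<dots> \<le> (1 + y) / 4" using wy by (rule divide_right_mono) simp
      also have "\<dots> \<le> (1 + Y) / 4" using ks0 by (simp add: Y mult.commute)
      finally show ?thesis .
    next
      case False
      have "n * s' * (n * s') \<le> (2 * real k * \<epsilon> * real K * w) * (n * s')" using ns n s' by (intro mult_right_mono) auto
      also have "\<dots> \<le> (2 * real k * \<epsilon> * real K * (4 * \<beta>)) * (n * s')" using False n s' e0 by (intro mult_right_mono mult_left_mono) auto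
      also have "\<dots> = (8 * real k * \<epsilon> * real K * s') * (n * \<beta>)" by simp
      also have "\<dots> \<le> (8 * real k * \<epsilon> * real K * s') * real K" using n s' e0 by (intro mult_left_mono) auto
      also have "\<dots> = s' / (8 * real k)" unfolding \<epsilon> using k K by (simp add: power2_eq_square)
      also have "\<dots> \<le> real k * s' / 8" using k s' by (simp add: divide_simps) (simp add: mult_le_cancel_left1 mult_ge1_I)
      finally show ?thesis using Ym y1 by (simp add: power2_eq_square)
    qed
    also have "\<dots> \<le> (1 - Y) * (1 + Y)"
    proof -
      have "1 / 4 * (1 + Y) \<le> (1 - Y) * (1 + Y)" using Y1 \<open>-1 < Y\<close> by (intro mult_right_mono) auto
      then show ?thesis by simp
    qed
    finally show "(n * s')\<^sup>2 \<le> (\<phi> Y)\<^sup>2" unfolding phi2 .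
  qed
qed

text \<open>The integrand of the modulus, with the step \<open>h * \<phi> Y\<close> in both the
  weight and the difference replaced by an independent variable \<open>s'\<close>.\<close>

definition step_young :: "ennreal \<Rightarrow> nat \<Rightarrow> nat \<Rightarrow> (real \<Rightarrow> real) \<Rightarrow> real \<Rightarrow> real \<Rightarrow> real \<Rightarrow> ennreal" where
  "step_young p k r F A Y s' =
     young p (ennreal (\<bar>sqrt ((1 - Y - real k * s' / 2) * (1 + Y - real k * s' / 2)) ^ r * fdiff k s' F (Y - real k * s' / 2)\<bar> / A))"

text \<open>The conditions say that \<open>h = s' / \<phi> Y\<close> is positive and at most
  \<open>1 / n\<close>, and that \<open>Y\<close> belongs to the domain for this \<open>h\<close>.
  The factor \<open>1 / \<phi> Y\<close> cancels the Jacobian of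
  \<open>s' = h * \<phi> Y\<close>.\<close>

definition step_density :: "ennreal \<Rightarrow> nat \<Rightarrow> nat \<Rightarrow> nat \<Rightarrow> (real \<Rightarrow> real) \<Rightarrow> real \<Rightarrow> real \<Rightarrow> real \<Rightarrow> ennreal" where
  "step_density p k r n F A Y s' =
     (if -1 < Y \<and> Y < 1 \<and> 0 < s' \<and> real n * s' \<le> \<phi> Y \<and> \<bar>Y\<bar> \<le> 1 - real k * s' / 2
      then ennreal (1 / \<phi> Y) * step_young p k r F A Y s' else 0)"

lemma step_young_measurable [measurable (raw)]:
  assumes [measurable]: "F \<in> borel_measurable borel" "e \<in> borel_measurable M" "s \<in> borel_measurable M"
  shows "(\<lambda>x. step_young p k r F A (e x) (s x)) \<in> borel_measurable M"
  unfolding step_young_def by measurable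

lemma step_density_measurable [measurable (raw)]:
  assumes [measurable]: "F \<in> borel_measurable borel" "e \<in> borel_measurable M" "s \<in> borel_measurable M"
  shows "(\<lambda>x. step_density p k r n F A (e x) (s x)) \<in> borel_measurable M"
  unfolding step_density_def by measurable

text \<open>For fixed \<open>y\<close> the pairs of centre \<open>Y = y + k s' / 2\<close> and step \<open>s' = h \<phi> Y\<close> are parametrised either by
  \<open>(y, s')\<close> or by \<open>(Y, h)\<close>; this converts the variable-step differences of the modulus into
  ordinary ones.\<close>

lemma change_of_step:
  fixes k r n :: nat and A :: real and F :: "real \<Rightarrow> real" and p :: ennreal
  assumes k: "1 \<le> k" and n: "1 \<le> n" and F[measurable]: "F \<in> borel_measurable borel"
    and mod: "\<And>h. 0 < h \<Longrightarrow> h \<le> 1 / real n \<Longrightarrow>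
      (\<integral>\<^sup>+Y\<in>\<DD> (real k * h). young p (ennreal (\<bar>\<W> (real k * h) Y ^ r * fdiff k (h * \<phi> Y) F (Y - real k * (h * \<phi> Y) / 2)\<bar> / A)) \<partial>lborel) \<le> 1"
  shows "(\<integral>\<^sup>+y. \<integral>\<^sup>+s'. step_density p k r n F A (y + real k * s' / 2) s' \<partial>lborel \<partial>lborel) \<le> ennreal (1 / real n)"
proof -
  let ?V = "step_density p k r n F A"
  let ?Z = "step_young p k r F A"
  define G where "G h Y = (if 0 < h \<and> h \<le> 1 / real n \<and> -1 < Y \<and> Y < 1 \<and> \<bar>Y\<bar> \<le> 1 - real k * (h * \<phi> Y) / 2 then ?Z Y (h * \<phi> Y) else 0)" for h Y
  have [measurable]: "case_prod G \<in> borel_measurable (lborel \<Otimes>\<^sub>M lborel)" unfolding G_def by measurable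
  have "(\<integral>\<^sup>+y. \<integral>\<^sup>+s'. ?V (y + real k * s' / 2) s' \<partial>lborel \<partial>lborel) = (\<integral>\<^sup>+s'. \<integral>\<^sup>+y. ?V (y + real k * s' / 2) s' \<partial>lborel \<partial>lborel)"
    by (rule lborel_pair.Fubini'[symmetric]) measurable
  also have "\<dots> = (\<integral>\<^sup>+s'. \<integral>\<^sup>+Y. ?V Y s' \<partial>lborel \<partial>lborel)"
  proof (rule nn_integral_cong)
    fix s' :: real
    show "(\<integral>\<^sup>+y. ?V (y + real k * s' / 2) s' \<partial>lborel) = (\<integral>\<^sup>+Y. ?V Y s' \<partial>lborel)"
      by (subst nn_integral_real_affine[of "\<lambda>Y. ?V Y s'" 1 "real k * s' / 2"]) (measurable, simp_all add: add.commute)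
  qed
  also have "\<dots> = (\<integral>\<^sup>+Y. \<integral>\<^sup>+s'. ?V Y s' \<partial>lborel \<partial>lborel)"
    by (rule lborel_pair.Fubini') measurable
  also have "\<dots> = (\<integral>\<^sup>+Y. \<integral>\<^sup>+h. G h Y \<partial>lborel \<partial>lborel)"
  proof (rule nn_integral_cong)
    fix Y :: real
    show "(\<integral>\<^sup>+s'. ?V Y s' \<partial>lborel) = (\<integral>\<^sup>+h. G h Y \<partial>lborel)"
    proof (cases "-1 < Y \<and> Y < 1")
      case True
      then have ph: "0 < \<phi> Y" by (intro phi_pos) auto
      have "(\<integral>\<^sup>+s'. ?V Y s' \<partial>lborel) = ennreal (\<phi> Y) * (\<integral>\<^sup>+h. ?V Y (\<phi> Y * h) \<partial>lborel)"
        using nn_integral_real_affine[of "\<lambda>s'. ?V Y s'" "\<phi> Y" 0] ph by simp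
      also have "\<dots> = (\<integral>\<^sup>+h. ennreal (\<phi> Y) * ?V Y (\<phi> Y * h) \<partial>lborel)"
        by (intro nn_integral_cmult[symmetric]) measurable
      also have "\<dots> = (\<integral>\<^sup>+h. G h Y \<partial>lborel)"
      proof (intro nn_integral_cong)
        fix h
        have c: "0 < \<phi> Y * h \<longleftrightarrow> 0 < h" "real n * (\<phi> Y * h) \<le> \<phi> Y \<longleftrightarrow> h \<le> 1 / real n"
          using ph n by (auto simp: zero_less_mult_iff field_simps)
        have "ennreal (\<phi> Y) * (ennreal (1 / \<phi> Y) * z) = z" for z
          using ph by (simp add: mult.assoc[symmetric] ennreal_mult[symmetric])
        then show "ennreal (\<phi> Y) * ?V Y (\<phi> Y * h) = G h Y"
          using True unfolding step_density_def G_def c by (simp add: mult.commute[of h])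
      qed
      finally show ?thesis .
    qed (auto simp: step_density_def G_def)
  qed
  also have "\<dots> = (\<integral>\<^sup>+h. \<integral>\<^sup>+Y. G h Y \<partial>lborel \<partial>lborel)"
    by (rule lborel_pair.Fubini'[symmetric]) measurable
  also have "\<dots> \<le> (\<integral>\<^sup>+h. indicator {0<..1 / real n} h \<partial>lborel)"
  proof (intro nn_integral_mono)
    fix h :: real
    show "(\<integral>\<^sup>+Y. G h Y \<partial>lborel) \<le> indicator {0<..1 / real n} h"
    proof (cases "h \<in> {0<..1 / real n}")
      case True
      then have "(\<integral>\<^sup>+Y\<in>\<DD> (real k * h). young p (ennreal (\<bar>\<W> (real k * h) Y ^ r * fdiff k (h * \<phi> Y) F (Y - real k * (h * \<phi> Y) / 2)\<bar> / A)) \<partial>lborel) \<le> 1"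
        by (intro mod) auto
      moreover have "(\<integral>\<^sup>+Y. G h Y \<partial>lborel) \<le> (\<integral>\<^sup>+Y\<in>\<DD> (real k * h). young p (ennreal (\<bar>\<W> (real k * h) Y ^ r * fdiff k (h * \<phi> Y) F (Y - real k * (h * \<phi> Y) / 2)\<bar> / A)) \<partial>lborel)"
        by (intro nn_integral_mono) (auto simp: G_def step_young_def \<DD>_def \<W>_def mult.assoc)
      ultimately show ?thesis using True by simp
    qed (auto simp: G_def)
  qed
  also have "\<dots> = ennreal (1 / real n)" by simp
  finally show "(\<integral>\<^sup>+y. \<integral>\<^sup>+s'. ?V (y + real k * s' / 2) s' \<partial>lborel \<partial>lborel) \<le> ennreal (1 / real n)" .
qed

lemma sin_diff_le:
  fixes a b :: real
  shows "sin a - sin b \<le> \<bar>a - b\<bar>"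
proof -
  have "\<bar>sin a - sin b\<bar> = 2 * (\<bar>sin ((a - b) / 2)\<bar> * \<bar>cos ((a + b) / 2)\<bar>)"
    unfolding sin_diff_sin by (simp add: abs_mult)
  also have "\<dots> \<le> 2 * (\<bar>(a - b) / 2\<bar> * 1)"
    by (intro mult_left_mono mult_mono abs_sin_x_le_abs_x) auto
  finally show ?thesis by simp
qed

lemma sqrt_one_minus_cos:
  assumes "0 \<le> a" "a \<le> 2 * pi"
  shows "sqrt (1 + (- cos a)) = sqrt 2 * sin (a / 2)"
proof -
  have "1 + (- cos a) = 2 * (sin (a / 2))\<^sup>2" using cos_double_sin[of "a / 2"] by simp
  moreover have "0 \<le> sin (a / 2)" using assms by (intro sin_ge_zero) auto
  ultimately show ?thesis by (simp add: real_sqrt_mult)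
qed

text \<open>All that is used of \<open>F\<close> being the derivative of order \<open>r\<close>;
  unlike derivatives, it is insensitive to null sets and easy to reflect. For \<open>r = 0\<close>
  it says nothing, and \<open>f = F\<close> is assumed instead.\<close>

definition taylor_form :: "nat \<Rightarrow> (real \<Rightarrow> real) \<Rightarrow> (real \<Rightarrow> real) \<Rightarrow> bool" where
  "taylor_form r F f \<longleftrightarrow> (\<forall>m u. r = Suc m \<longrightarrow> -1 < u \<longrightarrow> u < 1 \<longrightarrow> (\<exists>T::real poly. degree T \<le> m \<and> (\<forall>x. -1 < x \<longrightarrow> x \<le> u \<longrightarrow>
     f x = poly T x + (-1) ^ Suc m / fact m * (\<integral>t. indicator {x<..u} t * (F t * (t - x) ^ m) \<partial>lborel))))"

text \<open>As \<open>0 - 1 = 0\<close> for natural numbers, the interval with number \<open>0\<close> starts at \<open>-1\<close>. The factor \<open>\<sigma>\<close>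
  in the proof scales all steps simultaneously: local approximation bounds some terms by differences with
  one fixed step, and a suitable \<open>\<sigma> \<in> [1,2]\<close> makes these at most their averages over \<open>\<sigma>\<close>.\<close>

theorem half_approx:
  fixes k r K :: nat
  assumes k: "1 \<le> k" and K: "1 \<le> K"
  obtains C :: real where "1 \<le> C"
    "\<And>p \<nu> n F f A. 1 \<le> p \<Longrightarrow> 1 \<le> \<nu> \<Longrightarrow> \<nu> \<le> n \<Longrightarrow> n \<le> K * \<nu> \<Longrightarrow> locint F \<Longrightarrow> f \<in> borel_measurable borel \<Longrightarrow> (r = 0 \<Longrightarrow> f = F) \<Longrightarrow>
      taylor_form r F f \<Longrightarrow> 0 < A \<Longrightarrow>
      (\<And>h. 0 < h \<Longrightarrow> h \<le> 1 / real n \<Longrightarrow>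
        (\<integral>\<^sup>+Y\<in>\<DD> (real k * h). young p (ennreal (\<bar>\<W> (real k * h) Y ^ r * fdiff k (h * \<phi> Y) F (Y - real k * (h * \<phi> Y) / 2)\<bar> / A)) \<partial>lborel) \<le> 1) \<Longrightarrow>
      \<exists>P::nat \<Rightarrow> real poly. (\<forall>j. degree (P j) < k + r) \<and>
        (\<Sum>j<3 * \<nu> + 1. \<integral>\<^sup>+x\<in>{- cos (real (j - 1) * (pi / (6 * real \<nu>)))<..- cos ((real j + 1) * (pi / (6 * real \<nu>)))}.
            young p (ennreal (\<bar>f x - poly (P j) x\<bar> / (C / real n ^ r * A))) \<partial>lborel) \<le> ennreal C"
proof -
  \<comment> \<open>The relative size of the steps. In \<open>step_geometry\<close> the case near
    \<open>-1\<close> turns \<open>8 * k * \<epsilon> * K^2\<close> into \<open>1 / (8 * k)\<close>,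
    and \<open>k^2 * \<epsilon> \<le> 1 / 64\<close> keeps whole stencils short compared with
    \<open>\<beta> * w\<close>.\<close>
  define \<epsilon> where "\<epsilon> = 1 / (64 * (real k)\<^sup>2 * (real K)\<^sup>2)"
  have \<epsilon>: "0 < \<epsilon>" using k K by (simp add: \<epsilon>_def)
  have k\<epsilon>: "(real k)\<^sup>2 * \<epsilon> \<le> 1 / 64"
  proof -
    have "1 \<le> (real K)\<^sup>2" using K by simp
    then show ?thesis unfolding \<epsilon>_def using k by (simp add: divide_simps)
  qed
  have \<epsilon>1: "\<epsilon> \<le> 1"
  proof -
    have "1 * \<epsilon> \<le> (real k)\<^sup>2 * \<epsilon>" using k \<epsilon> by (intro mult_right_mono) auto
    then show ?thesis using k\<epsilon> by simp
  qed
  \<comment> \<open>An interval has length at most \<open>4 * \<beta> * w\<close>, which is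
    \<open>\<Lambda>\<close> times the basic step \<open>\<epsilon> * \<beta> * w\<close>.\<close>
  define \<Lambda> where "\<Lambda> = 4 / \<epsilon>"
  have \<Lambda>: "1 \<le> \<Lambda>" using \<epsilon> \<epsilon>1 by (simp add: \<Lambda>_def le_divide_eq)
  define CW where "CW = 2 ^ (k + 1) * (real k * \<Lambda>) ^ (k + 1)"
  have CW: "0 < CW" using k \<Lambda> by (simp add: CW_def)
  \<comment> \<open>The product of the overlap 2, the density factor
    \<open>4 * n / \<epsilon>\<close> and the bound \<open>1 / n\<close> from
    \<open>change_of_step\<close>.\<close>
  define T0 where "T0 = 8 / \<epsilon>"
  have T0: "0 < T0" using \<epsilon> by (simp add: T0_def)
  define C where "C = 1 + (8 * real K) ^ r * CW + T0 + real k * T0 + 1"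
  have C: "1 \<le> C" "(8 * real K) ^ r * CW \<le> C" "T0 + (real k * T0 + 1) \<le> C"
    using T0 CW by (auto simp: C_def intro!: add_nonneg_nonneg mult_nonneg_nonneg)
  show thesis
  proof (rule that[OF C(1)])
    fix p :: ennreal and \<nu> n :: nat and F f :: "real \<Rightarrow> real" and A :: real
    assume p: "1 \<le> p" and \<nu>: "1 \<le> \<nu>" and n: "\<nu> \<le> n" "n \<le> K * \<nu>" and F: "locint F"
      and f[measurable]: "f \<in> borel_measurable borel" and f0: "r = 0 \<Longrightarrow> f = F"
      and tf: "taylor_form r F f" and A: "0 < A"
      and mod: "\<And>h. 0 < h \<Longrightarrow> h \<le> 1 / real n \<Longrightarrow>
        (\<integral>\<^sup>+Y\<in>\<DD> (real k * h). young p (ennreal (\<bar>\<W> (real k * h) Y ^ r * fdiff k (h * \<phi> Y) F (Y - real k * (h * \<phi> Y) / 2)\<bar> / A)) \<partial>lborel) \<le> 1"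
    have [measurable]: "F \<in> borel_measurable borel" using F by (simp add: locint_def)
    have fr: "\<exists>T::real poly. degree T \<le> m \<and> (\<forall>x. -1 < x \<longrightarrow> x \<le> u \<longrightarrow>
        f x = poly T x + (-1) ^ Suc m / fact m * (\<integral>t. indicator {x<..u} t * (F t * (t - x) ^ m) \<partial>lborel))"
      if "r = Suc m" "-1 < u" "u < 1" for m u
      using tf that unfolding taylor_form_def by blast
    define \<beta> where "\<beta> = pi / (6 * real \<nu>)"
    have \<beta>: "0 < \<beta>" "6 * real \<nu> * \<beta> = pi" using \<nu> by (auto simp: \<beta>_def)
    have pi32: "pi \<le> 3.2" using pi_approx by simp
    have \<beta>6: "\<beta> \<le> pi / 6"
    proof -
      have "6 * \<beta> * 1 \<le> 6 * \<beta> * real \<nu>" using \<nu> \<beta> by (intro mult_left_mono) auto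
      then show ?thesis using \<beta>(2) by (simp add: ac_simps)
    qed
    have n0: "0 < real n" "1 \<le> n" using n \<nu> by auto
    have n\<beta>: "real n * \<beta> \<le> real K" "1 \<le> 2 * (real n * \<beta>)"
    proof -
      have "real n * \<beta> \<le> (real K * real \<nu>) * \<beta>" using n(2) \<beta> by (intro mult_right_mono) (auto simp flip: of_nat_mult)
      also have "\<dots> = real K * (pi / 6)" using \<nu> by (simp add: \<beta>_def)
      also have "\<dots> \<le> real K * 1" using pi32 by (intro mult_left_mono) auto
      finally show "real n * \<beta> \<le> real K" by simp
      have "real \<nu> * \<beta> \<le> real n * \<beta>" using n \<beta> by (intro mult_right_mono) auto
      then show "1 \<le> 2 * (real n * \<beta>)" using \<beta>(2) pi_gt3 by simp
    qed
    \<comment> \<open>The pieces run one mesh width beyond the midpoint, up to the angle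
      \<open>pi / 2 + \<beta> \<le> 2 * pi / 3\<close>; hence all right ends are at most
      \<open>1 / 2\<close>, and the two halves can be joined with an overlap.\<close>
    define N where "N = 3 * \<nu> + 1"
    define X where "X i = - cos (real i * \<beta>)" for i :: nat
    define l where "l j = X (j - 1)" for j
    define u where "u j = X (Suc j)" for j
    define w where "w j = sqrt (1 + u j)" for j
    have ang: "real i * \<beta> \<le> 2 * pi / 3" "real i * \<beta> \<le> pi" "real i * \<beta> \<le> 2 * pi" if "i \<le> Suc (3 * \<nu>)" for i
    proof -
      have "real i * \<beta> \<le> (3 * real \<nu> + 1) * \<beta>" using that \<beta> by (intro mult_right_mono) auto
      also have "\<dots> = pi / 2 + \<beta>" using \<beta>(2) by (simp add: algebra_simps)
      also have "\<dots> \<le> 2 * pi / 3" using \<beta>6 by simp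
      finally show "real i * \<beta> \<le> 2 * pi / 3" .
      then show "real i * \<beta> \<le> pi" "real i * \<beta> \<le> 2 * pi" using pi_gt_zero by linarith+
    qed
    have Xmono: "X i \<le> X j" if "i \<le> j" "j \<le> Suc (3 * \<nu>)" for i j
    proof -
      have "real i * \<beta> \<le> real j * \<beta>" using that \<beta> by (intro mult_right_mono) auto
      then have "cos (real j * \<beta>) \<le> cos (real i * \<beta>)" using ang(2)[OF that(2)] \<beta> by (intro cos_monotone_0_pi_le) auto
      then show ?thesis by (simp add: X_def)
    qed
    have Xstrict: "X i < X j" if "i < j" "j \<le> Suc (3 * \<nu>)" for i j
    proof -
      have "real i * \<beta> < real j * \<beta>" using that \<beta> by (intro mult_strict_right_mono) auto
      then have "cos (real j * \<beta>) < cos (real i * \<beta>)" using ang(2)[OF that(2)] \<beta> by (intro cos_monotone_0_pi) auto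
      then show ?thesis by (simp add: X_def)
    qed
    have Xm1: "-1 \<le> X i" for i by (simp add: X_def)
    have uhalf: "u j \<le> 1 / 2" if "j < N" for j
    proof -
      have "cos (2 * pi / 3) = - (1 / 2 :: real)"
      proof -
        have "cos (2 * pi / 3) = cos (pi - pi / 3)" by (rule arg_cong[of _ _ cos]) simp
        also have "\<dots> = - (1 / 2)" by (simp only: cos_pi_minus cos_60)
        finally show ?thesis .
      qed
      moreover have "cos (2 * pi / 3) \<le> cos (real (Suc j) * \<beta>)"
        using that ang[of "Suc j"] \<beta> by (intro cos_monotone_0_pi_le) (auto simp: N_def)
      ultimately show ?thesis by (simp add: u_def X_def)
    qed
    have lu: "l j < u j" "-1 \<le> l j" if "j < N" for j
      using that Xm1 by (auto simp: l_def u_def N_def intro!: Xstrict)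
    have wsin: "sqrt (1 + X i) = sqrt 2 * sin (real i * \<beta> / 2)" if "i \<le> Suc (3 * \<nu>)" for i
      unfolding X_def by (subst sqrt_one_minus_cos[OF _ ang(3)[OF that]]) (use \<beta> in auto)
    have sq2: "sqrt 2 \<le> 2" "1.4 \<le> sqrt 2" by (rule real_le_lsqrt real_le_rsqrt; simp add: power2_eq_square)+
    have wl: "w j - sqrt (1 + l j) \<le> 2 * \<beta>" if "j < N" for j
    proof -
      have "w j - sqrt (1 + l j) = sqrt 2 * (sin (real (Suc j) * \<beta> / 2) - sin (real (j - 1) * \<beta> / 2))"
        using that wsin[of "Suc j"] wsin[of "j - 1"] unfolding w_def u_def l_def by (simp add: N_def right_diff_distrib)
      also have "\<dots> \<le> sqrt 2 * \<bar>real (Suc j) * \<beta> / 2 - real (j - 1) * \<beta> / 2\<bar>" by (intro mult_left_mono sin_diff_le) auto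
      also have "\<dots> \<le> 2 * \<beta>"
      proof -
        have "real (Suc j) * \<beta> / 2 - real (j - 1) * \<beta> / 2 = (real (Suc j) - real (j - 1)) * (\<beta> / 2)" by (simp add: left_diff_distrib)
        then have "\<bar>real (Suc j) * \<beta> / 2 - real (j - 1) * \<beta> / 2\<bar> \<le> 2 * (\<beta> / 2)"
          using \<beta> by (simp only: abs_mult) (intro mult_mono, auto)
        then have "sqrt 2 * \<bar>real (Suc j) * \<beta> / 2 - real (j - 1) * \<beta> / 2\<bar> \<le> 2 * \<beta>"
          using sq2 \<beta> by (intro mult_mono) auto
        then show ?thesis .
      qed
      finally show ?thesis .
    qed
    have w\<beta>: "\<beta> \<le> 3 * w j" if "j < N" for j
    proof -
      have "2 * (\<beta> / 2) / pi \<le> 2 * (real (Suc j) * \<beta> / 2) / pi" using \<beta> by (intro divide_right_mono mult_left_mono) auto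
      also have "\<dots> \<le> sin (real (Suc j) * \<beta> / 2)"
        using ang(2)[of "Suc j"] that \<beta> by (intro sin_ge_chord) (auto simp: N_def)
      finally have "\<beta> / pi \<le> sin (real (Suc j) * \<beta> / 2)" by simp
      then have "1.4 * (\<beta> / pi) \<le> sqrt 2 * sin (real (Suc j) * \<beta> / 2)" using sq2 \<beta> by (intro mult_mono) auto
      also have "\<dots> = w j" using that wsin[of "Suc j"] unfolding w_def u_def by (simp add: N_def)
      finally have "1.4 * (\<beta> / pi) \<le> w j" .
      moreover have "\<beta> / 3.2 \<le> \<beta> / pi" using pi32 \<beta> by (intro divide_left_mono) auto
      ultimately show ?thesis using \<beta> by simp
    qed
    have wpos: "0 < w j" if "j < N" for j using w\<beta>[OF that] \<beta> by simp
    have w54: "w j \<le> 5 / 4" if "j < N" for j unfolding w_def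
      using uhalf[OF that] by (intro real_le_lsqrt) (auto simp: power2_eq_square)
    have \<beta>54: "\<beta> \<le> 0.54" using \<beta>6 pi32 by simp
    define s0 where "s0 j = \<epsilon> * \<beta> * w j" for j
    have s0: "0 < s0 j" if "j < N" for j using \<epsilon> \<beta> wpos[OF that] by (simp add: s0_def)
    \<comment> \<open>Up to the factor 2, \<open>sqrt (1 + y)\<close> is bounded by the weight of
      the modulus: its factor at the right end of the stencil is at least \<open>1 / 4\<close>, and
      the one at the left end is exactly \<open>1 + y\<close>.\<close>
    define A1 where "A1 = 2 ^ r * A"
    have A1: "0 < A1" using A by (simp add: A1_def)
    define Y where "Y x s' = young p (ennreal (sqrt (1 + x) ^ r * \<bar>fdiff k s' F x\<bar> / A1))" for x s'
    have mY[measurable (raw)]: "(\<lambda>v. Y (e v) (h v)) \<in> borel_measurable M" if [measurable]: "e \<in> borel_measurable M" "h \<in> borel_measurable M" for e h and M :: "real measure"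
      unfolding Y_def by measurable
    have mY2[measurable (raw)]: "(\<lambda>v. Y (e v) (h v)) \<in> borel_measurable M" if [measurable]: "e \<in> borel_measurable M" "h \<in> borel_measurable M" for e h and M :: "(real \<times> real) measure"
      unfolding Y_def by measurable
    let ?V = "step_density p k r n F A"
    define J where "J j = {l j<..u j}" for j
    have [measurable]: "J j \<in> sets borel" for j by (simp add: J_def)
    \<comment> \<open>The range of \<open>v\<close> up to \<open>2 * k\<close>, twice what local
      approximation asks for, leaves room for the scaling by \<open>\<sigma>\<close> in
      \<open>[1,2]\<close>.\<close>
    define I1 where "I1 j = (\<integral>\<^sup>+y\<in>J j. (\<integral>\<^sup>+v\<in>{0<..2 * real k}. Y y (s0 j * v) \<partial>lborel) \<partial>lborel)" for j
    \<comment> \<open>The density is inserted at the price of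
      \<open>1 \<le> s0 j * (4 * n / \<epsilon>) / \<phi> Y\<close>, where
      \<open>\<phi> Y \<le> 2 * w\<close> and \<open>1 \<le> 2 * n * \<beta>\<close>. The factor
      \<open>s0 j\<close> is then the Jacobian of \<open>s' = s0 j * v\<close>.\<close>
    have Yle: "Y y (s0 j * v) \<le> ennreal (s0 j) * (ennreal (4 * real n / \<epsilon>) * ?V (y + real k * (s0 j * v) / 2) (s0 j * v))"
      if j: "j < N" and y: "y \<in> J j" and v: "v \<in> {0<..2 * real k}" for j y v
    proof -
      define s' where "s' = s0 j * v"
      define Yc where "Yc = y + real k * s' / 2"
      have s': "0 < s'" "s' \<le> 2 * real k * (\<epsilon> * \<beta> * w j)"
        using v s0[OF j] unfolding s'_def s0_def[symmetric] by (auto simp: mult.commute intro: mult_left_mono)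
      note geo = step_geometry[OF k K \<epsilon>_def \<beta>(1) \<beta>54 w_def w\<beta>[OF j] uhalf[OF j] wl[OF j, unfolded w_def] lu(2)[OF j] _ _ n0(1) n\<beta>(1) s' Yc_def]
      have yj: "l j < y" "y \<le> u j" using y by (auto simp: J_def)
      note geo = geo[OF yj]
      have ks: "0 < real k * s'" using k s' by simp
      have Y1: "Yc < 1" using geo(2) ks by linarith
      have ph: "0 < \<phi> Yc" using geo(1) Y1 by (intro phi_pos) auto
      have yYc: "Yc - real k * s' / 2 = y" by (simp add: Yc_def)
      have dom: "\<bar>Yc\<bar> \<le> 1 - real k * s' / 2"
        using geo(2) lu(2)[OF j] yj unfolding Yc_def abs_le_iff by linarith
      have V: "?V Yc s' = ennreal (1 / \<phi> Yc) * step_young p k r F A Yc s'"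
        unfolding step_density_def using geo Y1 s' dom by simp
      have "Y y s' \<le> step_young p k r F A Yc s'"
        unfolding Y_def step_young_def yYc
      proof (intro young_mono ennreal_leI)
        have y1: "0 < 1 + y" using yj lu(2)[OF j] by simp
        have "(1 + y) / 4 \<le> (1 - Yc - real k * s' / 2) * (1 + Yc - real k * s' / 2)"
        proof -
          have "1 / 4 * (1 + y) \<le> (1 - Yc - real k * s' / 2) * (1 + y)"
            using geo(2) y1 by (intro mult_right_mono) auto
          moreover have "1 + Yc - real k * s' / 2 = 1 + y" by (simp add: Yc_def)
          ultimately show ?thesis by (simp only:)
        qed
        then have "sqrt ((1 + y) / 4) \<le> sqrt ((1 - Yc - real k * s' / 2) * (1 + Yc - real k * s' / 2))" by simp
        then have "sqrt (1 + y) / 2 \<le> sqrt ((1 - Yc - real k * s' / 2) * (1 + Yc - real k * s' / 2))" by (simp add: real_sqrt_divide)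
        then have "(sqrt (1 + y) / 2) ^ r \<le> sqrt ((1 - Yc - real k * s' / 2) * (1 + Yc - real k * s' / 2)) ^ r"
          using y1 by (intro power_mono) auto
        then have *: "(sqrt (1 + y) / 2) ^ r * \<bar>fdiff k s' F y\<bar> / A \<le> sqrt ((1 - Yc - real k * s' / 2) * (1 + Yc - real k * s' / 2)) ^ r * \<bar>fdiff k s' F y\<bar> / A"
          using A by (intro divide_right_mono mult_right_mono) auto
        have "sqrt (1 + y) ^ r * \<bar>fdiff k s' F y\<bar> / A1 = (sqrt (1 + y) / 2) ^ r * \<bar>fdiff k s' F y\<bar> / A"
          by (simp add: A1_def power_divide)
        also note *
        also have "sqrt ((1 - Yc - real k * s' / 2) * (1 + Yc - real k * s' / 2)) ^ r * \<bar>fdiff k s' F y\<bar> \<le> \<bar>sqrt ((1 - Yc - real k * s' / 2) * (1 + Yc - real k * s' / 2)) ^ r * fdiff k s' F y\<bar>"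
          by (simp add: abs_mult mult_right_mono)
        finally show "sqrt (1 + y) ^ r * \<bar>fdiff k s' F y\<bar> / A1 \<le> \<bar>sqrt ((1 - Yc - real k * s' / 2) * (1 + Yc - real k * s' / 2)) ^ r * fdiff k s' F y\<bar> / A"
          using A by (simp add: divide_right_mono)
      qed
      also have "\<dots> = 1 * step_young p k r F A Yc s'" by simp
      also have "\<dots> \<le> ennreal (s0 j * (4 * real n / \<epsilon>) * (1 / \<phi> Yc)) * step_young p k r F A Yc s'"
      proof (intro mult_right_mono)
        have "1 * (2 * w j) \<le> 2 * (real n * \<beta>) * (2 * w j)" using n\<beta>(2) wpos[OF j] by (intro mult_right_mono) auto
        also have "2 * (real n * \<beta>) * (2 * w j) = s0 j * (4 * real n / \<epsilon>)" using \<epsilon> by (simp add: s0_def)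
        finally have "2 * w j \<le> s0 j * (4 * real n / \<epsilon>)" by simp
        then have "\<phi> Yc \<le> s0 j * (4 * real n / \<epsilon>)" using geo(4) by linarith
        then have "\<phi> Yc * (1 / \<phi> Yc) \<le> s0 j * (4 * real n / \<epsilon>) * (1 / \<phi> Yc)" using ph by (intro mult_right_mono) auto
        then have "1 \<le> s0 j * (4 * real n / \<epsilon>) * (1 / \<phi> Yc)" using ph by simp
        then have "ennreal 1 \<le> ennreal (s0 j * (4 * real n / \<epsilon>) * (1 / \<phi> Yc))" by (rule ennreal_leI)
        then show "1 \<le> ennreal (s0 j * (4 * real n / \<epsilon>) * (1 / \<phi> Yc))" by simp
      qed auto
      also have "ennreal (s0 j * (4 * real n / \<epsilon>) * (1 / \<phi> Yc)) = ennreal (s0 j) * ennreal (4 * real n / \<epsilon>) * ennreal (1 / \<phi> Yc)"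
        using s0[OF j] \<epsilon> ph by (subst ennreal_mult, simp, simp, subst ennreal_mult) auto
      finally show ?thesis unfolding s'_def[symmetric] Yc_def[symmetric] V by (simp only: mult.assoc)
    qed
    \<comment> \<open>Each \<open>J j\<close> consists of two adjacent pieces, and the left pieces
      as well as the right pieces are pairwise disjoint; for \<open>j = 0\<close> the left piece is
      empty.\<close>
    have overlap: "(\<Sum>j<N. indicator (J j) y) \<le> (2 :: ennreal)" for y
    proof -
      have "(\<Sum>j<N. indicator (J j) y) \<le> (\<Sum>j<N. indicator {X (j - 1)<..X j} y + (indicator {X j<..X (Suc j)} y :: ennreal))"
        by (intro sum_mono) (auto simp: J_def l_def u_def indicator_def)
      also have "\<dots> = (\<Sum>j<N. indicator {X (j - 1)<..X j} y) + (\<Sum>j<N. indicator {X j<..X (Suc j)} y)" by (rule sum.distrib)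
      also have "(\<Sum>j<N. indicator {X j<..X (Suc j)} y) = (indicator {X 0<..X N} y :: ennreal)"
        using Xmono by (intro sum_indicator_consecutive) (auto simp: N_def)
      also have "(\<Sum>j<N. indicator {X (j - 1)<..X j} y) = (\<Sum>j<3 * \<nu>. (indicator {X j<..X (Suc j)} y :: ennreal))"
        unfolding N_def Suc_eq_plus1[symmetric] sum.lessThan_Suc_shift by simp
      also have "\<dots> = indicator {X 0<..X (3 * \<nu>)} y"
        using Xmono by (intro sum_indicator_consecutive) auto
      also have "indicator {X 0<..X (3 * \<nu>)} y + indicator {X 0<..X N} y \<le> (1 + 1 :: ennreal)" by (intro add_mono) (auto simp: indicator_def)
      finally show ?thesis by simp
    qed
    have I1sum: "(\<Sum>j<N. I1 j) \<le> ennreal T0"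
    proof -
      define c where "c = ennreal (4 * real n / \<epsilon>)"
      define W where "W y = (\<integral>\<^sup>+s'. ?V (y + real k * s' / 2) s' \<partial>lborel)" for y
      have [measurable]: "W \<in> borel_measurable borel" unfolding W_def by measurable
      have "I1 j \<le> (\<integral>\<^sup>+y. c * (W y * indicator (J j) y) \<partial>lborel)" if j: "j < N" for j
        unfolding I1_def
      proof (intro nn_integral_mono)
        fix y
        show "(\<integral>\<^sup>+v\<in>{0<..2 * real k}. Y y (s0 j * v) \<partial>lborel) * indicator (J j) y \<le> c * (W y * indicator (J j) y)"
        proof (cases "y \<in> J j")
          case True
          have "(\<integral>\<^sup>+v\<in>{0<..2 * real k}. Y y (s0 j * v) \<partial>lborel) \<le> (\<integral>\<^sup>+v. ennreal (s0 j) * (c * ?V (y + real k * (s0 j * v) / 2) (s0 j * v)) \<partial>lborel)"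
          proof (intro nn_integral_mono)
            fix v
            show "Y y (s0 j * v) * indicator {0<..2 * real k} v \<le> ennreal (s0 j) * (c * ?V (y + real k * (s0 j * v) / 2) (s0 j * v))"
              using Yle[OF j True, of v] by (cases "v \<in> {0<..2 * real k}") (auto simp: c_def)
          qed
          also have "\<dots> = ennreal (s0 j) * (\<integral>\<^sup>+v. c * ?V (y + real k * (s0 j * v) / 2) (s0 j * v) \<partial>lborel)"
            by (intro nn_integral_cmult) measurable
          also have "\<dots> = (\<integral>\<^sup>+s'. c * ?V (y + real k * s' / 2) s' \<partial>lborel)"
            using nn_integral_real_affine[of "\<lambda>s'. c * ?V (y + real k * s' / 2) s'" "s0 j" 0] s0[OF j] by simp
          also have "\<dots> = c * W y" unfolding W_def by (intro nn_integral_cmult) measurable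
          finally show ?thesis using True by simp
        qed simp
      qed
      then have "(\<Sum>j<N. I1 j) \<le> (\<Sum>j<N. \<integral>\<^sup>+y. c * (W y * indicator (J j) y) \<partial>lborel)" by (intro sum_mono) auto
      also have "\<dots> = (\<integral>\<^sup>+y. (\<Sum>j<N. c * (W y * indicator (J j) y)) \<partial>lborel)" by (intro nn_integral_sum[symmetric]) measurable
      also have "\<dots> \<le> (\<integral>\<^sup>+y. (2 * c) * W y \<partial>lborel)"
      proof (intro nn_integral_mono)
        fix y
        have "(\<Sum>j<N. c * (W y * indicator (J j) y)) = c * W y * (\<Sum>j<N. indicator (J j) y)" by (simp add: sum_distrib_left mult.assoc)
        also have "\<dots> \<le> c * W y * 2" by (intro mult_left_mono overlap) auto
        finally show "(\<Sum>j<N. c * (W y * indicator (J j) y)) \<le> (2 * c) * W y" by (simp add: ac_simps)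
      qed
      also have "\<dots> = (2 * c) * (\<integral>\<^sup>+y. W y \<partial>lborel)" by (intro nn_integral_cmult) measurable
      also have "\<dots> \<le> (2 * c) * ennreal (1 / real n)" unfolding W_def
        by (intro mult_left_mono change_of_step[OF k n0(2) _ mod]) auto
      also have "\<dots> = ennreal T0"
      proof -
        have "2 * c = ennreal (2 * (4 * real n / \<epsilon>))" unfolding c_def using \<epsilon> by (subst ennreal_mult) auto
        then have "(2 * c) * ennreal (1 / real n) = ennreal (2 * (4 * real n / \<epsilon>) * (1 / real n))" using \<epsilon> by (simp only: ) (intro ennreal_mult[symmetric], auto)
        also have "2 * (4 * real n / \<epsilon>) * (1 / real n) = T0" using n0 by (simp add: T0_def)
        finally show ?thesis .
      qed
      finally show ?thesis .
    qed
    define S1 where "S1 \<sigma> j = (\<integral>\<^sup>+x\<in>J j. (\<integral>\<^sup>+v\<in>{0<..real k}. Y x (\<sigma> * s0 j * v) \<partial>lborel) \<partial>lborel)" for \<sigma> j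
    define S2 where "S2 \<sigma> j i = (\<integral>\<^sup>+x\<in>J j. Y x (real i * (\<sigma> * s0 j)) \<partial>lborel)" for \<sigma> j i
    have S1: "S1 \<sigma> j \<le> I1 j" if \<sigma>: "\<sigma> \<in> {1..2}" for \<sigma> j
      unfolding S1_def I1_def
    proof (rule nn_integral_mono, rule mult_right_mono)
      fix x
      have "(\<integral>\<^sup>+v\<in>{0<..2 * real k}. Y x (s0 j * v) \<partial>lborel) = ennreal \<sigma> * (\<integral>\<^sup>+v. Y x (s0 j * (\<sigma> * v)) * indicator {0<..2 * real k} (\<sigma> * v) \<partial>lborel)"
        using nn_integral_real_affine[of "\<lambda>v. Y x (s0 j * v) * indicator {0<..2 * real k} v" \<sigma> 0] \<sigma> by simp
      also have "\<dots> \<ge> 1 * (\<integral>\<^sup>+v\<in>{0<..real k}. Y x (\<sigma> * s0 j * v) \<partial>lborel)"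
      proof (rule mult_mono[OF _ nn_integral_mono])
        show "1 \<le> ennreal \<sigma>" using \<sigma> ennreal_leI[of 1 \<sigma>] by simp
        fix v
        show "Y x (\<sigma> * s0 j * v) * indicator {0<..real k} v \<le> Y x (s0 j * (\<sigma> * v)) * indicator {0<..2 * real k} (\<sigma> * v)"
        proof (cases "v \<in> {0<..real k}")
          case True
          then have "\<sigma> * v \<in> {0<..2 * real k}" using \<sigma> by (auto intro: mult_mono)
          then show ?thesis using True by (simp add: ac_simps)
        qed simp
      qed auto
      finally show "(\<integral>\<^sup>+v\<in>{0<..real k}. Y x (\<sigma> * s0 j * v) \<partial>lborel) \<le> (\<integral>\<^sup>+v\<in>{0<..2 * real k}. Y x (s0 j * v) \<partial>lborel)" by simp
    qed auto
    \<comment> \<open>For fixed \<open>x\<close> the steps \<open>i * \<sigma> * s0 j\<close> are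
      values of \<open>s0 j * v\<close> at \<open>v = i * \<sigma>\<close>, which lies in
      \<open>(0, 2 k]\<close>; the factor \<open>i \<ge> 1\<close> of this substitution
      helps.\<close>
    have S2: "(\<integral>\<^sup>+\<sigma>\<in>{1..2}. S2 \<sigma> j i \<partial>lborel) \<le> I1 j" if i: "i \<in> {1..k}" for j i
    proof -
      have "(\<integral>\<^sup>+\<sigma>\<in>{1..2}. S2 \<sigma> j i \<partial>lborel) = (\<integral>\<^sup>+\<sigma>. \<integral>\<^sup>+x. indicator {1..2} \<sigma> * (Y x (real i * (\<sigma> * s0 j)) * indicator (J j) x) \<partial>lborel \<partial>lborel)"
        unfolding S2_def by (intro nn_integral_cong) (subst nn_integral_cmult, measurable, simp add: mult.commute)
      also have "\<dots> = (\<integral>\<^sup>+x. \<integral>\<^sup>+\<sigma>. indicator {1..2} \<sigma> * (Y x (real i * (\<sigma> * s0 j)) * indicator (J j) x) \<partial>lborel \<partial>lborel)"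
        by (rule lborel_pair.Fubini'[symmetric]) measurable
      also have "\<dots> \<le> I1 j" unfolding I1_def
      proof (intro nn_integral_mono)
        fix x
        have "(\<integral>\<^sup>+\<sigma>. indicator {1..2} \<sigma> * Y x (real i * (\<sigma> * s0 j)) \<partial>lborel) \<le> (\<integral>\<^sup>+v\<in>{0<..2 * real k}. Y x (s0 j * v) \<partial>lborel)"
        proof -
          have "(\<integral>\<^sup>+v\<in>{0<..2 * real k}. Y x (s0 j * v) \<partial>lborel) = ennreal (real i) * (\<integral>\<^sup>+\<sigma>. Y x (s0 j * (real i * \<sigma>)) * indicator {0<..2 * real k} (real i * \<sigma>) \<partial>lborel)"
            using nn_integral_real_affine[of "\<lambda>v. Y x (s0 j * v) * indicator {0<..2 * real k} v" "real i" 0] i by simp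
          also have "\<dots> \<ge> 1 * (\<integral>\<^sup>+\<sigma>. indicator {1..2} \<sigma> * Y x (real i * (\<sigma> * s0 j)) \<partial>lborel)"
          proof (rule mult_mono[OF _ nn_integral_mono])
            show "1 \<le> ennreal (real i)" using i ennreal_leI[of 1 "real i"] by simp
            fix \<sigma> :: real
            show "indicator {1..2} \<sigma> * Y x (real i * (\<sigma> * s0 j)) \<le> Y x (s0 j * (real i * \<sigma>)) * indicator {0<..2 * real k} (real i * \<sigma>)"
            proof (cases "\<sigma> \<in> {1..2}")
              case True
              have "real i * \<sigma> \<le> real k * 2" using True i by (intro mult_mono) auto
              moreover have "0 < real i * \<sigma>" using True i by simp
              ultimately have "real i * \<sigma> \<in> {0<..2 * real k}" by simp
              then show ?thesis using True by (simp add: ac_simps)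
            qed simp
          qed auto
          finally show ?thesis by simp
        qed
        then have "(\<integral>\<^sup>+\<sigma>. indicator {1..2} \<sigma> * Y x (real i * (\<sigma> * s0 j)) \<partial>lborel) * indicator (J j) x \<le> (\<integral>\<^sup>+v\<in>{0<..2 * real k}. Y x (s0 j * v) \<partial>lborel) * indicator (J j) x"
          by (intro mult_right_mono) auto
        then show "(\<integral>\<^sup>+\<sigma>. indicator {1..2} \<sigma> * (Y x (real i * (\<sigma> * s0 j)) * indicator (J j) x) \<partial>lborel) \<le> (\<integral>\<^sup>+v\<in>{0<..2 * real k}. Y x (s0 j * v) \<partial>lborel) * indicator (J j) x"
          by (cases "x \<in> J j") auto
      qed
      finally show ?thesis .
    qed
    \<comment> \<open>On the interval \<open>[1,2]\<close> of length 1 some value does not exceed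
      the average. The summand 1 makes the contradiction strict.\<close>
    have "\<exists>\<sigma>\<in>{1..2}. (\<Sum>j<N. \<Sum>i\<in>{1..k}. S2 \<sigma> j i) \<le> ennreal (real k * T0 + 1)"
    proof (rule ccontr)
      assume "\<not> ?thesis"
      then have gt: "ennreal (real k * T0 + 1) \<le> (\<Sum>j<N. \<Sum>i\<in>{1..k}. S2 \<sigma> j i)" if "\<sigma> \<in> {1..2}" for \<sigma> using that by (meson linear)
      have mS2: "(\<lambda>\<sigma>. S2 \<sigma> j i) \<in> borel_measurable borel" for j i unfolding S2_def by measurable
      have "ennreal (real k * T0 + 1) = (\<integral>\<^sup>+\<sigma>\<in>{1..2::real}. ennreal (real k * T0 + 1) \<partial>lborel)"
        by (subst nn_integral_cmult_indicator) auto
      also have "\<dots> \<le> (\<integral>\<^sup>+\<sigma>\<in>{1..2}. (\<Sum>j<N. \<Sum>i\<in>{1..k}. S2 \<sigma> j i) \<partial>lborel)"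
        using gt by (intro nn_integral_mono) (auto simp: indicator_def)
      also have "\<dots> = (\<Sum>j<N. \<Sum>i\<in>{1..k}. \<integral>\<^sup>+\<sigma>\<in>{1..2}. S2 \<sigma> j i \<partial>lborel)"
        unfolding sum_distrib_right using mS2 by (subst nn_integral_sum, simp, intro sum.cong refl nn_integral_sum) auto
      also have "\<dots> \<le> (\<Sum>j<N. \<Sum>i\<in>{1..k}. I1 j)" by (intro sum_mono S2)
      also have "\<dots> = ennreal (real k) * (\<Sum>j<N. I1 j)" by (simp add: sum_distrib_left ennreal_of_nat_eq_real_of_nat)
      also have "\<dots> \<le> ennreal (real k) * ennreal T0" by (intro mult_left_mono I1sum) auto
      also have "\<dots> = ennreal (real k * T0)" using T0 by (intro ennreal_mult[symmetric]) auto
      finally have "real k * T0 + 1 \<le> real k * T0" using T0 by (subst (asm) ennreal_le_iff) auto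
      then show False by simp
    qed
    then obtain \<sigma> where \<sigma>: "\<sigma> \<in> {1..2}" "(\<Sum>j<N. \<Sum>i\<in>{1..k}. S2 \<sigma> j i) \<le> ennreal (real k * T0 + 1)" by blast
    \<comment> \<open>Beyond \<open>N\<close> only the degree is required, so that a polynomial can
      be chosen for every natural number.\<close>
    define Good where "Good j Q \<longleftrightarrow> degree Q < k + r \<and> (j < N \<longrightarrow>
       (\<integral>\<^sup>+x\<in>J j. young p (ennreal (\<bar>f x - poly Q x\<bar> / (C / real n ^ r * A))) \<partial>lborel) \<le> I1 j + (\<Sum>i\<in>{1..k}. S2 \<sigma> j i))"
      for j and Q :: "real poly"
    have "\<exists>P. Good j P" for j
    proof (cases "j < N")
      case False
      then show ?thesis using k by (intro exI[of _ 0]) (auto simp: Good_def)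
    next
      case j: True
      define s where "s = \<sigma> * s0 j"
      have s: "0 < s" "s0 j \<le> s" "s \<le> 2 * s0 j" using \<sigma> s0[OF j] by (auto simp: s_def)
      have \<beta>w: "\<beta> * w j \<le> 1"
      proof -
        have "\<beta> * w j \<le> 0.54 * (5 / 4)" using \<beta>54 w54[OF j] wpos[OF j] by (intro mult_mono) auto
        then show ?thesis by simp
      qed
      have s1: "u j + (real k)\<^sup>2 * s < 1"
      proof -
        have "(real k)\<^sup>2 * s \<le> (real k)\<^sup>2 * (2 * s0 j)" using s by (intro mult_left_mono) auto
        also have "\<dots> = 2 * ((real k)\<^sup>2 * \<epsilon>) * (\<beta> * w j)" by (simp add: s0_def)
        also have "\<dots> \<le> 2 * (1 / 64) * 1" using k\<epsilon> \<beta>w \<beta> \<epsilon> wpos[OF j] by (intro mult_mono) auto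
        finally show ?thesis using uhalf[OF j] by simp
      qed
      have s2: "u j - l j \<le> \<Lambda> * s"
      proof -
        have "u j - l j \<le> 2 * (2 * \<beta>) * sqrt (1 + u j)"
          using lu[OF j] wl[OF j] \<beta> unfolding w_def by (intro sqrt_increment) auto
        also have "\<dots> = \<Lambda> * s0 j" using \<epsilon> by (simp add: \<Lambda>_def s0_def w_def)
        also have "\<dots> \<le> \<Lambda> * s" using s \<Lambda> by (intro mult_left_mono) auto
        finally show ?thesis .
      qed
      have uj: "-1 < u j" "u j < 1" using lu[OF j] uhalf[OF j] by auto
      obtain P :: "real poly" where P: "degree P < k + r"
        "(\<integral>\<^sup>+x\<in>{l j<..u j}. young p (ennreal (\<bar>f x - poly P x\<bar> / ((2 * (2 * \<beta>)) ^ r * (2 ^ (k + 1) * (real k * \<Lambda>) ^ (k + 1)) * A1))) \<partial>lborel)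
          \<le> (\<integral>\<^sup>+x\<in>{l j<..u j}. (\<integral>\<^sup>+v\<in>{0<..real k}. Y x (s * v) \<partial>lborel) \<partial>lborel) + (\<Sum>i\<in>{1..k}. \<integral>\<^sup>+x\<in>{l j<..u j}. Y x (real i * s) \<partial>lborel)"
        using local_approx[OF k \<Lambda> F f lu(2)[OF j] lu(1)[OF j] s(1) s1 s2 _ wl[OF j, unfolded w_def] p A1 f0 fr[OF _ uj]] \<beta>
        unfolding Y_def by auto
      have "(\<integral>\<^sup>+x\<in>J j. young p (ennreal (\<bar>f x - poly P x\<bar> / (C / real n ^ r * A))) \<partial>lborel)
        \<le> (\<integral>\<^sup>+x\<in>{l j<..u j}. young p (ennreal (\<bar>f x - poly P x\<bar> / ((2 * (2 * \<beta>)) ^ r * (2 ^ (k + 1) * (real k * \<Lambda>) ^ (k + 1)) * A1))) \<partial>lborel)"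
        unfolding J_def
      proof (intro nn_integral_mono mult_right_mono young_mono ennreal_leI divide_left_mono)
        \<comment> \<open>Here the power of \<open>n\<close> is gained:
          \<open>\<delta> = 2 * \<beta>\<close> gives \<open>(4 * \<beta>) ^ r\<close>, the factor
          \<open>2 ^ r\<close> comes from \<open>A1\<close>, and
          \<open>n * \<beta> \<le> K\<close>.\<close>
        have "(2 * (2 * \<beta>)) * 2 = 8 * \<beta>" by simp
        then have "(2 * (2 * \<beta>)) ^ r * 2 ^ r = (8 * \<beta>) ^ r" by (simp only: power_mult_distrib[symmetric])
        also have "\<dots> \<le> (8 * real K / real n) ^ r" using n\<beta>(1) n0 \<beta> by (intro power_mono) (auto simp: le_divide_eq ac_simps)
        also have "\<dots> = (8 * real K) ^ r / real n ^ r" by (rule power_divide)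
        finally have *: "(2 * (2 * \<beta>)) ^ r * 2 ^ r \<le> (8 * real K) ^ r / real n ^ r" .
        have "(2 * (2 * \<beta>)) ^ r * CW * A1 = ((2 * (2 * \<beta>)) ^ r * 2 ^ r) * (CW * A)" by (simp add: A1_def)
        also have "\<dots> \<le> ((8 * real K) ^ r / real n ^ r) * (CW * A)" using * CW A by (intro mult_right_mono) auto
        also have "\<dots> = ((8 * real K) ^ r * CW) / real n ^ r * A" by simp
        also have "\<dots> \<le> C / real n ^ r * A" using C(2) A n0 by (intro mult_right_mono divide_right_mono) auto
        finally show "(2 * (2 * \<beta>)) ^ r * (2 ^ (k + 1) * (real k * \<Lambda>) ^ (k + 1)) * A1 \<le> C / real n ^ r * A" by (simp add: CW_def)
        show "0 < C / real n ^ r * A * ((2 * (2 * \<beta>)) ^ r * (2 ^ (k + 1) * (real k * \<Lambda>) ^ (k + 1)) * A1)"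
          using C(1) n0 A A1 \<beta> CW unfolding CW_def[symmetric] by (intro mult_pos_pos divide_pos_pos zero_less_power) auto
      qed auto
      also note P(2)
      also have "(\<integral>\<^sup>+x\<in>{l j<..u j}. (\<integral>\<^sup>+v\<in>{0<..real k}. Y x (s * v) \<partial>lborel) \<partial>lborel) + (\<Sum>i\<in>{1..k}. \<integral>\<^sup>+x\<in>{l j<..u j}. Y x (real i * s) \<partial>lborel)
          = S1 \<sigma> j + (\<Sum>i\<in>{1..k}. S2 \<sigma> j i)" by (simp add: S1_def S2_def J_def s_def)
      also have "\<dots> \<le> I1 j + (\<Sum>i\<in>{1..k}. S2 \<sigma> j i)" by (intro add_right_mono S1 \<sigma>)
      finally show ?thesis using P(1) unfolding Good_def by blast
    qed
    then obtain P where "Good j (P j)" for j by metis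
    then have P: "\<And>j. degree (P j) < k + r" "\<And>j. j < N \<Longrightarrow>
       (\<integral>\<^sup>+x\<in>J j. young p (ennreal (\<bar>f x - poly (P j) x\<bar> / (C / real n ^ r * A))) \<partial>lborel) \<le> I1 j + (\<Sum>i\<in>{1..k}. S2 \<sigma> j i)"
      by (simp_all add: Good_def)
    have "(\<Sum>j<N. \<integral>\<^sup>+x\<in>J j. young p (ennreal (\<bar>f x - poly (P j) x\<bar> / (C / real n ^ r * A))) \<partial>lborel) \<le> (\<Sum>j<N. I1 j + (\<Sum>i\<in>{1..k}. S2 \<sigma> j i))"
      by (intro sum_mono P(2)) auto
    also have "\<dots> = (\<Sum>j<N. I1 j) + (\<Sum>j<N. \<Sum>i\<in>{1..k}. S2 \<sigma> j i)" by (rule sum.distrib)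
    also have "\<dots> \<le> ennreal T0 + ennreal (real k * T0 + 1)" by (intro add_mono I1sum \<sigma>(2))
    also have "\<dots> = ennreal (T0 + (real k * T0 + 1))" using T0 by (intro ennreal_plus[symmetric]) auto
    also have "\<dots> \<le> ennreal C" using C(3) by (rule ennreal_leI)
    finally show "\<exists>P::nat \<Rightarrow> real poly. (\<forall>j. degree (P j) < k + r) \<and>
        (\<Sum>j<3 * \<nu> + 1. \<integral>\<^sup>+x\<in>{- cos (real (j - 1) * (pi / (6 * real \<nu>)))<..- cos ((real j + 1) * (pi / (6 * real \<nu>)))}.
            young p (ennreal (\<bar>f x - poly (P j) x\<bar> / (C / real n ^ r * A))) \<partial>lborel) \<le> ennreal C"
      using P(1) unfolding N_def J_def l_def u_def X_def \<beta>_def by (intro exI[of _ P]) (simp add: add.commute)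
  qed
qed

section \<open>Representatives and reflection\<close>

lemma nn_integral_lebesgue_on:
  "S \<in> sets lebesgue \<Longrightarrow> (\<integral>\<^sup>+x. g x \<partial>lebesgue_on S) = (\<integral>\<^sup>+x\<in>S. g x \<partial>lborel)"
  by (simp add: nn_integral_restrict_space nn_integral_completion)

lemma negligible_iff_AE: "negligible {x. \<not> P x} \<longleftrightarrow> (AE x in lborel. P x)"
proof
  assume "negligible {x. \<not> P x}"
  then have "{x. \<not> P x} \<in> null_sets lebesgue" by (simp add: negligible_iff_null_sets)
  then have "AE x in lebesgue. P x" by (rule AE_I') auto
  then show "AE x in lborel. P x" by (simp add: AE_completion_iff)
next
  assume "AE x in lborel. P x"
  then have "AE x in lebesgue. P x" by (rule AE_completion)
  then obtain N where "N \<in> null_sets lebesgue" "{x. \<not> P x} \<subseteq> N"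
    by (auto simp: eventually_ae_filter)
  then show "negligible {x. \<not> P x}" by (metis negligible_iff_null_sets negligible_subset)
qed

lemma le_one_plus_young:
  assumes p: "1 \<le> p" shows "u \<le> 1 + young p u"
proof (cases "u \<le> 1 \<or> p = \<infinity> \<or> u = \<infinity>")
  case True
  then show ?thesis by (auto simp: young_def intro: add_increasing2)
next
  case False
  then obtain v where v: "u = ennreal v" "0 \<le> v" by (cases u) auto
  with False have v1: "1 < v" by (simp add: not_le flip: ennreal_1)
  have "1 \<le> enn2real p" using enn2real_ge_1 p False by auto
  then have "v powr 1 \<le> v powr enn2real p" using v1 by (intro powr_mono) auto
  then have "v \<le> v powr enn2real p" using v1 by simp
  then have "u \<le> ennreal (v powr enn2real p)" unfolding v(1) by (rule ennreal_leI)
  also have "\<dots> = young p u" using False v by (simp add: young_def)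
  finally show ?thesis by (simp add: add_increasing)
qed

text \<open>On \<open>{c<..d}\<close> the weight is at least \<open>m > 0\<close>, so
  \<open>\<bar>H\<bar>\<close> is bounded by a multiple of \<open>1 + young p\<close> of the
  weighted function, whose integral is finite.\<close>

lemma weighted_locint:
  assumes p: "1 \<le> p" and H[measurable]: "H \<in> borel_measurable borel"
    and eq: "AE x in lborel. x \<in> {-1<..<1} \<longrightarrow> F x = H x"
    and Lp: "Lp_norm p {-1..1} (\<lambda>x. F x * \<phi> x ^ r) < \<infinity>"
  shows "locint H"
proof -
  obtain a where a: "Lp_norm p {-1..1} (\<lambda>x. F x * \<phi> x ^ r) = ennreal a" "0 \<le> a"
    using Lp by (cases "Lp_norm p {-1..1} (\<lambda>x. F x * \<phi> x ^ r)") auto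
  define A where "A = a + 1"
  have A: "0 < A" using a by (simp add: A_def)
  have "(\<integral>\<^sup>+x. young p (ennreal (\<bar>F x * \<phi> x ^ r\<bar> / A)) \<partial>lebesgue_on {-1..1}) \<le> 1"
    using p A a by (intro young_Lp_norm_le) (auto simp: A_def intro!: ennreal_leI)
  then have "(\<integral>\<^sup>+x\<in>{-1..1}. young p (ennreal (\<bar>F x * \<phi> x ^ r\<bar> / A)) \<partial>lborel) \<le> 1"
    by (simp add: nn_integral_lebesgue_on)
  moreover have "(\<integral>\<^sup>+x\<in>{-1<..<1}. young p (ennreal (\<bar>H x * \<phi> x ^ r\<bar> / A)) \<partial>lborel) \<le> (\<integral>\<^sup>+x\<in>{-1..1}. young p (ennreal (\<bar>F x * \<phi> x ^ r\<bar> / A)) \<partial>lborel)"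
    using eq by (intro nn_integral_mono_AE) (auto elim!: eventually_mono simp: indicator_def)
  ultimately have I: "(\<integral>\<^sup>+x\<in>{-1<..<1}. young p (ennreal (\<bar>H x * \<phi> x ^ r\<bar> / A)) \<partial>lborel) \<le> 1" by (rule order_trans[rotated])
  have "integrable lborel (\<lambda>t. indicator {c<..d} t * H t)" if c: "-1 < c" and d: "d < 1" for c d
  proof (cases "c < d")
    case True
    define m where "m = sqrt ((1 - d) * (1 + c)) ^ r"
    have m: "0 < m" using c d by (simp add: m_def)
    show ?thesis
    proof (rule integrableI_bounded)
      have "(\<integral>\<^sup>+t. ennreal (norm (indicator {c<..d} t * H t)) \<partial>lborel)
        \<le> (\<integral>\<^sup>+t. ennreal (A / m) * (indicator {-1<..<1} t + young p (ennreal (\<bar>H t * \<phi> t ^ r\<bar> / A)) * indicator {-1<..<1} t) \<partial>lborel)"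
      proof (intro nn_integral_mono)
        fix t
        show "ennreal (norm (indicator {c<..d} t * H t)) \<le> ennreal (A / m) * (indicator {-1<..<1} t + young p (ennreal (\<bar>H t * \<phi> t ^ r\<bar> / A)) * indicator {-1<..<1} t)"
        proof (cases "t \<in> {c<..d}")
          case True
          then have t: "t \<in> {-1<..<1}" using c d by auto
          have "(1 - d) * (1 + c) \<le> (1 - t) * (1 + t)" using True c d by (intro mult_mono) auto
          also have "\<dots> = 1 - t\<^sup>2" by (simp add: power2_eq_square algebra_simps)
          finally have "sqrt ((1 - d) * (1 + c)) \<le> \<phi> t" unfolding \<phi>_def by (rule real_sqrt_le_mono)
          then have m': "m \<le> \<phi> t ^ r" unfolding m_def using c d by (intro power_mono) auto
          have "\<bar>H t\<bar> * m \<le> \<bar>H t\<bar> * \<phi> t ^ r" using m' by (intro mult_left_mono) auto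
          also have "\<dots> \<le> \<bar>H t * \<phi> t ^ r\<bar>" by (simp add: abs_mult mult_left_mono)
          finally have "\<bar>H t\<bar> \<le> A / m * (\<bar>H t * \<phi> t ^ r\<bar> / A)" using m A by (simp add: le_divide_eq)
          then have "ennreal \<bar>H t\<bar> \<le> ennreal (A / m * (\<bar>H t * \<phi> t ^ r\<bar> / A))" by (rule ennreal_leI)
          also have "\<dots> = ennreal (A / m) * ennreal (\<bar>H t * \<phi> t ^ r\<bar> / A)" using A m by (intro ennreal_mult) auto
          also have "\<dots> \<le> ennreal (A / m) * (1 + young p (ennreal (\<bar>H t * \<phi> t ^ r\<bar> / A)))" by (intro mult_left_mono le_one_plus_young p) auto
          finally show ?thesis using True t by simp
        qed simp
      qed
      also have "\<dots> = ennreal (A / m) * (\<integral>\<^sup>+t. indicator {-1<..<1} t + young p (ennreal (\<bar>H t * \<phi> t ^ r\<bar> / A)) * indicator {-1<..<1} t \<partial>lborel)"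
        by (intro nn_integral_cmult) measurable
      also have "\<dots> = ennreal (A / m) * ((\<integral>\<^sup>+t. indicator {-1<..<1::real} t \<partial>lborel) + (\<integral>\<^sup>+t\<in>{-1<..<1}. young p (ennreal (\<bar>H t * \<phi> t ^ r\<bar> / A)) \<partial>lborel))"
        by (intro arg_cong[of _ _ "(*) (ennreal (A / m))"] nn_integral_add) measurable
      also have "\<dots> \<le> ennreal (A / m) * (2 + 1)" using I by (intro mult_left_mono add_mono) auto
      also have "\<dots> < \<infinity>" by (simp add: ennreal_mult_less_top)
      finally show "(\<integral>\<^sup>+t. ennreal (norm (indicator {c<..d} t * H t)) \<partial>lborel) < \<infinity>" .
    qed measurable
  qed simp
  then show ?thesis by (simp add: locint_def)
qed

text \<open>The measurable product with the weight is divided by the weight, which is positive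
  inside, and a Borel version is chosen. The Tonelli arguments in two variables work with such a
  version.\<close>

lemma borel_representative:
  assumes p: "1 \<le> p" and G: "(\<lambda>x. F x * \<phi> x ^ r) \<in> Lp_space p {-1..1}"
  obtains F0 where "locint F0" "AE x in lborel. x \<in> {-1<..<1} \<longrightarrow> F x = F0 x"
proof -
  have "(\<lambda>x. if x \<in> {-1..1} then F x * \<phi> x ^ r else 0) \<in> borel_measurable lebesgue"
    using G by (subst borel_measurable_if) (auto simp: Lp_space_def)
  moreover have "\<phi> \<in> borel_measurable lebesgue" by (intro measurable_completion) simp
  ultimately have "(\<lambda>x. (if x \<in> {-1..1} then F x * \<phi> x ^ r else 0) / \<phi> x ^ r) \<in> borel_measurable lebesgue" by measurable
  from completion_ex_borel_measurable_real[OF this] obtain F0 where F0: "F0 \<in> borel_measurable borel"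
    "AE x in lborel. (if x \<in> {-1..1} then F x * \<phi> x ^ r else 0) / \<phi> x ^ r = F0 x" by auto
  have eq: "AE x in lborel. x \<in> {-1<..<1} \<longrightarrow> F x = F0 x"
    using F0(2)
  proof eventually_elim
    case (elim x)
    show ?case
    proof
      assume x: "x \<in> {-1<..<1}"
      then have "0 < \<phi> x" by (intro phi_pos) auto
      with elim x show "F x = F0 x" by auto
    qed
  qed
  show thesis
    using weighted_locint[OF p F0(1) eq] G eq by (intro that) (auto simp: Lp_space_def)
qed

text \<open>The derivative of the map vanishes only where \<open>c * Y = \<phi> Y\<close>, hence at
  most at two points; elsewhere preimages of null sets are null. Consequently a difference with
  variable step is not affected, up to null sets, by the choice of a representative.\<close>

lemma AE_off_null_curve:
  assumes N: "negligible N"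
  shows "AE Y in lborel. \<bar>Y\<bar> < 1 \<longrightarrow> Y + c * \<phi> Y \<notin> N"
proof -
  define S where "S = {Y. \<bar>Y\<bar> < 1 \<and> Y\<^sup>2 * (1 + c\<^sup>2) \<noteq> 1}"
  have 1: "negligible {Y \<in> S. Y + c * \<phi> Y \<in> N}"
  proof (rule negligible_differentiable_vimage[OF N, where f' = "\<lambda>Y. (*) (1 - c * Y / \<phi> Y)"])
    fix Y assume Y: "Y \<in> S"
    then have ph: "0 < \<phi> Y" "(\<phi> Y)\<^sup>2 = 1 - Y\<^sup>2" by (auto simp: S_def phi_pos) (auto simp: \<phi>_def abs_square_le_1)
    have inj: "inj ((*) a)" if "a \<noteq> 0" for a :: real using that by (intro injI) simp
    have "1 - c * Y / \<phi> Y \<noteq> 0"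
    proof
      assume "1 - c * Y / \<phi> Y = 0"
      then have "c * Y = \<phi> Y" using ph by (simp add: field_simps)
      then have "(c * Y)\<^sup>2 = 1 - Y\<^sup>2" using ph by simp
      then show False using Y by (simp add: S_def power_mult_distrib algebra_simps)
    qed
    then show "inj ((*) (1 - c * Y / \<phi> Y))" by (rule inj)
    have "0 < 1 - Y\<^sup>2" using Y by (simp add: S_def abs_square_less_1)
    then have "((\<lambda>Y. Y + c * \<phi> Y) has_real_derivative 1 - c * Y / \<phi> Y) (at Y)"
      unfolding \<phi>_def by (auto intro!: derivative_eq_intros simp: field_simps)
    then show "((\<lambda>Y. Y + c * \<phi> Y) has_derivative (*) (1 - c * Y / \<phi> Y)) (at Y within S)"
      by (simp add: has_field_derivative_def has_derivative_at_withinI)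
  qed
  have "Y = 1 / sqrt (1 + c\<^sup>2) \<or> Y = - (1 / sqrt (1 + c\<^sup>2))" if "Y\<^sup>2 * (1 + c\<^sup>2) = 1" for Y :: real
  proof -
    have pos: "0 < 1 + c\<^sup>2" by (simp add: add_pos_nonneg)
    then have "Y\<^sup>2 = 1 / (1 + c\<^sup>2)" using that by (simp add: field_simps)
    also have "\<dots> = (1 / sqrt (1 + c\<^sup>2))\<^sup>2" using pos by (simp add: power_divide)
    finally show ?thesis by (simp add: power2_eq_iff)
  qed
  then have "{Y::real. Y\<^sup>2 * (1 + c\<^sup>2) = 1} \<subseteq> {1 / sqrt (1 + c\<^sup>2), - (1 / sqrt (1 + c\<^sup>2))}" by blast
  then have 2: "negligible {Y::real. Y\<^sup>2 * (1 + c\<^sup>2) = 1}" by (rule negligible_subset[rotated]) simp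
  have "negligible {Y. \<not> (\<bar>Y\<bar> < 1 \<longrightarrow> Y + c * \<phi> Y \<notin> N)}"
    by (rule negligible_subset[OF negligible_Un[OF 1 2]]) (auto simp: S_def)
  then show ?thesis by (subst (asm) negligible_iff_AE)
qed

lemma AE_symmetric_difference:
  assumes h: "0 < h" and eq: "AE x in lborel. x \<in> {-1<..<1} \<longrightarrow> F x = F0 x"
  shows "AE Y in lborel. Y \<in> \<DD> (real k * h) \<longrightarrow>
    symmetric_difference k (h * \<phi> Y) F Y = fdiff k (h * \<phi> Y) F0 (Y - real k * (h * \<phi> Y) / 2)"
proof -
  \<comment> \<open>The endpoints are added because the stencil may reach them, while
    \<open>F\<close> and \<open>F0\<close> are compared only inside.\<close>
  define N where "N = {x. \<not> (x \<in> {-1<..<1} \<longrightarrow> F x = F0 x)} \<union> {-1, 1}"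
  have "negligible {x. \<not> (x \<in> {-1<..<1} \<longrightarrow> F x = F0 x)}" using eq by (subst negligible_iff_AE)
  then have N: "negligible N" unfolding N_def by (intro negligible_Un) auto
  have "AE Y in lborel. \<forall>i\<in>{..k}. \<bar>Y\<bar> < 1 \<longrightarrow> Y + ((real i - real k / 2) * h) * \<phi> Y \<notin> N"
    by (intro AE_finite_allI AE_off_null_curve N) auto
  then show ?thesis
  proof eventually_elim
    case (elim Y)
    show ?case
    proof
      assume "Y \<in> \<DD> (real k * h)"
      then have Y: "\<bar>Y\<bar> < 1" "\<bar>Y\<bar> \<le> 1 - real k * (h * \<phi> Y) / 2" by (auto simp: \<DD>_def mult.assoc)
      define s where "s = h * \<phi> Y"
      have s: "0 \<le> s" using h phi_nonneg[of Y] Y by (simp add: s_def)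
      have F: "F (Y + (real i - real k / 2) * s) = F0 (Y - real k * s / 2 + real i * s)" if i: "i \<le> k" for i
      proof -
        define z where "z = Y + (real i - real k / 2) * s"
        have z2: "z = Y - real k * s / 2 + real i * s" by (simp add: z_def algebra_simps)
        have is': "0 \<le> real i * s" "real i * s \<le> real k * s" using i s by (auto intro: mult_right_mono)
        have "z \<notin> N" using elim i Y unfolding z_def s_def by (simp add: mult.assoc)
        moreover have "z \<in> {-1..1}" unfolding z2 using Y(2) is' unfolding s_def[symmetric] by (auto simp: abs_le_iff)
        ultimately have "F z = F0 z" by (auto simp: N_def)
        also have "\<dots> = F0 (Y - real k * s / 2 + real i * s)" by (rule arg_cong[OF z2])
        finally show ?thesis unfolding z_def .
      qed
      have "0 \<le> real k * s" using s by simp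
      then have "Y - real k * s / 2 \<in> {-1..1} \<and> Y + real k * s / 2 \<in> {-1..1}"
        using Y(2) unfolding s_def[symmetric] by (auto simp: abs_le_iff)
      then show "symmetric_difference k (h * \<phi> Y) F Y = fdiff k (h * \<phi> Y) F0 (Y - real k * (h * \<phi> Y) / 2)"
        unfolding s_def[symmetric] symmetric_difference_def fdiff_def
        using F by (auto simp: atLeast0AtMost intro!: sum.cong)
    qed
  qed
qed

lemma DD_measurable [measurable]: "\<DD> \<delta> \<in> sets borel"
  unfolding \<DD>_def by measurable

lemma WW_measurable [measurable]: "\<W> \<delta> \<in> borel_measurable borel"
  unfolding \<W>_def[abs_def] by measurable

lemma modulus_young:
  assumes p: "1 \<le> p" and A: "0 < A" and h: "0 < h"
    and eq: "AE x in lborel. x \<in> {-1<..<1} \<longrightarrow> F x = F0 x"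
    and le: "Lp_norm p (\<DD> (real k * h)) (\<lambda>x. \<W> (real k * h) x ^ r * symmetric_difference k (h * \<phi> x) F x) \<le> ennreal A"
  shows "(\<integral>\<^sup>+Y\<in>\<DD> (real k * h). young p (ennreal (\<bar>\<W> (real k * h) Y ^ r * fdiff k (h * \<phi> Y) F0 (Y - real k * (h * \<phi> Y) / 2)\<bar> / A)) \<partial>lborel) \<le> 1"
proof -
  have "(\<integral>\<^sup>+Y\<in>\<DD> (real k * h). young p (ennreal (\<bar>\<W> (real k * h) Y ^ r * fdiff k (h * \<phi> Y) F0 (Y - real k * (h * \<phi> Y) / 2)\<bar> / A)) \<partial>lborel)
    = (\<integral>\<^sup>+Y\<in>\<DD> (real k * h). young p (ennreal (\<bar>\<W> (real k * h) Y ^ r * symmetric_difference k (h * \<phi> Y) F Y\<bar> / A)) \<partial>lborel)"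
    using AE_symmetric_difference[OF h eq, of k] by (intro nn_integral_cong_AE) (auto elim!: eventually_mono simp: indicator_def)
  also have "\<dots> = (\<integral>\<^sup>+Y. young p (ennreal (\<bar>\<W> (real k * h) Y ^ r * symmetric_difference k (h * \<phi> Y) F Y\<bar> / A)) \<partial>lebesgue_on (\<DD> (real k * h)))"
    by (intro nn_integral_lebesgue_on[symmetric]) (simp add: sets_completionI_sets)
  also have "\<dots> \<le> 1" by (intro young_Lp_norm_le p A le)
  finally show ?thesis .
qed

section \<open>Reflection at the origin and representatives of the smoothness class\<close>

lemma fdiff_reflect:
  "fdiff k s (\<lambda>x. c * F (- x)) y = c * ((-1) ^ k * fdiff k s F (- y - real k * s))"
proof -
  have E: "fdiff k s F (- y - real k * s) = (\<Sum>i\<le>k. (-1) ^ i * real (k choose i) * F (- y - real i * s))"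
    unfolding fdiff_def
  proof (rule sum.reindex_bij_witness[of _ "\<lambda>i. k - i" "\<lambda>i. k - i"])
    fix i assume "i \<in> {..k}"
    then have i: "i \<le> k" by simp
    have "k choose (k - i) = k choose i" using i by (rule binomial_symmetric[symmetric])
    moreover have "- y - real (k - i) * s = - y - real k * s + real i * s" using i by (simp add: of_nat_diff algebra_simps)
    ultimately show "(-1) ^ (k - i) * real (k choose (k - i)) * F (- y - real (k - i) * s) = (-1) ^ (k - i) * real (k choose i) * F (- y - real k * s + real i * s)" by (simp only:)
  qed auto
  have sgn: "(-1) ^ k * (-1) ^ i = ((-1) ^ (k - i) :: real)" if "i \<le> k" for i
  proof -
    have "(-1) ^ k = ((-1) ^ (k - i) * (-1) ^ i :: real)" using that by (simp flip: power_add)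
    moreover have "(-1) ^ i * (-1) ^ i = (1::real)" by (simp flip: power_mult_distrib)
    ultimately show ?thesis by (simp only: mult.assoc mult_1_right)
  qed
  have "fdiff k s (\<lambda>x. c * F (- x)) y = (\<Sum>i\<le>k. (-1) ^ (k - i) * real (k choose i) * (c * F (- y - real i * s)))"
    unfolding fdiff_def by simp
  also have "\<dots> = (\<Sum>i\<le>k. c * ((-1) ^ k * ((-1) ^ i * real (k choose i) * F (- y - real i * s))))"
    by (intro sum.cong refl) (simp add: sgn[symmetric])
  also have "\<dots> = c * ((-1) ^ k * fdiff k s F (- y - real k * s))" unfolding E by (simp only: sum_distrib_left)
  finally show ?thesis .
qed

text \<open>The domain, the weight and \<open>\<phi>\<close> are even, and reflection reverses the
  stencil, which changes the difference only by a sign.\<close>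

lemma modulus_integral_reflect:
  assumes [measurable]: "F \<in> borel_measurable borel" and c: "\<bar>c\<bar> = 1"
  shows "(\<integral>\<^sup>+Y\<in>\<DD> \<delta>. young p (ennreal (\<bar>\<W> \<delta> Y ^ r * fdiff k (h * \<phi> Y) (\<lambda>x. c * F (- x)) (Y - real k * (h * \<phi> Y) / 2)\<bar> / A)) \<partial>lborel)
    = (\<integral>\<^sup>+Y\<in>\<DD> \<delta>. young p (ennreal (\<bar>\<W> \<delta> Y ^ r * fdiff k (h * \<phi> Y) F (Y - real k * (h * \<phi> Y) / 2)\<bar> / A)) \<partial>lborel)"
proof -
  have sym: "\<phi> (- Y) = \<phi> Y" "\<W> \<delta> (- Y) = \<W> \<delta> Y" "indicator (\<DD> \<delta>) (- Y) = (indicator (\<DD> \<delta>) Y :: ennreal)" for Y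
    by (auto simp: \<phi>_def \<W>_def \<DD>_def indicator_def mult.commute)
  have fd: "\<bar>fdiff k (h * \<phi> Y) (\<lambda>x. c * F (- x)) (Y - real k * (h * \<phi> Y) / 2)\<bar> = \<bar>fdiff k (h * \<phi> Y) F (- Y - real k * (h * \<phi> Y) / 2)\<bar>" for Y
  proof -
    have "- (Y - real k * (h * \<phi> Y) / 2) - real k * (h * \<phi> Y) = - Y - real k * (h * \<phi> Y) / 2" by simp
    then show ?thesis unfolding fdiff_reflect abs_mult c power_abs by (simp only: abs_minus_cancel abs_one power_one mult_1)
  qed
  show ?thesis
    by (subst nn_integral_real_affine[where c = "-1" and t = 0])
      (measurable, simp_all add: sym abs_mult fd)
qed

lemma integral_indicator_reflect:
  fixes F :: "real \<Rightarrow> real"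
  assumes [measurable]: "F \<in> borel_measurable borel"
  shows "(\<integral>t. indicator {x<..b} t * F (- t) \<partial>lborel) = (\<integral>t. indicator {-b<..-x} t * F t \<partial>lborel)"
proof -
  have "(\<integral>t. indicator {-b<..-x} t * F t \<partial>lborel) = (\<integral>t. indicator {-b<..-x} (- t) * F (- t) \<partial>lborel)"
    by (subst lborel_integral_real_affine[where c = "-1" and t = 0]) auto
  also have "\<dots> = (\<integral>t. indicator {x<..b} t * F (- t) \<partial>lborel)"
  proof (rule integral_cong_AE)
    show "AE t in lborel. indicator {-b<..-x} (- t) * F (- t) = indicator {x<..b} t * F (- t)"
      using AE_lborel_singleton[of x] AE_lborel_singleton[of b] by eventually_elim (auto simp: indicator_def)
  qed measurable
  finally show ?thesis ..
qed

lemma locint_reflect: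
  assumes F: "locint F"
  shows "locint (\<lambda>x. c * F (- x))"
proof -
  have [measurable]: "F \<in> borel_measurable borel" using F by (simp add: locint_def)
  have "integrable lborel (\<lambda>t. indicator {a<..b} t * (c * F (- t)))" if a: "-1 < a" and b: "b < 1" for a b
  proof -
    \<comment> \<open>Reflection exchanges the open and the closed end, so a slightly longer
      interval is reflected and then cut down; \<open>e\<close> is the midpoint of \<open>-1\<close>
      and \<open>- b\<close>.\<close>
    define e where "e = (- 1 - b) / 2"
    have e: "-1 < e" "e < - b" using b by (auto simp: e_def)
    have "integrable lborel (\<lambda>t. indicator {e<..-a} t * F t)" using F e a by (simp add: locint_def)
    then have "integrable lborel (\<lambda>t. indicator {e<..-a} (0 + -1 * t) * F (0 + -1 * t))"
      by (rule lborel_integrable_real_affine[of "\<lambda>t. indicator {e<..-a} t * F t"]) simp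
    then have "integrable lborel (\<lambda>t. c * (indicator {a<..b} t *\<^sub>R (indicator {e<..-a} (0 + -1 * t) * F (0 + -1 * t))))"
      by (intro integrable_mult_right integrable_mult_indicator) auto
    moreover have "c * (indicator {a<..b} t *\<^sub>R (indicator {e<..-a} (0 + -1 * t) * F (0 + -1 * t))) = indicator {a<..b} t * (c * F (- t))" for t
      using e by (auto simp: indicator_def)
    ultimately show ?thesis by (simp only:)
  qed
  then show ?thesis by (simp add: locint_def)
qed

lemma higher_deriv_reflect:
  fixes f :: "real \<Rightarrow> real"
  assumes diff: "\<And>j x. j < n \<Longrightarrow> x \<in> {-1<..<1} \<Longrightarrow> (deriv ^^ j) f differentiable (at x)"
  shows "j \<le> n \<Longrightarrow> x \<in> {-1<..<1} \<Longrightarrow> (deriv ^^ j) (\<lambda>x. f (- x)) x = (-1) ^ j * (deriv ^^ j) f (- x)"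
    and "j < n \<Longrightarrow> x \<in> {-1<..<1} \<Longrightarrow> (deriv ^^ j) (\<lambda>x. f (- x)) differentiable (at x)"
proof -
  have step: "((deriv ^^ j) (\<lambda>x. f (- x)) has_real_derivative (-1) ^ Suc j * (deriv ^^ Suc j) f (- x)) (at x)"
    if j: "j < n" and x: "x \<in> {-1<..<1}"
      and IH: "\<And>x. x \<in> {-1<..<1} \<Longrightarrow> (deriv ^^ j) (\<lambda>x. f (- x)) x = (-1) ^ j * (deriv ^^ j) f (- x)" for j x
  proof -
    have "(deriv ^^ j) f differentiable (at (- x))" using x by (intro diff j) auto
    then have "((deriv ^^ j) f has_real_derivative (deriv ^^ Suc j) f (- x)) (at (- x))"
      by (simp add: DERIV_deriv_iff_real_differentiable)
    then have "((\<lambda>x. (-1) ^ j * (deriv ^^ j) f (- x)) has_real_derivative (-1) ^ j * ((deriv ^^ Suc j) f (- x) * -1)) (at x)"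
      by (intro DERIV_cmult DERIV_chain2[of "(deriv ^^ j) f" _ uminus]) (auto intro!: derivative_eq_intros)
    then have "((\<lambda>x. (-1) ^ j * (deriv ^^ j) f (- x)) has_real_derivative (-1) ^ Suc j * (deriv ^^ Suc j) f (- x)) (at x)"
      by (rule DERIV_cong) simp
    then show ?thesis
      by (rule has_field_derivative_transform_within_open[where S = "{-1<..<1}"]) (use x IH in auto)
  qed
  have 1: "(deriv ^^ j) (\<lambda>x. f (- x)) x = (-1) ^ j * (deriv ^^ j) f (- x)" if "j \<le> n" "x \<in> {-1<..<1}" for j x
    using that
  proof (induction j arbitrary: x)
    case (Suc j)
    have "((deriv ^^ j) (\<lambda>x. f (- x)) has_real_derivative (-1) ^ Suc j * (deriv ^^ Suc j) f (- x)) (at x)"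
      using Suc by (intro step) auto
    then have "deriv ((deriv ^^ j) (\<lambda>x. f (- x))) x = (-1) ^ Suc j * (deriv ^^ Suc j) f (- x)" by (rule DERIV_imp_deriv)
    then show ?case by (simp only: funpow.simps comp_def)
  qed simp
  show "j \<le> n \<Longrightarrow> x \<in> {-1<..<1} \<Longrightarrow> (deriv ^^ j) (\<lambda>x. f (- x)) x = (-1) ^ j * (deriv ^^ j) f (- x)" by (rule 1)
  show "j < n \<Longrightarrow> x \<in> {-1<..<1} \<Longrightarrow> (deriv ^^ j) (\<lambda>x. f (- x)) differentiable (at x)"
    using step[of j x] 1[of j] real_differentiable_def by fastforce
qed

text \<open>The gauge integral of the derivative and the Lebesgue integral of its representative
  agree, as both are gauge integrals of functions that coincide off a null set.\<close>

lemma local_FTC: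
  fixes G F0 :: "real \<Rightarrow> real"
  assumes G: "locally_abs_continuous_on {-1<..<1} G" and F0: "locint F0"
    and eq: "AE x in lborel. x \<in> {-1<..<1} \<longrightarrow> deriv G x = F0 x"
    and x: "-1 < x" "x \<le> b" "b < 1"
  shows "G b - G x = (\<integral>t. indicator {x<..b} t * F0 t \<partial>lborel)"
proof -
  define N where "N = {x. \<not> (x \<in> {-1<..<1} \<longrightarrow> deriv G x = F0 x)} \<union> {x}"
  have "negligible {x. \<not> (x \<in> {-1<..<1} \<longrightarrow> deriv G x = F0 x)}" using eq by (subst negligible_iff_AE)
  then have N: "negligible N" unfolding N_def by (intro negligible_Un) auto
  have "{x..b} \<subseteq> {-1<..<1}" using x by auto
  then have "abs_continuous_on {x..b} G" using G by (simp add: locally_abs_continuous_on_def)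
  from abs_continuous_FTC[OF this x(2)]
  have "((\<lambda>t. if t \<in> {x..b} then deriv G t else 0) has_integral (G b - G x)) UNIV" by (simp only: has_integral_restrict_UNIV)
  then have "((\<lambda>t. indicator {x<..b} t * F0 t) has_integral (G b - G x)) UNIV"
    by (rule has_integral_spike[OF N, rotated]) (use x in \<open>auto simp: N_def indicator_def\<close>)
  moreover have "((\<lambda>t. indicator {x<..b} t * F0 t) has_integral (\<integral>t. indicator {x<..b} t * F0 t \<partial>lborel)) UNIV"
    using F0 x by (intro has_integral_integral_real) (simp add: locint_def)
  ultimately show ?thesis by (rule has_integral_unique)
qed

lemma abs_continuous_on_imp_continuous_on:
  fixes g :: "real \<Rightarrow> real"
  assumes g: "abs_continuous_on {a..b} g"
  shows "continuous_on {a..b} g"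
  unfolding continuous_on_iff
proof (intro ballI allI impI)
  fix x and e :: real assume x: "x \<in> {a..b}" and e: "0 < e"
  obtain \<delta> where \<delta>: "\<delta> > 0" "\<And>D. D division_of \<Union>D \<Longrightarrow> \<Union>D \<subseteq> {a..b} \<Longrightarrow> (\<Sum>K\<in>D. Sup K - Inf K) < \<delta> \<Longrightarrow>
       (\<Sum>K\<in>D. \<bar>g (Sup K) - g (Inf K)\<bar>) < e"
    using abs_continuous_onE[OF g e] by blast
  have close: "\<bar>g v - g u\<bar> < e" if "u \<le> v" "u \<in> {a..b}" "v \<in> {a..b}" "v - u < \<delta>" for u v
  proof -
    have "{cbox u v} division_of cbox u v" using that by (intro division_of_self) auto
    then show ?thesis using \<delta>(2)[of "{{u..v}}"] that by (auto simp: cbox_interval)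
  qed
  then have "dist (g y) (g x) < e" if "y \<in> {a..b}" "dist y x < \<delta>" for y
    using that x close[of x y] close[of y x] by (cases "x \<le> y") (auto simp: dist_real_def abs_minus_commute)
  then show "\<exists>d>0. \<forall>x'\<in>{a..b}. dist x' x < d \<longrightarrow> dist (g x') (g x) < e" using \<delta>(1) by blast
qed

text \<open>Translates membership in the class into two Borel functions and Taylor formulas, one for
  each half of the interval. For \<open>r = 0\<close> one function serves for both. For
  \<open>r \<ge> 1\<close> the function \<open>f\<close> is continuous inside, so cutting it off
  outside \<open>(-1,1)\<close> gives a Borel function.\<close>

lemma smoothness_class_representative:
  assumes p: "1 \<le> p" and f: "f \<in> \<B> p r"
  obtains f0 F0 where "locint F0" "f0 \<in> borel_measurable borel" "r = 0 \<Longrightarrow> f0 = F0"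
    "f \<in> borel_measurable (lebesgue_on {-1..1})"
    "AE x in lborel. x \<in> {-1<..<1} \<longrightarrow> f x = f0 x"
    "AE x in lborel. x \<in> {-1<..<1} \<longrightarrow> (deriv ^^ r) f x = F0 x"
    "taylor_form r F0 f0" "taylor_form r (\<lambda>x. (-1) ^ r * F0 (- x)) (\<lambda>x. f0 (- x))"
proof (cases r)
  case 0
  then have fLp: "f \<in> Lp_space p {-1..1}" using f by (simp add: \<B>_def)
  then have "(\<lambda>x. (deriv ^^ r) f x * \<phi> x ^ r) \<in> Lp_space p {-1..1}" using 0 by simp
  from borel_representative[OF p this] obtain F0 where F0: "locint F0" "AE x in lborel. x \<in> {-1<..<1} \<longrightarrow> (deriv ^^ r) f x = F0 x" by blast
  show thesis
    by (rule that[of F0 F0]) (use F0 fLp 0 in \<open>auto simp: locint_def Lp_space_def taylor_form_def\<close>)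
next
  case (Suc m)
  have diff: "\<And>j x. j < m \<Longrightarrow> x \<in> {-1<..<1} \<Longrightarrow> (deriv ^^ j) f differentiable (at x)"
    and lac: "locally_abs_continuous_on {-1<..<1} ((deriv ^^ m) f)"
    and Lp: "(\<lambda>x. (deriv ^^ r) f x * \<phi> x ^ r) \<in> Lp_space p {-1..1}"
    using f by (auto simp: \<B>_def Suc)
  from borel_representative[OF p Lp] obtain F0 where F0: "locint F0" and eq: "AE x in lborel. x \<in> {-1<..<1} \<longrightarrow> (deriv ^^ r) f x = F0 x" by blast
  have [measurable]: "F0 \<in> borel_measurable borel" using F0 by (simp add: locint_def)
  have cont: "continuous_on {-1<..<1} f"
  proof (rule continuous_at_imp_continuous_on, rule ballI)
    fix x :: real assume x: "x \<in> {-1<..<1}"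
    show "isCont f x"
    \<comment> \<open>For \<open>r = 1\<close> the class demands no derivative everywhere, and
      continuity comes from local absolute continuity.\<close>
    proof (cases m)
      case 0
      define a b where "a = (x - 1) / 2" and "b = (x + 1) / 2"
      have ab: "-1 < a" "a < x" "x < b" "b < 1" using x by (auto simp: a_def b_def)
      then have "{a..b} \<subseteq> {-1<..<1}" by auto
      then have "continuous_on {a..b} f" using lac 0 by (intro abs_continuous_on_imp_continuous_on) (simp add: locally_abs_continuous_on_def)
      then show ?thesis using ab by (rule_tac continuous_on_interior[of "{a..b}"]) auto
    next
      case (Suc j)
      then show ?thesis using diff[of 0 x] x by (simp add: differentiable_imp_continuous_within)
    qed
  qed
  define f0 where "f0 x = indicator {-1<..<1} x *\<^sub>R f x" for x :: real
  have f0m[measurable]: "f0 \<in> borel_measurable borel"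
    unfolding f0_def[abs_def] using cont by (intro borel_measurable_continuous_on_indicator) auto
  have ff0: "f x = f0 x" if "x \<in> {-1<..<1}" for x using that by (simp add: f0_def)
  have fm: "f \<in> borel_measurable (lebesgue_on {-1..1})"
  proof -
    \<comment> \<open>The values at \<open>\<pm>1\<close> are arbitrary and have to be restored on
      the closed interval.\<close>
    have "(\<lambda>x. if x = 1 then f 1 else if x = -1 then f (-1) else f0 x) \<in> borel_measurable (lebesgue_on {-1..1})"
      by (intro measurable_restrict_space1 measurable_completion) simp
    moreover have "(if x = 1 then f 1 else if x = -1 then f (-1) else f0 x) = f x" if "x \<in> space (lebesgue_on {-1..1})" for x
      using that ff0[of x] by (auto simp: less_le)
    ultimately show ?thesis by (subst (asm) measurable_cong) auto
  qed
  have top: "(deriv ^^ m) f b - (deriv ^^ m) f x = (\<integral>t. indicator {x<..b} t * F0 t \<partial>lborel)" if "-1 < x" "x \<le> b" "b < 1" for x b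
    by (rule local_FTC[OF lac F0 _ that]) (use eq Suc in simp)
  have t1: "taylor_form r F0 f0"
    unfolding taylor_form_def
  proof (intro allI impI)
    fix m' and u :: real assume m': "r = Suc m'" and u: "-1 < u" "u < 1"
    then have mm: "m' = m" using Suc by simp
    obtain T :: "real poly" where T: "degree T \<le> m" "\<forall>x. -1 < x \<longrightarrow> x \<le> u \<longrightarrow>
           f x = poly T x + (-1) ^ Suc m / fact m * (\<integral>t. indicator {x<..u} t * (F0 t * (t - x) ^ m) \<partial>lborel)"
      using taylor_locint[OF F0 u diff top[OF _ _ u(2)]] by blast
    show "\<exists>T. degree T \<le> m' \<and> (\<forall>x. -1 < x \<longrightarrow> x \<le> u \<longrightarrow>
       f0 x = poly T x + (-1) ^ Suc m' / fact m' * (\<integral>t. indicator {x<..u} t * (F0 t * (t - x) ^ m') \<partial>lborel))"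
      unfolding mm
    proof (intro exI[of _ T] conjI allI impI T(1))
      fix x assume x: "-1 < x" "x \<le> u"
      then have "f0 x = f x" using u by (intro ff0[symmetric]) auto
      then show "f0 x = poly T x + (-1) ^ Suc m / fact m * (\<integral>t. indicator {x<..u} t * (F0 t * (t - x) ^ m) \<partial>lborel)"
        using T(2) x by simp
    qed
  qed
  let ?F = "\<lambda>x. (-1) ^ r * F0 (- x)" and ?f = "\<lambda>x. f (- x)"
  have diff': "(deriv ^^ j) ?f differentiable (at x)" if "j < m" "x \<in> {-1<..<1}" for j x
    using higher_deriv_reflect(2)[of m f j x] diff that by blast
  have rf: "(deriv ^^ m) ?f x = (-1) ^ m * (deriv ^^ m) f (- x)" if "x \<in> {-1<..<1}" for x
    using higher_deriv_reflect(1)[of m f m x] diff that by blast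
  have t2: "taylor_form r ?F (\<lambda>x. f0 (- x))"
    unfolding taylor_form_def
  proof (intro allI impI)
    fix m' and u :: real assume m': "r = Suc m'" and u: "-1 < u" "u < 1"
    then have mm: "m' = m" using Suc by simp
    have top': "(deriv ^^ m) ?f u - (deriv ^^ m) ?f x = (\<integral>t. indicator {x<..u} t * ((-1) ^ r * F0 (- t)) \<partial>lborel)" if x: "-1 < x" "x \<le> u" for x
    proof -
      have "(deriv ^^ m) ?f u - (deriv ^^ m) ?f x = (-1) ^ r * ((deriv ^^ m) f (- x) - (deriv ^^ m) f (- u))"
        using u x rf[of u] rf[of x] by (simp add: Suc algebra_simps)
      also have "(deriv ^^ m) f (- x) - (deriv ^^ m) f (- u) = (\<integral>t. indicator {-u<..-x} t * F0 t \<partial>lborel)"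
        using u x by (intro top) auto
      also have "\<dots> = (\<integral>t. indicator {x<..u} t * F0 (- t) \<partial>lborel)" by (rule integral_indicator_reflect[symmetric]) measurable
      also have "(-1) ^ r * \<dots> = (\<integral>t. (-1) ^ r * (indicator {x<..u} t * F0 (- t)) \<partial>lborel)" by simp
      finally show ?thesis by (simp add: mult.left_commute)
    qed
    obtain T :: "real poly" where T: "degree T \<le> m" "\<forall>x. -1 < x \<longrightarrow> x \<le> u \<longrightarrow>
           ?f x = poly T x + (-1) ^ Suc m / fact m * (\<integral>t. indicator {x<..u} t * (?F t * (t - x) ^ m) \<partial>lborel)"
      using taylor_locint[OF locint_reflect[OF F0] u diff' top'] by blast
    show "\<exists>T. degree T \<le> m' \<and> (\<forall>x. -1 < x \<longrightarrow> x \<le> u \<longrightarrow>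
       f0 (- x) = poly T x + (-1) ^ Suc m' / fact m' * (\<integral>t. indicator {x<..u} t * (?F t * (t - x) ^ m') \<partial>lborel))"
      unfolding mm
    proof (intro exI[of _ T] conjI allI impI T(1))
      fix x assume x: "-1 < x" "x \<le> u"
      then have "f0 (- x) = f (- x)" using u by (intro ff0[symmetric]) auto
      then show "f0 (- x) = poly T x + (-1) ^ Suc m / fact m * (\<integral>t. indicator {x<..u} t * (?F t * (t - x) ^ m) \<partial>lborel)"
        using T(2) x by simp
    qed
  qed
  show thesis
    by (rule that[OF F0 f0m _ fm _ eq t1 t2]) (use Suc ff0 in auto)
qed

lemma nn_integral_Icc_le_Ioc:
  fixes a b c d :: real
  assumes "c \<le> a" "b \<le> d"
  shows "(\<integral>\<^sup>+x\<in>{a..b}. g x \<partial>lborel) \<le> (\<integral>\<^sup>+x\<in>{c<..d}. g x \<partial>lborel)"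
  using AE_lborel_singleton[of a] assms
  by (intro nn_integral_mono_AE) (auto elim!: eventually_mono simp: indicator_def)

lemma nn_integral_Icc_le_reflected_Ioc:
  fixes a b c d :: real
  assumes [measurable]: "g \<in> borel_measurable borel" and "- d \<le> a" "b \<le> - c"
  shows "(\<integral>\<^sup>+x\<in>{a..b}. g x \<partial>lborel) \<le> (\<integral>\<^sup>+x\<in>{c<..d}. g (- x) \<partial>lborel)"
proof -
  have "(\<integral>\<^sup>+x\<in>{c<..d}. g (- x) \<partial>lborel) = (\<integral>\<^sup>+x. g x * indicator {c<..d} (- x) \<partial>lborel)"
    by (subst nn_integral_real_affine[where c = "-1" and t = 0]) auto
  moreover have "(\<integral>\<^sup>+x\<in>{a..b}. g x \<partial>lborel) \<le> (\<integral>\<^sup>+x. g x * indicator {c<..d} (- x) \<partial>lborel)"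
    using AE_lborel_singleton[of b] assms(2,3)
    by (intro nn_integral_mono_AE) (auto elim!: eventually_mono simp: indicator_def)
  ultimately show ?thesis by simp
qed

section \<open>The direct estimate\<close>

text \<open>Joins the two numberings: the pieces are counted from the right end \<open>1\<close>,
  while both \<open>L\<close> and \<open>R\<close> are counted from the left end \<open>-1\<close>,
  the latter after reflection. A local polynomial is good on two adjacent pieces, so piece
  \<open>i\<close> is covered by those with numbers \<open>i\<close> and \<open>Suc i\<close>. The
  factor 4 is two halves times two uses of each polynomial.\<close>

lemma local_polynomials:
  fixes P L R :: "nat \<Rightarrow> real poly" and g :: "real \<Rightarrow> real poly \<Rightarrow> ennreal" and \<nu> :: nat and c :: ennreal
  assumes \<nu>: "1 \<le> \<nu>" and [measurable]: "\<And>Q. (\<lambda>x. g x Q) \<in> borel_measurable borel"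
    and P: "\<And>i. P i = (if i \<le> 3 * \<nu> then R i else L (6 * \<nu> - i))"
    and L: "(\<Sum>j<3 * \<nu> + 1. \<integral>\<^sup>+x\<in>{- cos (real (j - 1) * (pi / (6 * real \<nu>)))<..- cos ((real j + 1) * (pi / (6 * real \<nu>)))}. g x (L j) \<partial>lborel) \<le> c"
    and R: "(\<Sum>j<3 * \<nu> + 1. \<integral>\<^sup>+x\<in>{- cos (real (j - 1) * (pi / (6 * real \<nu>)))<..- cos ((real j + 1) * (pi / (6 * real \<nu>)))}. g (- x) (R j) \<partial>lborel) \<le> c"
  shows "(\<Sum>i<6 * \<nu>. \<integral>\<^sup>+x\<in>{cos ((real i + 1) * (pi / (6 * real \<nu>)))..cos (real i * (pi / (6 * real \<nu>)))}. (g x (P i) + g x (P (Suc i))) \<partial>lborel) \<le> 4 * c"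
proof -
  define \<beta> where "\<beta> = pi / (6 * real \<nu>)"
  have \<beta>: "0 < \<beta>" "6 * real \<nu> * \<beta> = pi" using \<nu> by (auto simp: \<beta>_def)
  define Lj where "Lj j = (\<integral>\<^sup>+x\<in>{- cos (real (j - 1) * \<beta>)<..- cos ((real j + 1) * \<beta>)}. g x (L j) \<partial>lborel)" for j
  define Rj where "Rj j = (\<integral>\<^sup>+x\<in>{- cos (real (j - 1) * \<beta>)<..- cos ((real j + 1) * \<beta>)}. g (- x) (R j) \<partial>lborel)" for j
  define B where "B i = (if i \<le> 3 * \<nu> then Rj i else Lj (6 * \<nu> - i))" for i
  define I where "I i = {cos ((real i + 1) * \<beta>)..cos (real i * \<beta>)}" for i
  have anti: "cos (real j * \<beta>) \<le> cos (real i * \<beta>)" if "i \<le> j" "j \<le> 6 * \<nu>" for i j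
  proof (rule cos_monotone_0_pi_le)
    show "real i * \<beta> \<le> real j * \<beta>" using that \<beta> by (intro mult_right_mono) auto
    have "real j * \<beta> \<le> real (6 * \<nu>) * \<beta>" using that \<beta> by (intro mult_right_mono) auto
    then show "real j * \<beta> \<le> pi" using \<beta>(2) by simp
  qed (use \<beta> in simp)
  have neg: "- cos (real j * \<beta>) = cos (real (6 * \<nu> - j) * \<beta>)" if "j \<le> 6 * \<nu>" for j
  proof -
    have "real (6 * \<nu> - j) * \<beta> = pi - real j * \<beta>" using that \<beta>(2) by (simp add: of_nat_diff left_diff_distrib)
    then show ?thesis by simp
  qed
  \<comment> \<open>The interval of number \<open>j\<close> reaches from node \<open>j + 1\<close>
    to node \<open>j - 1\<close>, so it contains piece \<open>i\<close> for both choices of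
    \<open>j\<close>. In the reflected numbering the nodes are exchanged by
    \<open>neg\<close>.\<close>
  have Ile: "(\<integral>\<^sup>+x\<in>I i. g x (P j) \<partial>lborel) \<le> B j" if i: "i < 6 * \<nu>" and j: "j = i \<or> j = Suc i" for i j
  proof (cases "j \<le> 3 * \<nu>")
    case True
    have "(\<integral>\<^sup>+x\<in>{cos ((real i + 1) * \<beta>)..cos (real i * \<beta>)}. g x (R j) \<partial>lborel) \<le> Rj j"
      unfolding Rj_def
    proof (rule nn_integral_Icc_le_reflected_Ioc)
      have "Suc j \<le> 6 * \<nu>" using True \<nu> by linarith
      then have "cos (real (Suc j) * \<beta>) \<le> cos (real (Suc i) * \<beta>)" using j by (intro anti) auto
      then show "- (- cos ((real j + 1) * \<beta>)) \<le> cos ((real i + 1) * \<beta>)" by (simp add: add.commute)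
      show "cos (real i * \<beta>) \<le> - (- cos (real (j - 1) * \<beta>))" using anti[of "j - 1" i] i j by auto
    qed measurable
    then show ?thesis using True by (simp add: I_def P B_def)
  next
    case False
    define q where "q = 6 * \<nu> - j"
    have q: "j = 6 * \<nu> - q" "q \<le> 6 * \<nu>" "q < 3 * \<nu>" using False i j by (auto simp: q_def)
    have "(\<integral>\<^sup>+x\<in>{cos ((real i + 1) * \<beta>)..cos (real i * \<beta>)}. g x (L q) \<partial>lborel) \<le> Lj q"
      unfolding Lj_def
    proof (rule nn_integral_Icc_le_Ioc)
      have "- cos (real (q - 1) * \<beta>) = cos (real (6 * \<nu> - (q - 1)) * \<beta>)" using q by (intro neg) auto
      also have "\<dots> \<le> cos (real (Suc i) * \<beta>)" using q i j by (intro anti) auto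
      finally show "- cos (real (q - 1) * \<beta>) \<le> cos ((real i + 1) * \<beta>)" by (simp add: add.commute)
      have "cos (real i * \<beta>) \<le> cos (real (6 * \<nu> - Suc q) * \<beta>)" using q i j by (intro anti) auto
      also have "\<dots> = - cos (real (Suc q) * \<beta>)" using q by (intro neg[symmetric]) auto
      finally show "cos (real i * \<beta>) \<le> - cos ((real q + 1) * \<beta>)" by (simp add: add.commute)
    qed
    then show ?thesis using False by (simp add: I_def P B_def q_def)
  qed
  have Bsum: "(\<Sum>i\<le>6 * \<nu>. B i) \<le> 2 * c"
  proof -
    have "(\<Sum>i\<le>6 * \<nu>. B i) = (\<Sum>i\<in>{..3 * \<nu>} \<union> {3 * \<nu> + 1..6 * \<nu>}. B i)" by (rule arg_cong[of _ _ "sum B"]) auto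
    also have "\<dots> = (\<Sum>i\<le>3 * \<nu>. B i) + (\<Sum>i\<in>{3 * \<nu> + 1..6 * \<nu>}. B i)" by (rule sum.union_disjoint) auto
    also have "(\<Sum>i\<le>3 * \<nu>. B i) = (\<Sum>j<3 * \<nu> + 1. Rj j)" by (rule sum.cong) (auto simp: B_def)
    also have "(\<Sum>i\<in>{3 * \<nu> + 1..6 * \<nu>}. B i) = (\<Sum>j<3 * \<nu>. Lj j)"
      by (rule sum.reindex_bij_witness[of _ "\<lambda>j. 6 * \<nu> - j" "\<lambda>i. 6 * \<nu> - i"]) (auto simp: B_def)
    also have "\<dots> \<le> (\<Sum>j<3 * \<nu> + 1. Lj j)" by (rule sum_mono2) auto
    also have "(\<Sum>j<3 * \<nu> + 1. Rj j) + (\<Sum>j<3 * \<nu> + 1. Lj j) \<le> c + c"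
      using L R unfolding Rj_def Lj_def \<beta>_def by (intro add_mono) auto
    finally show ?thesis by (simp add: mult_2)
  qed
  have "(\<Sum>i<6 * \<nu>. \<integral>\<^sup>+x\<in>I i. (g x (P i) + g x (P (Suc i))) \<partial>lborel) \<le> (\<Sum>i<6 * \<nu>. B i + B (Suc i))"
  proof (rule sum_mono)
    fix i assume "i \<in> {..<6 * \<nu>}"
    then have i: "i < 6 * \<nu>" by simp
    have "(\<integral>\<^sup>+x\<in>I i. (g x (P i) + g x (P (Suc i))) \<partial>lborel) = (\<integral>\<^sup>+x\<in>I i. g x (P i) \<partial>lborel) + (\<integral>\<^sup>+x\<in>I i. g x (P (Suc i)) \<partial>lborel)"
      unfolding I_def distrib_right by (intro nn_integral_add) measurable
    also have "\<dots> \<le> B i + B (Suc i)" using i by (intro add_mono Ile) auto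
    finally show "(\<integral>\<^sup>+x\<in>I i. (g x (P i) + g x (P (Suc i))) \<partial>lborel) \<le> B i + B (Suc i)" .
  qed
  also have "\<dots> = (\<Sum>i<6 * \<nu>. B i) + (\<Sum>i<6 * \<nu>. B (Suc i))" by (rule sum.distrib)
  also have "(\<Sum>i<6 * \<nu>. B (Suc i)) = (\<Sum>i\<in>Suc ` {..<6 * \<nu>}. B i)" by (simp add: sum.reindex)
  also have "\<dots> \<le> (\<Sum>i\<le>6 * \<nu>. B i)" by (rule sum_mono2) auto
  also have "(\<Sum>i<6 * \<nu>. B i) \<le> (\<Sum>i\<le>6 * \<nu>. B i)" by (rule sum_mono2) auto
  also have "(\<Sum>i\<le>6 * \<nu>. B i) + (\<Sum>i\<le>6 * \<nu>. B i) \<le> 2 * c + 2 * c" by (intro add_mono Bsum)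
  also have "\<dots> = 4 * c" by (simp flip: distrib_right)
  finally show ?thesis unfolding I_def \<beta>_def by (simp add: add_right_mono)
qed

theorem theorem8p1:
  fixes k r :: nat and p :: ennreal
  assumes "k \<ge> 1" and "1 \<le> p"
  shows "\<exists>c::real. c > 0 \<and>
           (\<forall>f\<in>\<B> p r. \<forall>n\<ge>k + r.
              approx_degree n f p
                \<le> ennreal (c / real n ^ r) * modulus k r ((deriv ^^ r) f) (1 / real n) p)"
proof -
  define d where "d = k + r"
  \<comment> \<open>Bounds \<open>n / \<nu>\<close>: from \<open>n \<le> d + (d + 2) * \<nu>\<close>
    and \<open>1 \<le> \<nu>\<close>.\<close>
  define K where "K = d + 2 + d"
  have d: "1 \<le> d" and K: "1 \<le> K" using assms(1) by (auto simp: d_def K_def)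
  show ?thesis
  proof (rule half_approx[OF assms(1) K, where r = r], goal_cases)
    case half: (1 C1)
    note C1 = half(1)
    show ?case
    proof (rule glue_local_polynomials[OF d], goal_cases)
      case glue: (1 C2)
      note C2 = glue(1)
      \<comment> \<open>The first product bounds the integral of \<open>young\<close> of the glued
        error at scale \<open>C2 * C1 * A / n ^ r\<close>; by \<open>Lp_norm_le_young\<close> it
        reappears as a factor of the norm.\<close>
      define c where "c = C2 * (4 * C1) * (C2 * C1)"
      have c: "0 < c" using C1 C2 by (simp add: c_def)
      have bound: "approx_degree n f p \<le> ennreal (c / real n ^ r * A)"
        if f: "f \<in> \<B> p r" and n: "k + r \<le> n" and A: "0 < A"
          and mod: "modulus k r ((deriv ^^ r) f) (1 / real n) p \<le> ennreal A" for f n A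
      proof -
        \<comment> \<open>The largest \<open>\<nu>\<close> for which the glued polynomial has degree
          below \<open>n\<close>; it is at least 1 because \<open>n \<ge> d\<close>.\<close>
        define \<nu> where "\<nu> = (n - d) div (d + 2) + 1"
        have dm: "(n - d) div (d + 2) * (d + 2) + (n - d) mod (d + 2) = n - d" by (rule div_mult_mod_eq)
        have "(n - d) mod (d + 2) < d + 2" by simp
        then have \<nu>: "1 \<le> \<nu>" "\<nu> \<le> n" "n \<le> K * \<nu>" "d + (d + 2) * (\<nu> - 1) \<le> n"
        proof -
          show "1 \<le> \<nu>" by (simp add: \<nu>_def)
          have "(n - d) div (d + 2) \<le> n - d" by simp
          then show "\<nu> \<le> n" using d n unfolding \<nu>_def d_def[symmetric] by linarith
          show "d + (d + 2) * (\<nu> - 1) \<le> n" using dm n by (simp add: \<nu>_def d_def mult.commute)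
          have "(d + 2) * \<nu> = (n - d) div (d + 2) * (d + 2) + (d + 2)" by (simp add: \<nu>_def)
          then have "n \<le> d + (d + 2) * \<nu>" using dm \<open>(n - d) mod (d + 2) < d + 2\<close> by linarith
          also have "\<dots> \<le> d * \<nu> + (d + 2) * \<nu>" using \<open>1 \<le> \<nu>\<close> by simp
          also have "\<dots> = K * \<nu>" by (simp add: K_def algebra_simps)
          finally show "n \<le> K * \<nu>" .
        qed
        have n0: "0 < real n" using n assms(1) by simp
        obtain f0 F0 where F0: "locint F0" and f0[measurable]: "f0 \<in> borel_measurable borel" and r0: "r = 0 \<Longrightarrow> f0 = F0"
          and fm: "f \<in> borel_measurable (lebesgue_on {-1..1})"
          and ff0: "AE x in lborel. x \<in> {-1<..<1} \<longrightarrow> f x = f0 x"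
          and FF0: "AE x in lborel. x \<in> {-1<..<1} \<longrightarrow> (deriv ^^ r) f x = F0 x"
          and t1: "taylor_form r F0 f0" and t2: "taylor_form r (\<lambda>x. (-1) ^ r * F0 (- x)) (\<lambda>x. f0 (- x))"
          using smoothness_class_representative[OF assms(2) f] by blast
        have F0m: "F0 \<in> borel_measurable borel" using F0 by (simp add: locint_def)
        have mod1: "(\<integral>\<^sup>+Y\<in>\<DD> (real k * h). young p (ennreal (\<bar>\<W> (real k * h) Y ^ r * fdiff k (h * \<phi> Y) F0 (Y - real k * (h * \<phi> Y) / 2)\<bar> / A)) \<partial>lborel) \<le> 1"
          if h: "0 < h" "h \<le> 1 / real n" for h
        proof (rule modulus_young[OF assms(2) A h(1) FF0])
          have "Lp_norm p (\<DD> (real k * h)) (\<lambda>x. \<W> (real k * h) x ^ r * symmetric_difference k (h * \<phi> x) ((deriv ^^ r) f) x)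
            \<le> modulus k r ((deriv ^^ r) f) (1 / real n) p"
            unfolding modulus_def using h by (intro SUP_upper) auto
          also note mod
          finally show "Lp_norm p (\<DD> (real k * h)) (\<lambda>x. \<W> (real k * h) x ^ r * symmetric_difference k (h * \<phi> x) ((deriv ^^ r) f) x) \<le> ennreal A" .
        qed
        have mod2: "(\<integral>\<^sup>+Y\<in>\<DD> (real k * h). young p (ennreal (\<bar>\<W> (real k * h) Y ^ r * fdiff k (h * \<phi> Y) (\<lambda>x. (-1) ^ r * F0 (- x)) (Y - real k * (h * \<phi> Y) / 2)\<bar> / A)) \<partial>lborel) \<le> 1"
          if h: "0 < h" "h \<le> 1 / real n" for h
        proof -
          have "\<bar>(-1) ^ r\<bar> = (1::real)" by (simp add: power_abs)
          from modulus_integral_reflect[OF F0m this] show ?thesis using mod1[OF h] by simp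
        qed
        define A' where "A' = C1 / real n ^ r * A"
        have A': "0 < A'" using C1 A n0 by (simp add: A'_def)
        define g where "g x Q = young p (ennreal (\<bar>f0 x - poly Q x\<bar> / A'))" for x Q
        have gm: "(\<lambda>x. g x Q) \<in> borel_measurable borel" for Q unfolding g_def by measurable
        obtain L :: "nat \<Rightarrow> real poly" where L: "\<forall>j. degree (L j) < d"
          "(\<Sum>j<3 * \<nu> + 1. \<integral>\<^sup>+x\<in>{- cos (real (j - 1) * (pi / (6 * real \<nu>)))<..- cos ((real j + 1) * (pi / (6 * real \<nu>)))}. g x (L j) \<partial>lborel) \<le> ennreal C1"
          using half(2)[OF assms(2) \<nu>(1-3) F0 f0 r0 t1 A mod1] unfolding g_def A'_def d_def by blast
        have f0r: "(\<lambda>x. f0 (- x)) \<in> borel_measurable borel" by measurable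
        obtain R :: "nat \<Rightarrow> real poly" where R: "\<forall>j. degree (R j) < d"
          "(\<Sum>j<3 * \<nu> + 1. \<integral>\<^sup>+x\<in>{- cos (real (j - 1) * (pi / (6 * real \<nu>)))<..- cos ((real j + 1) * (pi / (6 * real \<nu>)))}.
              young p (ennreal (\<bar>f0 (- x) - poly (R j) x\<bar> / A')) \<partial>lborel) \<le> ennreal C1"
          using half(2)[OF assms(2) \<nu>(1-3) locint_reflect[OF F0, of "(-1) ^ r"] f0r _ t2 A mod2] r0 unfolding A'_def d_def by force
        \<comment> \<open>Composition with \<open>- x\<close> carries the polynomials of the
          reflected function back to the right half.\<close>
        define R' where "R' j = pcompose (R j) [:0, -1:]" for j
        have gR: "young p (ennreal (\<bar>f0 (- x) - poly (R j) x\<bar> / A')) = g (- x) (R' j)" for x j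
          by (simp add: g_def R'_def poly_pcompose)
        define P where "P i = (if i \<le> 3 * \<nu> then R' i else L (6 * \<nu> - i))" for i
        have Pd: "degree (P i) < d" for i using L(1) R(1) by (simp add: P_def R'_def degree_pcompose)
        have S: "(\<Sum>i<6 * \<nu>. \<integral>\<^sup>+x\<in>{cos ((real i + 1) * (pi / (6 * real \<nu>)))..cos (real i * (pi / (6 * real \<nu>)))}. (g x (P i) + g x (P (Suc i))) \<partial>lborel) \<le> 4 * ennreal C1"
          by (rule local_polynomials[OF \<nu>(1) gm P_def L(2) R(2)[unfolded gR]])
        obtain Q :: "real poly" where Q: "degree Q < d + (d + 2) * (\<nu> - 1)"
          "(\<integral>\<^sup>+x\<in>{-1<..1}. young p (ennreal (\<bar>f0 x - poly Q x\<bar> / (C2 * A'))) \<partial>lborel)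
            \<le> ennreal C2 * (\<Sum>i<6 * \<nu>. \<integral>\<^sup>+x\<in>{cos ((real i + 1) * (pi / (6 * real \<nu>)))..cos (real i * (pi / (6 * real \<nu>)))}. (g x (P i) + g x (P (Suc i))) \<partial>lborel)"
          using glue(2)[of p \<nu> f0 P A', OF assms(2) \<nu>(1) f0 Pd A', folded g_def] by (elim exE conjE) (rule that)
        have "(\<integral>\<^sup>+x. young p (ennreal (\<bar>f x - poly Q x\<bar> / (C2 * A'))) \<partial>lebesgue_on {-1..1})
          = (\<integral>\<^sup>+x\<in>{-1..1}. young p (ennreal (\<bar>f x - poly Q x\<bar> / (C2 * A'))) \<partial>lborel)"
          by (rule nn_integral_lebesgue_on) simp
        also have "\<dots> = (\<integral>\<^sup>+x\<in>{-1<..1}. young p (ennreal (\<bar>f0 x - poly Q x\<bar> / (C2 * A'))) \<partial>lborel)"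
        proof (rule nn_integral_cong_AE)
          show "AE x in lborel. young p (ennreal (\<bar>f x - poly Q x\<bar> / (C2 * A'))) * indicator {-1..1} x = young p (ennreal (\<bar>f0 x - poly Q x\<bar> / (C2 * A'))) * indicator {-1<..1} x"
            using ff0 AE_lborel_singleton[of "-1"] AE_lborel_singleton[of 1] by eventually_elim (auto simp: indicator_def)
        qed
        also have "\<dots> \<le> ennreal C2 * (4 * ennreal C1)" by (rule order_trans[OF Q(2)]) (intro mult_left_mono S, simp)
        also have "\<dots> = ennreal (C2 * (4 * C1))" using C1 C2 by (simp add: ennreal_mult)
        finally have int: "(\<integral>\<^sup>+x. young p (ennreal (\<bar>f x - poly Q x\<bar> / (C2 * A'))) \<partial>lebesgue_on {-1..1}) \<le> ennreal (C2 * (4 * C1))" .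
        have "1 * 1 \<le> C2 * (4 * C1)" using C1 C2 by (intro mult_mono) auto
        then have B1: "1 \<le> C2 * (4 * C1)" by simp
        have "approx_degree n f p \<le> Lp_norm p {-1..1} (\<lambda>x. f x - poly Q x)"
          unfolding approx_degree_def using Q(1) \<nu>(4) by (intro INF_lower) auto
        also have "\<dots> \<le> ennreal (C2 * (4 * C1) * (C2 * A'))"
        proof (rule Lp_norm_le_young[OF assms(2) _ B1 _ int])
          show "0 < C2 * A'" using C2 A' by simp
          have "poly Q \<in> borel_measurable (lebesgue_on {-1..1})"
            by (intro measurable_restrict_space1 measurable_completion) (simp add: borel_measurable_poly)
          then show "(\<lambda>x. f x - poly Q x) \<in> borel_measurable (lebesgue_on {-1..1})" using fm by (intro borel_measurable_diff)
        qed
        also have "C2 * (4 * C1) * (C2 * A') = c / real n ^ r * A" by (simp add: A'_def c_def)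
        finally show ?thesis .
      qed
      have "approx_degree n f p \<le> ennreal (c / real n ^ r) * modulus k r ((deriv ^^ r) f) (1 / real n) p"
        if f: "f \<in> \<B> p r" and n: "k + r \<le> n" for f n
      proof -
        have n0: "0 < real n" using n assms(1) by simp
        define q where "q = c / real n ^ r"
        have q: "0 < q" using c n0 by (simp add: q_def)
        show ?thesis
        proof (cases "modulus k r ((deriv ^^ r) f) (1 / real n) p")
          case top
          then show ?thesis using q by (simp add: ennreal_mult_top q_def[symmetric])
        next
          case (real M)
          show ?thesis unfolding q_def[symmetric]
          \<comment> \<open>The modulus may be 0, whereas the argument divides by \<open>A\<close>;
            hence it is applied with \<open>A = M + e / q\<close>, which adds just \<open>e\<close>
            to the bound.\<close>
          proof (rule ennreal_le_epsilon)
            fix e :: real assume e: "0 < e"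
            have "0 < M + e / q" using real q e by (intro add_nonneg_pos divide_pos_pos) auto
            moreover have "modulus k r ((deriv ^^ r) f) (1 / real n) p \<le> ennreal (M + e / q)"
              using real q e by (auto intro!: ennreal_leI)
            ultimately have "approx_degree n f p \<le> ennreal (q * (M + e / q))"
              unfolding q_def[symmetric] using bound[OF f n, folded q_def] by blast
            also have "q * (M + e / q) = q * M + e" using q by (simp add: distrib_left)
            also have "ennreal \<dots> = ennreal q * modulus k r ((deriv ^^ r) f) (1 / real n) p + ennreal e"
              using real q e by (simp add: ennreal_mult)
            finally show "approx_degree n f p \<le> ennreal q * modulus k r ((deriv ^^ r) f) (1 / real n) p + ennreal e" .
          qed
        qed
      qed
      then show ?case using c by blast
    qed
  qed
qed

end
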